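(* Consider the random field $X^{Q_2}$ generated under the true parameters $(\theta^*,\sigma^*,\mu_0^* )$ and the estimators $(\check S,\check\kappa,\check\eta)$ described in the context. Write $\xi_{k,\ell}=\langle\xi,e_{k,\ell}\rangle_{\theta^*}$ and assume that $\{\xi_{k,\ell}\}_{k,\ell\ge1}$ are independent, that $\sup_{k,\ell\ge1}\lambda_{k,\ell}^{1+\alpha}\mathbb E[\xi_{k,\ell}^4]<\infty$, and that at least one of the following holds: (i) $\mathbb E[\xi_{k,\ell}]=0$ for all $k,\ell\ge1$ and $\sup_{k,\ell\ge1}\lambda_{k,\ell}^{1+\alpha}\mathbb E[\xi_{k,\ell}^2]<\infty$; (ii) $\mathbb E[\|A_{\theta^*}^{(1+\alpha)/2}\xi\|_{\theta^*}^2]=\sum_{k,\ell\ge1}\lambda_{k,\ell}^{1+\alpha}\mathbb E[\xi_{k,\ell}^2]<\infty$. (Here $\lambda_{k,\ell}$, $e_{k,\ell}$ are evaluated at $\theta^*$.) Then for any $\gamma<\min\{\tfrac12,1-\alpha\}-\tfrac{\rho}{2}$, as $N\to\infty$ and $m\to\infty$, $$m^{1/2}N^\gamma\begin{pmatrix}\check S-S^*\\ \check\kappa-\kappa^*\\ \check\eta-\eta^*\end{pmatrix}\longrightarrow 0\quad\text{in probability}.$$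
   Context: Model. Let $D=[0,1]^2$, $\alpha\in(0,1)$ a known constant, $\theta=(\theta_0,\theta_1,\eta_1,\theta_2)\in\mathbb R^3\times(0,\infty)$, $\sigma>0$, $\mu_0\in(-2\pi^2,\infty)$. Put $-A_\theta=\theta_2(\partial_y^2+\partial_z^2)+\theta_1\partial_y+\eta_1\partial_z+\theta_0$ and, for $k,\ell\in\mathbb N$, $$e_{k,\ell}(y,z)=2\sin(\pi ky)\sin(\pi\ell z)e^{-\frac{\theta_1}{2\theta_2}y}e^{-\frac{\eta_1}{2\theta_2}z},\quad \lambda_{k,\ell}=-\theta_0+\frac{\theta_1^2+\eta_1^2}{4\theta_2}+\pi^2(k^2+\ell^2)\theta_2,\quad \mu_{k,\ell}=\pi^2(k^2+\ell^2)+\mu_0,$$ so $A_\theta e_{k,\ell}=\lambda_{k,\ell}e_{k,\ell}$. Let $\langle f,g\rangle_\theta=\int_0^1\int_0^1 f(y,z)g(y,z)e^{\frac{\theta_1}{\theta_2}y}e^{\frac{\eta_1}{\theta_2}z}\,dy\,dz$, $\|f\|_\theta=\langle f,f\rangle_\theta^{1/2}$, and $H_\theta=\{f:D\to\mathbb R:\ \|f\|_\theta<\infty,\ f=0\text{ on }\partial D\}$. Let $\{w_{k,\ell}\}_{k,\ell\ge1}$ be independent real standard Brownian motions and $\xi$ a random element of $H_\theta$ independent of them. The $Q_2$-Wiener process is $\langle W^{Q_2}_t,f\rangle_\theta=\sum_{k,\ell\ge1}\mu_{k,\ell}^{-\alpha/2}\langle f,e_{k,\ell}\rangle_\theta w_{k,\ell}(t)$,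 and $X^{Q_2}$ is the mild solution on $[0,1]\times D$ of $dX_t=-A_\theta X_t\,dt+\sigma\,dW_t^{Q_2}$, $X_0=\xi$, $X_t|_{\partial D}=0$, i.e. $X_t^{Q_2}(y,z)=\sum_{k,\ell\ge1}x^{Q_2}_{k,\ell}(t)e_{k,\ell}(y,z)$ with $$x_{k,\ell}^{Q_2}(t)=e^{-\lambda_{k,\ell}t}\langle\xi,e_{k,\ell}\rangle_\theta+\sigma\mu_{k,\ell}^{-\alpha/2}\int_0^te^{-\lambda_{k,\ell}(t-s)}\,dw_{k,\ell}(s).$$ $(\theta,\sigma)$ ranges over a compact convex $\Theta\subset\mathbb R^3\times(0,\infty)^2$ and $\mu_0$ over a compact convex subset of $(-2\pi^2,\infty)$; the data are generated with true values $(\theta^*,\sigma^* )=(\theta_0^*,\theta_1^*,\eta_1^*,\theta_2^*,\sigma^* )$ and $\mu_0^*$ in the respective interiors, and $\lambda_{1,1}^*>0$. Observations and thinning in space. $X_{t_i}(y_{j_1},z_{j_2})$ is observed at $t_i=i\Delta_N$, $\Delta_N=1/N$, $i=0,\dots,N$, $y_{j_1}=j_1/M_1$, $z_{j_2}=j_2/M_2$, $0\le j_1\le M_1$, $0\le j_2\le M_2$. Let $\overline m_1\le M_1$, $\overline m_2\le M_2$ with $\overline m_1\overline m_2=O(N^\rho)$ for some $0<\rho<\min\{1,2(1-\alpha)\}$, $\overline y_{j}=\lfloor M_1/\overline m_1\rfloor\, j/M_1$ ($0\le j\le\overline m_1$), $\overline z_{j}=\lfloor M_2/\overline m_2\rfloor\,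 j/M_2$ ($0\le j\le\overline m_2$). Fix $\delta\in(0,1/2)$, and let $J_1,J_2,m_1,m_2\ge1$ be such that $\overline y_{J_1}<\delta\le\overline y_{J_1+1}<\cdots<\overline y_{J_1+m_1}\le1-\delta<\overline y_{J_1+m_1+1}$ and $\overline z_{J_2}<\delta\le\overline z_{J_2+1}<\cdots<\overline z_{J_2+m_2}\le1-\delta<\overline z_{J_2+m_2+1}$. Put $\widetilde y_{j_1}=\overline y_{J_1+j_1}$ ($1\le j_1\le m_1$), $\widetilde z_{j_2}=\overline z_{J_2+j_2}$ ($1\le j_2\le m_2$), and $m=m_1m_2$ (so $m=O(N^\rho)$). Estimators. Let $S=\sigma^2/\theta_2^{1-\alpha}$, $\kappa=\theta_1/\theta_2$, $\eta=\eta_1/\theta_2$, with true values $S^*,\kappa^*,\eta^*$. With $\Delta_iX(y,z)=X_{t_i}(y,z)-X_{t_{i-1}}(y,z)$ let $Z_N^{Q_2}(y,z)=\frac{1}{N\Delta_N^\alpha}\sum_{i=1}^N(\Delta_iX^{Q_2}(y,z))^2$ and $$U^{(2)}_{N,m}(S,\kappa,\eta)=\sum_{j_1=1}^{m_1}\sum_{j_2=1}^{m_2}\Bigl(Z_N^{Q_2}(\widetilde y_{j_1},\widetilde z_{j_2})-\frac{\Gamma(1-\alpha)}{4\pi\alpha}\,S\,e^{-(\kappa\widetilde y_{j_1}+\eta\widetilde z_{j_2})}\Bigr)^2 .$$ $(\check S,\check\kappa,\check\eta)$ is a minimizer of $U^{(2)}_{N,m}$ over $\Xi_2$, a compact convex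 subset of $(0,\infty)\times\mathbb R^2$ with $(S^*,\kappa^*,\eta^* )\in\mathrm{Int}\,\Xi_2$. Here $\Gamma$ is the Gamma function.
   Formalization: Adds that m_1 ≥ 2 and m_2 ≥ 2 for all large N; with m_1 = 1 (e.g. δ=2/5, M_1=10, m̄_1=3) the contrast depends on (S,κ) only through S·exp(-κỹ_1), so minimizers are not unique and the claim fails. *)

theory Defs
  imports "HOL-Probability.Probability"
begin

text \<open>The drift parameter is the tuple \<open>\<theta> = (\<theta>0, \<theta>1, \<eta>1, \<theta>2)\<close>.  All eigensystem indices
  \<open>k\<close>, \<open>l\<close> start at 1.\<close>

type_synonym drift = "real \<times> real \<times> real \<times> real"

abbreviation unit_square :: "(real \<times> real) set"
  where "unit_square \<equiv> {0..1} \<times> {0..1}"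

abbreviation indices :: "(nat \<times> nat) set"
  where "indices \<equiv> {1..} \<times> {1..}"

fun eigfun :: "drift \<Rightarrow> nat \<Rightarrow> nat \<Rightarrow> real \<times> real \<Rightarrow> real" where
  "eigfun (\<theta>0, \<theta>1, \<eta>1, \<theta>2) k l (y, z) =
     2 * sin (pi * real k * y) * sin (pi * real l * z)
       * exp (- (\<theta>1 / (2 * \<theta>2)) * y) * exp (- (\<eta>1 / (2 * \<theta>2)) * z)"

fun eigval :: "drift \<Rightarrow> nat \<Rightarrow> nat \<Rightarrow> real" where
  "eigval (\<theta>0, \<theta>1, \<eta>1, \<theta>2) k l =
     - \<theta>0 + (\<theta>1\<^sup>2 + \<eta>1\<^sup>2) / (4 * \<theta>2) + pi\<^sup>2 * ((real k)\<^sup>2 + (real l)\<^sup>2) * \<theta>2"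

definition noise_eigval :: "real \<Rightarrow> nat \<Rightarrow> nat \<Rightarrow> real" where
  "noise_eigval \<mu>0 k l = pi\<^sup>2 * ((real k)\<^sup>2 + (real l)\<^sup>2) + \<mu>0"

fun weight :: "drift \<Rightarrow> real \<times> real \<Rightarrow> real" where
  "weight (\<theta>0, \<theta>1, \<eta>1, \<theta>2) (y, z) = exp (\<theta>1 / \<theta>2 * y) * exp (\<eta>1 / \<theta>2 * z)"

definition inner_w :: "drift \<Rightarrow> (real \<times> real \<Rightarrow> real) \<Rightarrow> (real \<times> real \<Rightarrow> real) \<Rightarrow> real" where
  "inner_w \<theta> f g = (\<integral>p. f p * g p * weight \<theta> p \<partial>lebesgue_on unit_square)"

definition norm_w :: "drift \<Rightarrow> (real \<times> real \<Rightarrow> real) \<Rightarrow> real" where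
  "norm_w \<theta> f = sqrt (inner_w \<theta> f f)"

text \<open>Elements of \<open>H_space \<theta>\<close> are functions, not classes modulo null sets; their values outside
  the unit square are irrelevant.  Integrability of the square expresses finiteness of the norm
  (the Bochner integral of a non-integrable function would be 0).\<close>

definition H_space :: "drift \<Rightarrow> (real \<times> real \<Rightarrow> real) set" where
  "H_space \<theta> = {f. f \<in> borel_measurable (lebesgue_on unit_square)
      \<and> integrable (lebesgue_on unit_square) (\<lambda>p. (f p)\<^sup>2 * weight \<theta> p)
      \<and> (\<forall>p\<in>frontier unit_square. f p = 0)}"

text \<open>The Borel sigma-algebra of \<open>H_space \<theta>\<close>, generated by the open sets of the (semi)norm.\<close>

definition H_borel :: "drift \<Rightarrow> (real \<times> real \<Rightarrow> real) measure" where
  "H_borel \<theta> = sigma (H_space \<theta>)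
     {U. U \<subseteq> H_space \<theta> \<and>
         (\<forall>f\<in>U. \<exists>\<epsilon>>0. \<forall>g\<in>H_space \<theta>. norm_w \<theta> (\<lambda>p. g p - f p) < \<epsilon> \<longrightarrow> g \<in> U)}"

text \<open>Stated with the nonnegative integral, so that no integrability is silently presupposed.\<close>

definition L2_tendsto ::
  "'a measure \<Rightarrow> ('i \<Rightarrow> 'a \<Rightarrow> real) \<Rightarrow> ('a \<Rightarrow> real) \<Rightarrow> 'i filter \<Rightarrow> bool" where
  "L2_tendsto M Y Z F \<longleftrightarrow>
     ((\<lambda>i. \<integral>\<^sup>+\<omega>. ennreal ((Y i \<omega> - Z \<omega>)\<^sup>2) \<partial>M) \<longlongrightarrow> 0) F"

definition tendsto_in_prob ::
  "'a measure \<Rightarrow> ('i \<Rightarrow> 'a \<Rightarrow> 'b::real_normed_vector) \<Rightarrow> ('a \<Rightarrow> 'b) \<Rightarrow> 'i filter \<Rightarrow> bool" where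
  "tendsto_in_prob M Y Z F \<longleftrightarrow>
     (\<forall>\<epsilon>>0. ((\<lambda>i. measure M {\<omega>\<in>space M. norm (Y i \<omega> - Z \<omega>) > \<epsilon>}) \<longlongrightarrow> 0) F)"

definition brownian_motion :: "'a measure \<Rightarrow> (real \<Rightarrow> 'a \<Rightarrow> real) \<Rightarrow> bool" where
  "brownian_motion M w \<longleftrightarrow>
     (\<forall>t\<ge>0. w t \<in> borel_measurable M)
   \<and> (AE \<omega> in M. w 0 \<omega> = 0)
   \<and> (\<forall>s\<ge>0. \<forall>t>s. distributed M lborel (\<lambda>\<omega>. w t \<omega> - w s \<omega>) (normal_density 0 (sqrt (t - s))))
   \<and> (\<forall>\<tau> n. 0 \<le> \<tau> 0 \<longrightarrow> incseq \<tau> \<longrightarrow>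
        prob_space.indep_vars M (\<lambda>_. borel) (\<lambda>i \<omega>. w (\<tau> (Suc i)) \<omega> - w (\<tau> i) \<omega>) {..<n::nat})
   \<and> (AE \<omega> in M. continuous_on {0..} (\<lambda>t. w t \<omega>))"

text \<open>A deterministic step function is coded by a list of triples \<open>(c, a, b)\<close>, each standing for
  \<open>c\<close> times the indicator of \<open>{a<..b}\<close>.\<close>

definition step_fun :: "(real \<times> real \<times> real) list \<Rightarrow> real \<Rightarrow> real" where
  "step_fun ps s = (\<Sum>(c, a, b)\<leftarrow>ps. c * indicator {a<..b} s)"

definition step_int ::
  "(real \<Rightarrow> 'a \<Rightarrow> real) \<Rightarrow> (real \<times> real \<times> real) list \<Rightarrow> 'a \<Rightarrow> real" where
  "step_int w ps \<omega> = (\<Sum>(c, a, b)\<leftarrow>ps. c * (w b \<omega> - w a \<omega>))"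

text \<open>\<open>is_wiener_integral M w f T I\<close>: the random variable \<open>I\<close> is a version of the stochastic integral
  of the deterministic integrand \<open>f\<close> with respect to \<open>w\<close> over \<open>[0, T]\<close>, i.e. the mean-square limit
  of the elementary integrals of step functions converging to \<open>f\<close> in \<open>L\<^sup>2[0, T]\<close>.  By the Ito
  isometry \<open>I\<close> is unique up to null sets and does not depend on the approximating sequence.\<close>

definition is_wiener_integral ::
  "'a measure \<Rightarrow> (real \<Rightarrow> 'a \<Rightarrow> real) \<Rightarrow> (real \<Rightarrow> real) \<Rightarrow> real \<Rightarrow> ('a \<Rightarrow> real) \<Rightarrow> bool" where
  "is_wiener_integral M w f T I \<longleftrightarrow>
     I \<in> borel_measurable M \<and>
     (\<exists>ps. (\<forall>n. \<forall>(c, a, b)\<in>set (ps n). 0 \<le> a \<and> a \<le> b \<and> b \<le> T)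
         \<and> L2_tendsto (lebesgue_on {0..T}) (\<lambda>n. step_fun (ps n)) f sequentially
         \<and> L2_tendsto M (\<lambda>n. step_int w (ps n)) I sequentially)"

definition is_coordinate ::
  "'a measure \<Rightarrow> real \<Rightarrow> drift \<Rightarrow> real \<Rightarrow> real \<Rightarrow> (nat \<Rightarrow> nat \<Rightarrow> real \<Rightarrow> 'a \<Rightarrow> real)
    \<Rightarrow> ('a \<Rightarrow> real \<times> real \<Rightarrow> real) \<Rightarrow> nat \<Rightarrow> nat \<Rightarrow> real \<Rightarrow> ('a \<Rightarrow> real) \<Rightarrow> bool" where
  "is_coordinate M \<alpha> \<theta> \<sigma> \<mu>0 w \<xi> k l t x \<longleftrightarrow>
     (\<exists>I. is_wiener_integral M (w k l) (\<lambda>s. exp (- eigval \<theta> k l * (t - s))) t I \<and>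
        (\<forall>\<omega>\<in>space M. x \<omega> = exp (- eigval \<theta> k l * t) * inner_w \<theta> (\<xi> \<omega>) (eigfun \<theta> k l)
                          + \<sigma> * noise_eigval \<mu>0 k l powr (- \<alpha> / 2) * I \<omega>))"

text \<open>The eigenfunction expansion is in general not absolutely convergent path by path, so the
  double series defining the value of the field at \<open>(t, p)\<close> is taken as an unordered sum in mean
  square.  The field is therefore determined up to a null set for each \<open>(t, p)\<close>.\<close>

definition is_mild_solution ::
  "'a measure \<Rightarrow> real \<Rightarrow> drift \<Rightarrow> real \<Rightarrow> real \<Rightarrow> (nat \<Rightarrow> nat \<Rightarrow> real \<Rightarrow> 'a \<Rightarrow> real)
    \<Rightarrow> ('a \<Rightarrow> real \<times> real \<Rightarrow> real) \<Rightarrow> (real \<Rightarrow> real \<times> real \<Rightarrow> 'a \<Rightarrow> real) \<Rightarrow> bool" where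
  "is_mild_solution M \<alpha> \<theta> \<sigma> \<mu>0 w \<xi> X \<longleftrightarrow>
     (\<exists>x. (\<forall>k\<ge>1. \<forall>l\<ge>1. \<forall>t\<in>{0..1}. is_coordinate M \<alpha> \<theta> \<sigma> \<mu>0 w \<xi> k l t (x k l t)) \<and>
        (\<forall>t\<in>{0..1}. \<forall>p\<in>unit_square. X t p \<in> borel_measurable M \<and>
           L2_tendsto M (\<lambda>F \<omega>. \<Sum>(k, l)\<in>F. x k l t \<omega> * eigfun \<theta> k l p) (X t p)
             (finite_subsets_at_top indices)))"

text \<open>With \<open>M\<close> grid cells and thinning parameter \<open>mb\<close>, the \<open>j\<close>-th thinned point; \<open>M div mb\<close> is the
  floor of the quotient.\<close>

definition thin :: "nat \<Rightarrow> nat \<Rightarrow> nat \<Rightarrow> real" where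
  "thin M mb j = real (M div mb) * real j / real M"

text \<open>Exactly the thinned points with indices \<open>J + 1, \<dots>, J + m\<close> lie in \<open>{\<delta>..1 - \<delta>}\<close>.\<close>

definition thin_window :: "real \<Rightarrow> nat \<Rightarrow> nat \<Rightarrow> nat \<Rightarrow> nat \<Rightarrow> bool" where
  "thin_window \<delta> M mb J m \<longleftrightarrow>
     1 \<le> mb \<and> mb \<le> M \<and> 1 \<le> J \<and> 1 \<le> m \<and> J + m + 1 \<le> mb \<and>
     thin M mb J < \<delta> \<and> \<delta> \<le> thin M mb (J + 1) \<and>
     (\<forall>j\<in>{J + 1..<J + m}. thin M mb j < thin M mb (j + 1)) \<and>
     thin M mb (J + m) \<le> 1 - \<delta> \<and> 1 - \<delta> < thin M mb (J + m + 1)"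

definition realized_vol ::
  "real \<Rightarrow> (real \<Rightarrow> real \<times> real \<Rightarrow> 'a \<Rightarrow> real) \<Rightarrow> nat \<Rightarrow> real \<times> real \<Rightarrow> 'a \<Rightarrow> real" where
  "realized_vol \<alpha> X N p \<omega> =
     1 / (real N * (1 / real N) powr \<alpha>) *
       (\<Sum>i=1..N. (X (real i / real N) p \<omega> - X (real (i - 1) / real N) p \<omega>)\<^sup>2)"

fun contrast ::
  "real \<Rightarrow> (real \<times> real \<Rightarrow> real) \<Rightarrow> (nat \<Rightarrow> real) \<Rightarrow> (nat \<Rightarrow> real) \<Rightarrow> nat \<Rightarrow> nat
    \<Rightarrow> real \<times> real \<times> real \<Rightarrow> real" where
  "contrast \<alpha> Z yt zt m1 m2 (S, \<kappa>, \<eta>) =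
     (\<Sum>j1=1..m1. \<Sum>j2=1..m2.
        (Z (yt j1, zt j2)
          - Gamma (1 - \<alpha>) / (4 * pi * \<alpha>) * S * exp (- (\<kappa> * yt j1 + \<eta> * zt j2)))\<^sup>2)"

end

theory Submission
  imports Defs
begin

text \<open>
  At a fixed point, each temporal increment is a Gaussian part plus the contribution of the initial
  value.  The latter has summable second moments over the whole grid, so its share in the realized
  volatility is \<open>O(1/N)\<close> in mean.  The Gaussian part is a limit of finite sums of step integrals; by
  Isserlis' formula the variance of its realized volatility is the sum of the squared entries of a
  covariance matrix, which is controlled mode by mode because the rows of the Ornstein--Uhlenbeck
  Gram matrices decay geometrically.  Its mean is, by \<open>2 sin\<^sup>2 x = 1 - cos 2x\<close>, a lattice sum of
  \<open>(1 - e\<^sup>-\<^sup>u) u\<^sup>-\<^sup>1\<^sup>-\<^sup>\<alpha>\<close> at \<open>u = \<Delta>(k\<^sup>2 + l\<^sup>2)\<close>, compared with an integral over a quadrant that evaluates to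
  a Gamma value, plus oscillating sums that are small away from the boundary by Abel summation.
  Both bias and standard deviation are \<open>O(N\<^sup>s\<^sup>-\<^sup>1)\<close> for every \<open>s \<in> (1/2, 1)\<close> with \<open>s \<ge> \<alpha>\<close>.

  The minimizer does not exceed the contrast at the truth, so the fitted and the true exponential
  surface differ in \<open>l\<^sup>2\<close> by at most twice the noise; on equispaced grids in the interior that
  distance dominates \<open>m\<^sup>1\<^sup>/\<^sup>2\<close> times the parameter error, and Markov's inequality gives the rate.
\<close>

section \<open>Gaussian moments of step integrals\<close>

text \<open>The field is given only as a mean-square limit, separately for each time and point, so
  its law is never identified. Moments are computed for finite sums of step integrals, and their
  distance to the field is a remainder treated together with the initial value. Of this remainder
  only the mean of its sum of squares is controlled. Hence every error is kept in the form
  \<open>A + A\<^sup>2 + V\<close>, with bounds for the means of \<open>A\<close> and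
  \<open>V\<close> but none for that of \<open>A\<^sup>2\<close>; Markov's inequality is applied to
  \<open>A\<close> itself. The exponent s is an interpolation parameter: near the origin the kernel
  behaves like u^(-\<alpha>), which forces s \<ge> \<alpha>, while the row sums and strip integrals
  converge only for s > 1/2. Summed over m points, the squared error has order m N^(-2(1-s)), and it
  dominates m times the squared parameter error. With the normalization N^\<gamma> and m =
  O(N^\<rho>) this leaves the requirement \<gamma> + \<rho>/2 < 1 - s, which is the claimed range of
  \<gamma> as s decreases to max(1/2, \<alpha>).\<close>

lemma (in finite_measure) integrable_power_le_4:
  fixes f :: "'a \<Rightarrow> real"
  assumes [measurable]: "f \<in> borel_measurable M" and "integrable M (\<lambda>x. f x ^ 4)" and "k \<le> 4"
  shows "integrable M (\<lambda>x. f x ^ k)"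
proof (rule Bochner_Integration.integrable_bound)
  show "integrable M (\<lambda>x. 1 + f x ^ 4)"
    using assms by simp
  have "\<bar>y\<bar> ^ k \<le> 1 + y ^ 4" for y :: real
  proof (cases "\<bar>y\<bar> \<le> 1")
    case True
    then have "\<bar>y\<bar> ^ k \<le> 1" by (simp add: power_le_one)
    moreover have "0 \<le> y ^ 4" by simp
    ultimately show ?thesis by linarith
  next
    case False
    then have "\<bar>y\<bar> ^ k \<le> \<bar>y\<bar> ^ 4" using assms(3) by (intro power_increasing) auto
    then show ?thesis by simp
  qed
  then show "AE x in M. norm (f x ^ k) \<le> norm (1 + f x ^ 4)"
    by (auto simp: power_abs)
qed measurable

text \<open>Only the first four moments of the Gaussian law are ever needed.  Unlike Gaussianity of a
  vector, this property does not pass to linear combinations, hence the hypotheses on sums and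
  differences below.\<close>

definition gaussian_moments :: "'a measure \<Rightarrow> ('a \<Rightarrow> real) \<Rightarrow> real \<Rightarrow> bool" where
  "gaussian_moments M Z v \<longleftrightarrow> Z \<in> borel_measurable M \<and> integrable M (\<lambda>\<omega>. Z \<omega> ^ 4) \<and>
     (\<integral>\<omega>. Z \<omega> \<partial>M) = 0 \<and> (\<integral>\<omega>. (Z \<omega>)\<^sup>2 \<partial>M) = v \<and> (\<integral>\<omega>. Z \<omega> ^ 4 \<partial>M) = 3 * v\<^sup>2"

context prob_space
begin

lemma gaussian_moments_integrable:
  assumes "gaussian_moments M Z v" "k \<le> 4"
  shows "integrable M (\<lambda>\<omega>. Z \<omega> ^ k)"
  by (rule integrable_power_le_4) (use assms in \<open>auto simp: gaussian_moments_def\<close>)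

lemma gaussian_moments_zero: "gaussian_moments M (\<lambda>_. 0) 0"
  by (simp add: gaussian_moments_def)

lemma gaussian_moments_scale:
  assumes "gaussian_moments M Z v"
  shows "gaussian_moments M (\<lambda>\<omega>. c * Z \<omega>) (c\<^sup>2 * v)"
  using assms unfolding gaussian_moments_def by (auto simp: power_mult_distrib)

lemma gaussian_moments_add:
  assumes ind: "indep_var borel X borel Y"
    and X: "gaussian_moments M X a" and Y: "gaussian_moments M Y b"
  shows "gaussian_moments M (\<lambda>\<omega>. X \<omega> + Y \<omega>) (a + b)"
proof -
  have [measurable]: "X \<in> borel_measurable M" "Y \<in> borel_measurable M"
    using X Y by (auto simp: gaussian_moments_def)
  have ip: "indep_var borel (\<lambda>\<omega>. X \<omega> ^ i) borel (\<lambda>\<omega>. Y \<omega> ^ j)" for i j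
    using indep_var_compose[OF ind, of "\<lambda>x. x ^ i" borel "\<lambda>x. x ^ j" borel] by (simp add: comp_def)
  note intX = gaussian_moments_integrable[OF X] and intY = gaussian_moments_integrable[OF Y]
  have int: "integrable M (\<lambda>\<omega>. X \<omega> ^ i * Y \<omega> ^ j)" if "i \<le> 4" "j \<le> 4" for i j
    using indep_var_integrable[OF ip intX intY] that by simp
  have E: "(\<integral>\<omega>. X \<omega> ^ i * Y \<omega> ^ j \<partial>M) = (\<integral>\<omega>. X \<omega> ^ i \<partial>M) * (\<integral>\<omega>. Y \<omega> ^ j \<partial>M)"
    if "i \<le> 4" "j \<le> 4" for i j
    using indep_var_lebesgue_integral[OF ip intX intY] that by simp
  have E1: "(\<integral>\<omega>. X \<omega> \<partial>M) = 0" "(\<integral>\<omega>. Y \<omega> \<partial>M) = 0"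
    and E2: "(\<integral>\<omega>. (X \<omega>)\<^sup>2 \<partial>M) = a" "(\<integral>\<omega>. (Y \<omega>)\<^sup>2 \<partial>M) = b"
    and E4: "(\<integral>\<omega>. X \<omega> ^ 4 \<partial>M) = 3 * a\<^sup>2" "(\<integral>\<omega>. Y \<omega> ^ 4 \<partial>M) = 3 * b\<^sup>2"
    using X Y by (auto simp: gaussian_moments_def)
  \<comment> \<open>Powers 0 and 1 are written out so that every summand has the shape
    \<open>X \<omega> ^ i * Y \<omega> ^ j\<close> covered by \<open>int\<close> and
    \<open>E\<close>. The terms with odd exponents vanish because each contains a first
    moment.\<close>
  have e4: "(x + y) ^ 4 = x ^ 4 * y ^ 0 + 4 * (x ^ 3 * y ^ 1) + 6 * (x ^ 2 * y ^ 2)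
      + 4 * (x ^ 1 * y ^ 3) + x ^ 0 * y ^ 4" for x y :: real
    by (simp add: eval_nat_numeral algebra_simps)
  have e2: "(x + y)\<^sup>2 = x ^ 2 * y ^ 0 + 2 * (x ^ 1 * y ^ 1) + x ^ 0 * y ^ 2" for x y :: real
    by (simp add: power2_eq_square algebra_simps)
  have "integrable M (\<lambda>\<omega>. (X \<omega> + Y \<omega>) ^ 4)"
    unfolding e4 by (intro Bochner_Integration.integrable_add integrable_mult_right int) auto
  moreover have "(\<integral>\<omega>. (X \<omega> + Y \<omega>) ^ 4 \<partial>M) = 3 * (a + b)\<^sup>2"
  proof -
    have "(\<integral>\<omega>. (X \<omega> + Y \<omega>) ^ 4 \<partial>M) =
       (\<integral>\<omega>. X \<omega> ^ 4 * Y \<omega> ^ 0 \<partial>M) + 4 * (\<integral>\<omega>. X \<omega> ^ 3 * Y \<omega> ^ 1 \<partial>M)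
       + 6 * (\<integral>\<omega>. X \<omega> ^ 2 * Y \<omega> ^ 2 \<partial>M) + 4 * (\<integral>\<omega>. X \<omega> ^ 1 * Y \<omega> ^ 3 \<partial>M)
       + (\<integral>\<omega>. X \<omega> ^ 0 * Y \<omega> ^ 4 \<partial>M)"
      unfolding e4 using int[of 4 0] int[of 3 1] int[of 2 2] int[of 1 3] int[of 0 4] by simp
    also have "\<dots> = 3 * a\<^sup>2 + 6 * (a * b) + 3 * b\<^sup>2"
      by (subst (1 2 3 4 5) E) (auto simp: E1 E2 E4 prob_space)
    finally show ?thesis by (simp add: power2_eq_square algebra_simps)
  qed
  moreover have "(\<integral>\<omega>. (X \<omega> + Y \<omega>)\<^sup>2 \<partial>M) = a + b"
  proof -
    have "(\<integral>\<omega>. (X \<omega> + Y \<omega>)\<^sup>2 \<partial>M) =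
       (\<integral>\<omega>. X \<omega> ^ 2 * Y \<omega> ^ 0 \<partial>M) + 2 * (\<integral>\<omega>. X \<omega> ^ 1 * Y \<omega> ^ 1 \<partial>M)
       + (\<integral>\<omega>. X \<omega> ^ 0 * Y \<omega> ^ 2 \<partial>M)"
      unfolding e2 using int[of 2 0] int[of 1 1] int[of 0 2] by simp
    also have "\<dots> = a + b"
      by (subst (1 2 3) E) (auto simp: E1 E2 E4 prob_space)
    finally show ?thesis .
  qed
  moreover have "(\<integral>\<omega>. X \<omega> + Y \<omega> \<partial>M) = 0"
    using intX[of 1] intY[of 1] E1 by simp
  ultimately show ?thesis
    by (simp add: gaussian_moments_def)
qed

lemma gaussian_moments_sum:
  assumes "finite I" "indep_vars (\<lambda>_. borel) X I" "\<And>i. i \<in> I \<Longrightarrow> gaussian_moments M (X i) (v i)"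
  shows "gaussian_moments M (\<lambda>\<omega>. \<Sum>i\<in>I. X i \<omega>) (\<Sum>i\<in>I. v i)"
  using assms
proof (induction I)
  case empty
  then show ?case by (simp add: gaussian_moments_zero)
next
  case (insert i I)
  have "indep_vars (\<lambda>_. borel) X I"
    using insert.prems(1) by (rule indep_vars_subset) auto
  then have "gaussian_moments M (\<lambda>\<omega>. X i \<omega> + (\<Sum>i\<in>I. X i \<omega>)) (v i + (\<Sum>i\<in>I. v i))"
    using insert by (intro gaussian_moments_add indep_vars_sum) auto
  then show ?case
    using insert.hyps by simp
qed

lemma gaussian_moments_normal:
  assumes D: "distributed M lborel Z (normal_density 0 s)" and "0 < s"
  shows "gaussian_moments M Z (s\<^sup>2)"
proof -
  have [measurable]: "Z \<in> borel_measurable M"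
    using distributed_measurable[OF D] by simp
  have nn: "AE x in lborel. 0 \<le> normal_density 0 s x" by simp
  have "(\<integral>\<omega>. Z \<omega> \<partial>M) = 0"
    using distributed_integral[OF D, of "\<lambda>x. x"] integral_normal_moment_odd[OF \<open>0 < s\<close>, of 0 0]
    by simp
  moreover have "(\<integral>\<omega>. (Z \<omega>)\<^sup>2 \<partial>M) = s\<^sup>2"
    using distributed_integral[OF D, of "\<lambda>x. x\<^sup>2"] integral_normal_moment_even[OF \<open>0 < s\<close>, of 0 1]
    by (simp add: eval_nat_numeral)
  moreover have "(\<integral>\<omega>. Z \<omega> ^ 4 \<partial>M) = 3 * (s\<^sup>2)\<^sup>2"
    using distributed_integral[OF D, of "\<lambda>x. x ^ 4"] integral_normal_moment_even[OF \<open>0 < s\<close>, of 0 2]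
    by (simp add: fact_numeral field_simps)
  moreover have "integrable M (\<lambda>\<omega>. Z \<omega> ^ 4)"
    using distributed_integrable[OF D, of "\<lambda>x. x ^ 4"] integrable_normal_moment[OF \<open>0 < s\<close>, of 0 4]
    by simp
  ultimately show ?thesis
    by (simp add: gaussian_moments_def)
qed

text \<open>The fourth moments of \<open>X + Y\<close> and \<open>X - Y\<close> determine the mixed moment by polarization.\<close>

lemma gaussian_moments_mixed:
  assumes X: "gaussian_moments M X a" and Y: "gaussian_moments M Y b"
    and P: "gaussian_moments M (\<lambda>\<omega>. X \<omega> + Y \<omega>) (a + b + 2 * c)"
    and Q: "gaussian_moments M (\<lambda>\<omega>. X \<omega> - Y \<omega>) (a + b - 2 * c)"
  shows "integrable M (\<lambda>\<omega>. (X \<omega>)\<^sup>2 * (Y \<omega>)\<^sup>2)"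
    and "(\<integral>\<omega>. (X \<omega>)\<^sup>2 * (Y \<omega>)\<^sup>2 \<partial>M) = a * b + 2 * c\<^sup>2"
proof -
  have e: "x\<^sup>2 * y\<^sup>2 = ((x + y) ^ 4 + (x - y) ^ 4 - 2 * x ^ 4 - 2 * y ^ 4) / 12" for x y :: real
    by (simp add: eval_nat_numeral algebra_simps)
  note i = gaussian_moments_integrable[OF X, of 4] gaussian_moments_integrable[OF Y, of 4]
    gaussian_moments_integrable[OF P, of 4] gaussian_moments_integrable[OF Q, of 4]
  show "integrable M (\<lambda>\<omega>. (X \<omega>)\<^sup>2 * (Y \<omega>)\<^sup>2)"
    unfolding e using i by simp
  have "(\<integral>\<omega>. (X \<omega>)\<^sup>2 * (Y \<omega>)\<^sup>2 \<partial>M) =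
      (3 * (a + b + 2 * c)\<^sup>2 + 3 * (a + b - 2 * c)\<^sup>2 - 6 * a\<^sup>2 - 6 * b\<^sup>2) / 12"
    unfolding e using i X Y P Q by (simp add: gaussian_moments_def)
  also have "\<dots> = a * b + 2 * c\<^sup>2"
    by (simp add: power2_eq_square field_simps)
  finally show "(\<integral>\<omega>. (X \<omega>)\<^sup>2 * (Y \<omega>)\<^sup>2 \<partial>M) = a * b + 2 * c\<^sup>2" .
qed

text \<open>The products \<open>G i i * G j j\<close> from the mixed moments add up to the squared
  trace and complete the square with \<open>x\<close>; what remains is the variance, twice the
  squared Frobenius norm of \<open>G\<close> times \<open>r\<^sup>2\<close>. The centre
  \<open>x\<close> is arbitrary, so bias and variance of a realized volatility come out of one
  identity.\<close>

lemma gaussian_moments_sum_squares: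
  assumes "finite I" and D: "\<And>i. i \<in> I \<Longrightarrow> gaussian_moments M (b i) (G i i)"
    and P: "\<And>i j. i \<in> I \<Longrightarrow> j \<in> I \<Longrightarrow>
      gaussian_moments M (\<lambda>\<omega>. b i \<omega> + b j \<omega>) (G i i + G j j + 2 * G i j)"
    and Q: "\<And>i j. i \<in> I \<Longrightarrow> j \<in> I \<Longrightarrow>
      gaussian_moments M (\<lambda>\<omega>. b i \<omega> - b j \<omega>) (G i i + G j j - 2 * G i j)"
  shows "integrable M (\<lambda>\<omega>. (r * (\<Sum>i\<in>I. (b i \<omega>)\<^sup>2) - x)\<^sup>2)"
    and "(\<integral>\<omega>. (r * (\<Sum>i\<in>I. (b i \<omega>)\<^sup>2) - x)\<^sup>2 \<partial>M) =
      (r * (\<Sum>i\<in>I. G i i) - x)\<^sup>2 + 2 * r\<^sup>2 * (\<Sum>i\<in>I. \<Sum>j\<in>I. (G i j)\<^sup>2)"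
proof -
  note mixed = gaussian_moments_mixed[OF D D P Q]
  note sq = gaussian_moments_integrable[OF D, of _ 2]
  have e: "(r * (\<Sum>i\<in>I. (b i \<omega>)\<^sup>2) - x)\<^sup>2 = r\<^sup>2 * (\<Sum>i\<in>I. \<Sum>j\<in>I. (b i \<omega>)\<^sup>2 * (b j \<omega>)\<^sup>2)
      - 2 * r * x * (\<Sum>i\<in>I. (b i \<omega>)\<^sup>2) + x\<^sup>2" for \<omega>
    unfolding sum_product[symmetric] by (simp add: power2_eq_square algebra_simps)
  show "integrable M (\<lambda>\<omega>. (r * (\<Sum>i\<in>I. (b i \<omega>)\<^sup>2) - x)\<^sup>2)"
    unfolding e using mixed(1) sq by simp
  have "(\<integral>\<omega>. (r * (\<Sum>i\<in>I. (b i \<omega>)\<^sup>2) - x)\<^sup>2 \<partial>M) =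
      r\<^sup>2 * (\<Sum>i\<in>I. \<Sum>j\<in>I. (\<integral>\<omega>. (b i \<omega>)\<^sup>2 * (b j \<omega>)\<^sup>2 \<partial>M))
      - 2 * r * x * (\<Sum>i\<in>I. (\<integral>\<omega>. (b i \<omega>)\<^sup>2 \<partial>M)) + x\<^sup>2"
    unfolding e using mixed(1) sq
    by (simp add: prob_space)
  also have "\<dots> = r\<^sup>2 * (\<Sum>i\<in>I. \<Sum>j\<in>I. G i i * G j j + 2 * (G i j)\<^sup>2)
      - 2 * r * x * (\<Sum>i\<in>I. G i i) + x\<^sup>2"
    using mixed(2) D by (simp add: gaussian_moments_def cong: sum.cong)
  also have "\<dots> = (r * (\<Sum>i\<in>I. G i i) - x)\<^sup>2 + 2 * r\<^sup>2 * (\<Sum>i\<in>I. \<Sum>j\<in>I. (G i j)\<^sup>2)"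
    by (simp only: sum.distrib sum_distrib_left[symmetric] sum_distrib_right[symmetric])
       (simp add: power2_eq_square algebra_simps)
  finally show "(\<integral>\<omega>. (r * (\<Sum>i\<in>I. (b i \<omega>)\<^sup>2) - x)\<^sup>2 \<partial>M) =
      (r * (\<Sum>i\<in>I. G i i) - x)\<^sup>2 + 2 * r\<^sup>2 * (\<Sum>i\<in>I. \<Sum>j\<in>I. (G i j)\<^sup>2)" .
qed

end

section \<open>Algebra of coded step functions and their integrals\<close>

lemma step_int_Nil [simp]: "step_int w [] \<omega> = 0"
  and step_int_Cons [simp]: "step_int w ((c, a, b) # ps) \<omega> = c * (w b \<omega> - w a \<omega>) + step_int w ps \<omega>"
  and step_int_append [simp]: "step_int w (ps @ qs) \<omega> = step_int w ps \<omega> + step_int w qs \<omega>"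
  by (simp_all add: step_int_def)

lemma step_fun_Nil [simp]: "step_fun [] s = 0"
  and step_fun_Cons [simp]: "step_fun ((c, a, b) # ps) s = c * indicator {a<..b} s + step_fun ps s"
  and step_fun_append [simp]: "step_fun (ps @ qs) s = step_fun ps s + step_fun qs s"
  by (simp_all add: step_fun_def)

text \<open>Appending codes adds both the functions and the integrals. With scaling, every linear
  combination of step integrals over one Brownian motion becomes a single step integral.\<close>

definition scale_steps :: "real \<Rightarrow> (real \<times> real \<times> real) list \<Rightarrow> (real \<times> real \<times> real) list" where
  "scale_steps r ps = map (\<lambda>(c, a, b). (r * c, a, b)) ps"

lemma scale_steps_simps [simp]:
  "scale_steps r [] = []"
  "scale_steps r ((c, a, b) # ps) = (r * c, a, b) # scale_steps r ps"
  by (simp_all add: scale_steps_def)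

lemma step_int_scale [simp]: "step_int w (scale_steps r ps) \<omega> = r * step_int w ps \<omega>"
  by (induction ps) (auto simp: algebra_simps)

lemma step_fun_scale [simp]: "step_fun (scale_steps r ps) s = r * step_fun ps s"
  by (induction ps) (auto simp: algebra_simps)

text \<open>No common right end is imposed, unlike in \<open>is_wiener_integral\<close>: an
  increment of the field combines integrals over two different horizons.\<close>

definition steps_nonneg :: "(real \<times> real \<times> real) list \<Rightarrow> bool" where
  "steps_nonneg ps \<longleftrightarrow> (\<forall>(c, a, b)\<in>set ps. 0 \<le> a \<and> a \<le> b)"

lemma steps_nonneg_simps [simp]:
  "steps_nonneg []"
  "steps_nonneg ((c, a, b) # ps) \<longleftrightarrow> 0 \<le> a \<and> a \<le> b \<and> steps_nonneg ps"
  "steps_nonneg (ps @ qs) \<longleftrightarrow> steps_nonneg ps \<and> steps_nonneg qs"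
  by (simp_all add: steps_nonneg_def ball_Un)

lemma steps_nonneg_scale [simp]: "steps_nonneg ps \<Longrightarrow> steps_nonneg (scale_steps r ps)"
  by (induction ps) auto

lemma borel_measurable_step_fun [measurable]: "step_fun ps \<in> borel_measurable borel"
proof (induction ps)
  case Nil
  have "step_fun [] = (\<lambda>_. 0)" by auto
  then show ?case by simp
next
  case (Cons p ps)
  obtain c a b where "p = (c, a, b)" by (cases p) auto
  then have "step_fun (p # ps) = (\<lambda>s. c * indicator {a<..b} s + step_fun ps s)" by auto
  with Cons show ?case by simp
qed

lemma step_fun_mult_integrable: "integrable lborel (\<lambda>s. step_fun ps s * step_fun qs s)"
proof (induction ps)
  case (Cons p ps)
  obtain c a b where p: "p = (c, a, b)" by (cases p) auto
  have "integrable lborel (\<lambda>s. indicator {a<..b} s * step_fun qs s)"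
  proof (induction qs)
    case (Cons q qs)
    obtain c' a' b' where q: "q = (c', a', b')" by (cases q) auto
    have "bounded ({a<..b} \<inter> {a'<..b'})"
      by (rule bounded_subset[OF bounded_closed_interval[of a b]]) auto
    then have "emeasure lborel ({a<..b} \<inter> {a'<..b'}) < \<infinity>"
      by (rule emeasure_bounded_finite)
    then have "integrable lborel (\<lambda>s. c' * (indicator ({a<..b} \<inter> {a'<..b'}) s :: real))"
      by (intro integrable_mult_right integrable_real_indicator) auto
    with Cons show ?case
      unfolding indicator_inter_arith by (simp add: q algebra_simps)
  qed simp
  with Cons show ?case
    by (simp add: p algebra_simps)
qed simp

text \<open>Step functions may have overlapping intervals; rewriting them on a common grid turns a step
  integral into a combination of independent Brownian increments.\<close>

lemma steps_on_grid:
  fixes \<tau> :: "nat \<Rightarrow> real"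
  assumes "incseq \<tau>" and "\<forall>(c, a, b)\<in>set ps. a \<in> \<tau> ` {..n} \<and> b \<in> \<tau> ` {..n} \<and> a \<le> b"
  shows "\<exists>d. (\<forall>(w :: real \<Rightarrow> 'w \<Rightarrow> real) \<omega>. step_int w ps \<omega> = (\<Sum>r<n. d r * (w (\<tau> (Suc r)) \<omega> - w (\<tau> r) \<omega> :: real))) \<and>
     (\<forall>s. step_fun ps s = (\<Sum>r<n. d r * indicator {\<tau> r<..\<tau> (Suc r)} s))"
  using assms(2)
proof (induction ps)
  case Nil
  show ?case by (rule exI[of _ "\<lambda>_. 0"]) simp
next
  case (Cons p ps)
  obtain c a b where p: "p = (c, a, b)" by (cases p) auto
  have "\<exists>d. (\<forall>(w :: real \<Rightarrow> 'w \<Rightarrow> real) \<omega>. step_int w ps \<omega> = (\<Sum>r<n. d r * (w (\<tau> (Suc r)) \<omega> - w (\<tau> r) \<omega> :: real))) \<and>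
      (\<forall>s. step_fun ps s = (\<Sum>r<n. d r * indicator {\<tau> r<..\<tau> (Suc r)} s))"
    by (rule Cons.IH) (use Cons.prems in simp)
  then obtain d where d1: "\<And>(w :: real \<Rightarrow> 'w \<Rightarrow> real) \<omega>. step_int w ps \<omega> = (\<Sum>r<n. d r * (w (\<tau> (Suc r)) \<omega> - w (\<tau> r) \<omega>))"
    and d2: "\<And>s. step_fun ps s = (\<Sum>r<n. d r * indicator {\<tau> r<..\<tau> (Suc r)} s)"
    by blast
  from Cons.prems p obtain i j where ij: "i \<le> n" "j \<le> n" "a = \<tau> i" "b = \<tau> j" "a \<le> b"
    by auto
  \<comment> \<open>Repeated grid points may deliver the ends of a degenerate interval in the wrong
    order; both ends then coincide and one index serves for both.\<close>
  have "\<exists>i j. i \<le> j \<and> j \<le> n \<and> a = \<tau> i \<and> b = \<tau> j"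
  proof (cases "i \<le> j")
    case True then show ?thesis using ij by auto
  next
    case False
    then have "\<tau> j \<le> \<tau> i" using assms(1) by (auto simp: incseq_def)
    then show ?thesis using ij by (intro exI[of _ i]) auto
  qed
  then obtain i j where ij: "i \<le> j" "j \<le> n" "a = \<tau> i" "b = \<tau> j" by blast
  define e where "e r = (if r \<in> {i..<j} then c else 0)" for r
  have tele: "(\<Sum>r<n. e r * g r) = c * (\<Sum>r\<in>{i..<j}. g r)" for g
  proof -
    have "(\<Sum>r<n. e r * g r) = (\<Sum>r\<in>{i..<j}. e r * g r)"
      using ij by (intro sum.mono_neutral_right) (auto simp: e_def)
    then show ?thesis by (simp add: e_def sum_distrib_left)
  qed
  have "(\<Sum>r\<in>{i..<j}. indicator {\<tau> r<..\<tau> (Suc r)} s) = (indicator {a<..b} s :: real)" for s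
    using ij(1) unfolding ij(3,4)
  proof (induction j rule: dec_induct)
    case (step k)
    have "\<tau> i \<le> \<tau> k" "\<tau> k \<le> \<tau> (Suc k)" using assms(1) step by (auto simp: incseq_def)
    then show ?case using step by (auto simp: indicator_def)
  qed simp
  then have "step_fun (p # ps) s = (\<Sum>r<n. (e r + d r) * indicator {\<tau> r<..\<tau> (Suc r)} s)" for s
    by (simp add: p d2 distrib_right sum.distrib tele)
  moreover have "step_int w (p # ps) \<omega> = (\<Sum>r<n. (e r + d r) * (w (\<tau> (Suc r)) \<omega> - w (\<tau> r) \<omega>))"
    for w :: "real \<Rightarrow> 'w \<Rightarrow> real" and \<omega>
    using ij by (simp add: p d1 distrib_right sum.distrib tele sum_Suc_diff'[of i j "\<lambda>r. w (\<tau> r) \<omega>"])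
  ultimately show ?case
    by (intro exI[of _ "\<lambda>r. e r + d r"] conjI allI)
qed

text \<open>The independence clause of \<open>brownian_motion\<close> speaks of infinite increasing
  sequences, so the sorted points are continued constantly by the largest one. Inserting 0 keeps the
  list nonempty.\<close>

lemma finite_set_grid:
  fixes T :: "real set"
  assumes "finite T" "T \<subseteq> {0..}"
  obtains \<tau> n where "incseq \<tau>" "0 \<le> \<tau> 0" "T \<subseteq> \<tau> ` {..n::nat}"
proof -
  define xs where "xs = sorted_list_of_set (insert 0 T)"
  have xs: "set xs = insert 0 T" "sorted xs" and ne: "xs \<noteq> []"
    using assms sorted_list_of_set_eq_Nil_iff[of "insert 0 T"]
    by (simp_all add: xs_def del: sorted_list_of_set_insert_remove)
  define \<tau> where "\<tau> r = xs ! min r (length xs - 1)" for r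
  have "incseq \<tau>"
    using xs(2) ne unfolding \<tau>_def
    by (intro incseq_SucI sorted_nth_mono) (auto simp: min_less_iff_disj)
  moreover have "0 \<le> \<tau> 0"
    using xs ne assms nth_mem[of 0 xs] by (auto simp: \<tau>_def)
  moreover have "T \<subseteq> \<tau> ` {..length xs}"
  proof
    fix t assume "t \<in> T"
    then obtain r where "r < length xs" "xs ! r = t"
      using xs(1) by (metis in_set_conv_nth insertI2)
    then show "t \<in> \<tau> ` {..length xs}"
      by (intro image_eqI[of _ _ r]) (auto simp: \<tau>_def min_def)
  qed
  ultimately show ?thesis using that by blast
qed

context prob_space
begin

lemma gaussian_moments_increment:
  assumes "brownian_motion M w" "0 \<le> a" "a \<le> b"
  shows "gaussian_moments M (\<lambda>\<omega>. w b \<omega> - w a \<omega>) (b - a)"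
proof (cases "a = b")
  case False
  then have "distributed M lborel (\<lambda>\<omega>. w b \<omega> - w a \<omega>) (normal_density 0 (sqrt (b - a)))"
    using assms by (auto simp: brownian_motion_def)
  from gaussian_moments_normal[OF this] show ?thesis using False assms by simp
qed (simp add: gaussian_moments_zero)

text \<open>Ito isometry for step functions. On a common grid the integral is a combination of
  independent increments whose variances are the cell lengths; the cells are disjoint, so squaring
  the step function produces the same weighted sum.\<close>

lemma gaussian_moments_step_int:
  assumes B: "brownian_motion M w" and ps: "steps_nonneg ps"
  shows "gaussian_moments M (step_int w ps) (\<integral>s. (step_fun ps s)\<^sup>2 \<partial>lborel)"
proof -
  define T where "T = (\<Union>(c, a, b)\<in>set ps. {a, b})"
  have "finite T" "T \<subseteq> {0..}"
    using ps by (auto simp: T_def steps_nonneg_def)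
  then obtain \<tau> n where \<tau>: "incseq \<tau>" "0 \<le> \<tau> 0" "T \<subseteq> \<tau> ` {..n::nat}"
    using finite_set_grid by blast
  have "\<forall>(c, a, b)\<in>set ps. a \<in> \<tau> ` {..n} \<and> b \<in> \<tau> ` {..n} \<and> a \<le> b"
    using ps \<tau>(3) by (force simp: T_def steps_nonneg_def)
  from steps_on_grid[OF \<tau>(1) this] obtain d where
    d: "(\<forall>(w :: real \<Rightarrow> 'a \<Rightarrow> real) \<omega>. step_int w ps \<omega> = (\<Sum>r<n. d r * (w (\<tau> (Suc r)) \<omega> - w (\<tau> r) \<omega>))) \<and>
      (\<forall>s. step_fun ps s = (\<Sum>r<n. d r * indicator {\<tau> r<..\<tau> (Suc r)} s))" by (elim exE)
  then have d1: "\<And>\<omega>. step_int w ps \<omega> = (\<Sum>r<n. d r * (w (\<tau> (Suc r)) \<omega> - w (\<tau> r) \<omega>))"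
    and d2: "\<And>s. step_fun ps s = (\<Sum>r<n. d r * indicator {\<tau> r<..\<tau> (Suc r)} s)"
    by simp_all
  have \<tau>_nn: "0 \<le> \<tau> r" for r
    using \<tau>(1,2) by (meson incseqD le0 order_trans)
  have \<tau>_mono: "r \<le> r' \<Longrightarrow> \<tau> r \<le> \<tau> r'" for r r'
    using \<tau>(1) by (simp add: incseqD)
  have "indep_vars (\<lambda>_. borel) (\<lambda>r \<omega>. w (\<tau> (Suc r)) \<omega> - w (\<tau> r) \<omega>) {..<n}"
    using B \<tau> by (auto simp: brownian_motion_def)
  then have "indep_vars (\<lambda>_. borel) (\<lambda>r \<omega>. d r * (w (\<tau> (Suc r)) \<omega> - w (\<tau> r) \<omega>)) {..<n}"
    by (rule indep_vars_compose2[where Y = "\<lambda>r x. d r * x"]) simp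
  then have "gaussian_moments M (\<lambda>\<omega>. \<Sum>r<n. d r * (w (\<tau> (Suc r)) \<omega> - w (\<tau> r) \<omega>))
      (\<Sum>r<n. (d r)\<^sup>2 * (\<tau> (Suc r) - \<tau> r))"
    by (intro gaussian_moments_sum gaussian_moments_scale gaussian_moments_increment[OF B])
       (auto simp: \<tau>_nn \<tau>_mono)
  moreover have "(\<integral>s. (step_fun ps s)\<^sup>2 \<partial>lborel) = (\<Sum>r<n. (d r)\<^sup>2 * (\<tau> (Suc r) - \<tau> r))"
  proof -
    have "(step_fun ps s)\<^sup>2 = (\<Sum>r<n. (d r)\<^sup>2 * indicator {\<tau> r<..\<tau> (Suc r)} s)" for s
    proof -
      have disj: "indicator {\<tau> r<..\<tau> (Suc r)} s * indicator {\<tau> r'<..\<tau> (Suc r')} s = (0::real)"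
        if "r \<noteq> r'" for r r'
        using that \<tau>_mono[of "Suc r" r'] \<tau>_mono[of "Suc r'" r]
        by (cases r r' rule: linorder_cases) (auto simp: indicator_def)
      have "(step_fun ps s)\<^sup>2 = (\<Sum>r<n. \<Sum>r'<n. d r * d r' *
          (indicator {\<tau> r<..\<tau> (Suc r)} s * indicator {\<tau> r'<..\<tau> (Suc r')} s))"
        unfolding d2 power2_eq_square sum_product by (intro sum.cong refl) (simp only: mult_ac)
      also have "\<dots> = (\<Sum>r<n. \<Sum>r'<n. if r' = r then (d r)\<^sup>2 * indicator {\<tau> r<..\<tau> (Suc r)} s else 0)"
      proof (intro sum.cong refl)
        fix r r'
        show "d r * d r' * (indicator {\<tau> r<..\<tau> (Suc r)} s * indicator {\<tau> r'<..\<tau> (Suc r')} s) =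
            (if r' = r then (d r)\<^sup>2 * indicator {\<tau> r<..\<tau> (Suc r)} s else 0)"
        proof (cases "r' = r")
          case False
          then show ?thesis using disj[of r r'] by (simp only: mult_zero_right if_False)
        qed (simp add: power2_eq_square indicator_def)
      qed
      also have "\<dots> = (\<Sum>r<n. (d r)\<^sup>2 * indicator {\<tau> r<..\<tau> (Suc r)} s)"
        by simp
      finally show ?thesis .
    qed
    then have "(\<integral>s. (step_fun ps s)\<^sup>2 \<partial>lborel) =
        (\<integral>s. (\<Sum>r<n. (d r)\<^sup>2 * indicator {\<tau> r<..\<tau> (Suc r)} s) \<partial>lborel)"
      by simp
    also have "\<dots> = (\<Sum>r<n. (\<integral>s. (d r)\<^sup>2 * indicator {\<tau> r<..\<tau> (Suc r)} s \<partial>lborel))"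
      by (rule Bochner_Integration.integral_sum) (auto simp: \<tau>_mono)
    also have "\<dots> = (\<Sum>r<n. (d r)\<^sup>2 * (\<tau> (Suc r) - \<tau> r))"
      by (simp add: \<tau>_mono)
    finally show ?thesis .
  qed
  ultimately show ?thesis
    by (simp add: d1[abs_def])
qed

text \<open>The Brownian motions are independent as random paths. A step integral with nonnegative
  nodes reads its path at finitely many times in \<open>{0..}\<close>, hence is a measurable
  function of the restricted path and inherits independence across modes.\<close>

lemma gaussian_moments_step_int_sum:
  assumes B: "\<And>k l. (k, l) \<in> F \<Longrightarrow> brownian_motion M (w k l)"
    and ind: "indep_vars (\<lambda>_. PiM {0..} (\<lambda>_. borel)) (\<lambda>(k, l) \<omega>. \<lambda>t\<in>{0..}. w k l t \<omega>) F"
    and "finite F" and ps: "\<And>k l. (k, l) \<in> F \<Longrightarrow> steps_nonneg (ps k l)"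
  shows "gaussian_moments M (\<lambda>\<omega>. \<Sum>(k, l)\<in>F. step_int (w k l) (ps k l) \<omega>)
    (\<Sum>(k, l)\<in>F. \<integral>s. (step_fun (ps k l) s)\<^sup>2 \<partial>lborel)"
proof -
  have path: "step_int w qs \<omega> = step_int (\<lambda>t f. f t) qs (\<lambda>t\<in>{0..}. w t \<omega>)"
    if "steps_nonneg qs" for w :: "real \<Rightarrow> 'a \<Rightarrow> real" and qs \<omega>
    using that by (induction qs) auto
  have meas: "step_int (\<lambda>t f. f t) qs \<in> borel_measurable (PiM {0..} (\<lambda>_. borel))"
    if "steps_nonneg qs" for qs
    using that
  proof (induction qs)
    case Nil
    have "step_int (\<lambda>t f. f t) [] = (\<lambda>f. 0)" by auto
    then show ?case by simp
  next
    case (Cons q qs)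
    obtain c a b where q: "q = (c, a, b)" by (cases q) auto
    then have "step_int (\<lambda>t f. f t) (q # qs) = (\<lambda>f. c * (f b - f a) + step_int (\<lambda>t f. f t) qs f)"
      by auto
    moreover have "(\<lambda>f. f a) \<in> borel_measurable (PiM {0..} (\<lambda>_. borel :: real measure))"
      "(\<lambda>f. f b) \<in> borel_measurable (PiM {0..} (\<lambda>_. borel :: real measure))"
      using Cons.prems by (auto simp: q intro!: measurable_component_singleton)
    ultimately show ?case using Cons by (auto simp: q)
  qed
  have "indep_vars (\<lambda>_. borel) (\<lambda>p \<omega>. step_int (\<lambda>t f. f t) (ps (fst p) (snd p))
      ((case p of (k, l) \<Rightarrow> \<lambda>\<omega>. \<lambda>t\<in>{0..}. w k l t \<omega>) \<omega>)) F"
    by (rule indep_vars_compose2[OF ind]) (use ps meas in \<open>auto\<close>)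
  also have "?this \<longleftrightarrow> indep_vars (\<lambda>_. borel) (\<lambda>p. step_int (w (fst p) (snd p)) (ps (fst p) (snd p))) F"
    using ps by (intro indep_vars_cong) (auto simp: path fun_eq_iff)
  finally have "gaussian_moments M (\<lambda>\<omega>. \<Sum>p\<in>F. step_int (w (fst p) (snd p)) (ps (fst p) (snd p)) \<omega>)
      (\<Sum>p\<in>F. \<integral>s. (step_fun (ps (fst p) (snd p)) s)\<^sup>2 \<partial>lborel)"
    using B ps \<open>finite F\<close> by (intro gaussian_moments_sum gaussian_moments_step_int) auto
  then show ?thesis by (simp add: case_prod_unfold)
qed

end

section \<open>Lattice sums\<close>

lemma nn_integral_scale:
  fixes f :: "real \<Rightarrow> ennreal"
  assumes [measurable]: "f \<in> borel_measurable borel" and "0 < c"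
  shows "(\<integral>\<^sup>+x. f (c * x) * indicator {0..} x \<partial>lborel) =
    ennreal (1 / c) * (\<integral>\<^sup>+x. f x * indicator {0..} x \<partial>lborel)"
proof -
  have "(\<integral>\<^sup>+x. f x * indicator {0..} x \<partial>lborel) =
      ennreal c * (\<integral>\<^sup>+x. f (c * x) * indicator {0..} (c * x) \<partial>lborel)"
    using nn_integral_real_affine[of "\<lambda>x. f x * indicator {0..} x" c 0] assms by simp
  also have "\<dots> = ennreal c * (\<integral>\<^sup>+x. f (c * x) * indicator {0..} x \<partial>lborel)"
    using assms by (intro arg_cong2[where f = times] nn_integral_cong)
      (auto simp: indicator_def zero_le_mult_iff)
  finally have "ennreal (1 / c) * (\<integral>\<^sup>+x. f x * indicator {0..} x \<partial>lborel) =
      (ennreal (1 / c) * ennreal c) * (\<integral>\<^sup>+x. f (c * x) * indicator {0..} x \<partial>lborel)"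
    by (simp add: mult.assoc)
  also have "ennreal (1 / c) * ennreal c = 1"
    using assms by (simp add: ennreal_mult[symmetric])
  finally show ?thesis by simp
qed

text \<open>Change of variables on bounded intervals, extended to the half line by continuity from
  below of the two density measures.\<close>

lemma nn_integral_square_substitution:
  fixes f :: "real \<Rightarrow> ennreal"
  assumes [measurable]: "f \<in> borel_measurable borel"
  shows "(\<integral>\<^sup>+x. f (x\<^sup>2) * ennreal (2 * x) * indicator {0..} x \<partial>lborel) =
    (\<integral>\<^sup>+x. f x * indicator {0..} x \<partial>lborel)"
proof -
  have fin: "(\<integral>\<^sup>+x. f (x\<^sup>2) * ennreal (2 * x) * indicator {0..real (Suc n)} x \<partial>lborel) =
      (\<integral>\<^sup>+x. f x * indicator {0..(real (Suc n))\<^sup>2} x \<partial>lborel)" for n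
  proof -
    have "((\<lambda>x. x\<^sup>2) has_real_derivative 2 * x) (at x)" for x :: real
      by (auto intro!: derivative_eq_intros)
    then show ?thesis
      using nn_integral_substitution_aux[of f 0 "real (Suc n)" "\<lambda>x. x\<^sup>2" "\<lambda>x. 2 * x"]
      by (auto intro!: continuous_intros)
  qed
  have "emeasure (density lborel (\<lambda>x. f (x\<^sup>2) * ennreal (2 * x))) (\<Union>n. {0..real (Suc n)}) =
      (SUP n. emeasure (density lborel (\<lambda>x. f (x\<^sup>2) * ennreal (2 * x))) {0..real (Suc n)})"
    by (rule SUP_emeasure_incseq[symmetric]) (auto simp: incseq_def)
  also have "\<dots> = (SUP n. emeasure (density lborel f) {0..(real (Suc n))\<^sup>2})"
    by (simp add: emeasure_density fin del: of_nat_Suc)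
  also have "\<dots> = emeasure (density lborel f) (\<Union>n. {0..(real (Suc n))\<^sup>2})"
    by (rule SUP_emeasure_incseq) (auto simp: incseq_def elim!: order_trans intro!: power_mono)
  also have "(\<Union>n. {0..(real (Suc n))\<^sup>2}) = {0..}"
  proof -
    have "\<exists>n. x \<le> (real (Suc n))\<^sup>2" for x
    proof -
      obtain n where "x \<le> real n" using real_arch_simple by blast
      moreover have "real n \<le> (real (Suc n))\<^sup>2" by (simp add: power2_eq_square algebra_simps)
      ultimately show ?thesis by (meson order_trans)
    qed
    then show ?thesis by auto
  qed
  also have "(\<Union>n. {0..real (Suc n)}) = {0..}"
  proof -
    have "\<exists>n. x \<le> real (Suc n)" for x
    proof -
      obtain n where "x \<le> real n" using real_arch_simple by blast
      then show ?thesis by (intro exI[of _ n]) simp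
    qed
    then show ?thesis by auto
  qed
  finally show ?thesis by (simp add: emeasure_density)
qed

text \<open>The lattice sums below compare with the integral of this function of \<open>x\<^sup>2 + y\<^sup>2\<close>
  over a quadrant.\<close>

definition heat_kernel :: "real \<Rightarrow> real \<Rightarrow> real" where
  "heat_kernel \<alpha> u = (1 - exp (- u)) * u powr (- 1 - \<alpha>)"

lemma borel_measurable_heat_kernel [measurable]: "heat_kernel \<alpha> \<in> borel_measurable borel"
  unfolding heat_kernel_def[abs_def] by measurable

lemma heat_kernel_nonneg: "0 \<le> u \<Longrightarrow> 0 \<le> heat_kernel \<alpha> u"
  by (simp add: heat_kernel_def)

text \<open>Since (1 - exp(-u)) / u is the integral of exp(-u s) over s in [0, 1], this is a double
  integral. With the order exchanged, the integral over u is Gamma(1 - \<alpha>) times s^(\<alpha> -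
  1), and integrating over s contributes 1 / \<alpha>. The origin is removed as a null set in both
  variables.\<close>

lemma nn_integral_heat_kernel:
  assumes "0 < \<alpha>" "\<alpha> < 1"
  shows "(\<integral>\<^sup>+u. ennreal (heat_kernel \<alpha> u) * indicator {0..} u \<partial>lborel) =
    ennreal (Gamma (1 - \<alpha>) / \<alpha>)"
proof -
  have mix: "ennreal (heat_kernel \<alpha> u) * indicator {0..} u =
      (\<integral>\<^sup>+s. ennreal (u powr (- \<alpha>) * exp (- (u * s))) * indicator {0..1} s * indicator {0..} u \<partial>lborel)"
    if "u \<noteq> 0" for u
  proof (cases "0 < u")
    case True
    have "(\<integral>\<^sup>+s. ennreal (u powr (- \<alpha>) * exp (- (u * s))) * indicator {0..1} s \<partial>lborel) =
        ennreal (- (u powr (- \<alpha>) * exp (- (u * 1)) / u) - - (u powr (- \<alpha>) * exp (- (u * 0)) / u))"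
      by (rule nn_integral_FTC_Icc)
         (use True in \<open>auto intro!: derivative_eq_intros simp: field_simps\<close>)
    also have "- (u powr (- \<alpha>) * exp (- (u * 1)) / u) - - (u powr (- \<alpha>) * exp (- (u * 0)) / u) =
        heat_kernel \<alpha> u"
      using True by (simp add: heat_kernel_def powr_diff powr_minus field_simps)
    finally show ?thesis using True by simp
  next
    case False
    with that have "indicator {0..} u = (0::ennreal)" by simp
    then show ?thesis by (simp only: mult_zero_right nn_integral_const mult_zero_left)
  qed
  have inner: "(\<integral>\<^sup>+u. ennreal (u powr (- \<alpha>) * exp (- (u * s))) * indicator {0..1} s * indicator {0..} u \<partial>lborel)
      = ennreal (Gamma (1 - \<alpha>)) * (ennreal (s powr (\<alpha> - 1)) * indicator {0..1} s)" if "s \<noteq> 0" for s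
  proof (cases "s \<in> {0<..1}")
    case True
    define f where "f = (\<lambda>v. ennreal ((v / s) powr (- \<alpha>) * exp (- v)))"
    have "(\<integral>\<^sup>+u. ennreal (u powr (- \<alpha>) * exp (- (u * s))) * indicator {0..1} s * indicator {0..} u \<partial>lborel)
       = (\<integral>\<^sup>+u. f (s * u) * indicator {0..} u \<partial>lborel)"
      using True by (intro nn_integral_cong) (auto simp: f_def mult_ac)
    also have "\<dots> = ennreal (1 / s) * (\<integral>\<^sup>+u. f u * indicator {0..} u \<partial>lborel)"
      using True by (intro nn_integral_scale) (auto simp: f_def)
    also have "(\<integral>\<^sup>+u. f u * indicator {0..} u \<partial>lborel) =
        (\<integral>\<^sup>+u. ennreal (s powr \<alpha>) * ennreal (indicator {0..} u * u powr ((1 - \<alpha>) - 1) / exp u) \<partial>lborel)"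
      using True by (intro nn_integral_cong)
        (auto simp: f_def indicator_def powr_divide powr_minus exp_minus ennreal_mult[symmetric] field_simps)
    also have "\<dots> = ennreal (s powr \<alpha>) * ennreal (Gamma (1 - \<alpha>))"
      using assms by (subst nn_integral_cmult) (auto simp: Gamma_conv_nn_integral_real)
    also have "ennreal (1 / s) * (ennreal (s powr \<alpha>) * ennreal (Gamma (1 - \<alpha>))) =
        ennreal (Gamma (1 - \<alpha>)) * ennreal (s powr (\<alpha> - 1))"
      using True assms
      by (simp add: ennreal_mult[symmetric] powr_diff Gamma_real_nonneg mult_ac)
    finally show ?thesis using True by simp
  next
    case False
    with that have "indicator {0..1} s = (0::ennreal)" by (auto simp: indicator_def)
    then show ?thesis by (simp only: mult_zero_right nn_integral_const mult_zero_left)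
  qed
  have "(\<integral>\<^sup>+u. ennreal (heat_kernel \<alpha> u) * indicator {0..} u \<partial>lborel) =
      (\<integral>\<^sup>+u. \<integral>\<^sup>+s. ennreal (u powr (- \<alpha>) * exp (- (u * s))) * indicator {0..1} s * indicator {0..} u \<partial>lborel \<partial>lborel)"
    by (intro nn_integral_cong_AE AE_I[of _ _ "{0}"]) (use mix in auto)
  also have "\<dots> = (\<integral>\<^sup>+s. \<integral>\<^sup>+u. ennreal (u powr (- \<alpha>) * exp (- (u * s))) * indicator {0..1} s * indicator {0..} u \<partial>lborel \<partial>lborel)"
    by (rule lborel_pair.Fubini') measurable
  also have "\<dots> = (\<integral>\<^sup>+s. ennreal (Gamma (1 - \<alpha>)) * (ennreal (s powr (\<alpha> - 1)) * indicator {0..1} s) \<partial>lborel)"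
    by (intro nn_integral_cong_AE AE_I[of _ _ "{0}"]) (use inner in auto)
  also have "\<dots> = ennreal (Gamma (1 - \<alpha>)) * (\<integral>\<^sup>+s. ennreal (s powr (\<alpha> - 1)) * indicator {0..1} s \<partial>lborel)"
    by (rule nn_integral_cmult) measurable
  also have "(\<integral>\<^sup>+s. ennreal (s powr (\<alpha> - 1)) * indicator {0..1} s \<partial>lborel) = ennreal (1 / \<alpha>)"
    using nn_integral_has_integral_lebesgue'[OF _ has_integral_powr_from_0[of "\<alpha> - 1" 1]] assms by simp
  finally show ?thesis
    using assms by (simp add: ennreal_mult[symmetric] Gamma_real_nonneg)
qed

text \<open>Polar coordinates in disguise: with y = x t the inner integral runs over the slope t,
  and after exchanging the order x enters through x^2 and the factor x dx. The radial integral is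
  half of \<open>nn_integral_heat_kernel\<close> divided by 1 + t^2, and the slopes contribute pi /
  2 through the arctangent.\<close>

lemma nn_integral_heat_kernel_quadrant:
  assumes "0 < \<alpha>" "\<alpha> < 1"
  shows "(\<integral>\<^sup>+x. (\<integral>\<^sup>+y. ennreal (heat_kernel \<alpha> (x\<^sup>2 + y\<^sup>2)) * indicator {0..} y \<partial>lborel) * indicator {0..} x \<partial>lborel)
    = ennreal (pi / 4 * (Gamma (1 - \<alpha>) / \<alpha>))"
proof -
  let ?\<phi> = "heat_kernel \<alpha>" and ?P = "ennreal (Gamma (1 - \<alpha>) / \<alpha>)"
  have inner: "(\<integral>\<^sup>+y. ennreal (?\<phi> (x\<^sup>2 + y\<^sup>2)) * indicator {0..} y \<partial>lborel) * indicator {0..} x =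
      (\<integral>\<^sup>+t. ennreal (?\<phi> (x\<^sup>2 * (1 + t\<^sup>2))) * ennreal x * indicator {0..} x * indicator {0..} t \<partial>lborel)"
    if "x \<noteq> 0" for x
  proof (cases "0 < x")
    case True
    have "ennreal x * (\<integral>\<^sup>+t. ennreal (?\<phi> (x\<^sup>2 + (x * t)\<^sup>2)) * indicator {0..} t \<partial>lborel) =
        ennreal x * (ennreal (1 / x) * (\<integral>\<^sup>+y. ennreal (?\<phi> (x\<^sup>2 + y\<^sup>2)) * indicator {0..} y \<partial>lborel))"
      using True by (subst nn_integral_scale[of "\<lambda>y. ennreal (?\<phi> (x\<^sup>2 + y\<^sup>2))"]) auto
    also have "\<dots> = (\<integral>\<^sup>+y. ennreal (?\<phi> (x\<^sup>2 + y\<^sup>2)) * indicator {0..} y \<partial>lborel)"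
      using True by (simp add: mult.assoc[symmetric] ennreal_mult[symmetric])
    finally have "(\<integral>\<^sup>+y. ennreal (?\<phi> (x\<^sup>2 + y\<^sup>2)) * indicator {0..} y \<partial>lborel) =
        (\<integral>\<^sup>+t. ennreal x * (ennreal (?\<phi> (x\<^sup>2 + (x * t)\<^sup>2)) * indicator {0..} t) \<partial>lborel)"
      by (subst nn_integral_cmult) auto
    then show ?thesis using True
      by (simp add: power_mult_distrib distrib_left mult_ac)
  next
    case False
    with that have "indicator {0..} x = (0::ennreal)" by simp
    then show ?thesis by (simp only: mult_zero_right nn_integral_const mult_zero_left)
  qed
  have outer: "(\<integral>\<^sup>+x. ennreal (?\<phi> (x\<^sup>2 * (1 + t\<^sup>2))) * ennreal x * indicator {0..} x * indicator {0..} t \<partial>lborel)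
      = ?P * ennreal (1 / 2) * (ennreal (1 / (1 + t\<^sup>2)) * indicator {0..} t)" for t
  proof -
    have pos: "0 < 1 + t\<^sup>2" by (simp add: add_pos_nonneg)
    have e: "ennreal x = ennreal (1 / 2) * ennreal (2 * x)" if "x \<ge> 0" for x
      using that by (subst ennreal_mult[symmetric]) auto
    have "(\<integral>\<^sup>+x. ennreal (?\<phi> (x\<^sup>2 * (1 + t\<^sup>2))) * ennreal x * indicator {0..} x * indicator {0..} t \<partial>lborel)
       = (\<integral>\<^sup>+x. (ennreal (1 / 2) * indicator {0..} t) *
          (ennreal (?\<phi> ((1 + t\<^sup>2) * x\<^sup>2)) * ennreal (2 * x) * indicator {0..} x) \<partial>lborel)"
    proof (intro nn_integral_cong)
      fix x
      show "ennreal (?\<phi> (x\<^sup>2 * (1 + t\<^sup>2))) * ennreal x * indicator {0..} x * indicator {0..} t =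
          (ennreal (1 / 2) * indicator {0..} t) *
          (ennreal (?\<phi> ((1 + t\<^sup>2) * x\<^sup>2)) * ennreal (2 * x) * indicator {0..} x)"
      proof (cases "0 \<le> x")
        case True
        show ?thesis by (subst e[OF True]) (simp only: mult_ac)
      qed simp
    qed
    also have "\<dots> = (ennreal (1 / 2) * indicator {0..} t) *
        (\<integral>\<^sup>+u. ennreal (?\<phi> ((1 + t\<^sup>2) * u)) * indicator {0..} u \<partial>lborel)"
      by (subst nn_integral_cmult) (auto intro!: arg_cong2[where f = times]
          nn_integral_square_substitution[of "\<lambda>u. ennreal (?\<phi> ((1 + t\<^sup>2) * u))"])
    also have "\<dots> = (ennreal (1 / 2) * indicator {0..} t) * (ennreal (1 / (1 + t\<^sup>2)) * ?P)"
      using pos by (subst nn_integral_scale[of "\<lambda>u. ennreal (?\<phi> u)"])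
        (auto simp: nn_integral_heat_kernel[OF assms])
    finally show ?thesis by (simp only: mult_ac)
  qed
  have "(\<integral>\<^sup>+x. (\<integral>\<^sup>+y. ennreal (?\<phi> (x\<^sup>2 + y\<^sup>2)) * indicator {0..} y \<partial>lborel) * indicator {0..} x \<partial>lborel) =
     (\<integral>\<^sup>+x. \<integral>\<^sup>+t. ennreal (?\<phi> (x\<^sup>2 * (1 + t\<^sup>2))) * ennreal x * indicator {0..} x * indicator {0..} t \<partial>lborel \<partial>lborel)"
    by (intro nn_integral_cong_AE AE_I[of _ _ "{0}"]) (use inner in auto)
  also have "\<dots> = (\<integral>\<^sup>+t. \<integral>\<^sup>+x. ennreal (?\<phi> (x\<^sup>2 * (1 + t\<^sup>2))) * ennreal x * indicator {0..} x * indicator {0..} t \<partial>lborel \<partial>lborel)"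
    by (rule lborel_pair.Fubini') measurable
  also have "\<dots> = ?P * ennreal (1 / 2) * (\<integral>\<^sup>+t. ennreal (1 / (1 + t\<^sup>2)) * indicator {0..} t \<partial>lborel)"
    unfolding outer by (rule nn_integral_cmult) measurable
  also have "(\<integral>\<^sup>+t. ennreal (1 / (1 + t\<^sup>2)) * indicator {0..} t \<partial>lborel) = ennreal (pi / 2 - arctan 0)"
  proof (rule nn_integral_FTC_atLeast)
    show "DERIV arctan t :> 1 / (1 + t\<^sup>2)" for t
      using DERIV_arctan[of t] by (simp add: divide_inverse)
    show "(arctan \<longlongrightarrow> pi / 2) at_top"
      by (rule tendsto_arctan_at_top)
  qed auto
  also have "?P * ennreal (1 / 2) * ennreal (pi / 2 - arctan 0) =
      ennreal (Gamma (1 - \<alpha>) / \<alpha> * (1 / 2) * (pi / 2 - arctan 0))"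
  proof -
    have nn: "0 \<le> Gamma (1 - \<alpha>) / \<alpha>" "0 \<le> Gamma (1 - \<alpha>) / \<alpha> * (1 / 2)"
      using assms by (auto simp: Gamma_real_nonneg)
    show ?thesis
      by (simp only: ennreal_mult'[OF nn(1)] ennreal_mult'[OF nn(2)])
  qed
  finally show ?thesis
    by (simp add: mult_ac)
qed

section \<open>Comparison of antitone sums with integrals\<close>

lemma suminf_le_nn_integral_antimono:
  fixes g :: "real \<Rightarrow> ennreal"
  assumes [measurable]: "g \<in> borel_measurable borel"
    and anti: "\<And>x y. 0 < x \<Longrightarrow> x \<le> y \<Longrightarrow> g y \<le> g x"
  shows "(\<Sum>k. g (real (Suc k))) \<le> (\<integral>\<^sup>+x. g x * indicator {0..} x \<partial>lborel)"
proof -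
  define N where "N = density lborel g"
  define A where "A k = {real k<..real (Suc k)}" for k
  have [measurable]: "A k \<in> sets borel" for k by (simp add: A_def)
  have "disjoint_family A"
    unfolding disjoint_family_on_def
  proof (intro ballI impI)
    fix m n :: nat assume "m \<noteq> n"
    then have "real (Suc m) \<le> real n \<or> real (Suc n) \<le> real m" by (simp only: of_nat_le_iff) linarith
    then show "A m \<inter> A n = {}" by (auto simp: A_def)
  qed
  have "g (real (Suc k)) \<le> emeasure N (A k)" for k
  proof -
    have "g (real (Suc k)) = (\<integral>\<^sup>+x. g (real (Suc k)) * indicator (A k) x \<partial>lborel)"
      by (simp add: nn_integral_cmult_indicator A_def)
    also have "\<dots> \<le> (\<integral>\<^sup>+x. g x * indicator (A k) x \<partial>lborel)"
      by (intro nn_integral_mono) (auto simp: A_def indicator_def intro!: anti)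
    finally show ?thesis by (simp add: N_def emeasure_density)
  qed
  then have "(\<Sum>k. g (real (Suc k))) \<le> (\<Sum>k. emeasure N (A k))"
    by (intro suminf_le) auto
  also have "\<dots> = emeasure N (\<Union>k. A k)"
    using \<open>disjoint_family A\<close> by (intro suminf_emeasure) (auto simp: N_def)
  also have "\<dots> \<le> emeasure N {0..}"
    by (intro emeasure_mono) (auto simp: A_def N_def)
  finally show ?thesis by (simp add: N_def emeasure_density)
qed

text \<open>On a cell beyond 1 the integrand is at most its value at the left end; the cell next to
  the origin has no such bound and stays as an integral. Antitonicity is asked only for positive
  arguments, since \<open>heat_kernel\<close> takes the value 0 at the origin.\<close>

lemma nn_integral_antimono_le_suminf:
  fixes g :: "real \<Rightarrow> ennreal"
  assumes [measurable]: "g \<in> borel_measurable borel"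
    and anti: "\<And>x y. 0 < x \<Longrightarrow> x \<le> y \<Longrightarrow> g y \<le> g x"
  shows "(\<integral>\<^sup>+x. g x * indicator {0..} x \<partial>lborel) \<le>
    (\<integral>\<^sup>+x. g x * indicator {0..1} x \<partial>lborel) + (\<Sum>k. g (real (Suc k)))"
proof -
  define N where "N = density lborel g"
  define A where "A k = {real (Suc k)..real (Suc (Suc k))}" for k
  have [measurable]: "A k \<in> sets borel" for k by (simp add: A_def)
  have "{0..} \<subseteq> {0..1} \<union> (\<Union>k. A k)"
  proof
    fix x :: real assume "x \<in> {0..}"
    show "x \<in> {0..1} \<union> (\<Union>k. A k)"
    proof (cases "x \<le> 1")
      case False
      define k where "k = nat \<lfloor>x\<rfloor> - 1"
      have k: "real (Suc k) = of_int \<lfloor>x\<rfloor>" "real (Suc (Suc k)) = of_int \<lfloor>x\<rfloor> + 1"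
        using False by (simp_all add: k_def)
      have "x \<in> A k"
        unfolding A_def k using of_int_floor_le[of x] real_of_int_floor_add_one_ge[of x] by simp
      then show ?thesis by blast
    qed (use \<open>x \<in> {0..}\<close> in auto)
  qed
  then have "emeasure N {0..} \<le> emeasure N ({0..1} \<union> (\<Union>k. A k))"
    by (intro emeasure_mono) (auto simp: N_def)
  also have "\<dots> \<le> emeasure N {0..1} + emeasure N (\<Union>k. A k)"
    by (intro emeasure_subadditive) (auto simp: N_def)
  also have "emeasure N (\<Union>k. A k) \<le> (\<Sum>k. emeasure N (A k))"
    by (intro emeasure_subadditive_countably) (auto simp: N_def)
  also have "\<dots> \<le> (\<Sum>k. g (real (Suc k)))"
  proof (intro suminf_le)
    fix k
    have "emeasure N (A k) = (\<integral>\<^sup>+x. g x * indicator (A k) x \<partial>lborel)"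
      by (simp add: N_def emeasure_density)
    also have "\<dots> \<le> (\<integral>\<^sup>+x. g (real (Suc k)) * indicator (A k) x \<partial>lborel)"
      by (intro nn_integral_mono) (auto simp: A_def indicator_def intro!: anti)
    also have "\<dots> = g (real (Suc k))"
      by (simp add: nn_integral_cmult_indicator A_def)
    finally show "emeasure N (A k) \<le> g (real (Suc k))" .
  qed auto
  finally show ?thesis by (simp add: N_def emeasure_density add_left_mono)
qed

text \<open>The one-dimensional comparisons are applied in each variable in turn. Each passage from
  the integral to the sum loses a strip of width 1 along an axis. By symmetry the first strip equals
  \<open>E\<close>; the second is an integral of row sums, and rows lie below their integrals, so it
  is at most \<open>E\<close> as well.\<close>

lemma lattice_sum_integral_comparison:
  fixes f :: "real \<Rightarrow> real \<Rightarrow> ennreal"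
  assumes [measurable]: "case_prod f \<in> borel_measurable (borel \<Otimes>\<^sub>M borel)"
    and anti: "\<And>x x' y. 0 < x \<Longrightarrow> x \<le> x' \<Longrightarrow> 0 \<le> y \<Longrightarrow> f x' y \<le> f x y"
    and sym: "\<And>x y. f x y = f y x"
  defines "J \<equiv> \<integral>\<^sup>+x. (\<integral>\<^sup>+y. f x y * indicator {0..} y \<partial>lborel) * indicator {0..} x \<partial>lborel"
    and "E \<equiv> \<integral>\<^sup>+x. (\<integral>\<^sup>+y. f x y * indicator {0..} y \<partial>lborel) * indicator {0..1} x \<partial>lborel"
    and "T \<equiv> \<Sum>k. \<Sum>l. f (real (Suc k)) (real (Suc l))"
  shows "T \<le> J" and "J \<le> T + 2 * E"
proof -
  have anti': "f y x' \<le> f y x" if "0 < x" "x \<le> x'" "0 \<le> y" for x x' y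
    using anti[OF that] sym by simp
  define A where "A x = (\<integral>\<^sup>+y. f x y * indicator {0..} y \<partial>lborel)" for x
  define h where "h x = (\<Sum>l. f x (real (Suc l)))" for x
  have [measurable]: "A \<in> borel_measurable borel" "h \<in> borel_measurable borel"
    unfolding A_def[abs_def] h_def[abs_def] by measurable
  have hA: "h x \<le> A x" if "0 \<le> x" for x
    unfolding h_def A_def by (rule suminf_le_nn_integral_antimono) (use that anti' in auto)
  have "T \<le> (\<Sum>k. A (real (Suc k)))"
    unfolding T_def h_def[symmetric] by (intro suminf_le hA) auto
  also have "\<dots> \<le> (\<integral>\<^sup>+x. A x * indicator {0..} x \<partial>lborel)"
    by (rule suminf_le_nn_integral_antimono)
       (auto simp: A_def indicator_def intro!: nn_integral_mono anti)
  finally show "T \<le> J" by (simp add: J_def A_def)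
  have "A x * indicator {0..} x \<le>
      (\<integral>\<^sup>+y. f x y * indicator {0..1} y * indicator {0..} x \<partial>lborel) + h x * indicator {0..} x" for x
  proof (cases "0 \<le> x")
    case True
    then show ?thesis
      unfolding A_def h_def using nn_integral_antimono_le_suminf[of "f x"] anti' by auto
  qed simp
  then have "J \<le> (\<integral>\<^sup>+x. (\<integral>\<^sup>+y. f x y * indicator {0..1} y * indicator {0..} x \<partial>lborel) + h x * indicator {0..} x \<partial>lborel)"
    unfolding J_def A_def[symmetric] by (intro nn_integral_mono)
  also have "\<dots> = (\<integral>\<^sup>+x. (\<integral>\<^sup>+y. f x y * indicator {0..1} y * indicator {0..} x \<partial>lborel) \<partial>lborel)
      + (\<integral>\<^sup>+x. h x * indicator {0..} x \<partial>lborel)"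
    by (intro nn_integral_add) measurable
  also have "(\<integral>\<^sup>+x. (\<integral>\<^sup>+y. f x y * indicator {0..1} y * indicator {0..} x \<partial>lborel) \<partial>lborel) =
      (\<integral>\<^sup>+y. (\<integral>\<^sup>+x. f x y * indicator {0..1} y * indicator {0..} x \<partial>lborel) \<partial>lborel)"
    by (rule lborel_pair.Fubini') measurable
  also have "\<dots> = E"
    unfolding E_def
  proof (intro nn_integral_cong)
    fix y
    show "(\<integral>\<^sup>+x. f x y * indicator {0..1} y * indicator {0..} x \<partial>lborel) =
        (\<integral>\<^sup>+x. f y x * indicator {0..} x \<partial>lborel) * indicator {0..1} y"
      by (subst nn_integral_multc[symmetric]) (auto simp: sym[of _ y] mult_ac intro!: nn_integral_cong)
  qed
  finally have J: "J \<le> E + (\<integral>\<^sup>+x. h x * indicator {0..} x \<partial>lborel)" .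
  have h: "(\<integral>\<^sup>+x. h x * indicator {0..} x \<partial>lborel) \<le>
      (\<integral>\<^sup>+x. h x * indicator {0..1} x \<partial>lborel) + (\<Sum>k. h (real (Suc k)))"
    by (rule nn_integral_antimono_le_suminf) (auto simp: h_def intro!: suminf_le anti)
  have hE: "(\<integral>\<^sup>+x. h x * indicator {0..1} x \<partial>lborel) \<le> E"
    unfolding E_def A_def[symmetric] by (intro nn_integral_mono) (auto simp: indicator_def hA)
  have "J \<le> E + (E + (\<Sum>k. h (real (Suc k))))"
    using add_left_mono[OF order_trans[OF h add_right_mono[OF hE]]] J by (rule order_trans[rotated])
  then show "J \<le> T + 2 * E"
    by (simp only: T_def h_def[symmetric] mult_2 add_ac)
qed

text \<open>\<open>1 - exp (- u)\<close> lies below both u and 1, hence below every power of u with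
  exponent in [0, 1]. The range of \<open>s\<close> says that 1 + \<alpha> - s is such an
  exponent.\<close>

lemma heat_kernel_le_powr:
  assumes "0 < u" "\<alpha> \<le> s" "s \<le> 1 + \<alpha>"
  shows "heat_kernel \<alpha> u \<le> u powr (- s)"
proof -
  have "1 - exp (- u) \<le> u powr (1 + \<alpha> - s)"
  proof (cases "u \<le> 1")
    case True
    have "1 - exp (- u) \<le> u powr 1" using exp_ge_add_one_self[of "- u"] assms by simp
    also have "\<dots> \<le> u powr (1 + \<alpha> - s)" using assms True by (intro powr_mono') auto
    finally show ?thesis .
  next
    case False
    then have "1 \<le> u powr (1 + \<alpha> - s)" using assms by (intro ge_one_powr_ge_zero) auto
    then show ?thesis using exp_gt_zero[of "- u"] by linarith
  qed
  then have "heat_kernel \<alpha> u \<le> u powr (1 + \<alpha> - s) * u powr (- 1 - \<alpha>)"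
    unfolding heat_kernel_def by (intro mult_right_mono) auto
  also have "\<dots> = u powr (- s)"
    by (simp add: powr_add[symmetric])
  finally show ?thesis .
qed

text \<open>A product of two nonnegative antitone factors: u^(-\<alpha>) and the quotient (1 -
  exp(-u)) / u, whose derivative has the right sign by exp x \<ge> 1 + x.\<close>

lemma heat_kernel_antimono:
  assumes "0 < \<alpha>" "0 < u" "u \<le> v"
  shows "heat_kernel \<alpha> v \<le> heat_kernel \<alpha> u"
proof -
  have e: "heat_kernel \<alpha> x = (1 - exp (- x)) / x * x powr (- \<alpha>)" if "0 < x" for x
    using that by (simp add: heat_kernel_def powr_diff powr_minus field_simps)
  have "(1 - exp (- v)) / v \<le> (1 - exp (- u)) / u"
  proof (rule DERIV_nonpos_imp_nonincreasing[OF assms(3), of "\<lambda>x. (1 - exp (- x)) / x"])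
    fix x assume "u \<le> x" "x \<le> v"
    then have x: "0 < x" using assms by simp
    have "((\<lambda>x. (1 - exp (- x)) / x) has_real_derivative (exp (- x) * x - (1 - exp (- x))) / (x * x)) (at x)"
      using x by (auto intro!: derivative_eq_intros)
    moreover have "exp (- x) * x - (1 - exp (- x)) \<le> 0"
      using exp_ge_add_one_self[of x] by (simp add: exp_minus field_simps)
    ultimately show "\<exists>y. ((\<lambda>x. (1 - exp (- x)) / x) has_real_derivative y) (at x) \<and> y \<le> 0"
      using x by (intro exI[of _ "(exp (- x) * x - (1 - exp (- x))) / (x * x)"])
        (auto simp: divide_nonpos_pos)
  qed
  moreover have "v powr (- \<alpha>) \<le> u powr (- \<alpha>)"
    using assms by (intro powr_mono2') auto
  ultimately show ?thesis
    using assms by (simp only: e) (intro mult_mono; simp)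
qed

text \<open>For y < 1 the inequality x y \<le> x^2 + y^2 separates the variables, and both factors
  are integrable because s < 1. For y \<ge> 1 dropping x leaves y^(-2s), integrable because s > 1/2.
  This controls the error strip \<open>E\<close> of
  \<open>lattice_sum_integral_comparison\<close>.\<close>

lemma nn_integral_strip_finite:
  fixes s :: real
  assumes "1 / 2 < s" "s < 1"
  shows "(\<integral>\<^sup>+x. (\<integral>\<^sup>+y. ennreal ((x\<^sup>2 + y\<^sup>2) powr (- s)) * indicator {0..} y \<partial>lborel) * indicator {0..1} x \<partial>lborel) < \<infinity>"
proof -
  have i1: "(\<integral>\<^sup>+y. ennreal (y powr (- s)) * indicator {0..1} y \<partial>lborel) = ennreal (1 / (1 - s))"
    using nn_integral_has_integral_lebesgue'[OF _ has_integral_powr_from_0[of "- s" 1]] assms by simp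
  have i2: "(\<integral>\<^sup>+y. ennreal (y powr (- (2 * s))) * indicator {1..} y \<partial>lborel) = ennreal (1 / (2 * s - 1))"
    using nn_integral_has_integral_lebesgue'[OF _ has_integral_powr_to_inf[of "- (2 * s)" 1]] assms
    by (simp add: field_simps minus_divide_right)
  have inner: "(\<integral>\<^sup>+y. ennreal ((x\<^sup>2 + y\<^sup>2) powr (- s)) * indicator {0..} y \<partial>lborel) \<le>
      ennreal (x powr (- s)) * ennreal (1 / (1 - s)) + ennreal (1 / (2 * s - 1))" if "0 < x" for x
  proof -
    have pt: "ennreal ((x\<^sup>2 + y\<^sup>2) powr (- s)) * indicator {0..} y \<le>
        ennreal (x powr (- s)) * (ennreal (y powr (- s)) * indicator {0..1} y)
        + ennreal (y powr (- (2 * s))) * indicator {1..} y" if "y \<noteq> 0" for y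
    proof (cases "0 < y")
      case y: True
      show ?thesis
      proof (cases "y < 1")
        case True
        have "0 \<le> (x - y)\<^sup>2" by simp
        then have "x * y \<le> x\<^sup>2 + y\<^sup>2" using mult_pos_pos[OF \<open>0 < x\<close> y] by (simp add: power2_eq_square algebra_simps)
        then have "(x\<^sup>2 + y\<^sup>2) powr (- s) \<le> (x * y) powr (- s)"
          using \<open>0 < x\<close> y assms by (intro powr_mono2') auto
        then show ?thesis using True y \<open>0 < x\<close>
          by (simp add: powr_mult ennreal_mult[symmetric])
      next
        case False
        have "(x\<^sup>2 + y\<^sup>2) powr (- s) \<le> (y\<^sup>2) powr (- s)"
          using y assms by (intro powr_mono2') auto
        also have "\<dots> = y powr (- (2 * s))"
          using y by (simp add: powr_powr flip: powr_numeral)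
        finally have "ennreal ((x\<^sup>2 + y\<^sup>2) powr (- s)) \<le> ennreal (y powr (- (2 * s)))"
          by (rule ennreal_leI)
        then show ?thesis using False by (auto intro: add_increasing)
      qed
    qed (use that in auto)
    have "(\<integral>\<^sup>+y. ennreal ((x\<^sup>2 + y\<^sup>2) powr (- s)) * indicator {0..} y \<partial>lborel) \<le>
       (\<integral>\<^sup>+y. ennreal (x powr (- s)) * (ennreal (y powr (- s)) * indicator {0..1} y)
        + ennreal (y powr (- (2 * s))) * indicator {1..} y \<partial>lborel)"
      by (intro nn_integral_mono_AE AE_I[of _ _ "{0}"]) (use pt in auto)
    also have "\<dots> = ennreal (x powr (- s)) * ennreal (1 / (1 - s)) + ennreal (1 / (2 * s - 1))"
      by (simp add: nn_integral_add nn_integral_cmult i1 i2)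
    finally show ?thesis .
  qed
  have "(\<integral>\<^sup>+x. (\<integral>\<^sup>+y. ennreal ((x\<^sup>2 + y\<^sup>2) powr (- s)) * indicator {0..} y \<partial>lborel) * indicator {0..1} x \<partial>lborel) \<le>
     (\<integral>\<^sup>+x. ennreal (1 / (1 - s)) * (ennreal (x powr (- s)) * indicator {0..1} x)
        + ennreal (1 / (2 * s - 1)) * indicator {0..1} x \<partial>lborel)"
  proof (intro nn_integral_mono_AE AE_I[of _ _ "{0}"])
    have "(\<integral>\<^sup>+y. ennreal ((x\<^sup>2 + y\<^sup>2) powr (- s)) * indicator {0..} y \<partial>lborel) * indicator {0..1} x \<le>
        ennreal (1 / (1 - s)) * (ennreal (x powr (- s)) * indicator {0..1} x)
        + ennreal (1 / (2 * s - 1)) * indicator {0..1} x" if "x \<noteq> 0" for x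
    proof (cases "x \<in> {0<..1}")
      case True
      then show ?thesis using inner[of x] by (simp add: mult_ac)
    next
      case False
      with that have "indicator {0..1} x = (0::ennreal)" by (auto simp: indicator_def)
      then show ?thesis by simp
    qed
    then show "{x \<in> space lborel. \<not> (\<integral>\<^sup>+y. ennreal ((x\<^sup>2 + y\<^sup>2) powr (- s)) * indicator {0..} y \<partial>lborel) * indicator {0..1} x \<le>
        ennreal (1 / (1 - s)) * (ennreal (x powr (- s)) * indicator {0..1} x)
        + ennreal (1 / (2 * s - 1)) * indicator {0..1} x} \<subseteq> {0}"
      by auto
  qed auto
  also have "\<dots> = ennreal (1 / (1 - s)) * ennreal (1 / (1 - s)) + ennreal (1 / (2 * s - 1))"
    by (simp add: nn_integral_add nn_integral_cmult i1 nn_integral_cmult_indicator)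
  also have "\<dots> < \<infinity>"
    by (simp add: ennreal_mult_less_top)
  finally show ?thesis .
qed

text \<open>The comparison with integrals yields an iterated series starting at 0 in both indices;
  the shift by \<open>Suc\<close> and the counting measure turn it into an unordered sum over
  \<open>indices\<close>, the form in which the field is expanded.\<close>

lemma has_sum_indices_of_suminf:
  fixes a :: "nat \<times> nat \<Rightarrow> real"
  assumes nn: "\<And>p. p \<in> indices \<Longrightarrow> 0 \<le> a p"
    and T: "(\<Sum>k. \<Sum>l. ennreal (a (Suc k, Suc l))) = ennreal T" "0 \<le> T"
  shows "(a has_sum T) indices"
proof -
  have bij: "bij_betw (map_prod Suc Suc) UNIV indices"
  proof -
    have "map_prod Suc Suc ` UNIV = indices"
    proof (intro equalityI subsetI)
      fix p assume "p \<in> indices"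
      then show "p \<in> map_prod Suc Suc ` UNIV"
        by (cases p) (auto simp: Suc_le_eq gr0_conv_Suc)
    qed auto
    then show ?thesis by (auto simp: bij_betw_def inj_on_def)
  qed
  have nnT: "(\<integral>\<^sup>+p. ennreal (a p) \<partial>count_space indices) = ennreal T"
  proof -
    have "(\<integral>\<^sup>+p. ennreal (a p) \<partial>count_space indices) =
        (\<integral>\<^sup>+p. ennreal (a (map_prod Suc Suc p)) \<partial>count_space UNIV)"
      by (rule nn_integral_bij_count_space[OF bij, symmetric])
    also have "\<dots> = (\<integral>\<^sup>+k. \<integral>\<^sup>+l. ennreal (a (map_prod Suc Suc (k, l))) \<partial>count_space UNIV \<partial>count_space UNIV)"
      by (rule nn_integral_fst_count_space[symmetric])
    finally show ?thesis
      by (simp add: nn_integral_count_space_nat T)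
  qed
  have "integrable (count_space indices) a"
  proof (rule integrableI_nonneg)
    show "(\<integral>\<^sup>+p. ennreal (a p) \<partial>count_space indices) < \<infinity>"
      unfolding nnT by simp
  qed (auto simp: AE_count_space nn)
  then have abs: "Infinite_Set_Sum.abs_summable_on a indices"
    by (simp add: Infinite_Set_Sum.abs_summable_on_def)
  have "ennreal T = ennreal (infsetsum a indices)"
    using nn_integral_conv_infsetsum[OF abs nn] nnT by simp
  then have "T = infsetsum a indices"
    using T(2) nn by (simp add: ennreal_inj infsetsum_nonneg)
  then have "T = infsum a indices"
    using infsetsum_infsum[OF abs] by simp
  moreover have "a summable_on indices"
    using abs abs_summable_equivalent abs_summable_summable by blast
  ultimately show ?thesis
    by (simp add: has_sum_infsum)
qed

text \<open>Squares exhaust the index set. This carries bounds for finite iterated sums, the form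
  produced by Abel summation, over to the unordered sum.\<close>

lemma has_sum_indices_box:
  fixes a :: "nat \<times> nat \<Rightarrow> real"
  assumes "(a has_sum S) indices"
  shows "(\<lambda>n. \<Sum>l=1..n. \<Sum>k=1..n. a (k, l)) \<longlonglongrightarrow> S"
proof -
  have "filterlim (\<lambda>n. {1..n} \<times> {1..n}) (finite_subsets_at_top indices) sequentially"
    unfolding filterlim_finite_subsets_at_top
  proof (intro allI impI)
    fix X :: "(nat \<times> nat) set" assume X: "finite X \<and> X \<subseteq> indices"
    then obtain m where m: "\<And>k l. (k, l) \<in> X \<Longrightarrow> k \<le> m \<and> l \<le> m"
    proof -
      have "finite (fst ` X \<union> snd ` X)" using X by simp
      then obtain m where "\<forall>k\<in>fst ` X \<union> snd ` X. k \<le> m"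
        using finite_nat_set_iff_bounded_le by auto
      then show ?thesis by (intro that[of m]) force
    qed
    show "\<forall>\<^sub>F n in sequentially. finite ({1..n} \<times> {1..n}) \<and> X \<subseteq> {1..n} \<times> {1..n} \<and> {1..n} \<times> {1..n} \<subseteq> indices"
      using eventually_ge_at_top[of m]
    proof eventually_elim
      case (elim n)
      have "p \<in> {1..n} \<times> {1..n}" if "p \<in> X" for p
        using m[of "fst p" "snd p"] that X elim by (cases p) force
      then show ?case by auto
    qed
  qed
  then have "(\<lambda>n. sum a ({1..n} \<times> {1..n})) \<longlonglongrightarrow> S"
    using assms unfolding has_sum_def by (rule filterlim_compose[rotated])
  moreover have "sum a ({1..n} \<times> {1..n}) = (\<Sum>l=1..n. \<Sum>k=1..n. a (k, l))" for n
    by (subst sum.swap) (simp add: sum.cartesian_product)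
  ultimately show ?thesis by simp
qed

section \<open>Oscillating lattice sums\<close>

lemma cos_sum_bound:
  assumes "sin (pi * y) \<noteq> 0"
  shows "\<bar>\<Sum>k=1..n. cos (2 * pi * real k * y)\<bar> \<le> 1 / \<bar>sin (pi * y)\<bar>"
proof -
  \<comment> \<open>The Dirichlet kernel: after multiplication by twice the sine of half the step,
    the cosines telescope.\<close>
  have "2 * sin (pi * y) * (\<Sum>k=1..n. cos (2 * pi * real k * y)) =
      sin ((2 * real n + 1) * (pi * y)) - sin (pi * y)"
  proof (induction n)
    case (Suc n)
    have "2 * sin (pi * y) * cos (2 * pi * real (Suc n) * y) =
        sin (pi * y + 2 * pi * real (Suc n) * y) + sin (pi * y - 2 * pi * real (Suc n) * y)"
      by (simp only: sin_add sin_diff)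
    also have "pi * y + 2 * pi * real (Suc n) * y = (2 * real (Suc n) + 1) * (pi * y)"
      by (simp add: algebra_simps)
    also have "pi * y - 2 * pi * real (Suc n) * y = - ((2 * real n + 1) * (pi * y))"
      by (simp add: algebra_simps)
    finally show ?case using Suc by (simp add: distrib_left)
  qed simp
  moreover have "\<bar>sin ((2 * real n + 1) * (pi * y)) - sin (pi * y)\<bar> \<le> 2"
    using abs_sin_le_one[of "(2 * real n + 1) * (pi * y)"] abs_sin_le_one[of "pi * y"] by linarith
  ultimately have "2 * \<bar>sin (pi * y)\<bar> * \<bar>\<Sum>k=1..n. cos (2 * pi * real k * y)\<bar> \<le> 2"
    by (metis abs_mult abs_numeral)
  then show ?thesis using assms by (simp add: field_simps)
qed

text \<open>Summation by parts turns the sum into a combination of partial sums of \<open>c\<close>: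
  the weights \<open>f k - f (Suc k)\<close> and the last \<open>f n\<close> are nonnegative and add
  up to \<open>f 1\<close>.\<close>

lemma abel_sum_bound:
  fixes f c :: "nat \<Rightarrow> real"
  assumes anti: "\<And>k. 1 \<le> k \<Longrightarrow> f (Suc k) \<le> f k" and nn: "\<And>k. 1 \<le> k \<Longrightarrow> 0 \<le> f k"
    and B: "\<And>n. \<bar>\<Sum>k=1..n. c k\<bar> \<le> B"
  shows "\<bar>\<Sum>k=1..n. f k * c k\<bar> \<le> f 1 * B"
proof -
  define C where "C n = (\<Sum>k=1..n. c k)" for n
  have "(\<Sum>k=1..n. f k * c k) = (\<Sum>k\<in>{1..<n}. (f k - f (Suc k)) * C k) + f n * C n" if "1 \<le> n" for n
    using that
  proof (induction n rule: dec_induct)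
    case base
    then show ?case by (simp add: C_def)
  next
    case (step n)
    then show ?case by (simp add: C_def algebra_simps)
  qed
  moreover have "\<bar>(\<Sum>k\<in>{1..<n}. (f k - f (Suc k)) * C k) + f n * C n\<bar> \<le> f 1 * B" if "1 \<le> n" for n
  proof -
    have "\<bar>(\<Sum>k\<in>{1..<n}. (f k - f (Suc k)) * C k) + f n * C n\<bar> \<le>
        (\<Sum>k\<in>{1..<n}. \<bar>(f k - f (Suc k)) * C k\<bar>) + \<bar>f n * C n\<bar>"
      by (rule order_trans[OF abs_triangle_ineq add_right_mono[OF sum_abs]])
    also have "\<dots> \<le> (\<Sum>k\<in>{1..<n}. (f k - f (Suc k)) * B) + f n * B"
      using anti nn B[folded C_def] that
      by (intro add_mono sum_mono) (auto simp: abs_mult intro!: mult_mono)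
    also have "\<dots> = f 1 * B"
    proof -
      have "(\<Sum>k\<in>{1..<n}. f k - f (Suc k)) = f 1 - f n"
        using that sum_Suc_diff'[of 1 n f] by (simp add: sum_subtractf)
      then show ?thesis
        by (simp only: sum_distrib_right[symmetric]) (simp add: algebra_simps)
    qed
    finally show ?thesis .
  qed
  moreover have "0 \<le> f 1 * B"
    using nn[of 1] B[of 0] by simp
  ultimately show ?thesis
    by (cases "1 \<le> n") auto
qed

text \<open>The factor \<open>D\<close> is the area of a cell of the lattice with mesh sqrt D, so
  the sum over all indices is a Riemann sum over the quadrant for the kernel evaluated at x^2 + y^2,
  with a limit independent of \<open>D\<close>.\<close>

definition lattice_term :: "real \<Rightarrow> real \<Rightarrow> nat \<times> nat \<Rightarrow> real" where
  "lattice_term \<alpha> D = (\<lambda>(k, l). D * heat_kernel \<alpha> (D * ((real k)\<^sup>2 + (real l)\<^sup>2)))"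

lemma lattice_term_nonneg: "0 < D \<Longrightarrow> 0 \<le> lattice_term \<alpha> D p"
  by (auto simp: lattice_term_def case_prod_unfold intro!: mult_nonneg_nonneg heat_kernel_nonneg)

lemma lattice_term_antimono:
  assumes "0 < \<alpha>" "0 < D" "1 \<le> k" "1 \<le> l"
  shows "lattice_term \<alpha> D (Suc k, l) \<le> lattice_term \<alpha> D (k, l)"
    and "lattice_term \<alpha> D (k, Suc l) \<le> lattice_term \<alpha> D (k, l)"
  using assms unfolding lattice_term_def
  by (auto intro!: mult_left_mono heat_kernel_antimono mult_pos_pos add_pos_pos power_mono)

lemma lattice_term_le:
  assumes "0 < D" "\<alpha> \<le> s" "s \<le> 1 + \<alpha>" "0 < (real k)\<^sup>2 + (real l)\<^sup>2"
  shows "lattice_term \<alpha> D (k, l) \<le> D powr (1 - s) * ((real k)\<^sup>2 + (real l)\<^sup>2) powr (- s)"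
proof -
  let ?r = "(real k)\<^sup>2 + (real l)\<^sup>2"
  have "lattice_term \<alpha> D (k, l) \<le> D * (D * ?r) powr (- s)"
    unfolding lattice_term_def using assms by (auto intro!: mult_left_mono heat_kernel_le_powr)
  also have "\<dots> = D powr (1 - s) * ?r powr (- s)"
    using assms powr_add[of D 1 "- s"] by (simp add: powr_mult mult.assoc)
  finally show ?thesis .
qed

text \<open>Scaling both variables by the mesh makes the comparison integral independent of
  \<open>D\<close>. The error sits in the strips, where \<open>heat_kernel_le_powr\<close> replaces
  the kernel by the power with exponent -s; this scales like \<open>D powr (1 - s)\<close>.\<close>

lemma lattice_term_has_sum:
  assumes "0 < \<alpha>" "\<alpha> < 1" "\<alpha> \<le> s" "1 / 2 < s" "s < 1"
  obtains C where "0 \<le> C"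
    "\<And>D. 0 < D \<Longrightarrow> \<exists>S. (lattice_term \<alpha> D has_sum S) indices \<and>
        S \<le> pi / 4 * (Gamma (1 - \<alpha>) / \<alpha>) \<and> pi / 4 * (Gamma (1 - \<alpha>) / \<alpha>) \<le> S + C * D powr (1 - s)"
proof -
  define J where "J = pi / 4 * (Gamma (1 - \<alpha>) / \<alpha>)"
  have J0: "0 \<le> J" using assms by (auto simp: J_def Gamma_real_nonneg)
  obtain c where c: "(\<integral>\<^sup>+x. (\<integral>\<^sup>+y. ennreal ((x\<^sup>2 + y\<^sup>2) powr (- s)) * indicator {0..} y \<partial>lborel) * indicator {0..1} x \<partial>lborel)
      = ennreal c" "0 \<le> c"
    using nn_integral_strip_finite[of s] assms less_top_ennreal by auto
  have "\<exists>S. (lattice_term \<alpha> D has_sum S) indices \<and> S \<le> J \<and> J \<le> S + 2 * c * D powr (1 - s)" if D: "0 < D" for D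
  proof -
    define f where "f x y = ennreal (D * heat_kernel \<alpha> (D * (x\<^sup>2 + y\<^sup>2)))" for x y
    have [measurable]: "case_prod f \<in> borel_measurable (borel \<Otimes>\<^sub>M borel)"
      unfolding f_def[abs_def] by measurable
    have anti: "f x' y \<le> f x y" if "0 < x" "x \<le> x'" "0 \<le> y" for x x' y
      using that D assms(1) unfolding f_def
      by (intro ennreal_leI mult_left_mono heat_kernel_antimono)
         (auto intro!: mult_pos_pos add_pos_nonneg power_mono)
    have sym: "f x y = f y x" for x y
      by (simp add: f_def add.commute)
    define T where "T = (\<Sum>k. \<Sum>l. f (real (Suc k)) (real (Suc l)))"
    define E where "E = (\<integral>\<^sup>+x. (\<integral>\<^sup>+y. f x y * indicator {0..} y \<partial>lborel) * indicator {0..1} x \<partial>lborel)"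
    note cmp = lattice_sum_integral_comparison[of f, OF _ anti sym, folded T_def E_def]
    have J: "(\<integral>\<^sup>+x. (\<integral>\<^sup>+y. f x y * indicator {0..} y \<partial>lborel) * indicator {0..} x \<partial>lborel) = ennreal J"
    proof -
      let ?r = "sqrt D"
      define g where "g x y = ennreal (heat_kernel \<alpha> (x\<^sup>2 + y\<^sup>2))" for x y
      have [measurable]: "case_prod g \<in> borel_measurable (borel \<Otimes>\<^sub>M borel)"
        unfolding g_def[abs_def] by measurable
      define G where "G x = (\<integral>\<^sup>+y. g x y * indicator {0..} y \<partial>lborel)" for x
      have [measurable]: "G \<in> borel_measurable borel"
        unfolding G_def[abs_def] by measurable
      have fg: "f x y = ennreal D * g (?r * x) (?r * y)" for x y
        using D by (simp add: f_def g_def ennreal_mult' power_mult_distrib distrib_left)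
      have "(\<integral>\<^sup>+y. f x y * indicator {0..} y \<partial>lborel) = ennreal D * (ennreal (1 / ?r) * G (?r * x))" for x
        using D unfolding fg mult.assoc G_def
        by (subst nn_integral_cmult) (auto simp: nn_integral_scale[of "g (?r * x)" ?r])
      then have "(\<integral>\<^sup>+x. (\<integral>\<^sup>+y. f x y * indicator {0..} y \<partial>lborel) * indicator {0..} x \<partial>lborel) =
          (\<integral>\<^sup>+x. (ennreal D * ennreal (1 / ?r)) * (G (?r * x) * indicator {0..} x) \<partial>lborel)"
        by (simp add: mult.assoc)
      also have "\<dots> = (ennreal D * ennreal (1 / ?r)) * (ennreal (1 / ?r) * (\<integral>\<^sup>+x. G x * indicator {0..} x \<partial>lborel))"
        using D by (subst nn_integral_cmult) (auto simp: nn_integral_scale[of G ?r])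
      also have "\<dots> = (ennreal D * ennreal (1 / ?r) * ennreal (1 / ?r)) * ennreal J"
        using nn_integral_heat_kernel_quadrant[OF assms(1,2)]
        by (simp add: G_def g_def J_def mult.assoc)
      also have "ennreal D * ennreal (1 / ?r) * ennreal (1 / ?r) = 1"
        using D by (simp add: ennreal_mult[symmetric])
      finally show ?thesis by simp
    qed
    have "T \<le> ennreal J" using cmp(1) J by simp
    then obtain S where S: "T = ennreal S" "0 \<le> S" by (cases T) (auto simp: top_unique)
    have "E \<le> ennreal (D powr (1 - s)) * ennreal c"
    proof -
      \<comment> \<open>At the origin the kernel is 0, so only the remaining points need the power
        bound.\<close>
      have "f x y \<le> ennreal (D powr (1 - s)) * ennreal ((x\<^sup>2 + y\<^sup>2) powr (- s))" for x y
      proof (cases "x = 0 \<and> y = 0")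
        case False
        then have "0 < x\<^sup>2 + y\<^sup>2" by (auto simp: sum_power2_gt_zero_iff)
        then have "D * heat_kernel \<alpha> (D * (x\<^sup>2 + y\<^sup>2)) \<le> D * (D * (x\<^sup>2 + y\<^sup>2)) powr (- s)"
          using D assms by (intro mult_left_mono heat_kernel_le_powr) auto
        also have "\<dots> = D powr (1 - s) * (x\<^sup>2 + y\<^sup>2) powr (- s)"
          using D powr_add[of D 1 "- s"] by (simp add: powr_mult mult.assoc)
        finally show ?thesis
          by (simp add: f_def ennreal_mult'[symmetric] ennreal_leI)
      qed (simp add: f_def heat_kernel_def)
      then have "E \<le> (\<integral>\<^sup>+x. (\<integral>\<^sup>+y. ennreal (D powr (1 - s)) * (ennreal ((x\<^sup>2 + y\<^sup>2) powr (- s)) * indicator {0..} y) \<partial>lborel)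
          * indicator {0..1} x \<partial>lborel)"
        unfolding E_def by (intro nn_integral_mono mult_right_mono) (auto simp: mult.assoc[symmetric] intro!: mult_right_mono)
      also have "\<dots> = ennreal (D powr (1 - s)) * ennreal c"
        unfolding c(1)[symmetric]
        by (subst nn_integral_cmult, measurable, simp only: mult.assoc)
           (subst nn_integral_cmult, measurable)
      finally show ?thesis .
    qed
    then have "ennreal S + 2 * E \<le> ennreal S + 2 * (ennreal (D powr (1 - s)) * ennreal c)"
      by (intro add_left_mono mult_left_mono) auto
    moreover have "ennreal J \<le> ennreal S + 2 * E"
      using cmp(2) J S by simp
    ultimately have "ennreal J \<le> ennreal S + 2 * (ennreal (D powr (1 - s)) * ennreal c)"
      by (rule order_trans[rotated])
    also have "\<dots> = ennreal (S + 2 * c * D powr (1 - s))"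
      using S c by (simp add: ennreal_mult' ennreal_plus mult_ac flip: ennreal_numeral)
    finally have "J \<le> S + 2 * c * D powr (1 - s)"
      using S c by (subst (asm) ennreal_le_iff) auto
    moreover have "S \<le> J"
      using \<open>T \<le> ennreal J\<close> S J0 by simp
    moreover have "(lattice_term \<alpha> D has_sum S) indices"
    proof (rule has_sum_indices_of_suminf)
      show "(\<Sum>k. \<Sum>l. ennreal (lattice_term \<alpha> D (Suc k, Suc l))) = ennreal S"
        using S by (simp add: T_def f_def lattice_term_def)
    qed (use D S lattice_term_nonneg in auto)
    ultimately show ?thesis by blast
  qed
  then show ?thesis
    using that[of "2 * c"] c(2) by (simp add: J_def)
qed

lemma sin_pi_ge:
  assumes "0 < \<delta>" "\<delta> < 1 / 2" "\<delta> \<le> y" "y \<le> 1 - \<delta>"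
  shows "sin (pi * \<delta>) \<le> sin (pi * y)"
proof (cases "y \<le> 1 / 2")
  case True
  have "0 \<le> pi * \<delta>" "pi * \<delta> \<le> pi * y" "pi * y \<le> pi / 2"
    using True assms mult_left_mono[of y "1 / 2" pi] by auto
  then show ?thesis using pi_gt_zero by (intro sin_monotone_2pi_le) linarith+
next
  case False
  have "sin (pi * \<delta>) \<le> sin (pi * (1 - y))"
  proof -
    have "0 \<le> pi * \<delta>" "pi * \<delta> \<le> pi * (1 - y)" "pi * (1 - y) \<le> pi / 2"
      using False assms mult_left_mono[of "1 - y" "1 / 2" pi] mult_left_mono[of \<delta> "1 - y" pi] by auto
    then show ?thesis using pi_gt_zero by (intro sin_monotone_2pi_le) linarith+
  qed
  also have "\<dots> = sin (pi * y)"
    by (simp add: right_diff_distrib sin_diff)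
  finally show ?thesis .
qed

text \<open>The partial sums of the cosines are bounded because \<open>y\<close> stays away from 0 and 1, so Abel
  summation in \<open>k\<close> against the antimonotone lattice terms leaves only the row \<open>k = 1\<close>.\<close>

lemma lattice_term_oscillating:
  assumes "0 < \<alpha>" "\<alpha> < 1" "\<alpha> \<le> s" "1 / 2 < s" "s < 1" "0 < \<delta>" "\<delta> < 1 / 2"
  obtains C where "0 \<le> C"
    "\<And>D y d n. 0 < D \<Longrightarrow> \<delta> \<le> y \<Longrightarrow> y \<le> 1 - \<delta> \<Longrightarrow> (\<And>l. \<bar>d l\<bar> \<le> 1) \<Longrightarrow>
      \<bar>\<Sum>l=1..n. \<Sum>k=1..n. lattice_term \<alpha> D (k, l) * (cos (2 * pi * real k * y) * d l)\<bar> \<le> C * D powr (1 - s)"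
proof -
  \<comment> \<open>This series bounds the row k = 1; it converges because 2 s > 1.\<close>
  define K where "K = (\<Sum>l. real l powr (- (2 * s)))"
  have sK: "summable (\<lambda>l. real l powr (- (2 * s)))"
    using assms by (subst summable_real_powr_iff) auto
  have row: "(\<Sum>l=1..n. lattice_term \<alpha> D (1, l)) \<le> D powr (1 - s) * K" if D: "0 < D" for D n
  proof -
    have "lattice_term \<alpha> D (1, l) \<le> D powr (1 - s) * real l powr (- (2 * s))" if "l \<in> {1..n}" for l
    proof -
      have "lattice_term \<alpha> D (1, l) \<le> D powr (1 - s) * ((real 1)\<^sup>2 + (real l)\<^sup>2) powr (- s)"
        using D assms that by (intro lattice_term_le) (auto intro: add_pos_nonneg)
      also have "((real 1)\<^sup>2 + (real l)\<^sup>2) powr (- s) \<le> ((real l)\<^sup>2) powr (- s)"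
        using that assms by (intro powr_mono2') auto
      also have "((real l)\<^sup>2) powr (- s) = real l powr (- (2 * s))"
        using that by (simp add: powr_powr flip: powr_numeral)
      finally show ?thesis by (simp add: mult_left_mono)
    qed
    then have "(\<Sum>l=1..n. lattice_term \<alpha> D (1, l)) \<le> D powr (1 - s) * (\<Sum>l=1..n. real l powr (- (2 * s)))"
      unfolding sum_distrib_left by (rule sum_mono)
    also have "\<dots> \<le> D powr (1 - s) * K"
      unfolding K_def using sK by (intro mult_left_mono sum_le_suminf) auto
    finally show ?thesis .
  qed
  have sin_pos: "0 < sin (pi * \<delta>)"
    using assms by (intro sin_gt_zero) (auto simp: field_simps)
  have K0: "0 \<le> K" unfolding K_def using sK by (intro suminf_nonneg) auto
  show ?thesis
  proof (rule that[of "K / sin (pi * \<delta>)"])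
    show "0 \<le> K / sin (pi * \<delta>)" using K0 sin_pos by simp
    fix D y :: real and d :: "nat \<Rightarrow> real" and n
    assume D: "0 < D" and y: "\<delta> \<le> y" "y \<le> 1 - \<delta>" and d: "\<And>l. \<bar>d l\<bar> \<le> 1"
    have sy: "sin (pi * \<delta>) \<le> sin (pi * y)"
      using assms y by (intro sin_pi_ge) auto
    have B: "\<bar>\<Sum>k=1..j. cos (2 * pi * real k * y)\<bar> \<le> 1 / sin (pi * \<delta>)" for j
    proof -
      have "1 / \<bar>sin (pi * y)\<bar> \<le> 1 / sin (pi * \<delta>)"
        using sy sin_pos by (simp add: frac_le)
      then show ?thesis using cos_sum_bound[of y j] sy sin_pos by simp
    qed
    have "\<bar>\<Sum>l=1..n. \<Sum>k=1..n. lattice_term \<alpha> D (k, l) * (cos (2 * pi * real k * y) * d l)\<bar> \<le>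
        (\<Sum>l=1..n. \<bar>(\<Sum>k=1..n. lattice_term \<alpha> D (k, l) * cos (2 * pi * real k * y)) * d l\<bar>)"
      by (rule order_trans[OF _ sum_abs]) (simp add: sum_distrib_right mult.assoc)
    also have "\<dots> \<le> (\<Sum>l=1..n. lattice_term \<alpha> D (1, l) * (1 / sin (pi * \<delta>)))"
    proof (rule sum_mono)
      fix l assume l: "l \<in> {1..n}"
      have "\<bar>\<Sum>k=1..n. lattice_term \<alpha> D (k, l) * cos (2 * pi * real k * y)\<bar> \<le>
          lattice_term \<alpha> D (1, l) * (1 / sin (pi * \<delta>))"
        using l D assms(1) B
        by (intro abel_sum_bound lattice_term_antimono lattice_term_nonneg) auto
      then show "\<bar>(\<Sum>k=1..n. lattice_term \<alpha> D (k, l) * cos (2 * pi * real k * y)) * d l\<bar> \<le>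
          lattice_term \<alpha> D (1, l) * (1 / sin (pi * \<delta>))"
        using mult_mono[OF _ d[of l], of _ "lattice_term \<alpha> D (1, l) * (1 / sin (pi * \<delta>))"]
        by (force simp: abs_mult)
    qed
    also have "\<dots> = (\<Sum>l=1..n. lattice_term \<alpha> D (1, l)) * (1 / sin (pi * \<delta>))"
      by (rule sum_distrib_right[symmetric])
    also have "\<dots> \<le> (D powr (1 - s) * K) * (1 / sin (pi * \<delta>))"
      using row[OF D, of n] sin_pos by (intro mult_right_mono) auto
    finally show "\<bar>\<Sum>l=1..n. \<Sum>k=1..n. lattice_term \<alpha> D (k, l) * (cos (2 * pi * real k * y) * d l)\<bar> \<le>
        K / sin (pi * \<delta>) * D powr (1 - s)"
      by (simp add: mult_ac)
  qed
qed

text \<open>With both sine squares expanded, the product splits into four sums. The plain one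
  carries the Gamma value; each of the other three contains a cosine and is bounded by
  \<open>lattice_term_oscillating\<close>, whose factor \<open>d\<close> is taken to be 1 or the
  cosine in the other variable.\<close>

lemma lattice_sin_has_sum:
  assumes "0 < \<alpha>" "\<alpha> < 1" "\<alpha> \<le> s" "1 / 2 < s" "s < 1" "0 < \<delta>" "\<delta> < 1 / 2"
  obtains C where "0 \<le> C"
    "\<And>D y z. 0 < D \<Longrightarrow> \<delta> \<le> y \<Longrightarrow> y \<le> 1 - \<delta> \<Longrightarrow> \<delta> \<le> z \<Longrightarrow> z \<le> 1 - \<delta> \<Longrightarrow>
      \<exists>S. ((\<lambda>(k, l). lattice_term \<alpha> D (k, l) * (4 * (sin (pi * real k * y))\<^sup>2 * (sin (pi * real l * z))\<^sup>2)) has_sum S) indices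
        \<and> \<bar>S - pi / 4 * (Gamma (1 - \<alpha>) / \<alpha>)\<bar> \<le> C * D powr (1 - s)"
proof -
  obtain C1 where C1: "0 \<le> C1" "\<And>D y d n. 0 < D \<Longrightarrow> \<delta> \<le> y \<Longrightarrow> y \<le> 1 - \<delta> \<Longrightarrow> (\<And>l. \<bar>d l\<bar> \<le> 1) \<Longrightarrow>
      \<bar>\<Sum>l=1..n. \<Sum>k=1..n. lattice_term \<alpha> D (k, l) * (cos (2 * pi * real k * y) * d l)\<bar> \<le> C1 * D powr (1 - s)"
    by (fact lattice_term_oscillating[OF assms])
  obtain C2 where C2: "0 \<le> C2" "\<And>D. 0 < D \<Longrightarrow> \<exists>S. (lattice_term \<alpha> D has_sum S) indices \<and>
        S \<le> pi / 4 * (Gamma (1 - \<alpha>) / \<alpha>) \<and> pi / 4 * (Gamma (1 - \<alpha>) / \<alpha>) \<le> S + C2 * D powr (1 - s)"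
    by (fact lattice_term_has_sum[OF assms(1-5)])
  show ?thesis
  proof (rule that[of "3 * C1 + C2"])
    show "0 \<le> 3 * C1 + C2" using C1 C2 by simp
    fix D y z :: real
    assume D: "0 < D" and y: "\<delta> \<le> y" "y \<le> 1 - \<delta>" and z: "\<delta> \<le> z" "z \<le> 1 - \<delta>"
    define a where "a = lattice_term \<alpha> D"
    define cy where "cy k = cos (2 * pi * real k * y)" for k :: nat
    define cz where "cz l = cos (2 * pi * real l * z)" for l :: nat
    define \<epsilon> where "\<epsilon> = D powr (1 - s)"
    obtain S0 where S0: "(a has_sum S0) indices" "S0 \<le> pi / 4 * (Gamma (1 - \<alpha>) / \<alpha>)"
        "pi / 4 * (Gamma (1 - \<alpha>) / \<alpha>) \<le> S0 + C2 * \<epsilon>"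
      using C2(2)[OF D] unfolding a_def \<epsilon>_def by blast
    have summ: "(\<lambda>(k, l). a (k, l) * c k l) summable_on indices"
      if "\<And>k l. \<bar>c k l\<bar> \<le> 1" for c :: "nat \<Rightarrow> nat \<Rightarrow> real"
    proof (rule abs_summable_summable[OF Infinite_Sum.abs_summable_on_comparison_test'])
      show "a summable_on indices" using S0(1) by (rule has_sum_imp_summable)
      fix p show "norm (case p of (k, l) \<Rightarrow> a (k, l) * c k l) \<le> a p"
        using that lattice_term_nonneg[OF D, of \<alpha> p]
        by (cases p) (auto simp: a_def abs_mult intro!: mult_left_le)
    qed
    have bound: "\<bar>S\<bar> \<le> C1 * \<epsilon>"
      if "((\<lambda>(k, l). a (k, l) * c k l) has_sum S) indices"
        "\<And>n. \<bar>\<Sum>l=1..n. \<Sum>k=1..n. a (k, l) * c k l\<bar> \<le> C1 * \<epsilon>" for S and c :: "nat \<Rightarrow> nat \<Rightarrow> real"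
      using tendsto_rabs[OF has_sum_indices_box[OF that(1)]] that(2)
      by (intro LIMSEQ_le_const2[of _ "\<bar>S\<bar>"]) auto
    have c1: "\<bar>cy k\<bar> \<le> 1" "\<bar>cz l\<bar> \<le> 1" for k l by (auto simp: cy_def cz_def)
    obtain S1 where S1: "((\<lambda>(k, l). a (k, l) * cy k) has_sum S1) indices"
      using summ[of "\<lambda>k l. cy k"] c1 by (auto simp: summable_on_def)
    obtain S2 where S2: "((\<lambda>(k, l). a (k, l) * cz l) has_sum S2) indices"
      using summ[of "\<lambda>k l. cz l"] c1 by (auto simp: summable_on_def)
    obtain S3 where S3: "((\<lambda>(k, l). a (k, l) * (cy k * cz l)) has_sum S3) indices"
      using summ[of "\<lambda>k l. cy k * cz l"] c1 by (auto simp: summable_on_def abs_mult mult_le_one)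
    have "\<bar>S1\<bar> \<le> C1 * \<epsilon>"
    proof (rule bound[OF S1])
      fix n show "\<bar>\<Sum>l=1..n. \<Sum>k=1..n. a (k, l) * cy k\<bar> \<le> C1 * \<epsilon>"
        using C1(2)[OF D y, of "\<lambda>_. 1" n] by (simp add: a_def cy_def \<epsilon>_def)
    qed
    moreover have "\<bar>S3\<bar> \<le> C1 * \<epsilon>"
    proof (rule bound[OF S3])
      fix n show "\<bar>\<Sum>l=1..n. \<Sum>k=1..n. a (k, l) * (cy k * cz l)\<bar> \<le> C1 * \<epsilon>"
        using C1(2)[OF D y, of cz n] c1(2) by (simp add: a_def cy_def \<epsilon>_def)
    qed
    moreover have "\<bar>S2\<bar> \<le> C1 * \<epsilon>"
    proof (rule bound[OF S2])
      fix n
      \<comment> \<open>Here the only cosine sits on the second index. Exchanging the indices, under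
        which \<open>lattice_term\<close> is symmetric, moves it to the index that is summed by
        parts.\<close>
      have "(\<Sum>l=1..n. \<Sum>k=1..n. a (k, l) * cz l) = (\<Sum>l=1..n. \<Sum>k=1..n. a (k, l) * (cz k * 1))"
        by (subst sum.swap) (simp add: a_def lattice_term_def add.commute)
      then show "\<bar>\<Sum>l=1..n. \<Sum>k=1..n. a (k, l) * cz l\<bar> \<le> C1 * \<epsilon>"
        using C1(2)[OF D z, of "\<lambda>_. 1" n] by (simp add: a_def cz_def \<epsilon>_def)
    qed
    moreover have "((\<lambda>(k, l). a (k, l) * (4 * (sin (pi * real k * y))\<^sup>2 * (sin (pi * real l * z))\<^sup>2))
        has_sum (S0 - S1 - S2 + S3)) indices"
    proof -
      have h: "2 * (sin t)\<^sup>2 = 1 - cos (2 * t)" for t :: real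
        by (simp add: cos_double_sin)
      have "((\<lambda>p. a p + - (case p of (k, l) \<Rightarrow> a (k, l) * cy k) + - (case p of (k, l) \<Rightarrow> a (k, l) * cz l)
          + (case p of (k, l) \<Rightarrow> a (k, l) * (cy k * cz l))) has_sum (S0 + - S1 + - S2 + S3)) indices"
        by (intro has_sum_add has_sum_uminusI S0(1) S1 S2 S3)
      also have "(\<lambda>p. a p + - (case p of (k, l) \<Rightarrow> a (k, l) * cy k) + - (case p of (k, l) \<Rightarrow> a (k, l) * cz l)
          + (case p of (k, l) \<Rightarrow> a (k, l) * (cy k * cz l))) =
          (\<lambda>(k, l). a (k, l) * ((2 * (sin (pi * real k * y))\<^sup>2) * (2 * (sin (pi * real l * z))\<^sup>2)))"
        by (auto simp: fun_eq_iff h cy_def cz_def algebra_simps)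
      finally show ?thesis by (simp add: mult_ac)
    qed
    moreover have "\<bar>(S0 - S1 - S2 + S3) - pi / 4 * (Gamma (1 - \<alpha>) / \<alpha>)\<bar> \<le> (3 * C1 + C2) * \<epsilon>"
      using S0 calculation(1-3) by (simp add: distrib_right)
    ultimately show "\<exists>S. ((\<lambda>(k, l). lattice_term \<alpha> D (k, l) * (4 * (sin (pi * real k * y))\<^sup>2 * (sin (pi * real l * z))\<^sup>2)) has_sum S) indices
        \<and> \<bar>S - pi / 4 * (Gamma (1 - \<alpha>) / \<alpha>)\<bar> \<le> (3 * C1 + C2) * D powr (1 - s)"
      unfolding a_def \<epsilon>_def by blast
  qed
qed

section \<open>Perturbation and growth estimates for eigenvalues and variances\<close>

lemma powr_minus_lipschitz:
  fixes x y m a :: real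
  assumes "0 < m" "m \<le> x" "m \<le> y" "0 < a"
  shows "\<bar>x powr (- a) - y powr (- a)\<bar> \<le> a * m powr (- a - 1) * \<bar>x - y\<bar>"
proof -
  have "norm (x powr (- a) - y powr (- a)) \<le> (a * m powr (- a - 1)) * norm (x - y)"
  proof (rule field_differentiable_bound[of "{m..}" _ "\<lambda>z. - a * z powr (- a - 1)"])
    fix z assume z: "z \<in> {m..}"
    show "((\<lambda>z. z powr (- a)) has_field_derivative - a * z powr (- a - 1)) (at z within {m..})"
      using z assms by (auto intro!: derivative_eq_intros)
    have "z powr (- a - 1) \<le> m powr (- a - 1)"
      using z assms by (intro powr_mono2') auto
    then show "norm (- a * z powr (- a - 1)) \<le> a * m powr (- a - 1)"
      using assms by (auto simp: abs_mult)
  qed (use assms in auto)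
  then show ?thesis by simp
qed

text \<open>The quotient is the variance of a stationary Ornstein--Uhlenbeck increment of length
  \<Delta> with rate x and unit noise. It is also the integral of exp(-x t) over [0, \<Delta>],
  hence at most \<Delta>.\<close>

lemma exp_mean_bounds:
  fixes x \<Delta> :: real
  assumes "0 < x" "0 \<le> \<Delta>"
  shows "0 \<le> (1 - exp (- x * \<Delta>)) / x" "(1 - exp (- x * \<Delta>)) / x \<le> \<Delta>"
proof -
  show "0 \<le> (1 - exp (- x * \<Delta>)) / x"
    using assms by (intro divide_nonneg_pos) auto
  show "(1 - exp (- x * \<Delta>)) / x \<le> \<Delta>"
    using exp_ge_add_one_self[of "- x * \<Delta>"] assms by (simp add: field_simps)
qed

lemma exp_mean_lipschitz:
  fixes x y m \<Delta> :: real
  assumes "0 < m" "m \<le> x" "m \<le> y" "0 \<le> \<Delta>"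
  shows "\<bar>(1 - exp (- x * \<Delta>)) / x - (1 - exp (- y * \<Delta>)) / y\<bar> \<le> \<Delta> / m * \<bar>x - y\<bar>"
proof -
  let ?d = "\<lambda>z. (\<Delta> * exp (- z * \<Delta>) * z - (1 - exp (- z * \<Delta>))) / (z * z)"
  have "norm ((1 - exp (- x * \<Delta>)) / x - (1 - exp (- y * \<Delta>)) / y) \<le> (\<Delta> / m) * norm (x - y)"
  proof (rule field_differentiable_bound[of "{m..}" _ ?d])
    fix z assume z: "z \<in> {m..}"
    then have z0: "0 < z" using assms by simp
    show "((\<lambda>z. (1 - exp (- z * \<Delta>)) / z) has_field_derivative ?d z) (at z within {m..})"
      using z0 by (auto intro!: derivative_eq_intros)
    have "\<bar>\<Delta> * exp (- z * \<Delta>) * z - (1 - exp (- z * \<Delta>))\<bar> \<le> \<Delta> * z"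
    proof -
      have "1 - exp (- z * \<Delta>) \<le> \<Delta> * z"
        using exp_ge_add_one_self[of "- z * \<Delta>"] by (simp add: mult.commute)
      moreover have "0 \<le> 1 - exp (- z * \<Delta>)" using z0 assms by simp
      moreover have "\<Delta> * exp (- z * \<Delta>) * z \<le> \<Delta> * 1 * z"
        using z0 assms by (intro mult_right_mono mult_left_mono) auto
      moreover have "0 \<le> \<Delta> * exp (- z * \<Delta>) * z" using z0 assms by simp
      ultimately show ?thesis by linarith
    qed
    then have "\<bar>\<Delta> * exp (- z * \<Delta>) * z - (1 - exp (- z * \<Delta>))\<bar> / (z * z) \<le> \<Delta> * z / (z * z)"
      using z0 by (intro divide_right_mono) auto
    then have "\<bar>?d z\<bar> \<le> \<Delta> * z / (z * z)"
      using z0 by (simp only: abs_divide abs_mult abs_of_pos)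
    also have "\<dots> = \<Delta> / z" using z0 by simp
    also have "\<dots> \<le> \<Delta> / m" using z assms by (intro divide_left_mono) auto
    finally show "norm (?d z) \<le> \<Delta> / m" by simp
  qed (use assms in auto)
  then show ?thesis by simp
qed

text \<open>For negative \<open>c\<close>, the assumption q \<ge> 2 gives c \<ge> c q / 2. The
  threshold 2 is the least value of k^2 + l^2 over the modes, so positivity at the first mode
  controls all of them.\<close>

lemma affine_ge_mult:
  fixes b c q :: real
  assumes "0 < b" "0 < c + 2 * b" "2 \<le> q"
  shows "min b ((c + 2 * b) / 2) * q \<le> c + b * q"
proof (cases "0 \<le> c")
  case True
  have "min b ((c + 2 * b) / 2) * q \<le> b * q"
    using assms by (intro mult_right_mono) auto
  then show ?thesis using True by simp
next
  case False
  have "min b ((c + 2 * b) / 2) * q \<le> (c + 2 * b) / 2 * q"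
    by (rule mult_right_mono[OF min.cobounded2]) (use assms in simp)
  also have "\<dots> = c * (q / 2) + b * q" by (simp add: field_simps)
  finally have "min b ((c + 2 * b) / 2) * q \<le> c * (q / 2) + b * q" .
  moreover have "c * (q / 2) \<le> c * 1"
    using False assms by (intro mult_left_mono_neg) auto
  ultimately show ?thesis by linarith
qed

lemma lattice_term_has_sum_le:
  assumes \<alpha>: "0 < \<alpha>" "\<alpha> < 1" and "0 < D"
  obtains S where "(lattice_term \<alpha> D has_sum S) indices" "S \<le> pi / 4 * (Gamma (1 - \<alpha>) / \<alpha>)"
\<comment> \<open>The exponent only has to be admissible, and \<open>max \<alpha> (3 / 4)\<close> is
  so for every \<alpha>; the error bound attached to it is discarded.\<close>
proof (rule lattice_term_has_sum[OF \<alpha>, of "max \<alpha> (3 / 4)"])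
  fix C assume "\<And>D. 0 < D \<Longrightarrow> \<exists>S. (lattice_term \<alpha> D has_sum S) indices \<and>
        S \<le> pi / 4 * (Gamma (1 - \<alpha>) / \<alpha>) \<and>
        pi / 4 * (Gamma (1 - \<alpha>) / \<alpha>) \<le> S + C * D powr (1 - max \<alpha> (3 / 4))"
  from this[OF \<open>0 < D\<close>] that show thesis by blast
qed (use \<alpha> in auto)

section \<open>Variances along the spectrum\<close>

text \<open>\<open>b\<close> stands for \<theta>2 and \<open>c\<close> for the part of the
  eigenvalue that does not depend on the mode. The assumptions on
  \<open>c + 2 * (pi\<^sup>2 * b)\<close> and on \<open>\<mu>0\<close> say that the eigenvalues of
  drift and noise are positive at k = l = 1.\<close>

locale spectrum =
  fixes b c \<mu>0 \<alpha> :: real and lam :: "nat \<Rightarrow> nat \<Rightarrow> real"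
  assumes lam_def: "\<And>k l. lam k l = c + pi\<^sup>2 * ((real k)\<^sup>2 + (real l)\<^sup>2) * b"
    and b: "0 < b" and lam_pos_11: "0 < c + 2 * (pi\<^sup>2 * b)" and \<mu>0: "- 2 * pi\<^sup>2 < \<mu>0"
    and \<alpha>: "0 < \<alpha>" "\<alpha> < 1"
begin

definition q :: "nat \<Rightarrow> nat \<Rightarrow> real" where "q k l = (real k)\<^sup>2 + (real l)\<^sup>2"

text \<open>The two inner minima are the constants of \<open>affine_ge_mult\<close> for
  \<open>lam\<close> and for \<open>noise_eigval\<close>. Their minimum lets one threshold
  \<open>\<epsilon> * q k l\<close> serve for both.\<close>

definition \<epsilon> :: real where
  "\<epsilon> = min (min (pi\<^sup>2 * b) ((c + 2 * (pi\<^sup>2 * b)) / 2)) (min (pi\<^sup>2) ((\<mu>0 + 2 * pi\<^sup>2) / 2))"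

definition K :: real where "K = \<bar>c\<bar> + pi\<^sup>2 * b"

lemma q_ge_2: "1 \<le> k \<Longrightarrow> 1 \<le> l \<Longrightarrow> 2 \<le> q k l"
proof -
  assume "1 \<le> k" "1 \<le> l"
  then have "1\<^sup>2 \<le> (real k)\<^sup>2" "1\<^sup>2 \<le> (real l)\<^sup>2"
    by (auto intro!: power_mono)
  then show ?thesis by (simp add: q_def)
qed

lemma \<epsilon>_pos: "0 < \<epsilon>"
  using b lam_pos_11 \<mu>0 by (simp add: \<epsilon>_def)

lemma K_pos: "0 < K"
  using b by (simp add: K_def add_nonneg_pos)

text \<open>Later estimates see the spectrum through q = k^2 + l^2. The last two bounds place the
  leading terms above the same threshold, so that the mean value estimates can compare them with the
  exact eigenvalues on one half line.\<close>

lemma lam_bounds: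
  assumes "1 \<le> k" "1 \<le> l"
  shows "\<epsilon> * q k l \<le> lam k l" "lam k l \<le> K * q k l" "\<epsilon> * q k l \<le> noise_eigval \<mu>0 k l"
    "\<epsilon> * q k l \<le> pi\<^sup>2 * b * q k l" "\<epsilon> * q k l \<le> pi\<^sup>2 * q k l"
proof -
  note q2 = q_ge_2[OF assms]
  have e: "\<epsilon> * q k l \<le> x * q k l" if "\<epsilon> \<le> x" for x
    using q2 that by (intro mult_right_mono) auto
  have \<epsilon>: "\<epsilon> \<le> min (pi\<^sup>2 * b) ((c + 2 * (pi\<^sup>2 * b)) / 2)" "\<epsilon> \<le> min (pi\<^sup>2) ((\<mu>0 + 2 * pi\<^sup>2) / 2)"
    by (simp_all only: \<epsilon>_def min.cobounded1 min.cobounded2)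
  have "\<epsilon> * q k l \<le> c + pi\<^sup>2 * b * q k l"
    by (rule order_trans[OF e[OF \<epsilon>(1)] affine_ge_mult]) (use b lam_pos_11 q2 in auto)
  then show "\<epsilon> * q k l \<le> lam k l"
    by (simp add: lam_def q_def mult_ac)
  have "\<epsilon> * q k l \<le> \<mu>0 + pi\<^sup>2 * q k l"
    by (rule order_trans[OF e[OF \<epsilon>(2)] affine_ge_mult]) (use \<mu>0 q2 in auto)
  then show "\<epsilon> * q k l \<le> noise_eigval \<mu>0 k l"
    by (simp add: noise_eigval_def q_def add.commute)
  have "c \<le> \<bar>c\<bar> * q k l"
    using q2 mult_left_mono[of 1 "q k l" "\<bar>c\<bar>"] by linarith
  then show "lam k l \<le> K * q k l"
    by (simp add: lam_def K_def q_def algebra_simps)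
  show "\<epsilon> * q k l \<le> pi\<^sup>2 * b * q k l" "\<epsilon> * q k l \<le> pi\<^sup>2 * q k l"
    by (rule e, simp add: \<epsilon>_def)+
qed

lemma \<epsilon>q_pos: "1 \<le> k \<Longrightarrow> 1 \<le> l \<Longrightarrow> 0 < \<epsilon> * q k l"
  using q_ge_2[of k l] \<epsilon>_pos by simp

lemma lam_pos: "1 \<le> k \<Longrightarrow> 1 \<le> l \<Longrightarrow> 0 < lam k l"
  by (rule less_le_trans[OF \<epsilon>q_pos lam_bounds(1)])

lemma noise_eigval_pos: "1 \<le> k \<Longrightarrow> 1 \<le> l \<Longrightarrow> 0 < noise_eigval \<mu>0 k l"
  by (rule less_le_trans[OF \<epsilon>q_pos lam_bounds(3)])

text \<open>Read off from the convergent lattice sum with \<open>D = 1\<close>: since q \<ge> 2, the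
  factor 1 - exp(-q) is bounded away from 0.\<close>

lemma q_powr_summable: "(\<lambda>(k, l). q k l powr (- \<alpha> - 1)) summable_on indices"
proof -
  obtain S where "(lattice_term \<alpha> 1 has_sum S) indices"
    using lattice_term_has_sum_le[OF \<alpha> zero_less_one] by blast
  then have "(\<lambda>p. lattice_term \<alpha> 1 p * (1 / (1 - exp (- 2)))) summable_on indices"
    by (intro summable_on_cmult_left) (auto simp: summable_on_def)
  moreover have "(case p of (k, l) \<Rightarrow> q k l powr (- \<alpha> - 1)) \<le> lattice_term \<alpha> 1 p * (1 / (1 - exp (- 2)))"
    if "p \<in> indices" for p
  proof -
    obtain k l where p: "p = (k, l)" "1 \<le> k" "1 \<le> l" using \<open>p \<in> indices\<close> by auto
    have "1 - exp (- 2) \<le> 1 - exp (- q k l)" using q_ge_2[OF p(2,3)] by simp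
    moreover have "0 < 1 - exp (- 2 :: real)" by simp
    ultimately have "q k l powr (- \<alpha> - 1) * (1 - exp (- 2)) \<le> (1 - exp (- q k l)) * q k l powr (- 1 - \<alpha>)"
      by (simp add: mult.commute[of _ "_ powr _"] mult_left_mono diff_right_commute minus_diff_commute)
    then show ?thesis
      by (simp add: p lattice_term_def heat_kernel_def q_def field_simps)
  qed
  ultimately show ?thesis
    by (rule summable_on_comparison_test) auto
qed

text \<open>The first sum serves the initial value, the second the noise. Terms are dominated by a
  multiple of the lattice term with parameter \<open>K * \<Delta>\<close>, and all lattice sums lie
  below the same integral; the conversion factor \<open>(K * \<Delta>) powr \<alpha>\<close>
  supplies the rate.\<close>

lemma sum_eigval_bound:
  obtains C where "0 \<le> C"
    "\<And>F \<Delta>. finite F \<Longrightarrow> F \<subseteq> indices \<Longrightarrow> 0 < \<Delta> \<Longrightarrow>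
      (\<Sum>(k, l)\<in>F. lam k l powr (- 1 - \<alpha>) * (1 - exp (- lam k l * \<Delta>))) \<le> C * \<Delta> powr \<alpha>"
    "\<And>F \<Delta>. finite F \<Longrightarrow> F \<subseteq> indices \<Longrightarrow> 0 < \<Delta> \<Longrightarrow>
      (\<Sum>(k, l)\<in>F. noise_eigval \<mu>0 k l powr (- \<alpha>) * ((1 - exp (- lam k l * \<Delta>)) / lam k l)) \<le> C * \<Delta> powr \<alpha>"
proof -
  define J where "J = pi / 4 * (Gamma (1 - \<alpha>) / \<alpha>)"
  have J0: "0 \<le> J" using \<alpha> by (auto simp: J_def Gamma_real_nonneg)
  define C where "C = \<epsilon> powr (- 1 - \<alpha>) * K powr \<alpha> * J"
  have lt: "sum (lattice_term \<alpha> D) F \<le> J" if "finite F" "F \<subseteq> indices" and D: "0 < D" for F D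
  proof -
    obtain S where "(lattice_term \<alpha> D has_sum S) indices" "S \<le> J"
      using lattice_term_has_sum_le[OF \<alpha> D] unfolding J_def by blast
    then show ?thesis
      using finite_sum_le_has_sum[OF \<open>(lattice_term \<alpha> D has_sum S) indices\<close> that(1,2)]
        lattice_term_nonneg[OF D] by fastforce
  qed
  \<comment> \<open>One majorant for both families: the lower bound
    \<open>\<epsilon> * q k l\<close> goes into the power, the upper bound \<open>K * q k l\<close>
    into the exponential.\<close>
  have fin: "(\<Sum>(k, l)\<in>F. g k l) \<le> C * \<Delta> powr \<alpha>"
    if F: "finite F" "F \<subseteq> indices" and \<Delta>: "0 < \<Delta>"
      and g: "\<And>k l. 1 \<le> k \<Longrightarrow> 1 \<le> l \<Longrightarrow>
        g k l \<le> (\<epsilon> * q k l) powr (- 1 - \<alpha>) * (1 - exp (- (K * q k l) * \<Delta>))"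
    for F \<Delta> and g :: "nat \<Rightarrow> nat \<Rightarrow> real"
  proof -
    have "g k l \<le> \<epsilon> powr (- 1 - \<alpha>) * (K * \<Delta>) powr \<alpha> * lattice_term \<alpha> (K * \<Delta>) (k, l)"
      if "1 \<le> k" "1 \<le> l" for k l
    proof -
      have D: "0 < K * \<Delta>" using K_pos \<Delta> by simp
      have qp: "0 < q k l" using q_ge_2[OF that] by simp
      have "(K * \<Delta>) powr \<alpha> * (K * \<Delta>) * (K * \<Delta>) powr (- 1 - \<alpha>) = 1"
      proof -
        have "x powr \<alpha> * x * x powr (- 1 - \<alpha>) = 1" if "0 < x" for x :: real
          using that by (simp add: powr_diff powr_minus)
        then show ?thesis using D by blast
      qed
      then have "\<epsilon> powr (- 1 - \<alpha>) * (K * \<Delta>) powr \<alpha> * lattice_term \<alpha> (K * \<Delta>) (k, l) =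
          (\<epsilon> * q k l) powr (- 1 - \<alpha>) * (1 - exp (- (K * q k l) * \<Delta>))"
        using D qp \<epsilon>_pos
        by (simp add: lattice_term_def heat_kernel_def q_def[symmetric] powr_mult mult_ac)
      then show ?thesis using g[OF that] by simp
    qed
    then have "(\<Sum>(k, l)\<in>F. g k l) \<le> (\<Sum>p\<in>F. \<epsilon> powr (- 1 - \<alpha>) * (K * \<Delta>) powr \<alpha> * lattice_term \<alpha> (K * \<Delta>) p)"
      using F by (intro sum_mono) auto
    also have "\<dots> = \<epsilon> powr (- 1 - \<alpha>) * (K * \<Delta>) powr \<alpha> * sum (lattice_term \<alpha> (K * \<Delta>)) F"
      by (simp add: sum_distrib_left)
    also have "\<dots> \<le> \<epsilon> powr (- 1 - \<alpha>) * (K * \<Delta>) powr \<alpha> * J"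
      using lt[OF F, of "K * \<Delta>"] K_pos \<Delta> by (intro mult_left_mono) auto
    also have "\<dots> = C * \<Delta> powr \<alpha>"
      using K_pos \<Delta> by (simp add: C_def powr_mult)
    finally show ?thesis .
  qed
  have e: "0 \<le> 1 - exp (- lam k l * \<Delta>)" "1 - exp (- lam k l * \<Delta>) \<le> 1 - exp (- (K * q k l) * \<Delta>)"
    if "1 \<le> k" "1 \<le> l" "0 < \<Delta>" for k l \<Delta>
    using lam_bounds(2)[OF that(1,2)] lam_pos[OF that(1,2)] that(3) by auto
  show ?thesis
  proof (rule that[of C])
    show "0 \<le> C" using J0 by (simp add: C_def)
    fix F :: "(nat \<times> nat) set" and \<Delta> :: real
    assume F: "finite F" "F \<subseteq> indices" and \<Delta>: "0 < \<Delta>"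
    show "(\<Sum>(k, l)\<in>F. lam k l powr (- 1 - \<alpha>) * (1 - exp (- lam k l * \<Delta>))) \<le> C * \<Delta> powr \<alpha>"
    proof (rule fin[OF F \<Delta>])
      fix k l :: nat assume kl: "1 \<le> k" "1 \<le> l"
      show "lam k l powr (- 1 - \<alpha>) * (1 - exp (- lam k l * \<Delta>)) \<le>
          (\<epsilon> * q k l) powr (- 1 - \<alpha>) * (1 - exp (- (K * q k l) * \<Delta>))"
        using lam_bounds[OF kl] \<epsilon>q_pos[OF kl] e[OF kl \<Delta>] \<alpha>
        by (intro mult_mono powr_mono2') auto
    qed
    show "(\<Sum>(k, l)\<in>F. noise_eigval \<mu>0 k l powr (- \<alpha>) * ((1 - exp (- lam k l * \<Delta>)) / lam k l)) \<le> C * \<Delta> powr \<alpha>"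
    proof (rule fin[OF F \<Delta>])
      fix k l :: nat assume kl: "1 \<le> k" "1 \<le> l"
      have "noise_eigval \<mu>0 k l powr (- \<alpha>) * ((1 - exp (- lam k l * \<Delta>)) / lam k l) \<le>
          (\<epsilon> * q k l) powr (- \<alpha>) * ((1 - exp (- (K * q k l) * \<Delta>)) / (\<epsilon> * q k l))"
        using lam_bounds[OF kl] \<epsilon>q_pos[OF kl] e[OF kl \<Delta>] \<alpha> lam_pos[OF kl]
        by (intro mult_mono powr_mono2' frac_le) auto
      also have "\<dots> = (\<epsilon> * q k l) powr (- 1 - \<alpha>) * (1 - exp (- (K * q k l) * \<Delta>))"
        using \<epsilon>q_pos[OF kl] powr_add[of "\<epsilon> * q k l" "-1" "- \<alpha>"] by (simp add: powr_minus field_simps)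
      finally show "noise_eigval \<mu>0 k l powr (- \<alpha>) * ((1 - exp (- lam k l * \<Delta>)) / lam k l) \<le>
          (\<epsilon> * q k l) powr (- 1 - \<alpha>) * (1 - exp (- (K * q k l) * \<Delta>))" .
    qed
  qed
qed

text \<open>The exact eigenvalues are replaced by their leading terms, one factor at a time. The
  loss is \<Delta> times a summable weight, for \<Delta> \<le> 1 and s \<ge> \<alpha> of no larger
  order than the error \<Delta>^(\<alpha> + 1 - s) of the lattice sum.\<close>

lemma variance_term_perturbation:
  assumes "1 \<le> k" "1 \<le> l" "0 \<le> \<Delta>"
  shows "\<bar>noise_eigval \<mu>0 k l powr (- \<alpha>) * ((1 - exp (- lam k l * \<Delta>)) / lam k l) -
      (pi\<^sup>2 * q k l) powr (- \<alpha>) * ((1 - exp (- (pi\<^sup>2 * b * q k l) * \<Delta>)) / (pi\<^sup>2 * b * q k l))\<bar>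
    \<le> (\<alpha> * \<bar>\<mu>0\<bar> + \<bar>c\<bar>) * \<epsilon> powr (- \<alpha> - 1) * \<Delta> * q k l powr (- \<alpha> - 1)"
proof -
  note kl = assms(1,2)
  define m where "m = \<epsilon> * q k l"
  define h where "h x = (1 - exp (- x * \<Delta>)) / x" for x
  have m: "0 < m" using \<epsilon>q_pos[OF kl] by (simp add: m_def)
  note bd = lam_bounds[OF kl, folded m_def]
  have d1: "\<bar>noise_eigval \<mu>0 k l powr (- \<alpha>) - (pi\<^sup>2 * q k l) powr (- \<alpha>)\<bar> \<le> \<alpha> * m powr (- \<alpha> - 1) * \<bar>\<mu>0\<bar>"
    using powr_minus_lipschitz[OF m bd(3) bd(5) \<alpha>(1)] by (simp add: noise_eigval_def q_def)
  have d2: "\<bar>h (lam k l) - h (pi\<^sup>2 * b * q k l)\<bar> \<le> \<Delta> / m * \<bar>c\<bar>"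
    using exp_mean_lipschitz[OF m bd(1) bd(4) assms(3)] unfolding h_def
    by (simp add: lam_def q_def mult_ac)
  have h: "0 \<le> h (lam k l)" "h (lam k l) \<le> \<Delta>"
    using exp_mean_bounds[OF lam_pos[OF kl] assms(3)] by (auto simp: h_def)
  have pw: "(pi\<^sup>2 * q k l) powr (- \<alpha>) \<le> m powr (- \<alpha>)"
    using m bd \<alpha> by (intro powr_mono2') auto
  have "\<bar>noise_eigval \<mu>0 k l powr (- \<alpha>) * h (lam k l) - (pi\<^sup>2 * q k l) powr (- \<alpha>) * h (pi\<^sup>2 * b * q k l)\<bar>
     \<le> \<bar>(noise_eigval \<mu>0 k l powr (- \<alpha>) - (pi\<^sup>2 * q k l) powr (- \<alpha>)) * h (lam k l)\<bar>
      + \<bar>(pi\<^sup>2 * q k l) powr (- \<alpha>) * (h (lam k l) - h (pi\<^sup>2 * b * q k l))\<bar>"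
    by (rule order_trans[OF _ abs_triangle_ineq]) (simp add: algebra_simps)
  also have "\<dots> \<le> (\<alpha> * m powr (- \<alpha> - 1) * \<bar>\<mu>0\<bar>) * \<Delta> + m powr (- \<alpha>) * (\<Delta> / m * \<bar>c\<bar>)"
    unfolding abs_mult using d1 d2 h pw \<alpha> by (intro add_mono mult_mono) auto
  also have "m powr (- \<alpha>) * (\<Delta> / m * \<bar>c\<bar>) = m powr (- \<alpha> - 1) * \<Delta> * \<bar>c\<bar>"
    using m by (simp add: powr_diff)
  finally show ?thesis
    using q_ge_2[OF kl] \<epsilon>_pos by (simp add: h_def m_def powr_mult algebra_simps)
qed

lemma noise_has_sum:
  assumes s: "\<alpha> \<le> s" "1 / 2 < s" "s < 1" and \<delta>: "0 < \<delta>" "\<delta> < 1 / 2"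
  obtains C where "0 \<le> C"
    "\<And>\<Delta> y z. 0 < \<Delta> \<Longrightarrow> \<Delta> \<le> 1 \<Longrightarrow> \<delta> \<le> y \<Longrightarrow> y \<le> 1 - \<delta> \<Longrightarrow> \<delta> \<le> z \<Longrightarrow> z \<le> 1 - \<delta> \<Longrightarrow>
      \<exists>H. ((\<lambda>(k, l). noise_eigval \<mu>0 k l powr (- \<alpha>) * ((1 - exp (- lam k l * \<Delta>)) / lam k l)
            * (4 * (sin (pi * real k * y))\<^sup>2 * (sin (pi * real l * z))\<^sup>2)) has_sum H) indices
        \<and> \<bar>H - \<Delta> powr \<alpha> * (b powr (\<alpha> - 1) * (Gamma (1 - \<alpha>) / (4 * pi * \<alpha>)))\<bar> \<le> C * \<Delta> powr (\<alpha> + 1 - s)"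
proof (rule lattice_sin_has_sum[OF \<alpha> s \<delta>])
  fix C0 assume C0: "0 \<le> C0" "\<And>D y z. 0 < D \<Longrightarrow> \<delta> \<le> y \<Longrightarrow> y \<le> 1 - \<delta> \<Longrightarrow> \<delta> \<le> z \<Longrightarrow> z \<le> 1 - \<delta> \<Longrightarrow>
      \<exists>S. ((\<lambda>(k, l). lattice_term \<alpha> D (k, l) * (4 * (sin (pi * real k * y))\<^sup>2 * (sin (pi * real l * z))\<^sup>2)) has_sum S) indices
        \<and> \<bar>S - pi / 4 * (Gamma (1 - \<alpha>) / \<alpha>)\<bar> \<le> C0 * D powr (1 - s)"
  obtain Q where Q: "((\<lambda>(k, l). q k l powr (- \<alpha> - 1)) has_sum Q) indices"
    using q_powr_summable by (auto simp: summable_on_def)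
  have Q0: "0 \<le> Q" by (rule has_sum_nonneg[OF Q]) auto
  define P where "P = (\<alpha> * \<bar>\<mu>0\<bar> + \<bar>c\<bar>) * \<epsilon> powr (- \<alpha> - 1)"
  have P0: "0 \<le> P" using \<alpha> by (simp add: P_def)
  \<comment> \<open>Up to \<open>\<Delta> powr \<alpha>\<close>, the factor between the lattice term
    with \<open>D = pi\<^sup>2 * b * \<Delta>\<close> and the variance. Its 1 / pi^2 turns the pi /
    4 of the quadrant into the 1 / (4 pi) of the limit.\<close>
  define B where "B = b powr (\<alpha> - 1) / pi\<^sup>2"
  define C where "C = 4 * P * Q + B * C0 * (pi\<^sup>2 * b) powr (1 - s)"
  show thesis
  proof (rule that[of C])
    show "0 \<le> C" using P0 Q0 C0 by (simp add: C_def B_def)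
    fix \<Delta> y z :: real
    assume \<Delta>: "0 < \<Delta>" "\<Delta> \<le> 1" and yz: "\<delta> \<le> y" "y \<le> 1 - \<delta>" "\<delta> \<le> z" "z \<le> 1 - \<delta>"
    define D where "D = pi\<^sup>2 * b * \<Delta>"
    have D: "0 < D" using \<Delta> b by (simp add: D_def)
    define T where "T k l = 4 * (sin (pi * real k * y))\<^sup>2 * (sin (pi * real l * z))\<^sup>2" for k l
    have T: "0 \<le> T k l" "T k l \<le> 4" for k l
    proof -
      have "(sin (pi * real k * y))\<^sup>2 * (sin (pi * real l * z))\<^sup>2 \<le> 1"
        by (intro mult_le_one) (auto simp: abs_square_le_1)
      then show "0 \<le> T k l" "T k l \<le> 4" by (auto simp: T_def)
    qed
    define v where "v k l = noise_eigval \<mu>0 k l powr (- \<alpha>) * ((1 - exp (- lam k l * \<Delta>)) / lam k l)" for k l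
    obtain S where S: "((\<lambda>(k, l). lattice_term \<alpha> D (k, l) * T k l) has_sum S) indices"
      "\<bar>S - pi / 4 * (Gamma (1 - \<alpha>) / \<alpha>)\<bar> \<le> C0 * D powr (1 - s)"
      using C0(2)[OF D yz] unfolding T_def by blast
    have main: "B * \<Delta> powr \<alpha> * lattice_term \<alpha> D (k, l) =
        (pi\<^sup>2 * q k l) powr (- \<alpha>) * ((1 - exp (- (pi\<^sup>2 * b * q k l) * \<Delta>)) / (pi\<^sup>2 * b * q k l))"
      if "1 \<le> k" "1 \<le> l" for k l
    proof -
      define r where "r = pi\<^sup>2 * q k l"
      have r: "0 < r" using q_ge_2[OF that] by (simp add: r_def)
      have "lattice_term \<alpha> D (k, l) = pi\<^sup>2 * b * \<Delta> * ((1 - exp (- (b * r * \<Delta>))) * (b * r * \<Delta>) powr (- 1 - \<alpha>))"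
        by (simp add: lattice_term_def heat_kernel_def D_def r_def q_def mult_ac)
      also have "(b * r * \<Delta>) powr (- 1 - \<alpha>) = r powr (- \<alpha>) / (b powr \<alpha> * \<Delta> powr \<alpha> * (b * r * \<Delta>))"
        using b r \<Delta> by (simp add: powr_mult powr_diff powr_minus field_simps)
      finally show ?thesis
        using b r \<Delta> by (simp add: B_def r_def[symmetric] powr_diff mult.assoc) (simp add: field_simps r_def)
    qed
    define e where "e p = (case p of (k, l) \<Rightarrow> (v k l - B * \<Delta> powr \<alpha> * lattice_term \<alpha> D (k, l)) * T k l)" for p
    have e_le: "\<bar>e p\<bar> \<le> 4 * P * \<Delta> * (case p of (k, l) \<Rightarrow> q k l powr (- \<alpha> - 1))" if "p \<in> indices" for p
    proof -
      obtain k l where p: "p = (k, l)" "1 \<le> k" "1 \<le> l" using \<open>p \<in> indices\<close> by auto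
      have "\<bar>v k l - B * \<Delta> powr \<alpha> * lattice_term \<alpha> D (k, l)\<bar> \<le> P * \<Delta> * q k l powr (- \<alpha> - 1)"
        unfolding main[OF p(2,3)] v_def P_def using variance_term_perturbation[OF p(2,3)] \<Delta> by simp
      then have "\<bar>v k l - B * \<Delta> powr \<alpha> * lattice_term \<alpha> D (k, l)\<bar> * \<bar>T k l\<bar> \<le> (P * \<Delta> * q k l powr (- \<alpha> - 1)) * 4"
        using T by (intro mult_mono) auto
      then show ?thesis by (simp add: p e_def abs_mult mult_ac)
    qed
    have bound_sum: "((\<lambda>p. 4 * P * \<Delta> * (case p of (k, l) \<Rightarrow> q k l powr (- \<alpha> - 1))) has_sum (4 * P * \<Delta> * Q)) indices"
      by (rule has_sum_cmult_right[OF Q])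
    have "e summable_on indices"
      by (rule abs_summable_summable[OF Infinite_Sum.abs_summable_on_comparison_test'])
         (use has_sum_imp_summable[OF bound_sum] e_le in auto)
    then obtain E where E: "(e has_sum E) indices"
      by (auto simp: summable_on_def)
    have E_le: "\<bar>E\<bar> \<le> 4 * P * \<Delta> * Q"
      using norm_infsum_le[OF E bound_sum] e_le by simp
    have "((\<lambda>p. B * \<Delta> powr \<alpha> * (case p of (k, l) \<Rightarrow> lattice_term \<alpha> D (k, l) * T k l) + e p)
        has_sum (B * \<Delta> powr \<alpha> * S + E)) indices"
      by (intro has_sum_add has_sum_cmult_right S(1) E)
    also have "(\<lambda>p. B * \<Delta> powr \<alpha> * (case p of (k, l) \<Rightarrow> lattice_term \<alpha> D (k, l) * T k l) + e p) =
        (\<lambda>(k, l). v k l * T k l)"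
      by (auto simp: fun_eq_iff e_def algebra_simps)
    finally have H: "((\<lambda>(k, l). v k l * T k l) has_sum (B * \<Delta> powr \<alpha> * S + E)) indices" .
    have g: "b powr (\<alpha> - 1) * (Gamma (1 - \<alpha>) / (4 * pi * \<alpha>)) = B * (pi / 4 * (Gamma (1 - \<alpha>) / \<alpha>))"
      using \<alpha> by (simp add: B_def power2_eq_square)
    have "\<bar>B * \<Delta> powr \<alpha> * S + E - \<Delta> powr \<alpha> * (B * (pi / 4 * (Gamma (1 - \<alpha>) / \<alpha>)))\<bar> \<le>
        \<bar>B * \<Delta> powr \<alpha> * (S - pi / 4 * (Gamma (1 - \<alpha>) / \<alpha>))\<bar> + \<bar>E\<bar>"
      by (rule order_trans[OF _ abs_triangle_ineq]) (simp add: algebra_simps)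
    also have "\<dots> \<le> B * \<Delta> powr \<alpha> * (C0 * D powr (1 - s)) + 4 * P * \<Delta> * Q"
      using S(2) E_le by (intro add_mono) (auto simp: abs_mult B_def intro!: mult_left_mono divide_right_mono)
    also have "\<dots> \<le> B * \<Delta> powr \<alpha> * (C0 * D powr (1 - s)) + 4 * P * \<Delta> powr (\<alpha> + 1 - s) * Q"
    proof -
      \<comment> \<open>Absorbs the perturbation into the lattice error; it rests on \<Delta> \<le>
        1 and s \<ge> \<alpha>.\<close>
      have "\<Delta> powr 1 \<le> \<Delta> powr (\<alpha> + 1 - s)"
        using \<Delta> s by (intro powr_mono') auto
      then show ?thesis using \<Delta> P0 Q0 by (intro add_left_mono mult_right_mono mult_left_mono) auto
    qed
    also have "\<dots> = C * \<Delta> powr (\<alpha> + 1 - s)"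
    proof -
      have "D powr (1 - s) = (pi\<^sup>2 * b) powr (1 - s) * \<Delta> powr (1 - s)"
        using b \<Delta> unfolding D_def by (subst powr_mult) auto
      moreover have "\<Delta> powr (\<alpha> + 1 - s) = \<Delta> powr \<alpha> * \<Delta> powr (1 - s)"
        by (simp add: powr_add[symmetric] algebra_simps)
      ultimately show ?thesis by (simp add: C_def algebra_simps)
    qed
    finally show "\<exists>H. ((\<lambda>(k, l). noise_eigval \<mu>0 k l powr (- \<alpha>) * ((1 - exp (- lam k l * \<Delta>)) / lam k l)
            * (4 * (sin (pi * real k * y))\<^sup>2 * (sin (pi * real l * z))\<^sup>2)) has_sum H) indices
        \<and> \<bar>H - \<Delta> powr \<alpha> * (b powr (\<alpha> - 1) * (Gamma (1 - \<alpha>) / (4 * pi * \<alpha>)))\<bar> \<le> C * \<Delta> powr (\<alpha> + 1 - s)"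
      using H unfolding v_def T_def g by blast
  qed
qed

end

section \<open>Gram matrix of Ornstein--Uhlenbeck increments\<close>

text \<open>Extended by 0 outside [0, t], so that kernels of different horizons are functions on one
  line and can be subtracted.\<close>

definition ou_kernel :: "real \<Rightarrow> real \<Rightarrow> real \<Rightarrow> real" where
  "ou_kernel lam t s = indicator {0..t} s * exp (- lam * (t - s))"

lemma borel_measurable_ou_kernel [measurable]: "ou_kernel lam t \<in> borel_measurable borel"
  unfolding ou_kernel_def[abs_def] by measurable

lemma ou_kernel_inner:
  assumes "0 < lam" "0 \<le> t" "0 \<le> u"
  shows "has_bochner_integral lborel (\<lambda>s. ou_kernel lam t s * ou_kernel lam u s)
    ((exp (- lam * \<bar>t - u\<bar>) - exp (- lam * (t + u))) / (2 * lam))"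
proof -
  have *: "has_bochner_integral lborel (\<lambda>s. ou_kernel lam t s * ou_kernel lam u s)
    ((exp (- lam * \<bar>t - u\<bar>) - exp (- lam * (t + u))) / (2 * lam))" if "u \<le> t" "0 \<le> u" for t u
  proof -
    define F where "F s = exp (2 * lam * s - lam * (t + u)) / (2 * lam)" for s
    have "has_bochner_integral lborel (\<lambda>s. exp (2 * lam * s - lam * (t + u)) * indicator {0..u} s) (F u - F 0)"
      using assms that
      by (intro has_bochner_integral_FTC_Icc_real) (auto simp: F_def intro!: derivative_eq_intros)
    also have "(\<lambda>s. exp (2 * lam * s - lam * (t + u)) * indicator {0..u} s) =
        (\<lambda>s. ou_kernel lam t s * ou_kernel lam u s)"
      using that by (auto simp: fun_eq_iff ou_kernel_def indicator_def exp_add[symmetric] algebra_simps)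
    also have "F u - F 0 = (exp (- lam * \<bar>t - u\<bar>) - exp (- lam * (t + u))) / (2 * lam)"
      using that by (simp add: F_def algebra_simps diff_divide_distrib)
    finally show ?thesis .
  qed
  show ?thesis
  proof (cases "u \<le> t")
    case True
    then show ?thesis using * assms by simp
  next
    case False
    then show ?thesis using *[of t u] assms by (simp add: mult.commute abs_minus_commute add.commute)
  qed
qed

definition ou_increment :: "real \<Rightarrow> nat \<Rightarrow> nat \<Rightarrow> real \<Rightarrow> real" where
  "ou_increment lam N i s = ou_kernel lam (real i / real N) s - ou_kernel lam (real (i - 1) / real N) s"

text \<open>By the isometry this is the covariance matrix of the increments of a single mode started
  at 0 with unit noise.\<close>

definition ou_gram :: "real \<Rightarrow> nat \<Rightarrow> nat \<Rightarrow> nat \<Rightarrow> real" where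
  "ou_gram lam N i j = (\<integral>s. ou_increment lam N i s * ou_increment lam N j s \<partial>lborel)"

lemma ou_gram_sym: "ou_gram lam N i j = ou_gram lam N j i"
  by (simp add: ou_gram_def mult.commute)

text \<open>Here \<open>\<rho>\<close> is the decay factor of the mode over one time step, not the
  exponent that bounds the number of design points.\<close>

context
  fixes lam :: real and N :: nat and \<rho> :: real
  assumes lam: "0 < lam" and N: "0 < N" and \<rho>_def: "\<rho> = exp (- lam / real N)"
begin

lemma \<rho>: "0 < \<rho>" "\<rho> < 1"
  using lam N by (auto simp: \<rho>_def)

lemma ou_kernel_grid_inner:
  "has_bochner_integral lborel (\<lambda>s. ou_kernel lam (real i / real N) s * ou_kernel lam (real j / real N) s)
    ((\<rho> ^ (if i \<le> j then j - i else i - j) - \<rho> ^ (i + j)) / (2 * lam))"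
proof -
  have e: "exp (- lam * (real n / real N)) = \<rho> ^ n" for n
    by (simp add: \<rho>_def exp_of_nat_mult[symmetric])
  have "\<bar>real i / real N - real j / real N\<bar> = real (if i \<le> j then j - i else i - j) / real N"
    using N by (simp add: diff_divide_distrib[symmetric] of_nat_diff abs_divide)
  moreover have "real i / real N + real j / real N = real (i + j) / real N"
    by (simp add: add_divide_distrib)
  ultimately show ?thesis
    using ou_kernel_inner[OF lam, of "real i / real N" "real j / real N"]
    by (simp only: e) simp
qed

lemma ou_increment_integrable:
  "integrable lborel (\<lambda>s. ou_increment lam N i s * ou_increment lam N j s)"
proof -
  note h = has_bochner_integral_iff[THEN iffD1, OF ou_kernel_grid_inner, THEN conjunct1]
  show ?thesis
    unfolding ou_increment_def left_diff_distrib right_diff_distrib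
    by (intro Bochner_Integration.integrable_diff h)
qed

lemma ou_gram_eq:
  fixes r defines "r \<equiv> \<lambda>i j. (\<rho> ^ (if i \<le> j then j - i else i - j) - \<rho> ^ (i + j)) / (2 * lam)"
  shows "ou_gram lam N i j = r i j - r i (j - 1) - r (i - 1) j + r (i - 1) (j - 1)"
proof -
  note h = has_bochner_integral_iff[THEN iffD1, OF ou_kernel_grid_inner, folded r_def]
  have "ou_gram lam N i j = (\<integral>s.
      ou_kernel lam (real i / real N) s * ou_kernel lam (real j / real N) s
      - ou_kernel lam (real i / real N) s * ou_kernel lam (real (j - 1) / real N) s
      - (ou_kernel lam (real (i - 1) / real N) s * ou_kernel lam (real j / real N) s
      - ou_kernel lam (real (i - 1) / real N) s * ou_kernel lam (real (j - 1) / real N) s) \<partial>lborel)"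
    unfolding ou_gram_def ou_increment_def by (simp add: left_diff_distrib right_diff_distrib algebra_simps)
  also have "\<dots> = r i j - r i (j - 1) - (r (i - 1) j - r (i - 1) (j - 1))"
    using h by (simp add: r_def)
  finally show ?thesis by simp
qed

text \<open>The first part is the variance of a stationary increment; the second, decaying
  geometrically in \<open>m\<close>, accounts for the start at 0.\<close>

lemma ou_gram_diag:
  "ou_gram lam N (Suc m) (Suc m) = (1 - \<rho>) / lam - (1 - \<rho>)\<^sup>2 * \<rho> ^ (2 * m) / (2 * lam)"
proof -
  have "ou_gram lam N (Suc m) (Suc m) =
      ((1 - \<rho> ^ (m + m + 2)) - (\<rho> - \<rho> ^ (m + m + 1)) - (\<rho> - \<rho> ^ (m + m + 1)) + (1 - \<rho> ^ (m + m))) / (2 * lam)"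
    unfolding ou_gram_eq by (simp add: diff_divide_distrib add_divide_distrib del: power_Suc)
  also have "\<dots> = (2 * (1 - \<rho>) - (1 - \<rho>)\<^sup>2 * \<rho> ^ (m + m)) / (2 * lam)"
    by (rule arg_cong[of _ _ "\<lambda>x. x / (2 * lam)"]) (simp add: power2_eq_square algebra_simps)
  finally show ?thesis by (simp add: diff_divide_distrib flip: mult_2)
qed

text \<open>The indices are written with an offset \<open>d\<close> so that no truncated subtraction
  remains. Off-diagonal entries are negative and carry an extra factor 1 - \<rho> compared with the
  diagonal.\<close>

lemma ou_gram_offdiag:
  "ou_gram lam N (Suc m) (Suc (Suc (m + d))) = - ((1 - \<rho>)\<^sup>2 * (\<rho> ^ d + \<rho> ^ (2 * m + d + 1)) / (2 * lam))"
proof -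
  have "ou_gram lam N (Suc m) (Suc (Suc (m + d))) =
      ((\<rho> ^ (d + 1) - \<rho> ^ (m + (m + d) + 3)) - (\<rho> ^ d - \<rho> ^ (m + (m + d) + 2))
       - (\<rho> ^ (d + 2) - \<rho> ^ (m + (m + d) + 2)) + (\<rho> ^ (d + 1) - \<rho> ^ (m + (m + d) + 1))) / (2 * lam)"
    unfolding ou_gram_eq
    by (simp add: diff_divide_distrib add_divide_distrib Suc_diff_le numeral_3_eq_3 del: power_Suc)
  also have "\<dots> = (- ((1 - \<rho>)\<^sup>2 * (\<rho> ^ d + \<rho> ^ (m + (m + d) + 1)))) / (2 * lam)"
    by (rule arg_cong[of _ _ "\<lambda>x. x / (2 * lam)"])
       (simp add: power2_eq_square power3_eq_cube power_add power_mult algebra_simps)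
  also have "m + (m + d) + 1 = 2 * m + d + 1" by simp
  finally show ?thesis by simp
qed

lemma geometric_le: "(1 - \<rho>) * (\<Sum>d<n. \<rho> ^ d) \<le> 1"
  using \<rho> by (simp add: one_diff_power_eq[symmetric])

lemma ou_gram_diag_bounds:
  assumes "1 \<le> i"
  shows "\<bar>ou_gram lam N i i\<bar> \<le> (1 - \<rho>) / lam"
proof -
  obtain m where m: "i = Suc m" using assms by (cases i) auto
  define x where "x = (1 - \<rho>)\<^sup>2 * \<rho> ^ (2 * m)"
  have "x \<le> (1 - \<rho>) * 1 * 1"
    unfolding x_def power2_eq_square using \<rho> by (intro mult_mono power_le_one) auto
  moreover have "0 \<le> x" using \<rho> by (simp add: x_def)
  ultimately have "\<bar>(1 - \<rho> - x / 2) / lam\<bar> \<le> (1 - \<rho>) / lam"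
    using lam by (simp add: divide_right_mono)
  moreover have "ou_gram lam N i i = (1 - \<rho> - x / 2) / lam"
    unfolding m ou_gram_diag x_def by (simp add: diff_divide_distrib)
  ultimately show ?thesis by simp
qed

lemma ou_gram_offdiag_bound:
  assumes "1 \<le> i" "i < j"
  shows "\<bar>ou_gram lam N i j\<bar> \<le> (1 - \<rho>)\<^sup>2 / lam * \<rho> ^ (j - i - 1)"
proof -
  obtain m where m: "i = Suc m" using assms by (cases i) auto
  obtain d where d: "j = Suc (Suc (m + d))" using less_imp_Suc_add[OF assms(2)] m by auto
  have "\<rho> ^ (2 * m + d + 1) \<le> \<rho> ^ d" using \<rho> by (intro power_decreasing) auto
  then have "(1 - \<rho>)\<^sup>2 * (\<rho> ^ d + \<rho> ^ (2 * m + d + 1)) \<le> (1 - \<rho>)\<^sup>2 * (2 * \<rho> ^ d)"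
    by (intro mult_left_mono) auto
  then have "(1 - \<rho>)\<^sup>2 * (\<rho> ^ d + \<rho> ^ (2 * m + d + 1)) / (2 * lam) \<le> (1 - \<rho>)\<^sup>2 * (2 * \<rho> ^ d) / (2 * lam)"
    using lam by (intro divide_right_mono) auto
  moreover have "0 \<le> (1 - \<rho>)\<^sup>2 * (\<rho> ^ d + \<rho> ^ (2 * m + d + 1)) / (2 * lam)"
    using lam \<rho> by simp
  ultimately have "\<bar>ou_gram lam N i j\<bar> \<le> (1 - \<rho>)\<^sup>2 * (2 * \<rho> ^ d) / (2 * lam)"
    unfolding m d ou_gram_offdiag by (simp only: abs_minus_cancel abs_of_nonneg)
  then show ?thesis by (simp add: m d)
qed

text \<open>The extra factor 1 - \<rho> cancels the geometric series on either side of the diagonal,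
  so a row sums to at most three times the diagonal bound, uniformly in \<open>lam\<close> and
  \<open>N\<close>. This is what keeps the variance of the realized volatility at order 1 /
  N.\<close>

lemma ou_gram_row_sum:
  assumes i: "i \<in> {1..n}"
  shows "(\<Sum>j=1..n. \<bar>ou_gram lam N i j\<bar>) \<le> 3 * ((1 - \<rho>) / lam)"
proof -
  have geo: "(\<Sum>j\<in>S. (1 - \<rho>)\<^sup>2 / lam * \<rho> ^ f j) \<le> (1 - \<rho>) / lam"
    if "inj_on f S" "f ` S \<subseteq> {..<n}" for S :: "nat set" and f
  proof -
    have "(\<Sum>j\<in>S. \<rho> ^ f j) = (\<Sum>d\<in>f ` S. \<rho> ^ d)"
      using that(1) by (simp add: sum.reindex)
    also have "\<dots> \<le> (\<Sum>d<n. \<rho> ^ d)"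
      using that(2) \<rho> by (intro sum_mono2) auto
    finally have "(1 - \<rho>) * (\<Sum>j\<in>S. \<rho> ^ f j) \<le> 1"
      using \<rho> by (intro order_trans[OF mult_left_mono geometric_le[of n]]) auto
    then have "(1 - \<rho>) / lam * ((1 - \<rho>) * (\<Sum>j\<in>S. \<rho> ^ f j)) \<le> (1 - \<rho>) / lam * 1"
      using \<rho> lam by (intro mult_left_mono) auto
    moreover have "(\<Sum>j\<in>S. (1 - \<rho>)\<^sup>2 / lam * \<rho> ^ f j) = (1 - \<rho>) / lam * ((1 - \<rho>) * (\<Sum>j\<in>S. \<rho> ^ f j))"
      unfolding sum_distrib_left[symmetric] by (simp add: power2_eq_square)
    ultimately show ?thesis by simp
  qed
  have below: "\<bar>ou_gram lam N i j\<bar> \<le> (1 - \<rho>)\<^sup>2 / lam * \<rho> ^ (i - j - 1)" if "j \<in> {1..<i}" for j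
    using ou_gram_offdiag_bound[of j i] that by (subst ou_gram_sym) auto
  have "{1..n} = insert i ({i<..n} \<union> {1..<i})" using i by auto
  then have "(\<Sum>j=1..n. \<bar>ou_gram lam N i j\<bar>) =
      \<bar>ou_gram lam N i i\<bar> + ((\<Sum>j\<in>{i<..n}. \<bar>ou_gram lam N i j\<bar>) + (\<Sum>j\<in>{1..<i}. \<bar>ou_gram lam N i j\<bar>))"
    by (simp, subst sum.union_disjoint) auto
  also have "\<dots> \<le> (1 - \<rho>) / lam + ((\<Sum>j\<in>{i<..n}. (1 - \<rho>)\<^sup>2 / lam * \<rho> ^ (j - i - 1))
      + (\<Sum>j\<in>{1..<i}. (1 - \<rho>)\<^sup>2 / lam * \<rho> ^ (i - j - 1)))"
    using i by (intro add_mono sum_mono ou_gram_diag_bounds ou_gram_offdiag_bound below) auto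
  also have "\<dots> \<le> (1 - \<rho>) / lam + ((1 - \<rho>) / lam + (1 - \<rho>) / lam)"
    using i by (intro add_mono geo order_refl) (auto simp: inj_on_def)
  finally show ?thesis by linarith
qed

text \<open>The summands are the squared increments of exp(- lam t) along the time grid. The bound
  is used for the trace of the Gram matrix and again for the initial value.\<close>

lemma ou_increment_factor_sum: "(\<Sum>i=1..n. ((1 - \<rho>) * \<rho> ^ (i - 1))\<^sup>2) \<le> 1 - \<rho>"
proof -
  have "(\<Sum>i=1..n. ((1 - \<rho>) * \<rho> ^ (i - 1))\<^sup>2) = (\<Sum>d<n. (1 - \<rho>)\<^sup>2 * (\<rho> ^ d)\<^sup>2)"
    by (rule sum.reindex_bij_witness[of _ Suc "\<lambda>i. i - 1"]) (auto simp: power_mult_distrib)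
  also have "\<dots> \<le> (\<Sum>d<n. (1 - \<rho>)\<^sup>2 * \<rho> ^ d)"
    using \<rho> by (intro sum_mono mult_left_mono)
      (auto simp: power_mult[symmetric] intro!: power_decreasing)
  also have "\<dots> = (1 - \<rho>) * ((1 - \<rho>) * (\<Sum>d<n. \<rho> ^ d))"
    by (simp add: sum_distrib_left power2_eq_square mult_ac)
  also have "\<dots> \<le> (1 - \<rho>) * 1"
    using \<rho> geometric_le by (intro mult_left_mono) auto
  finally show ?thesis by simp
qed

lemma ou_gram_trace: "\<bar>(\<Sum>i=1..n. ou_gram lam N i i) - real n * ((1 - \<rho>) / lam)\<bar> \<le> (1 - \<rho>) / lam"
proof -
  have "(\<Sum>i=1..n. ou_gram lam N i i) =
      (\<Sum>i=1..n. (1 - \<rho>) / lam - ((1 - \<rho>) * \<rho> ^ (i - 1))\<^sup>2 / (2 * lam))"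
  proof (rule sum.cong)
    fix i assume "i \<in> {1..n}"
    then obtain m where m: "i = Suc m" by (cases i) auto
    show "ou_gram lam N i i = (1 - \<rho>) / lam - ((1 - \<rho>) * \<rho> ^ (i - 1))\<^sup>2 / (2 * lam)"
      unfolding m ou_gram_diag by (simp add: power_mult_distrib power_mult[symmetric] mult.commute)
  qed simp
  also have "\<dots> = real n * ((1 - \<rho>) / lam) - (\<Sum>i=1..n. ((1 - \<rho>) * \<rho> ^ (i - 1))\<^sup>2) / (2 * lam)"
    by (simp add: sum_subtractf sum_divide_distrib)
  finally have "(\<Sum>i=1..n. ou_gram lam N i i) - real n * ((1 - \<rho>) / lam) =
      - ((\<Sum>i=1..n. ((1 - \<rho>) * \<rho> ^ (i - 1))\<^sup>2) / (2 * lam))" by simp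
  moreover have "0 \<le> (\<Sum>i=1..n. ((1 - \<rho>) * \<rho> ^ (i - 1))\<^sup>2) / (2 * lam)"
    using lam by (intro divide_nonneg_pos sum_nonneg) auto
  moreover have "(\<Sum>i=1..n. ((1 - \<rho>) * \<rho> ^ (i - 1))\<^sup>2) / (2 * lam) \<le> (1 - \<rho>) / lam"
    using ou_increment_factor_sum[of n] lam \<rho> by (intro frac_le) auto
  ultimately show ?thesis by (simp only: abs_minus_cancel abs_of_nonneg)
qed

end

section \<open>Approximation of Wiener integrals\<close>

text \<open>Continuity of the inner product: the difference of the products is (fn - f)(gn - g) + f
  (gn - g) + g (fn - f). It transfers the convergence of step functions to the covariances.\<close>

lemma tendsto_integral_mult:
  fixes f g :: "'b \<Rightarrow> real" and fn gn :: "nat \<Rightarrow> 'b \<Rightarrow> real"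
  assumes [measurable]: "f \<in> borel_measurable M" "g \<in> borel_measurable M"
      "\<And>n. fn n \<in> borel_measurable M" "\<And>n. gn n \<in> borel_measurable M"
    and f: "integrable M (\<lambda>x. (f x)\<^sup>2)" and g: "integrable M (\<lambda>x. (g x)\<^sup>2)"
    and fn: "\<And>n. integrable M (\<lambda>x. (fn n x)\<^sup>2)" and gn: "\<And>n. integrable M (\<lambda>x. (gn n x)\<^sup>2)"
    and cf: "(\<lambda>n. \<integral>x. (fn n x - f x)\<^sup>2 \<partial>M) \<longlonglongrightarrow> 0"
    and cg: "(\<lambda>n. \<integral>x. (gn n x - g x)\<^sup>2 \<partial>M) \<longlonglongrightarrow> 0"
  shows "(\<lambda>n. \<integral>x. fn n x * gn n x \<partial>M) \<longlonglongrightarrow> (\<integral>x. f x * g x \<partial>M)"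
proof -
  have prod: "integrable M (\<lambda>x. a x * b x)"
    if [measurable]: "a \<in> borel_measurable M" "b \<in> borel_measurable M"
      and "integrable M (\<lambda>x. (a x)\<^sup>2)" "integrable M (\<lambda>x. (b x)\<^sup>2)" for a b :: "'b \<Rightarrow> real"
  proof (rule Bochner_Integration.integrable_bound)
    show "integrable M (\<lambda>x. (a x)\<^sup>2 + (b x)\<^sup>2)" using that by simp
    have "\<bar>u * v\<bar> \<le> u\<^sup>2 + v\<^sup>2" for u v :: real
      using zero_le_power2[of "\<bar>u\<bar> - \<bar>v\<bar>"] zero_le_power2[of u] zero_le_power2[of v]
        mult_nonneg_nonneg[of "\<bar>u\<bar>" "\<bar>v\<bar>"]
      by (simp only: power2_diff abs_mult power2_abs)
    then show "AE x in M. norm (a x * b x) \<le> norm ((a x)\<^sup>2 + (b x)\<^sup>2)" by simp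
  qed measurable
  have sqd: "integrable M (\<lambda>x. (a x - b x)\<^sup>2)"
    if [measurable]: "a \<in> borel_measurable M" "b \<in> borel_measurable M"
      and "integrable M (\<lambda>x. (a x)\<^sup>2)" "integrable M (\<lambda>x. (b x)\<^sup>2)" for a b :: "'b \<Rightarrow> real"
    unfolding power2_diff mult.assoc using prod[OF that] that by simp
  \<comment> \<open>Cauchy--Schwarz in weighted form. The free weight \<open>\<eta>\<close> first
    makes the share of the fixed factor small; the vanishing factor is then beaten by taking n
    large.\<close>
  have cs: "\<bar>\<integral>x. a x * b x \<partial>M\<bar> \<le> \<eta> / 2 * (\<integral>x. (a x)\<^sup>2 \<partial>M) + 1 / (2 * \<eta>) * (\<integral>x. (b x)\<^sup>2 \<partial>M)"
    if m: "a \<in> borel_measurable M" "b \<in> borel_measurable M"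
      and i: "integrable M (\<lambda>x. (a x)\<^sup>2)" "integrable M (\<lambda>x. (b x)\<^sup>2)" and "0 < \<eta>" for a b :: "'b \<Rightarrow> real" and \<eta>
  proof -
    have pt: "\<bar>u * v\<bar> \<le> \<eta> / 2 * u\<^sup>2 + 1 / (2 * \<eta>) * v\<^sup>2" for u v :: real
    proof -
      have "0 \<le> (\<eta> * \<bar>u\<bar> - \<bar>v\<bar>)\<^sup>2 / (2 * \<eta>)" using \<open>0 < \<eta>\<close> by simp
      also have "\<dots> = \<eta> / 2 * u\<^sup>2 + 1 / (2 * \<eta>) * v\<^sup>2 - \<bar>u * v\<bar>"
        using \<open>0 < \<eta>\<close> by (simp add: power2_diff power_mult_distrib abs_mult field_simps power2_eq_square)
      finally show ?thesis by simp
    qed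
    have "\<bar>\<integral>x. a x * b x \<partial>M\<bar> \<le> (\<integral>x. \<bar>a x * b x\<bar> \<partial>M)"
      by (rule integral_abs_bound)
    also have "\<dots> \<le> (\<integral>x. \<eta> / 2 * (a x)\<^sup>2 + 1 / (2 * \<eta>) * (b x)\<^sup>2 \<partial>M)"
      using prod[OF m i] i by (intro integral_mono pt) auto
    also have "\<dots> = \<eta> / 2 * (\<integral>x. (a x)\<^sup>2 \<partial>M) + 1 / (2 * \<eta>) * (\<integral>x. (b x)\<^sup>2 \<partial>M)"
      using i by simp
    finally show ?thesis .
  qed
  have lim0: "(\<lambda>n. \<integral>x. a x * (bn n x - b x) \<partial>M) \<longlonglongrightarrow> 0"
    if m: "a \<in> borel_measurable M" "b \<in> borel_measurable M" "\<And>n. bn n \<in> borel_measurable M"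
      and i: "integrable M (\<lambda>x. (a x)\<^sup>2)" "integrable M (\<lambda>x. (b x)\<^sup>2)" "\<And>n. integrable M (\<lambda>x. (bn n x)\<^sup>2)"
      and c: "(\<lambda>n. \<integral>x. (bn n x - b x)\<^sup>2 \<partial>M) \<longlonglongrightarrow> 0"
    for a b :: "'b \<Rightarrow> real" and bn :: "nat \<Rightarrow> 'b \<Rightarrow> real"
  proof (rule LIMSEQ_I)
    fix r :: real assume "0 < r"
    define A where "A = (\<integral>x. (a x)\<^sup>2 \<partial>M)"
    have A0: "0 \<le> A" by (simp add: A_def)
    define \<eta> where "\<eta> = r / (A + 1)"
    have \<eta>: "0 < \<eta>" using \<open>0 < r\<close> A0 by (simp add: \<eta>_def)
    have "0 < r * \<eta>" using \<eta> \<open>0 < r\<close> by simp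
    from LIMSEQ_D[OF c this] obtain n0 where n0: "\<And>n. n0 \<le> n \<Longrightarrow> (\<integral>x. (bn n x - b x)\<^sup>2 \<partial>M) < r * \<eta>"
      by auto
    show "\<exists>n0. \<forall>n\<ge>n0. norm ((\<integral>x. a x * (bn n x - b x) \<partial>M) - 0) < r"
    proof (intro exI allI impI)
      fix n assume "n0 \<le> n"
      have "\<bar>\<integral>x. a x * (bn n x - b x) \<partial>M\<bar> \<le> \<eta> / 2 * A + 1 / (2 * \<eta>) * (\<integral>x. (bn n x - b x)\<^sup>2 \<partial>M)"
        unfolding A_def using m i \<eta> by (intro cs sqd) auto
      also have "\<dots> < \<eta> / 2 * A + 1 / (2 * \<eta>) * (r * \<eta>)"
        using n0[OF \<open>n0 \<le> n\<close>] \<eta> by (intro add_strict_left_mono mult_strict_left_mono) auto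
      also have "\<dots> = \<eta> * A / 2 + r / 2" using \<eta> by simp
      also have "\<dots> \<le> r"
      proof -
        have "\<eta> * A \<le> r" unfolding \<eta>_def using A0 \<open>0 < r\<close> by (simp add: field_simps)
        then show ?thesis by simp
      qed
      finally show "norm ((\<integral>x. a x * (bn n x - b x) \<partial>M) - 0) < r" by simp
    qed
  qed
  have lim1: "(\<lambda>n. \<integral>x. (fn n x - f x) * (gn n x - g x) \<partial>M) \<longlonglongrightarrow> 0"
  proof (rule Lim_null_comparison)
    show "(\<lambda>n. 1 / 2 * (\<integral>x. (fn n x - f x)\<^sup>2 \<partial>M) + 1 / (2 * 1) * (\<integral>x. (gn n x - g x)\<^sup>2 \<partial>M)) \<longlonglongrightarrow> 0"
      using tendsto_add[OF tendsto_mult_right_zero[OF cf, of "1/2"] tendsto_mult_right_zero[OF cg, of "1/2"]]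
      by simp
    show "\<forall>\<^sub>F n in sequentially. norm (\<integral>x. (fn n x - f x) * (gn n x - g x) \<partial>M) \<le>
        1 / 2 * (\<integral>x. (fn n x - f x)\<^sup>2 \<partial>M) + 1 / (2 * 1) * (\<integral>x. (gn n x - g x)\<^sup>2 \<partial>M)"
      unfolding real_norm_def using f g fn gn by (intro always_eventually allI cs sqd) auto
  qed
  have "(\<integral>x. fn n x * gn n x \<partial>M) = (\<integral>x. (fn n x - f x) * (gn n x - g x) \<partial>M)
      + (\<integral>x. f x * (gn n x - g x) \<partial>M) + (\<integral>x. g x * (fn n x - f x) \<partial>M) + (\<integral>x. f x * g x \<partial>M)" for n
  proof -
    have i: "integrable M (\<lambda>x. (fn n x - f x) * (gn n x - g x))"
      "integrable M (\<lambda>x. f x * (gn n x - g x))" "integrable M (\<lambda>x. g x * (fn n x - f x))"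
      "integrable M (\<lambda>x. f x * g x)"
      using f g fn gn by (auto intro!: prod sqd)
    have "(\<integral>x. fn n x * gn n x \<partial>M) = (\<integral>x. (fn n x - f x) * (gn n x - g x) + f x * (gn n x - g x)
        + g x * (fn n x - f x) + f x * g x \<partial>M)"
      by (intro Bochner_Integration.integral_cong) (auto simp: algebra_simps)
    then show ?thesis using i by simp
  qed
  moreover have "(\<lambda>n. (\<integral>x. (fn n x - f x) * (gn n x - g x) \<partial>M)
      + (\<integral>x. f x * (gn n x - g x) \<partial>M) + (\<integral>x. g x * (fn n x - f x) \<partial>M) + (\<integral>x. f x * g x \<partial>M))
      \<longlonglongrightarrow> 0 + 0 + 0 + (\<integral>x. f x * g x \<partial>M)"
    by (intro tendsto_add lim1 lim0 tendsto_const) (use f g fn gn cf cg in auto)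
  ultimately show ?thesis by simp
qed

section \<open>Calculus of mean-square convergence\<close>

lemma L2_tendsto_add:
  assumes [measurable]: "\<And>i. f i \<in> borel_measurable M" "\<And>i. g i \<in> borel_measurable M"
      "f0 \<in> borel_measurable M" "g0 \<in> borel_measurable M"
    and f: "L2_tendsto M f f0 F" and g: "L2_tendsto M g g0 F"
  shows "L2_tendsto M (\<lambda>i x. f i x + g i x) (\<lambda>x. f0 x + g0 x) F"
  unfolding L2_tendsto_def
proof (rule tendsto_sandwich[OF always_eventually always_eventually])
  show "\<forall>i. (0::ennreal) \<le> (\<integral>\<^sup>+x. ennreal ((f i x + g i x - (f0 x + g0 x))\<^sup>2) \<partial>M)" by simp
  show "\<forall>i. (\<integral>\<^sup>+x. ennreal ((f i x + g i x - (f0 x + g0 x))\<^sup>2) \<partial>M) \<le>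
      2 * (\<integral>\<^sup>+x. ennreal ((f i x - f0 x)\<^sup>2) \<partial>M) + 2 * (\<integral>\<^sup>+x. ennreal ((g i x - g0 x)\<^sup>2) \<partial>M)"
  proof
    fix i
    have "(u + v - (u0 + v0))\<^sup>2 \<le> 2 * (u - u0)\<^sup>2 + 2 * (v - v0)\<^sup>2" for u v u0 v0 :: real
      using zero_le_power2[of "(u - u0) - (v - v0)"] by (simp add: power2_eq_square algebra_simps)
    then have "ennreal ((u + v - (u0 + v0))\<^sup>2) \<le> ennreal (2 * (u - u0)\<^sup>2 + 2 * (v - v0)\<^sup>2)" for u v u0 v0 :: real
      by (rule ennreal_leI)
    also have "ennreal (2 * a + 2 * b) = 2 * ennreal a + 2 * ennreal b" if "0 \<le> a" "0 \<le> b" for a b :: real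
      using that by (simp add: ennreal_mult')
    finally have "(\<integral>\<^sup>+x. ennreal ((f i x + g i x - (f0 x + g0 x))\<^sup>2) \<partial>M) \<le>
        (\<integral>\<^sup>+x. 2 * ennreal ((f i x - f0 x)\<^sup>2) + 2 * ennreal ((g i x - g0 x)\<^sup>2) \<partial>M)"
      by (intro nn_integral_mono) simp
    also have "\<dots> = 2 * (\<integral>\<^sup>+x. ennreal ((f i x - f0 x)\<^sup>2) \<partial>M) + 2 * (\<integral>\<^sup>+x. ennreal ((g i x - g0 x)\<^sup>2) \<partial>M)"
      by (simp add: nn_integral_add nn_integral_cmult)
    finally show "(\<integral>\<^sup>+x. ennreal ((f i x + g i x - (f0 x + g0 x))\<^sup>2) \<partial>M) \<le>
      2 * (\<integral>\<^sup>+x. ennreal ((f i x - f0 x)\<^sup>2) \<partial>M) + 2 * (\<integral>\<^sup>+x. ennreal ((g i x - g0 x)\<^sup>2) \<partial>M)" .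
  qed
  have "((\<lambda>i. 2 * (\<integral>\<^sup>+x. ennreal ((f i x - f0 x)\<^sup>2) \<partial>M) + 2 * (\<integral>\<^sup>+x. ennreal ((g i x - g0 x)\<^sup>2) \<partial>M)) \<longlongrightarrow> 2 * 0 + 2 * 0) F"
    using f g unfolding L2_tendsto_def
    by (intro tendsto_add ennreal_tendsto_cmult) auto
  then show "((\<lambda>i. 2 * (\<integral>\<^sup>+x. ennreal ((f i x - f0 x)\<^sup>2) \<partial>M) + 2 * (\<integral>\<^sup>+x. ennreal ((g i x - g0 x)\<^sup>2) \<partial>M)) \<longlongrightarrow> 0) F"
    by simp
qed simp

lemma L2_tendsto_cmult:
  assumes [measurable]: "\<And>i. f i \<in> borel_measurable M" "f0 \<in> borel_measurable M"
    and f: "L2_tendsto M f f0 F"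
  shows "L2_tendsto M (\<lambda>i x. c * f i x) (\<lambda>x. c * f0 x) F"
proof -
  have "(\<integral>\<^sup>+x. ennreal ((c * f i x - c * f0 x)\<^sup>2) \<partial>M) = ennreal (c\<^sup>2) * (\<integral>\<^sup>+x. ennreal ((f i x - f0 x)\<^sup>2) \<partial>M)" for i
    unfolding right_diff_distrib[symmetric] power_mult_distrib
    by (simp add: ennreal_mult' nn_integral_cmult)
  moreover have "((\<lambda>i. ennreal (c\<^sup>2) * (\<integral>\<^sup>+x. ennreal ((f i x - f0 x)\<^sup>2) \<partial>M)) \<longlongrightarrow> ennreal (c\<^sup>2) * 0) F"
    using f unfolding L2_tendsto_def by (intro ennreal_tendsto_cmult) auto
  ultimately show ?thesis
    by (simp add: L2_tendsto_def)
qed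

lemma L2_tendsto_diff:
  assumes [measurable]: "\<And>i. f i \<in> borel_measurable M" "\<And>i. g i \<in> borel_measurable M"
      "f0 \<in> borel_measurable M" "g0 \<in> borel_measurable M"
    and f: "L2_tendsto M f f0 F" and g: "L2_tendsto M g g0 F"
  shows "L2_tendsto M (\<lambda>i x. f i x - g i x) (\<lambda>x. f0 x - g0 x) F"
  using L2_tendsto_add[OF _ _ _ _ f L2_tendsto_cmult[OF _ _ g, of "-1"]] by simp

lemma L2_tendsto_sum:
  assumes "\<And>i j. j \<in> A \<Longrightarrow> f j i \<in> borel_measurable M" "\<And>j. j \<in> A \<Longrightarrow> f0 j \<in> borel_measurable M"
    and "\<And>j. j \<in> A \<Longrightarrow> L2_tendsto M (f j) (f0 j) F" and "finite A"
  shows "L2_tendsto M (\<lambda>i x. \<Sum>j\<in>A. f j i x) (\<lambda>x. \<Sum>j\<in>A. f0 j x) F"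
  using assms(4,1-3)
proof (induction A)
  case empty
  then show ?case by (simp add: L2_tendsto_def)
next
  case (insert j A)
  then show ?case by (simp, intro L2_tendsto_add) auto
qed

lemma L2_tendsto_imp_integral:
  assumes [measurable]: "\<And>i. f i \<in> borel_measurable M" "f0 \<in> borel_measurable M"
    and f: "L2_tendsto M f f0 F"
  shows "((\<lambda>i. \<integral>x. (f i x - f0 x)\<^sup>2 \<partial>M) \<longlongrightarrow> 0) F"
proof -
  have "((\<lambda>i. enn2real (\<integral>\<^sup>+x. ennreal ((f i x - f0 x)\<^sup>2) \<partial>M)) \<longlongrightarrow> 0) F"
    using f unfolding L2_tendsto_def by (intro tendsto_enn2real) auto
  then show ?thesis
    by (simp add: integral_eq_nn_integral)
qed

text \<open>The definition of the integral lives on [0, t]. The approximating step functions vanish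
  outside, so the convergence can be restated on the whole line, where integrands of different
  horizons are comparable.\<close>

lemma wiener_integral_approximation:
  assumes I: "is_wiener_integral M w (\<lambda>s. exp (- lam * (t - s))) t I"
  shows "\<exists>ps. (\<forall>n. steps_nonneg (ps n)) \<and> L2_tendsto lborel (\<lambda>n. step_fun (ps n)) (ou_kernel lam t) sequentially
    \<and> L2_tendsto M (\<lambda>n. step_int w (ps n)) I sequentially"
proof -
  obtain ps where ps: "\<And>n. \<forall>(c, a, b)\<in>set (ps n). 0 \<le> a \<and> a \<le> b \<and> b \<le> t"
    "L2_tendsto (lebesgue_on {0..t}) (\<lambda>n. step_fun (ps n)) (\<lambda>s. exp (- lam * (t - s))) sequentially"
    "L2_tendsto M (\<lambda>n. step_int w (ps n)) I sequentially"
    using I unfolding is_wiener_integral_def by blast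
  have zero: "step_fun qs s = 0" if "\<forall>(c, a, b)\<in>set qs. 0 \<le> a \<and> a \<le> b \<and> b \<le> t" "s \<notin> {0..t}" for qs s
    using that by (induction qs) auto
  have "(\<integral>\<^sup>+s. ennreal ((step_fun (ps n) s - exp (- lam * (t - s)))\<^sup>2) \<partial>lebesgue_on {0..t}) =
      (\<integral>\<^sup>+s. ennreal ((step_fun (ps n) s - ou_kernel lam t s)\<^sup>2) \<partial>lborel)" for n
  proof -
    have "(\<integral>\<^sup>+s. ennreal ((step_fun (ps n) s - exp (- lam * (t - s)))\<^sup>2) \<partial>lebesgue_on {0..t}) =
        (\<integral>\<^sup>+s. ennreal ((step_fun (ps n) s - exp (- lam * (t - s)))\<^sup>2) * indicator {0..t} s \<partial>lebesgue)"
      by (rule nn_integral_restrict_space) simp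
    also have "\<dots> = (\<integral>\<^sup>+s. ennreal ((step_fun (ps n) s - exp (- lam * (t - s)))\<^sup>2) * indicator {0..t} s \<partial>lborel)"
      by (rule nn_integral_completion)
    also have "\<dots> = (\<integral>\<^sup>+s. ennreal ((step_fun (ps n) s - ou_kernel lam t s)\<^sup>2) \<partial>lborel)"
      by (intro nn_integral_cong) (auto simp: ou_kernel_def indicator_def zero[OF ps(1)])
    finally show ?thesis .
  qed
  then have "L2_tendsto lborel (\<lambda>n. step_fun (ps n)) (ou_kernel lam t) sequentially"
    using ps(2) by (simp add: L2_tendsto_def)
  moreover have "steps_nonneg (ps n)" for n
    using ps(1)[of n] by (force simp: steps_nonneg_def)
  ultimately show ?thesis using ps(3) by blast
qed

lemma borel_measurable_step_int:
  assumes "brownian_motion M w" "steps_nonneg ps"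
  shows "step_int w ps \<in> borel_measurable M"
  using assms(2)
proof (induction ps)
  case Nil
  have "step_int w [] = (\<lambda>\<omega>. 0)" by auto
  then show ?case by simp
next
  case (Cons p ps)
  obtain c a b where p: "p = (c, a, b)" by (cases p) auto
  have "step_int w (p # ps) = (\<lambda>\<omega>. c * (w b \<omega> - w a \<omega>) + step_int w ps \<omega>)" by (auto simp: p)
  moreover have "w a \<in> borel_measurable M" "w b \<in> borel_measurable M"
    using assms(1) Cons.prems by (auto simp: brownian_motion_def p)
  ultimately show ?case using Cons by (simp add: p)
qed

text \<open>\<open>G\<close> is the covariance; sums and differences are included so that polarization yields
  the mixed fourth moments without joint Gaussianity.\<close>

definition gaussian_family :: "'a measure \<Rightarrow> 'i set \<Rightarrow> ('i \<Rightarrow> 'a \<Rightarrow> real) \<Rightarrow> ('i \<Rightarrow> 'i \<Rightarrow> real) \<Rightarrow> bool" where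
  "gaussian_family M A b G \<longleftrightarrow> (\<forall>i\<in>A. gaussian_moments M (b i) (G i i)) \<and>
     (\<forall>i\<in>A. \<forall>j\<in>A. gaussian_moments M (\<lambda>\<omega>. b i \<omega> + b j \<omega>) (G i i + G j j + 2 * G i j)
       \<and> gaussian_moments M (\<lambda>\<omega>. b i \<omega> - b j \<omega>) (G i i + G j j - 2 * G i j))"

context prob_space
begin

text \<open>\<open>b i + c * b j\<close> is again a sum of step integrals, with codes scaled and
  appended. One computation with a general coefficient \<open>c\<close> therefore yields the three
  requirements, at c = 0, 1 and -1.\<close>

lemma gaussian_family_step_int:
  assumes B: "\<And>k l. (k, l) \<in> F \<Longrightarrow> brownian_motion M (w k l)"
    and ind: "indep_vars (\<lambda>_. PiM {0..} (\<lambda>_. borel)) (\<lambda>(k, l) \<omega>. \<lambda>t\<in>{0..}. w k l t \<omega>) F"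
    and "finite F" and d: "\<And>k l i. (k, l) \<in> F \<Longrightarrow> i \<in> A \<Longrightarrow> steps_nonneg (d k l i)"
  shows "gaussian_family M A (\<lambda>i \<omega>. \<Sum>(k, l)\<in>F. a k l * step_int (w k l) (d k l i) \<omega>)
    (\<lambda>i j. \<Sum>(k, l)\<in>F. (a k l)\<^sup>2 * (\<integral>s. step_fun (d k l i) s * step_fun (d k l j) s \<partial>lborel))"
proof -
  let ?b = "\<lambda>i \<omega>. \<Sum>(k, l)\<in>F. a k l * step_int (w k l) (d k l i) \<omega>"
  let ?G = "\<lambda>i j. \<Sum>(k, l)\<in>F. (a k l)\<^sup>2 * (\<integral>s. step_fun (d k l i) s * step_fun (d k l j) s \<partial>lborel)"
  have comb: "gaussian_moments M (\<lambda>\<omega>. ?b i \<omega> + c * ?b j \<omega>) (?G i i + c\<^sup>2 * ?G j j + 2 * c * ?G i j)"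
    if ij: "i \<in> A" "j \<in> A" for i j c
  proof -
    define e where "e k l = scale_steps (a k l) (d k l i) @ scale_steps (c * a k l) (d k l j)" for k l
    have "gaussian_moments M (\<lambda>\<omega>. \<Sum>(k, l)\<in>F. step_int (w k l) (e k l) \<omega>)
        (\<Sum>(k, l)\<in>F. \<integral>s. (step_fun (e k l) s)\<^sup>2 \<partial>lborel)"
      using d ij by (intro gaussian_moments_step_int_sum B ind \<open>finite F\<close>) (auto simp: e_def)
    moreover have "(\<Sum>(k, l)\<in>F. step_int (w k l) (e k l) \<omega>) = ?b i \<omega> + c * ?b j \<omega>" for \<omega>
      by (simp add: e_def case_prod_unfold sum.distrib sum_distrib_left mult.assoc)
    moreover have "(\<Sum>(k, l)\<in>F. \<integral>s. (step_fun (e k l) s)\<^sup>2 \<partial>lborel) = ?G i i + c\<^sup>2 * ?G j j + 2 * c * ?G i j"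
    proof -
      have "(\<integral>s. (step_fun (e k l) s)\<^sup>2 \<partial>lborel) =
          (a k l)\<^sup>2 * (\<integral>s. step_fun (d k l i) s * step_fun (d k l i) s \<partial>lborel)
          + c\<^sup>2 * ((a k l)\<^sup>2 * (\<integral>s. step_fun (d k l j) s * step_fun (d k l j) s \<partial>lborel))
          + 2 * c * ((a k l)\<^sup>2 * (\<integral>s. step_fun (d k l i) s * step_fun (d k l j) s \<partial>lborel))" for k l
      proof -
        have "(\<integral>s. (step_fun (e k l) s)\<^sup>2 \<partial>lborel) =
          (\<integral>s. (a k l)\<^sup>2 * (step_fun (d k l i) s * step_fun (d k l i) s)
            + c\<^sup>2 * ((a k l)\<^sup>2 * (step_fun (d k l j) s * step_fun (d k l j) s))
            + 2 * c * ((a k l)\<^sup>2 * (step_fun (d k l i) s * step_fun (d k l j) s)) \<partial>lborel)"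
          by (intro Bochner_Integration.integral_cong) (auto simp: e_def power2_eq_square algebra_simps)
        then show ?thesis
          by (simp add: step_fun_mult_integrable)
      qed
      then show ?thesis
        by (simp add: case_prod_unfold sum.distrib sum_distrib_left)
    qed
    ultimately show ?thesis by simp
  qed
  show ?thesis
    unfolding gaussian_family_def
  proof (intro conjI ballI)
    fix i assume "i \<in> A" then show "gaussian_moments M (?b i) (?G i i)"
      using comb[of i i 0] by simp
  next
    fix i j assume "i \<in> A" "j \<in> A"
    then show "gaussian_moments M (\<lambda>\<omega>. ?b i \<omega> + ?b j \<omega>) (?G i i + ?G j j + 2 * ?G i j)"
      "gaussian_moments M (\<lambda>\<omega>. ?b i \<omega> - ?b j \<omega>) (?G i i + ?G j j - 2 * ?G i j)"
      using comb[of i j 1] comb[of i j "-1"] by simp_all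
  qed
qed

text \<open>Mean-square convergence alone does not control fourth moments, so the Gaussian family is
  built from the step approximants, and the Wiener integrals are only required to be near in mean
  square. There are finitely many times and pairs of times, hence one approximation index serves all
  of them.\<close>

lemma noise_increment_approximation:
  fixes N :: nat
  assumes B: "\<And>k l. (k, l) \<in> F \<Longrightarrow> brownian_motion M (w k l)"
    and ind: "indep_vars (\<lambda>_. PiM {0..} (\<lambda>_. borel)) (\<lambda>(k, l) \<omega>. \<lambda>t\<in>{0..}. w k l t \<omega>) F"
    and "finite F" and lam: "\<And>k l. (k, l) \<in> F \<Longrightarrow> 0 < lam k l" and "0 < N" and "0 < \<tau>"
    and I: "\<And>k l i. (k, l) \<in> F \<Longrightarrow> i \<le> N \<Longrightarrow>
      is_wiener_integral M (w k l) (\<lambda>s. exp (- lam k l * (real i / real N - s))) (real i / real N) (I k l i)"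
  obtains b G where "gaussian_family M {1..N} b G"
    and "\<And>i j. i \<in> {1..N} \<Longrightarrow> j \<in> {1..N} \<Longrightarrow>
      \<bar>G i j - (\<Sum>(k, l)\<in>F. (a k l)\<^sup>2 * ou_gram (lam k l) N i j)\<bar> \<le> \<tau>"
    and "\<And>i. i \<in> {1..N} \<Longrightarrow>
      (\<integral>\<^sup>+\<omega>. ennreal ((b i \<omega> - (\<Sum>(k, l)\<in>F. a k l * (I k l i \<omega> - I k l (i - 1) \<omega>)))\<^sup>2) \<partial>M) \<le> ennreal \<tau>"
proof -
  define P where "P k l i qs \<longleftrightarrow> (\<forall>n. steps_nonneg (qs n)) \<and>
      L2_tendsto lborel (\<lambda>n. step_fun (qs n)) (ou_kernel (lam k l) (real i / real N)) sequentially \<and>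
      L2_tendsto M (\<lambda>n. step_int (w k l) (qs n)) (I k l i) sequentially" for k l i qs
  define ps where "ps k l i = (SOME qs. P k l i qs)" for k l i
  have "P k l i (ps k l i)" if "(k, l) \<in> F" "i \<le> N" for k l i
    unfolding ps_def using wiener_integral_approximation[OF I[OF that]]
    by (intro someI_ex[of "P k l i"]) (simp add: P_def)
  then have ps: "\<And>k l i n. (k, l) \<in> F \<Longrightarrow> i \<le> N \<Longrightarrow> steps_nonneg (ps k l i n)"
    "\<And>k l i. (k, l) \<in> F \<Longrightarrow> i \<le> N \<Longrightarrow>
      L2_tendsto lborel (\<lambda>n. step_fun (ps k l i n)) (ou_kernel (lam k l) (real i / real N)) sequentially"
    "\<And>k l i. (k, l) \<in> F \<Longrightarrow> i \<le> N \<Longrightarrow>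
      L2_tendsto M (\<lambda>n. step_int (w k l) (ps k l i n)) (I k l i) sequentially"
    by (simp_all add: P_def)
  have I_meas: "I k l i \<in> borel_measurable M" if "(k, l) \<in> F" "i \<le> N" for k l i
    using I[OF that] by (simp add: is_wiener_integral_def)
  \<comment> \<open>The code of an increment: the approximants at two neighbouring times, the
    earlier one with coefficient -1.\<close>
  define d where "d n k l i = ps k l i n @ scale_steps (-1) (ps k l (i - 1) n)" for n k l i
  have d_nn: "steps_nonneg (d n k l i)" if "(k, l) \<in> F" "i \<in> {1..N}" for n k l i
    using that ps(1) by (auto simp: d_def)
  define b where "b n i \<omega> = (\<Sum>(k, l)\<in>F. a k l * step_int (w k l) (d n k l i) \<omega>)" for n i \<omega>
  define G where "G n i j = (\<Sum>(k, l)\<in>F. (a k l)\<^sup>2 * (\<integral>s. step_fun (d n k l i) s * step_fun (d n k l j) s \<partial>lborel))" for n i j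
  have fam: "gaussian_family M {1..N} (b n) (G n)" for n
    unfolding b_def[abs_def] G_def[abs_def]
    by (rule gaussian_family_step_int) (use B ind \<open>finite F\<close> d_nn in auto)
  have "\<forall>\<^sub>F n in sequentially. \<forall>i\<in>{1..N}.
      (\<integral>\<^sup>+\<omega>. ennreal ((b n i \<omega> - (\<Sum>(k, l)\<in>F. a k l * (I k l i \<omega> - I k l (i - 1) \<omega>)))\<^sup>2) \<partial>M) < ennreal \<tau>"
  proof (rule eventually_ball_finite, simp, intro ballI)
    fix i assume i: "i \<in> {1..N}"
    have "L2_tendsto M (\<lambda>n \<omega>. \<Sum>p\<in>F. a (fst p) (snd p) * step_int (w (fst p) (snd p)) (d n (fst p) (snd p) i) \<omega>)
        (\<lambda>\<omega>. \<Sum>p\<in>F. a (fst p) (snd p) * (I (fst p) (snd p) i \<omega> - I (fst p) (snd p) (i - 1) \<omega>)) sequentially"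
    proof (rule L2_tendsto_sum)
      fix p assume "p \<in> F"
      then obtain k l where p: "p = (k, l)" "(k, l) \<in> F" by (cases p) auto
      have m: "step_int (w k l) (d n k l i) \<in> borel_measurable M" "I k l i \<in> borel_measurable M"
        "I k l (i - 1) \<in> borel_measurable M" "step_int (w k l) (ps k l i n) \<in> borel_measurable M"
        "step_int (w k l) (ps k l (i - 1) n) \<in> borel_measurable M" for n
        using p i d_nn ps(1) I_meas B by (auto intro!: borel_measurable_step_int)
      then show "(\<lambda>\<omega>. a (fst p) (snd p) * step_int (w (fst p) (snd p)) (d n (fst p) (snd p) i) \<omega>) \<in> borel_measurable M"
        "(\<lambda>\<omega>. a (fst p) (snd p) * (I (fst p) (snd p) i \<omega> - I (fst p) (snd p) (i - 1) \<omega>)) \<in> borel_measurable M" for n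
        by (auto simp: p)
      have "L2_tendsto M (\<lambda>n \<omega>. step_int (w k l) (ps k l i n) \<omega> - step_int (w k l) (ps k l (i - 1) n) \<omega>)
          (\<lambda>\<omega>. I k l i \<omega> - I k l (i - 1) \<omega>) sequentially"
        using p i m ps(3) by (intro L2_tendsto_diff) auto
      then have "L2_tendsto M (\<lambda>n \<omega>. a k l * (step_int (w k l) (ps k l i n) \<omega> - step_int (w k l) (ps k l (i - 1) n) \<omega>))
          (\<lambda>\<omega>. a k l * (I k l i \<omega> - I k l (i - 1) \<omega>)) sequentially"
        using m by (intro L2_tendsto_cmult) auto
      then show "L2_tendsto M (\<lambda>n \<omega>. a (fst p) (snd p) * step_int (w (fst p) (snd p)) (d n (fst p) (snd p) i) \<omega>)
        (\<lambda>\<omega>. a (fst p) (snd p) * (I (fst p) (snd p) i \<omega> - I (fst p) (snd p) (i - 1) \<omega>)) sequentially"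
        by (simp add: p d_def)
    qed (rule \<open>finite F\<close>)
    then show "\<forall>\<^sub>F n in sequentially.
      (\<integral>\<^sup>+\<omega>. ennreal ((b n i \<omega> - (\<Sum>(k, l)\<in>F. a k l * (I k l i \<omega> - I k l (i - 1) \<omega>)))\<^sup>2) \<partial>M) < ennreal \<tau>"
      unfolding L2_tendsto_def b_def case_prod_unfold
      by (rule order_tendstoD(2)) (use \<open>0 < \<tau>\<close> in simp)
  qed
  moreover have "\<forall>\<^sub>F n in sequentially. \<forall>i\<in>{1..N}. \<forall>j\<in>{1..N}.
      \<bar>G n i j - (\<Sum>(k, l)\<in>F. (a k l)\<^sup>2 * ou_gram (lam k l) N i j)\<bar> < \<tau>"
  proof (rule eventually_ball_finite, simp, intro ballI, rule eventually_ball_finite, simp, intro ballI)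
    fix i j assume ij: "i \<in> {1..N}" "j \<in> {1..N}"
    have "(\<lambda>n. \<integral>s. step_fun (d n k l i) s * step_fun (d n k l j) s \<partial>lborel) \<longlonglongrightarrow> ou_gram (lam k l) N i j"
      if kl: "(k, l) \<in> F" for k l
    proof -
      have [measurable]: "ou_increment (lam k l) N i' \<in> borel_measurable borel" for i'
        unfolding ou_increment_def[abs_def] by measurable
      have L2: "(\<lambda>n. \<integral>s. (step_fun (d n k l i) s - ou_increment (lam k l) N i s)\<^sup>2 \<partial>lborel) \<longlonglongrightarrow> 0"
        if "i \<in> {1..N}" for i
      proof (rule L2_tendsto_imp_integral)
        have "L2_tendsto lborel (\<lambda>n s. step_fun (ps k l i n) s - step_fun (ps k l (i - 1) n) s)
            (\<lambda>s. ou_kernel (lam k l) (real i / real N) s - ou_kernel (lam k l) (real (i - 1) / real N) s) sequentially"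
          using that by (intro L2_tendsto_diff ps(2)[OF kl]) auto
        then show "L2_tendsto lborel (\<lambda>n. step_fun (d n k l i)) (ou_increment (lam k l) N i) sequentially"
          by (simp add: L2_tendsto_def d_def ou_increment_def)
      qed auto
      show ?thesis
        unfolding ou_gram_def
        by (rule tendsto_integral_mult)
           (use L2 ij step_fun_mult_integrable ou_increment_integrable[OF lam[OF kl] \<open>0 < N\<close> refl]
            in \<open>auto simp: power2_eq_square\<close>)
    qed
    then have "(\<lambda>n. \<Sum>(k, l)\<in>F. (a k l)\<^sup>2 * (\<integral>s. step_fun (d n k l i) s * step_fun (d n k l j) s \<partial>lborel))
        \<longlonglongrightarrow> (\<Sum>(k, l)\<in>F. (a k l)\<^sup>2 * ou_gram (lam k l) N i j)"
      unfolding case_prod_unfold by (intro tendsto_sum tendsto_mult tendsto_const) auto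
    then have "(\<lambda>n. G n i j) \<longlonglongrightarrow> (\<Sum>(k, l)\<in>F. (a k l)\<^sup>2 * ou_gram (lam k l) N i j)"
      by (simp add: G_def)
    from tendstoD[OF this \<open>0 < \<tau>\<close>]
    show "\<forall>\<^sub>F n in sequentially. \<bar>G n i j - (\<Sum>(k, l)\<in>F. (a k l)\<^sup>2 * ou_gram (lam k l) N i j)\<bar> < \<tau>"
      by (simp add: dist_real_def)
  qed
  ultimately have "\<forall>\<^sub>F n in sequentially.
      (\<forall>i\<in>{1..N}. (\<integral>\<^sup>+\<omega>. ennreal ((b n i \<omega> - (\<Sum>(k, l)\<in>F. a k l * (I k l i \<omega> - I k l (i - 1) \<omega>)))\<^sup>2) \<partial>M) < ennreal \<tau>) \<and>
      (\<forall>i\<in>{1..N}. \<forall>j\<in>{1..N}. \<bar>G n i j - (\<Sum>(k, l)\<in>F. (a k l)\<^sup>2 * ou_gram (lam k l) N i j)\<bar> < \<tau>)"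
    by (rule eventually_conj)
  then obtain n where n: "\<forall>i\<in>{1..N}. (\<integral>\<^sup>+\<omega>. ennreal ((b n i \<omega> - (\<Sum>(k, l)\<in>F. a k l * (I k l i \<omega> - I k l (i - 1) \<omega>)))\<^sup>2) \<partial>M) < ennreal \<tau>"
      "\<forall>i\<in>{1..N}. \<forall>j\<in>{1..N}. \<bar>G n i j - (\<Sum>(k, l)\<in>F. (a k l)\<^sup>2 * ou_gram (lam k l) N i j)\<bar> < \<tau>"
    using eventually_happens'[OF sequentially_bot] by blast
  show ?thesis
    by (rule that[OF fam[of n]]) (use n in \<open>auto intro: less_imp_le\<close>)
qed

end

section \<open>Realized volatility\<close>

text \<open>Z = A + 2 K + B with the cross term K. Cauchy--Schwarz gives K^2 \<le> A B, and B = g +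
  (B - g) leaves the term g A. Thus \<open>A\<close> enters linearly as well as squared, and its
  smallness in mean already has to match the squared rate.\<close>

lemma square_sum_perturbation:
  fixes r b :: "'i \<Rightarrow> real" and \<nu> g :: real and I :: "'i set"
  defines "Z \<equiv> \<nu> * (\<Sum>i\<in>I. (r i + b i)\<^sup>2)" and "A \<equiv> \<nu> * (\<Sum>i\<in>I. (r i)\<^sup>2)" and "B \<equiv> \<nu> * (\<Sum>i\<in>I. (b i)\<^sup>2)"
  shows "(Z - g)\<^sup>2 \<le> 9 * A\<^sup>2 + 12 * (g * A) + 9 * (B - g)\<^sup>2"
proof -
  define K where "K = \<nu> * (\<Sum>i\<in>I. r i * b i)"
  have "(\<Sum>i\<in>I. r i * b i)\<^sup>2 \<le> (\<Sum>i\<in>I. (r i)\<^sup>2) * (\<Sum>i\<in>I. (b i)\<^sup>2)"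
    by (rule Cauchy_Schwarz_ineq_sum)
  then have "K\<^sup>2 \<le> A * B"
  proof -
    assume "(\<Sum>i\<in>I. r i * b i)\<^sup>2 \<le> (\<Sum>i\<in>I. (r i)\<^sup>2) * (\<Sum>i\<in>I. (b i)\<^sup>2)"
    then have "\<nu>\<^sup>2 * (\<Sum>i\<in>I. r i * b i)\<^sup>2 \<le> \<nu>\<^sup>2 * ((\<Sum>i\<in>I. (r i)\<^sup>2) * (\<Sum>i\<in>I. (b i)\<^sup>2))"
      by (rule mult_left_mono) simp
    then show ?thesis
      unfolding K_def A_def B_def power_mult_distrib power2_eq_square[of \<nu>] by (simp only: mult_ac)
  qed
  also have "A * B = A * g + A * (B - g)" by (simp add: algebra_simps)
  also have "A * (B - g) \<le> A\<^sup>2 / 2 + (B - g)\<^sup>2 / 2"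
  proof -
    have "u * v \<le> u\<^sup>2 / 2 + v\<^sup>2 / 2" for u v :: real
      using zero_le_power2[of "u - v"] unfolding power2_diff by linarith
    then show ?thesis .
  qed
  finally have K: "K\<^sup>2 \<le> g * A + A\<^sup>2 / 2 + (B - g)\<^sup>2 / 2" by (simp add: mult.commute)
  have "Z = A + 2 * K + B"
    unfolding Z_def A_def B_def K_def power2_sum sum.distrib
    by (simp add: sum_distrib_left[of 2, symmetric] mult.assoc distrib_left)
  then have "(Z - g)\<^sup>2 = (A + 2 * K + (B - g))\<^sup>2" by (simp add: algebra_simps)
  also have "\<dots> \<le> 3 * (A\<^sup>2 + (2 * K)\<^sup>2 + (B - g)\<^sup>2)"
  proof -
    have "(x + y + z)\<^sup>2 \<le> 3 * (x\<^sup>2 + y\<^sup>2 + z\<^sup>2)" for x y z :: real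
      using zero_le_power2[of "x - y"] zero_le_power2[of "y - z"] zero_le_power2[of "x - z"]
      by (simp add: power2_eq_square algebra_simps)
    then show ?thesis .
  qed
  also have "\<dots> = 3 * A\<^sup>2 + 12 * K\<^sup>2 + 3 * (B - g)\<^sup>2" by (simp add: power_mult_distrib)
  finally show ?thesis using K by linarith
qed

declare eigval.simps [simp del]

text \<open>\<open>\<xi>_bound\<close> is the common consequence of the two alternative conditions on the initial
  value; nothing else about \<open>\<xi>\<close> enters the limit.\<close>

locale spde_field = prob_space M for M :: "'a measure" +
  fixes \<alpha> \<theta>0 \<theta>1 \<eta>1 \<theta>2 \<sigma> \<mu>0 C\<xi> :: real
    and w :: "nat \<Rightarrow> nat \<Rightarrow> real \<Rightarrow> 'a \<Rightarrow> real" and \<xi>c :: "nat \<Rightarrow> nat \<Rightarrow> 'a \<Rightarrow> real"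
    and x I :: "nat \<Rightarrow> nat \<Rightarrow> real \<Rightarrow> 'a \<Rightarrow> real" and X :: "real \<Rightarrow> real \<times> real \<Rightarrow> 'a \<Rightarrow> real"
  assumes \<alpha>: "0 < \<alpha>" "\<alpha> < 1" and \<theta>2: "0 < \<theta>2" and \<sigma>: "0 < \<sigma>"
    and lam11: "0 < eigval (\<theta>0, \<theta>1, \<eta>1, \<theta>2) 1 1" and \<mu>0: "- 2 * pi\<^sup>2 < \<mu>0"
    and w: "\<And>k l. 1 \<le> k \<Longrightarrow> 1 \<le> l \<Longrightarrow> brownian_motion M (w k l)"
    and w_indep: "indep_vars (\<lambda>_. PiM {0..} (\<lambda>_. borel)) (\<lambda>(k, l) \<omega>. \<lambda>t\<in>{0..}. w k l t \<omega>) indices"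
    and X_meas: "\<And>t p. t \<in> {0..1} \<Longrightarrow> p \<in> unit_square \<Longrightarrow> X t p \<in> borel_measurable M"
    and X_series: "\<And>t p. t \<in> {0..1} \<Longrightarrow> p \<in> unit_square \<Longrightarrow>
      L2_tendsto M (\<lambda>F \<omega>. \<Sum>(k, l)\<in>F. x k l t \<omega> * eigfun (\<theta>0, \<theta>1, \<eta>1, \<theta>2) k l p) (X t p) (finite_subsets_at_top indices)"
    and x_eq: "\<And>k l t \<omega>. 1 \<le> k \<Longrightarrow> 1 \<le> l \<Longrightarrow> t \<in> {0..1} \<Longrightarrow> \<omega> \<in> space M \<Longrightarrow>
      x k l t \<omega> = exp (- eigval (\<theta>0, \<theta>1, \<eta>1, \<theta>2) k l * t) * \<xi>c k l \<omega>
        + \<sigma> * noise_eigval \<mu>0 k l powr (- \<alpha> / 2) * I k l t \<omega>"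
    and I_wiener: "\<And>k l t. 1 \<le> k \<Longrightarrow> 1 \<le> l \<Longrightarrow> t \<in> {0..1} \<Longrightarrow>
      is_wiener_integral M (w k l) (\<lambda>s. exp (- eigval (\<theta>0, \<theta>1, \<eta>1, \<theta>2) k l * (t - s))) t (I k l t)"
    and \<xi>_meas: "\<And>k l. 1 \<le> k \<Longrightarrow> 1 \<le> l \<Longrightarrow> \<xi>c k l \<in> borel_measurable M"
    and C\<xi>: "0 \<le> C\<xi>"
    and \<xi>_bound: "\<And>F d. finite F \<Longrightarrow> F \<subseteq> indices \<Longrightarrow>
      (\<integral>\<^sup>+\<omega>. ennreal ((\<Sum>(k, l)\<in>F. d k l * \<xi>c k l \<omega>)\<^sup>2) \<partial>M) \<le>
      ennreal (C\<xi> * (\<Sum>(k, l)\<in>F. eigval (\<theta>0, \<theta>1, \<eta>1, \<theta>2) k l powr (- 1 - \<alpha>) * (d k l)\<^sup>2))"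
begin

abbreviation "\<theta> \<equiv> (\<theta>0, \<theta>1, \<eta>1, \<theta>2)"
abbreviation "lam \<equiv> eigval \<theta>"

sublocale spectrum \<theta>2 "- \<theta>0 + (\<theta>1\<^sup>2 + \<eta>1\<^sup>2) / (4 * \<theta>2)" \<mu>0 \<alpha> lam
proof
  show "0 < - \<theta>0 + (\<theta>1\<^sup>2 + \<eta>1\<^sup>2) / (4 * \<theta>2) + 2 * (pi\<^sup>2 * \<theta>2)"
    using lam11 by (simp add: eigval.simps mult_ac)
qed (use \<alpha> \<theta>2 \<mu>0 in \<open>auto simp: eigval.simps\<close>)

text \<open>The square of the exponential factor of the eigenfunctions, which becomes the
  exponential part of the fitted surface at the true parameters.\<close>

definition damping :: "real \<times> real \<Rightarrow> real" where
  "damping p = exp (- (\<theta>1 / \<theta>2 * fst p + \<eta>1 / \<theta>2 * snd p))"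

definition damping_max :: real where "damping_max = exp (\<bar>\<theta>1 / \<theta>2\<bar> + \<bar>\<eta>1 / \<theta>2\<bar>)"

definition limit_vol :: "real \<times> real \<Rightarrow> real" where
  "limit_vol p = Gamma (1 - \<alpha>) / (4 * pi * \<alpha>) * (\<sigma>\<^sup>2 / \<theta>2 powr (1 - \<alpha>)) * damping p"

definition modes :: "real \<times> real \<Rightarrow> nat \<Rightarrow> nat \<Rightarrow> real" where
  "modes p k l = 4 * (sin (pi * real k * fst p))\<^sup>2 * (sin (pi * real l * snd p))\<^sup>2"

lemma eigfun_square: "(eigfun \<theta> k l p)\<^sup>2 = modes p k l * damping p"
proof -
  have "exp (- (\<theta>1 / (2 * \<theta>2)) * fst p) * exp (- (\<theta>1 / (2 * \<theta>2)) * fst p) *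
      (exp (- (\<eta>1 / (2 * \<theta>2)) * snd p) * exp (- (\<eta>1 / (2 * \<theta>2)) * snd p)) = damping p"
    unfolding damping_def exp_add[symmetric] using \<theta>2 by (simp add: field_simps)
  then show ?thesis
    by (cases p) (simp add: modes_def power2_eq_square mult_ac)
qed

lemma modes_bounds: "0 \<le> modes p k l" "modes p k l \<le> 4"
proof -
  have "(sin (pi * real k * fst p))\<^sup>2 * (sin (pi * real l * snd p))\<^sup>2 \<le> 1"
    by (intro mult_le_one) (auto simp: abs_square_le_1)
  then show "0 \<le> modes p k l" "modes p k l \<le> 4" by (auto simp: modes_def)
qed

lemma damping_bounds:
  assumes "p \<in> unit_square"
  shows "0 < damping p" "damping p \<le> damping_max"
proof -
  have "- (c * y) \<le> \<bar>c\<bar>" if "0 \<le> y" "y \<le> 1" for c y :: real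
  proof -
    have "\<bar>c * y\<bar> \<le> \<bar>c\<bar>" using that by (simp add: abs_mult mult_left_le)
    then show ?thesis by linarith
  qed
  note * = this
  have "0 \<le> fst p" "fst p \<le> 1" "0 \<le> snd p" "snd p \<le> 1"
    using assms by (auto simp: mem_Times_iff)
  from *[OF this(1,2), of "\<theta>1 / \<theta>2"] *[OF this(3,4), of "\<eta>1 / \<theta>2"]
  have "- (\<theta>1 / \<theta>2 * fst p + \<eta>1 / \<theta>2 * snd p) \<le> \<bar>\<theta>1 / \<theta>2\<bar> + \<bar>\<eta>1 / \<theta>2\<bar>"
    by linarith
  then show "damping p \<le> damping_max" by (simp only: damping_def damping_max_def exp_le_cancel_iff)
qed (simp add: damping_def)

lemma eigfun_square_le:
  assumes "p \<in> unit_square"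
  shows "(eigfun \<theta> k l p)\<^sup>2 \<le> 4 * damping_max"
  unfolding eigfun_square using modes_bounds[of p k l] damping_bounds[OF assms]
  by (intro mult_mono) auto

lemma limit_vol_bounds:
  assumes "p \<in> unit_square"
  shows "0 \<le> limit_vol p" "limit_vol p \<le> Gamma (1 - \<alpha>) / (4 * pi * \<alpha>) * (\<sigma>\<^sup>2 / \<theta>2 powr (1 - \<alpha>)) * damping_max"
proof -
  have c: "0 \<le> Gamma (1 - \<alpha>) / (4 * pi * \<alpha>) * (\<sigma>\<^sup>2 / \<theta>2 powr (1 - \<alpha>))"
    using \<alpha> by (auto intro!: mult_nonneg_nonneg divide_nonneg_nonneg simp: Gamma_real_nonneg)
  show "0 \<le> limit_vol p"
    unfolding limit_vol_def by (rule mult_nonneg_nonneg[OF c less_imp_le[OF damping_bounds(1)[OF assms]]])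
  show "limit_vol p \<le> Gamma (1 - \<alpha>) / (4 * pi * \<alpha>) * (\<sigma>\<^sup>2 / \<theta>2 powr (1 - \<alpha>)) * damping_max"
    unfolding limit_vol_def using c damping_bounds(2)[OF assms] by (rule mult_left_mono[rotated])
qed

text \<open>\<open>m\<close> is the variance that an increment would have if every mode in
  \<open>F\<close> were stationary. The trace of the covariance misses \<open>N * m\<close> by at
  most \<open>m\<close> plus the tolerances, which governs the bias; the squared entries are bounded
  through absolute row sums, which governs the variance.\<close>

lemma noise_vol_moments:
  assumes fam: "gaussian_family M {1..N} b G" and "0 < N"
    and G: "\<And>i j. i \<in> {1..N} \<Longrightarrow> j \<in> {1..N} \<Longrightarrow>
      \<bar>G i j - (\<Sum>(k, l)\<in>F. (a k l)\<^sup>2 * ou_gram (lam k l) N i j)\<bar> \<le> \<tau>"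
    and F: "finite F" "F \<subseteq> indices"
  defines "m \<equiv> \<Sum>(k, l)\<in>F. (a k l)\<^sup>2 * ((1 - exp (- lam k l / real N)) / lam k l)"
  shows "integrable M (\<lambda>\<omega>. (\<nu> * (\<Sum>i=1..N. (b i \<omega>)\<^sup>2) - g)\<^sup>2)"
    and "(\<integral>\<omega>. (\<nu> * (\<Sum>i=1..N. (b i \<omega>)\<^sup>2) - g)\<^sup>2 \<partial>M) \<le>
      (\<bar>\<nu>\<bar> * (real N * \<tau> + m) + \<bar>\<nu> * (real N * m) - g\<bar>)\<^sup>2 + 4 * \<nu>\<^sup>2 * real N * (9 * m\<^sup>2 + real N * \<tau>\<^sup>2)"
proof -
  define \<Gamma> where "\<Gamma> i j = (\<Sum>(k, l)\<in>F. (a k l)\<^sup>2 * ou_gram (lam k l) N i j)" for i j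
  define v where "v k l = (1 - exp (- lam k l / real N)) / lam k l" for k l
  have pos: "0 < lam k l" if "(k, l) \<in> F" for k l
    using that F lam_pos by auto
  note exact = gaussian_moments_sum_squares[of "{1..N}" b G \<nu> g]
  show "integrable M (\<lambda>\<omega>. (\<nu> * (\<Sum>i=1..N. (b i \<omega>)\<^sup>2) - g)\<^sup>2)"
    using fam by (intro exact) (auto simp: gaussian_family_def)
  have var: "(\<integral>\<omega>. (\<nu> * (\<Sum>i=1..N. (b i \<omega>)\<^sup>2) - g)\<^sup>2 \<partial>M) =
      (\<nu> * (\<Sum>i=1..N. G i i) - g)\<^sup>2 + 2 * \<nu>\<^sup>2 * (\<Sum>i=1..N. \<Sum>j=1..N. (G i j)\<^sup>2)"
    using fam by (intro exact) (auto simp: gaussian_family_def)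
  have m_nn: "0 \<le> m"
    unfolding m_def using less_imp_le[OF pos] \<open>0 < N\<close>
    by (intro sum_nonneg) (auto intro!: mult_nonneg_nonneg divide_nonneg_nonneg)
  have trace: "\<bar>(\<Sum>i=1..N. \<Gamma> i i) - real N * m\<bar> \<le> m"
  proof -
    have "(\<Sum>i=1..N. \<Gamma> i i) = (\<Sum>(k, l)\<in>F. (a k l)\<^sup>2 * (\<Sum>i=1..N. ou_gram (lam k l) N i i))"
      unfolding \<Gamma>_def by (subst sum.swap) (simp add: case_prod_unfold sum_distrib_left)
    then have eq: "(\<Sum>i=1..N. \<Gamma> i i) - real N * m =
        (\<Sum>(k, l)\<in>F. (a k l)\<^sup>2 * ((\<Sum>i=1..N. ou_gram (lam k l) N i i) - real N * v k l))"
      by (simp add: m_def v_def case_prod_unfold sum_distrib_left sum_subtractf right_diff_distrib mult_ac)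
    have "\<bar>(\<Sum>i=1..N. \<Gamma> i i) - real N * m\<bar> \<le> (\<Sum>(k, l)\<in>F. (a k l)\<^sup>2 * \<bar>(\<Sum>i=1..N. ou_gram (lam k l) N i i) - real N * v k l\<bar>)"
      unfolding eq by (rule order_trans[OF sum_abs]) (simp add: case_prod_unfold abs_mult)
    also have "\<dots> \<le> m"
      unfolding m_def
    proof (rule sum_mono)
      fix p assume "p \<in> F"
      then obtain k l where p: "p = (k, l)" "(k, l) \<in> F" by (cases p) auto
      have "\<bar>(\<Sum>i=1..N. ou_gram (lam k l) N i i) - real N * v k l\<bar> \<le> (1 - exp (- lam k l / real N)) / lam k l"
        unfolding v_def by (rule ou_gram_trace[OF pos[OF p(2)] \<open>0 < N\<close> refl])
      then show "(case p of (k, l) \<Rightarrow> (a k l)\<^sup>2 * \<bar>(\<Sum>i=1..N. ou_gram (lam k l) N i i) - real N * v k l\<bar>) \<le>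
          (case p of (k, l) \<Rightarrow> (a k l)\<^sup>2 * ((1 - exp (- lam k l / real N)) / lam k l))"
        unfolding p prod.case by (rule mult_left_mono) simp
    qed
    finally show ?thesis .
  qed
  have row: "(\<Sum>j=1..N. \<bar>\<Gamma> i j\<bar>) \<le> 3 * m" if i: "i \<in> {1..N}" for i
  proof -
    have "(\<Sum>j=1..N. \<bar>\<Gamma> i j\<bar>) \<le> (\<Sum>j=1..N. \<Sum>(k, l)\<in>F. (a k l)\<^sup>2 * \<bar>ou_gram (lam k l) N i j\<bar>)"
      unfolding \<Gamma>_def
      by (intro sum_mono order_trans[OF sum_abs]) (simp add: case_prod_unfold abs_mult)
    also have "\<dots> = (\<Sum>(k, l)\<in>F. (a k l)\<^sup>2 * (\<Sum>j=1..N. \<bar>ou_gram (lam k l) N i j\<bar>))"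
      by (subst sum.swap) (simp add: case_prod_unfold sum_distrib_left)
    also have "\<dots> \<le> (\<Sum>(k, l)\<in>F. (a k l)\<^sup>2 * (3 * ((1 - exp (- lam k l / real N)) / lam k l)))"
    proof (rule sum_mono)
      fix p assume "p \<in> F"
      then obtain k l where p: "p = (k, l)" "(k, l) \<in> F" by (cases p) auto
      have "(\<Sum>j=1..N. \<bar>ou_gram (lam k l) N i j\<bar>) \<le> 3 * ((1 - exp (- lam k l / real N)) / lam k l)"
        by (rule ou_gram_row_sum[OF pos[OF p(2)] \<open>0 < N\<close> refl i])
      then show "(case p of (k, l) \<Rightarrow> (a k l)\<^sup>2 * (\<Sum>j=1..N. \<bar>ou_gram (lam k l) N i j\<bar>)) \<le>
          (case p of (k, l) \<Rightarrow> (a k l)\<^sup>2 * (3 * ((1 - exp (- lam k l / real N)) / lam k l)))"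
        unfolding p prod.case by (rule mult_left_mono) simp
    qed
    also have "\<dots> = 3 * m"
      unfolding m_def sum_distrib_left by (intro sum.cong refl) (simp only: case_prod_unfold mult.left_commute)
    finally show ?thesis .
  qed
  have "\<bar>\<nu> * (\<Sum>i=1..N. G i i) - g\<bar> \<le> \<bar>\<nu>\<bar> * (real N * \<tau> + m) + \<bar>\<nu> * (real N * m) - g\<bar>"
  proof -
    have "\<bar>(\<Sum>i=1..N. G i i) - (\<Sum>i=1..N. \<Gamma> i i)\<bar> \<le> (\<Sum>i=1..N. \<bar>G i i - \<Gamma> i i\<bar>)"
      unfolding sum_subtractf[symmetric] by (rule sum_abs)
    also have "\<dots> \<le> (\<Sum>i=1..N. \<tau>)"
      using G by (intro sum_mono) (auto simp: \<Gamma>_def)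
    finally have "\<bar>(\<Sum>i=1..N. G i i) - real N * m\<bar> \<le> real N * \<tau> + m"
      using trace by simp
    then have "\<bar>\<nu>\<bar> * \<bar>(\<Sum>i=1..N. G i i) - real N * m\<bar> \<le> \<bar>\<nu>\<bar> * (real N * \<tau> + m)"
      by (rule mult_left_mono) simp
    then have "\<bar>\<nu> * (\<Sum>i=1..N. G i i) - \<nu> * (real N * m)\<bar> \<le> \<bar>\<nu>\<bar> * (real N * \<tau> + m)"
      unfolding right_diff_distrib[symmetric] abs_mult .
    then show ?thesis by linarith
  qed
  then have T1: "(\<nu> * (\<Sum>i=1..N. G i i) - g)\<^sup>2 \<le> (\<bar>\<nu>\<bar> * (real N * \<tau> + m) + \<bar>\<nu> * (real N * m) - g\<bar>)\<^sup>2"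
    by (metis abs_ge_zero power2_abs power_mono)
  have "(\<Sum>i=1..N. \<Sum>j=1..N. (G i j)\<^sup>2) \<le> (\<Sum>i=1..N. \<Sum>j=1..N. 2 * (\<Gamma> i j)\<^sup>2 + 2 * \<tau>\<^sup>2)"
  proof (intro sum_mono)
    fix i j assume ij: "i \<in> {1..N}" "j \<in> {1..N}"
    have "(G i j)\<^sup>2 \<le> 2 * (\<Gamma> i j)\<^sup>2 + 2 * (G i j - \<Gamma> i j)\<^sup>2"
      using zero_le_power2[of "\<Gamma> i j - (G i j - \<Gamma> i j)"] by (simp add: power2_eq_square algebra_simps)
    moreover have "(G i j - \<Gamma> i j)\<^sup>2 \<le> \<tau>\<^sup>2"
      using G[OF ij] by (metis \<Gamma>_def abs_ge_zero power2_abs power_mono)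
    ultimately show "(G i j)\<^sup>2 \<le> 2 * (\<Gamma> i j)\<^sup>2 + 2 * \<tau>\<^sup>2" by linarith
  qed
  also have "\<dots> = 2 * (\<Sum>i=1..N. \<Sum>j=1..N. (\<Gamma> i j)\<^sup>2) + 2 * (real N)\<^sup>2 * \<tau>\<^sup>2"
    by (simp add: sum.distrib sum_distrib_left power2_eq_square mult_ac)
  also have "(\<Sum>i=1..N. \<Sum>j=1..N. (\<Gamma> i j)\<^sup>2) \<le> (\<Sum>i=1..N. (3 * m)\<^sup>2)"
  proof (rule sum_mono)
    fix i assume i: "i \<in> {1..N}"
    have "(\<Sum>j=1..N. (\<Gamma> i j)\<^sup>2) = (\<Sum>j=1..N. \<bar>\<Gamma> i j\<bar> * \<bar>\<Gamma> i j\<bar>)"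
      by (simp add: power2_eq_square)
    \<comment> \<open>The squares of a row are bounded by the square of its absolute sum. No order
      is lost, since that sum is at most three times the diagonal bound \<open>m\<close>.\<close>
    also have "\<dots> \<le> (\<Sum>j=1..N. \<bar>\<Gamma> i j\<bar> * (\<Sum>j=1..N. \<bar>\<Gamma> i j\<bar>))"
      by (intro sum_mono mult_left_mono member_le_sum) auto
    also have "\<dots> = (\<Sum>j=1..N. \<bar>\<Gamma> i j\<bar>)\<^sup>2"
      by (simp add: sum_distrib_right[symmetric] power2_eq_square)
    also have "\<dots> \<le> (3 * m)\<^sup>2"
      using row[OF i] by (intro power_mono sum_nonneg) auto
    finally show "(\<Sum>j=1..N. (\<Gamma> i j)\<^sup>2) \<le> (3 * m)\<^sup>2" .
  qed
  finally have "(\<Sum>i=1..N. \<Sum>j=1..N. (G i j)\<^sup>2) \<le> 2 * (real N * (9 * m\<^sup>2)) + 2 * (real N)\<^sup>2 * \<tau>\<^sup>2"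
    by (simp add: power_mult_distrib)
  then have "2 * \<nu>\<^sup>2 * (\<Sum>i=1..N. \<Sum>j=1..N. (G i j)\<^sup>2) \<le>
      2 * \<nu>\<^sup>2 * (2 * (real N * (9 * m\<^sup>2)) + 2 * (real N)\<^sup>2 * \<tau>\<^sup>2)"
    by (rule mult_left_mono) simp
  also have "\<dots> = 4 * \<nu>\<^sup>2 * real N * (9 * m\<^sup>2 + real N * \<tau>\<^sup>2)"
    by (simp add: algebra_simps power2_eq_square)
  finally show "(\<integral>\<omega>. (\<nu> * (\<Sum>i=1..N. (b i \<omega>)\<^sup>2) - g)\<^sup>2 \<partial>M) \<le>
      (\<bar>\<nu>\<bar> * (real N * \<tau> + m) + \<bar>\<nu> * (real N * m) - g\<bar>)\<^sup>2 + 4 * \<nu>\<^sup>2 * real N * (9 * m\<^sup>2 + real N * \<tau>\<^sup>2)"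
    using T1 unfolding var by linarith
qed

end

section \<open>Error of the realized volatility at one point\<close>

lemma rate_bounds:
  fixes n \<alpha> s :: real
  assumes n: "1 \<le> n" and \<alpha>: "0 < \<alpha>" "\<alpha> < 1" and s: "\<alpha> \<le> s" "1 / 2 < s" "s < 1"
  shows "n powr (\<alpha> - 1) * (n * (1 / n\<^sup>2)) \<le> 1 / n" "n powr (\<alpha> - 1) * n powr (- \<alpha>) = 1 / n"
    "n powr (\<alpha> - 1) * n = n powr \<alpha>" "n powr \<alpha> * (1 / n\<^sup>2) \<le> 1 / n"
    "1 / n \<le> n powr (- (1 - s))" "1 / n \<le> n powr (- 2 * (1 - s))" "(1 / n) powr \<alpha> = n powr (- \<alpha>)"
    "n powr \<alpha> * (1 / n) powr (\<alpha> + 1 - s) = n powr (- (1 - s))"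
    "1 / (n * (1 / n) powr \<alpha>) = n powr (\<alpha> - 1)" "(n powr (- (1 - s)))\<^sup>2 = n powr (- 2 * (1 - s))"
    "(n powr (\<alpha> - 1))\<^sup>2 * n * (n * (1 / n\<^sup>2)\<^sup>2) \<le> 1 / n"
    "(n powr (\<alpha> - 1))\<^sup>2 * n * (n powr (- \<alpha>))\<^sup>2 = 1 / n"
proof -
  have pos: "0 < n" using n by simp
  have inv: "1 / n = n powr (- 1)" using pos by (simp add: powr_minus field_simps)
  have le1: "n powr (\<alpha> - 1) \<le> 1" using powr_mono[of "\<alpha> - 1" 0 n] n \<alpha> by simp
  show 1: "n powr (\<alpha> - 1) * (n * (1 / n\<^sup>2)) \<le> 1 / n"
    using le1 pos by (simp add: power2_eq_square mult_left_le_one_le field_simps)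
  show 2: "n powr (\<alpha> - 1) * n powr (- \<alpha>) = 1 / n"
    unfolding inv powr_add[symmetric] by simp
  show 3: "n powr (\<alpha> - 1) * n = n powr \<alpha>"
    using pos by (simp add: powr_diff)
  show "n powr \<alpha> * (1 / n\<^sup>2) \<le> 1 / n"
    using 1 unfolding 3[symmetric] by (simp only: mult.assoc)
  show "1 / n \<le> n powr (- (1 - s))" "1 / n \<le> n powr (- 2 * (1 - s))"
    unfolding inv by (rule powr_mono; use n s in simp)+
  have ip: "(1 / n) powr x = n powr (- x)" for x
    using pos by (simp add: powr_divide powr_minus field_simps)
  show "(1 / n) powr \<alpha> = n powr (- \<alpha>)" by (rule ip)
  show "n powr \<alpha> * (1 / n) powr (\<alpha> + 1 - s) = n powr (- (1 - s))"
    unfolding ip powr_add[symmetric] by simp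
  show "1 / (n * (1 / n) powr \<alpha>) = n powr (\<alpha> - 1)"
    unfolding ip using pos by (simp add: powr_minus powr_diff field_simps)
  show "(n powr (- (1 - s)))\<^sup>2 = n powr (- 2 * (1 - s))"
    unfolding power2_eq_square powr_add[symmetric] by (simp add: algebra_simps)
  have "(n powr (\<alpha> - 1))\<^sup>2 * n * (n * (1 / n\<^sup>2)\<^sup>2) = (n powr (\<alpha> - 1) * (n * (1 / n\<^sup>2)))\<^sup>2"
    by (simp add: power2_eq_square)
  also have "\<dots> \<le> (1 / n)\<^sup>2"
    using 1 pos by (intro power_mono) auto
  also have "\<dots> \<le> 1 / n"
    using n by (simp add: power2_eq_square field_simps)
  finally show "(n powr (\<alpha> - 1))\<^sup>2 * n * (n * (1 / n\<^sup>2)\<^sup>2) \<le> 1 / n" .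
  have "(n powr (\<alpha> - 1))\<^sup>2 * n * (n powr (- \<alpha>))\<^sup>2 = (n powr (\<alpha> - 1) * n powr (- \<alpha>))\<^sup>2 * n"
    by (simp add: power_mult_distrib)
  also have "\<dots> = 1 / n" unfolding 2 using pos by (simp add: power2_eq_square)
  finally show "(n powr (\<alpha> - 1))\<^sup>2 * n * (n powr (- \<alpha>))\<^sup>2 = 1 / n" .
qed

lemma nn_integral_sum_of_four:
  fixes f1 f2 f3 f4 :: "'b \<Rightarrow> ennreal"
  assumes "f1 \<in> borel_measurable M" "f2 \<in> borel_measurable M" "f3 \<in> borel_measurable M" "f4 \<in> borel_measurable M"
  shows "(\<integral>\<^sup>+x. c * (f1 x + f2 x + f3 x + f4 x) \<partial>M) =
    c * ((\<integral>\<^sup>+x. f1 x \<partial>M) + (\<integral>\<^sup>+x. f2 x \<partial>M) + (\<integral>\<^sup>+x. f3 x \<partial>M) + (\<integral>\<^sup>+x. f4 x \<partial>M))"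
  using assms by (simp add: nn_integral_add nn_integral_cmult)

context spde_field
begin

text \<open>Along the grid the squared decrements of each mode sum to at most 1 - \<rho>, where
  \<rho> is its decay factor. The weighted total is thus the first sum of
  \<open>sum_eigval_bound\<close>, of order N^(-\<alpha>), and becomes of order 1 / N under the
  normalization N^(\<alpha> - 1).\<close>

lemma initial_increments_bound:
  assumes F: "finite F" "F \<subseteq> indices" and "0 < N" and p: "p \<in> unit_square"
    and T: "(\<Sum>(k, l)\<in>F. lam k l powr (- 1 - \<alpha>) * (1 - exp (- lam k l / real N))) \<le> T"
  shows "(\<Sum>i=1..N. \<integral>\<^sup>+\<omega>. ennreal ((\<Sum>(k, l)\<in>F. (exp (- lam k l * (real i / real N))
      - exp (- lam k l * (real (i - 1) / real N))) * eigfun \<theta> k l p * \<xi>c k l \<omega>)\<^sup>2) \<partial>M) \<le>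
    ennreal (C\<xi> * (4 * damping_max * T))"
proof -
  define d where "d i k l = (exp (- lam k l * (real i / real N))
      - exp (- lam k l * (real (i - 1) / real N))) * eigfun \<theta> k l p" for i k l
  have pos: "0 < lam k l" if "(k, l) \<in> F" for k l
    using that F lam_pos by auto
  have dsq: "(\<Sum>i=1..N. (d i k l)\<^sup>2) \<le> (1 - exp (- lam k l / real N)) * (4 * damping_max)" if kl: "(k, l) \<in> F" for k l
  proof -
    define \<rho> where "\<rho> = exp (- lam k l / real N)"
    have e: "exp (- lam k l * (real n / real N)) = \<rho> ^ n" for n
      by (simp add: \<rho>_def exp_of_nat_mult[symmetric])
    have "(\<Sum>i=1..N. (d i k l)\<^sup>2) = (\<Sum>i=1..N. ((1 - \<rho>) * \<rho> ^ (i - 1))\<^sup>2) * (eigfun \<theta> k l p)\<^sup>2"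
      unfolding sum_distrib_right
    proof (rule sum.cong)
      fix i assume "i \<in> {1..N}"
      then obtain j where j: "i = Suc j" by (cases i) auto
      show "(d i k l)\<^sup>2 = ((1 - \<rho>) * \<rho> ^ (i - 1))\<^sup>2 * (eigfun \<theta> k l p)\<^sup>2"
        unfolding d_def e j by (simp add: power2_eq_square algebra_simps)
    qed simp
    also have "\<dots> \<le> (1 - \<rho>) * (4 * damping_max)"
      using ou_increment_factor_sum[OF pos[OF kl] \<open>0 < N\<close> \<rho>_def, of N] eigfun_square_le[OF p, of k l]
        pos[OF kl] \<open>0 < N\<close>
      by (intro mult_mono) (auto simp: \<rho>_def)
    finally show ?thesis by (simp add: \<rho>_def)
  qed
  have "(\<Sum>i=1..N. \<integral>\<^sup>+\<omega>. ennreal ((\<Sum>(k, l)\<in>F. d i k l * \<xi>c k l \<omega>)\<^sup>2) \<partial>M) \<le>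
      (\<Sum>i=1..N. ennreal (C\<xi> * (\<Sum>(k, l)\<in>F. lam k l powr (- 1 - \<alpha>) * (d i k l)\<^sup>2)))"
    using F by (intro sum_mono \<xi>_bound) auto
  also have "\<dots> = ennreal (\<Sum>i=1..N. C\<xi> * (\<Sum>(k, l)\<in>F. lam k l powr (- 1 - \<alpha>) * (d i k l)\<^sup>2))"
    using C\<xi> by (intro sum_ennreal mult_nonneg_nonneg sum_nonneg) auto
  also have "(\<Sum>i=1..N. C\<xi> * (\<Sum>(k, l)\<in>F. lam k l powr (- 1 - \<alpha>) * (d i k l)\<^sup>2)) =
      C\<xi> * (\<Sum>(k, l)\<in>F. lam k l powr (- 1 - \<alpha>) * (\<Sum>i=1..N. (d i k l)\<^sup>2))"
    unfolding sum_distrib_left[symmetric]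
    by (subst sum.swap) (simp add: case_prod_unfold sum_distrib_left)
  also have "ennreal \<dots> \<le> ennreal (C\<xi> * (4 * damping_max * T))"
  proof (intro ennreal_leI mult_left_mono C\<xi>)
    have "(\<Sum>(k, l)\<in>F. lam k l powr (- 1 - \<alpha>) * (\<Sum>i=1..N. (d i k l)\<^sup>2)) \<le>
        (\<Sum>(k, l)\<in>F. lam k l powr (- 1 - \<alpha>) * ((1 - exp (- lam k l / real N)) * (4 * damping_max)))"
    proof (rule sum_mono)
      fix q assume "q \<in> F"
      then obtain k l where q: "q = (k, l)" "(k, l) \<in> F" by (cases q) auto
      show "(case q of (k, l) \<Rightarrow> lam k l powr (- 1 - \<alpha>) * (\<Sum>i=1..N. (d i k l)\<^sup>2)) \<le>
          (case q of (k, l) \<Rightarrow> lam k l powr (- 1 - \<alpha>) * ((1 - exp (- lam k l / real N)) * (4 * damping_max)))"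
        unfolding q prod.case by (rule mult_left_mono[OF dsq[OF q(2)]]) simp
    qed
    also have "\<dots> = 4 * damping_max * (\<Sum>(k, l)\<in>F. lam k l powr (- 1 - \<alpha>) * (1 - exp (- lam k l / real N)))"
      unfolding sum_distrib_left by (intro sum.cong refl) (simp add: case_prod_unfold mult_ac)
    also have "\<dots> \<le> 4 * damping_max * T"
      using T by (intro mult_left_mono) (auto simp: damping_max_def)
    finally show "(\<Sum>(k, l)\<in>F. lam k l powr (- 1 - \<alpha>) * (\<Sum>i=1..N. (d i k l)\<^sup>2)) \<le> 4 * damping_max * T" .
  qed
  finally show ?thesis unfolding d_def .
qed

text \<open>Finitely many requirements on the net of finite index sets are met by one
  \<open>F\<close>: closeness to the field at all N + 1 times and closeness of the variance series.
  An increment then differs from \<open>b i\<close> by two tails, the step approximation and the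
  initial value. Squaring four terms costs a factor 4, and three of them are at most \<tau>, whence
  the 12.\<close>

lemma truncation:
  assumes p: "p \<in> unit_square" and "0 < N" "0 < \<tau>"
    and H: "((\<lambda>(k, l). v k l) has_sum H) indices"
  obtains F b G where "finite F" "F \<subseteq> indices" "\<bar>(\<Sum>(k, l)\<in>F. v k l) - H\<bar> \<le> \<tau>"
    "gaussian_family M {1..N} b G"
    "\<And>i j. i \<in> {1..N} \<Longrightarrow> j \<in> {1..N} \<Longrightarrow>
      \<bar>G i j - (\<Sum>(k, l)\<in>F. (\<sigma> * noise_eigval \<mu>0 k l powr (- \<alpha> / 2) * eigfun \<theta> k l p)\<^sup>2 * ou_gram (lam k l) N i j)\<bar> \<le> \<tau>"
    "\<And>i. i \<in> {1..N} \<Longrightarrow>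
      (\<integral>\<^sup>+\<omega>. ennreal ((X (real i / real N) p \<omega> - X (real (i - 1) / real N) p \<omega> - b i \<omega>)\<^sup>2) \<partial>M) \<le>
      ennreal (12 * \<tau>) + 4 * (\<integral>\<^sup>+\<omega>. ennreal ((\<Sum>(k, l)\<in>F. (exp (- lam k l * (real i / real N))
        - exp (- lam k l * (real (i - 1) / real N))) * eigfun \<theta> k l p * \<xi>c k l \<omega>)\<^sup>2) \<partial>M)"
proof -
  define a where "a k l = \<sigma> * noise_eigval \<mu>0 k l powr (- \<alpha> / 2) * eigfun \<theta> k l p" for k l
  define XF where "XF F t \<omega> = (\<Sum>(k, l)\<in>F. exp (- lam k l * t) * eigfun \<theta> k l p * \<xi>c k l \<omega>) + (\<Sum>(k, l)\<in>F. a k l * I k l t \<omega>)"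
    for F t \<omega>
  have grid: "real i / real N \<in> {0..1}" if "i \<le> N" for i
    using that \<open>0 < N\<close> by (auto simp: divide_le_eq_1)
  have I_meas: "I k l t \<in> borel_measurable M" if "1 \<le> k" "1 \<le> l" "t \<in> {0..1}" for k l t
    using I_wiener[OF that] by (simp add: is_wiener_integral_def)
  have e1: "\<forall>\<^sub>F F in finite_subsets_at_top indices. finite F \<and> F \<subseteq> indices"
    by (rule eventually_finite_subsets_at_top_weakI) auto
  have e2: "\<forall>\<^sub>F F in finite_subsets_at_top indices. \<forall>i\<in>{0..N}.
      (\<integral>\<^sup>+\<omega>. ennreal (((\<Sum>(k, l)\<in>F. x k l (real i / real N) \<omega> * eigfun \<theta> k l p) - X (real i / real N) p \<omega>)\<^sup>2) \<partial>M) < ennreal \<tau>"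
  proof (rule eventually_ball_finite, simp, intro ballI)
    fix i assume "i \<in> {0..N}"
    then have "L2_tendsto M (\<lambda>F \<omega>. \<Sum>(k, l)\<in>F. x k l (real i / real N) \<omega> * eigfun \<theta> k l p)
        (X (real i / real N) p) (finite_subsets_at_top indices)"
      using p by (intro X_series grid) auto
    then show "\<forall>\<^sub>F F in finite_subsets_at_top indices.
      (\<integral>\<^sup>+\<omega>. ennreal (((\<Sum>(k, l)\<in>F. x k l (real i / real N) \<omega> * eigfun \<theta> k l p) - X (real i / real N) p \<omega>)\<^sup>2) \<partial>M) < ennreal \<tau>"
      unfolding L2_tendsto_def by (rule order_tendstoD(2)) (use \<open>0 < \<tau>\<close> in simp)
  qed
  have e3: "\<forall>\<^sub>F F in finite_subsets_at_top indices. dist (\<Sum>(k, l)\<in>F. v k l) H < \<tau>"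
    using H \<open>0 < \<tau>\<close> unfolding has_sum_def by (rule tendstoD)
  have "\<forall>\<^sub>F F in finite_subsets_at_top indices. (finite F \<and> F \<subseteq> indices) \<and> (\<forall>i\<in>{0..N}.
      (\<integral>\<^sup>+\<omega>. ennreal (((\<Sum>(k, l)\<in>F. x k l (real i / real N) \<omega> * eigfun \<theta> k l p) - X (real i / real N) p \<omega>)\<^sup>2) \<partial>M) < ennreal \<tau>)
      \<and> dist (\<Sum>(k, l)\<in>F. v k l) H < \<tau>"
    by (rule eventually_conj[OF e1 eventually_conj[OF e2 e3]])
  from eventually_happens'[OF finite_subsets_at_top_neq_bot this]
  obtain F where F_all: "(finite F \<and> F \<subseteq> indices) \<and> (\<forall>i\<in>{0..N}.
      (\<integral>\<^sup>+\<omega>. ennreal (((\<Sum>(k, l)\<in>F. x k l (real i / real N) \<omega> * eigfun \<theta> k l p) - X (real i / real N) p \<omega>)\<^sup>2) \<partial>M) < ennreal \<tau>)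
      \<and> dist (\<Sum>(k, l)\<in>F. v k l) H < \<tau>" by (rule exE)
  have F: "finite F" "F \<subseteq> indices" "dist (\<Sum>(k, l)\<in>F. v k l) H < \<tau>"
    using F_all by simp_all
  have tail: "(\<integral>\<^sup>+\<omega>. ennreal (((\<Sum>(k, l)\<in>F. x k l (real i / real N) \<omega> * eigfun \<theta> k l p) - X (real i / real N) p \<omega>)\<^sup>2) \<partial>M) < ennreal \<tau>"
    if "i \<in> {0..N}" for i
    using F_all that by (elim conjE) (rule bspec)
  have kl: "1 \<le> k" "1 \<le> l" if "(k, l) \<in> F" for k l using that F(2) by auto
  have XF_eq: "(\<Sum>(k, l)\<in>F. x k l t \<omega> * eigfun \<theta> k l p) = XF F t \<omega>" if "t \<in> {0..1}" "\<omega> \<in> space M" for t \<omega>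
    unfolding XF_def sum.distrib[symmetric]
  proof (rule sum.cong)
    fix q assume "q \<in> F"
    then obtain k l where q: "q = (k, l)" "(k, l) \<in> F" by (cases q) auto
    show "(case q of (k, l) \<Rightarrow> x k l t \<omega> * eigfun \<theta> k l p) =
        (case q of (k, l) \<Rightarrow> exp (- lam k l * t) * eigfun \<theta> k l p * \<xi>c k l \<omega>)
        + (case q of (k, l) \<Rightarrow> a k l * I k l t \<omega>)"
      unfolding q prod.case x_eq[OF kl[OF q(2)] that] by (simp add: a_def algebra_simps)
  qed simp
  have aF_meas: "(\<lambda>\<omega>. \<Sum>(k, l)\<in>F. c k l * \<xi>c k l \<omega>) \<in> borel_measurable M" for c
    unfolding case_prod_unfold using \<xi>_meas kl by (intro borel_measurable_sum borel_measurable_times) auto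
  have XF_meas: "XF F t \<in> borel_measurable M" if "t \<in> {0..1}" for t
  proof -
    have "(\<lambda>\<omega>. \<Sum>(k, l)\<in>F. a k l * I k l t \<omega>) \<in> borel_measurable M"
      unfolding case_prod_unfold using I_meas kl that by (intro borel_measurable_sum borel_measurable_times) auto
    then show ?thesis
      unfolding XF_def[abs_def] using aF_meas by (intro borel_measurable_add) auto
  qed
  show thesis
  proof (rule noise_increment_approximation[of F w lam N \<tau> "\<lambda>k l i. I k l (real i / real N)" a])
    show "indep_vars (\<lambda>_. PiM {0..} (\<lambda>_. borel)) (\<lambda>(k, l) \<omega>. \<lambda>t\<in>{0..}. w k l t \<omega>) F"
      using w_indep F(2) by (rule indep_vars_subset)
  next
    fix b G
    assume fam: "gaussian_family M {1..N} b G"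
      and G: "\<And>i j. i \<in> {1..N} \<Longrightarrow> j \<in> {1..N} \<Longrightarrow> \<bar>G i j - (\<Sum>(k, l)\<in>F. (a k l)\<^sup>2 * ou_gram (lam k l) N i j)\<bar> \<le> \<tau>"
      and bI: "\<And>i. i \<in> {1..N} \<Longrightarrow>
        (\<integral>\<^sup>+\<omega>. ennreal ((b i \<omega> - (\<Sum>(k, l)\<in>F. a k l * (I k l (real i / real N) \<omega> - I k l (real (i - 1) / real N) \<omega>)))\<^sup>2) \<partial>M) \<le> ennreal \<tau>"
    show thesis
    proof (rule that[OF F(1,2) _ fam])
      show "\<bar>(\<Sum>(k, l)\<in>F. v k l) - H\<bar> \<le> \<tau>"
        using F(3) by (simp add: dist_real_def)
      show "\<bar>G i j - (\<Sum>(k, l)\<in>F. (\<sigma> * noise_eigval \<mu>0 k l powr (- \<alpha> / 2) * eigfun \<theta> k l p)\<^sup>2 * ou_gram (lam k l) N i j)\<bar> \<le> \<tau>"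
        if "i \<in> {1..N}" "j \<in> {1..N}" for i j
        using G[OF that] by (simp only: a_def)
      fix i assume i: "i \<in> {1..N}"
      let ?t = "real i / real N" and ?u = "real (i - 1) / real N"
      have tu: "?t \<in> {0..1}" "?u \<in> {0..1}" using i by (intro grid; auto)+
      define A where "A \<omega> = (\<Sum>(k, l)\<in>F. (exp (- lam k l * ?t) - exp (- lam k l * ?u)) * eigfun \<theta> k l p * \<xi>c k l \<omega>)" for \<omega>
      define W where "W \<omega> = (\<Sum>(k, l)\<in>F. a k l * (I k l ?t \<omega> - I k l ?u \<omega>))" for \<omega>
      have inc: "XF F ?t \<omega> - XF F ?u \<omega> = A \<omega> + W \<omega>" for \<omega>
        by (simp add: XF_def A_def W_def case_prod_unfold sum_subtractf left_diff_distrib right_diff_distrib)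
      have [measurable]: "A \<in> borel_measurable M" "W \<in> borel_measurable M" "b i \<in> borel_measurable M"
        "XF F ?t \<in> borel_measurable M" "XF F ?u \<in> borel_measurable M" "X ?t p \<in> borel_measurable M" "X ?u p \<in> borel_measurable M"
      proof -
        show "A \<in> borel_measurable M" unfolding A_def[abs_def] by (rule aF_meas)
        show "b i \<in> borel_measurable M"
          using fam i by (auto simp: gaussian_family_def gaussian_moments_def)
        show "XF F ?t \<in> borel_measurable M" "XF F ?u \<in> borel_measurable M" "X ?t p \<in> borel_measurable M" "X ?u p \<in> borel_measurable M"
          using XF_meas X_meas tu p by auto
        show "W \<in> borel_measurable M"
          unfolding W_def[abs_def] case_prod_unfold using I_meas kl tu
          by (intro borel_measurable_sum borel_measurable_times borel_measurable_diff) auto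
      qed
      have tail': "(\<integral>\<^sup>+\<omega>. ennreal ((XF F (real j / real N) \<omega> - X (real j / real N) p \<omega>)\<^sup>2) \<partial>M) \<le> ennreal \<tau>" if "j \<le> N" for j
      proof -
        have "(\<integral>\<^sup>+\<omega>. ennreal ((XF F (real j / real N) \<omega> - X (real j / real N) p \<omega>)\<^sup>2) \<partial>M) =
            (\<integral>\<^sup>+\<omega>. ennreal (((\<Sum>(k, l)\<in>F. x k l (real j / real N) \<omega> * eigfun \<theta> k l p) - X (real j / real N) p \<omega>)\<^sup>2) \<partial>M)"
          using grid[OF that] by (intro nn_integral_cong) (simp only: XF_eq)
        then show ?thesis using tail[of j] that by simp
      qed
      have four: "(u1 + u2 + u3 + u4)\<^sup>2 \<le> 4 * (u1\<^sup>2 + u2\<^sup>2 + u3\<^sup>2 + u4\<^sup>2)" for u1 u2 u3 u4 :: real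
        using zero_le_power2[of "u1 - u2"] zero_le_power2[of "u1 - u3"] zero_le_power2[of "u1 - u4"]
          zero_le_power2[of "u2 - u3"] zero_le_power2[of "u2 - u4"] zero_le_power2[of "u3 - u4"]
        by (simp add: power2_eq_square algebra_simps)
      have "ennreal ((X ?t p \<omega> - X ?u p \<omega> - b i \<omega>)\<^sup>2) \<le>
          4 * (ennreal ((XF F ?t \<omega> - X ?t p \<omega>)\<^sup>2) + ennreal ((XF F ?u \<omega> - X ?u p \<omega>)\<^sup>2)
            + ennreal ((b i \<omega> - W \<omega>)\<^sup>2) + ennreal ((A \<omega>)\<^sup>2))" for \<omega>
      proof -
        have "X ?t p \<omega> - X ?u p \<omega> - b i \<omega> =
            - (XF F ?t \<omega> - X ?t p \<omega>) + (XF F ?u \<omega> - X ?u p \<omega>) + - (b i \<omega> - W \<omega>) + A \<omega>"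
          using inc[of \<omega>] by simp
        then have "(X ?t p \<omega> - X ?u p \<omega> - b i \<omega>)\<^sup>2 \<le>
            4 * ((- (XF F ?t \<omega> - X ?t p \<omega>))\<^sup>2 + (XF F ?u \<omega> - X ?u p \<omega>)\<^sup>2 + (- (b i \<omega> - W \<omega>))\<^sup>2 + (A \<omega>)\<^sup>2)"
          using four by presburger
        then have "ennreal ((X ?t p \<omega> - X ?u p \<omega> - b i \<omega>)\<^sup>2) \<le>
            ennreal (4 * ((XF F ?t \<omega> - X ?t p \<omega>)\<^sup>2 + (XF F ?u \<omega> - X ?u p \<omega>)\<^sup>2 + (b i \<omega> - W \<omega>)\<^sup>2 + (A \<omega>)\<^sup>2))"
          unfolding power2_minus by (rule ennreal_leI)
        then show ?thesis
          by (simp add: ennreal_mult' ennreal_plus)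
      qed
      then have "(\<integral>\<^sup>+\<omega>. ennreal ((X ?t p \<omega> - X ?u p \<omega> - b i \<omega>)\<^sup>2) \<partial>M) \<le>
          (\<integral>\<^sup>+\<omega>. 4 * (ennreal ((XF F ?t \<omega> - X ?t p \<omega>)\<^sup>2) + ennreal ((XF F ?u \<omega> - X ?u p \<omega>)\<^sup>2)
            + ennreal ((b i \<omega> - W \<omega>)\<^sup>2) + ennreal ((A \<omega>)\<^sup>2)) \<partial>M)"
        by (rule nn_integral_mono)
      also have "\<dots> = 4 * ((\<integral>\<^sup>+\<omega>. ennreal ((XF F ?t \<omega> - X ?t p \<omega>)\<^sup>2) \<partial>M) + (\<integral>\<^sup>+\<omega>. ennreal ((XF F ?u \<omega> - X ?u p \<omega>)\<^sup>2) \<partial>M)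
            + (\<integral>\<^sup>+\<omega>. ennreal ((b i \<omega> - W \<omega>)\<^sup>2) \<partial>M) + (\<integral>\<^sup>+\<omega>. ennreal ((A \<omega>)\<^sup>2) \<partial>M))"
        by (rule nn_integral_sum_of_four) measurable
      also have "\<dots> \<le> 4 * (ennreal \<tau> + ennreal \<tau> + ennreal \<tau> + (\<integral>\<^sup>+\<omega>. ennreal ((A \<omega>)\<^sup>2) \<partial>M))"
        using i bI[OF i] unfolding W_def by (intro mult_left_mono add_mono tail' order_refl) auto
      also have "\<dots> = ennreal (12 * \<tau>) + 4 * (\<integral>\<^sup>+\<omega>. ennreal ((A \<omega>)\<^sup>2) \<partial>M)"
      proof -
        have "ennreal \<tau> + ennreal \<tau> + ennreal \<tau> = ennreal (3 * \<tau>)"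
          using \<open>0 < \<tau>\<close> by (simp flip: ennreal_plus)
        moreover have "4 * ennreal (3 * \<tau>) = ennreal (12 * \<tau>)"
          using \<open>0 < \<tau>\<close> ennreal_mult'[of 4 "3 * \<tau>"] by simp
        ultimately show ?thesis by (simp add: distrib_left)
      qed
      finally show "(\<integral>\<^sup>+\<omega>. ennreal ((X ?t p \<omega> - X ?u p \<omega> - b i \<omega>)\<^sup>2) \<partial>M) \<le>
          ennreal (12 * \<tau>) + 4 * (\<integral>\<^sup>+\<omega>. ennreal ((\<Sum>(k, l)\<in>F. (exp (- lam k l * ?t)
            - exp (- lam k l * ?u)) * eigfun \<theta> k l p * \<xi>c k l \<omega>)\<^sup>2) \<partial>M)"
        unfolding A_def .
    qed
  qed (use w kl lam_pos F \<open>0 < N\<close> \<open>0 < \<tau>\<close> I_wiener grid in auto)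
qed

end

lemma nn_integral_cmult_sum:
  fixes f :: "'i \<Rightarrow> 'b \<Rightarrow> ennreal"
  assumes "\<And>i. i \<in> A \<Longrightarrow> f i \<in> borel_measurable M"
  shows "(\<integral>\<^sup>+x. c * (\<Sum>i\<in>A. f i x) \<partial>M) = c * (\<Sum>i\<in>A. \<integral>\<^sup>+x. f i x \<partial>M)"
  using assms by (subst nn_integral_cmult) (auto simp: nn_integral_sum)

context spde_field
begin

text \<open>\<open>A\<close> is the realized volatility of the remainder, initial value included,
  and \<open>V\<close> is the squared error of the Gaussian part. The initial value is controlled
  through second moments, which bounds the mean of \<open>A\<close> but not that of its square; the
  square is therefore left inside the pathwise inequality.\<close>

lemma pointwise_error:
  assumes s: "\<alpha> \<le> s" "1 / 2 < s" "s < 1" and \<delta>: "0 < \<delta>" "\<delta> < 1 / 2"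
  obtains C where "0 \<le> C"
    "\<And>N y z. 0 < N \<Longrightarrow> \<delta> \<le> y \<Longrightarrow> y \<le> 1 - \<delta> \<Longrightarrow> \<delta> \<le> z \<Longrightarrow> z \<le> 1 - \<delta> \<Longrightarrow>
      \<exists>A V. A \<in> borel_measurable M \<and> V \<in> borel_measurable M \<and>
        (\<forall>\<omega>. 0 \<le> A \<omega> \<and> 0 \<le> V \<omega> \<and>
          (realized_vol \<alpha> X N (y, z) \<omega> - limit_vol (y, z))\<^sup>2 \<le> C * (A \<omega> + (A \<omega>)\<^sup>2 + V \<omega>)) \<and>
        (\<integral>\<^sup>+\<omega>. ennreal (A \<omega>) \<partial>M) \<le> ennreal (C / real N) \<and>
        (\<integral>\<^sup>+\<omega>. ennreal (V \<omega>) \<partial>M) \<le> ennreal (C * real N powr (- 2 * (1 - s)))"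
proof (rule sum_eigval_bound)
  fix C1 :: real
  assume C1: "0 \<le> C1"
    "\<And>F \<Delta>. finite F \<Longrightarrow> F \<subseteq> indices \<Longrightarrow> 0 < \<Delta> \<Longrightarrow>
      (\<Sum>(k, l)\<in>F. lam k l powr (- 1 - \<alpha>) * (1 - exp (- lam k l * \<Delta>))) \<le> C1 * \<Delta> powr \<alpha>"
    "\<And>F \<Delta>. finite F \<Longrightarrow> F \<subseteq> indices \<Longrightarrow> 0 < \<Delta> \<Longrightarrow>
      (\<Sum>(k, l)\<in>F. noise_eigval \<mu>0 k l powr (- \<alpha>) * ((1 - exp (- lam k l * \<Delta>)) / lam k l)) \<le> C1 * \<Delta> powr \<alpha>"
  show thesis
  proof (rule noise_has_sum[OF s \<delta>])
    fix C2 :: real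
    assume C2: "0 \<le> C2"
      "\<And>\<Delta> y z. 0 < \<Delta> \<Longrightarrow> \<Delta> \<le> 1 \<Longrightarrow> \<delta> \<le> y \<Longrightarrow> y \<le> 1 - \<delta> \<Longrightarrow> \<delta> \<le> z \<Longrightarrow> z \<le> 1 - \<delta> \<Longrightarrow>
      \<exists>H. ((\<lambda>(k, l). noise_eigval \<mu>0 k l powr (- \<alpha>) * ((1 - exp (- lam k l * \<Delta>)) / lam k l)
            * (4 * (sin (pi * real k * y))\<^sup>2 * (sin (pi * real l * z))\<^sup>2)) has_sum H) indices
        \<and> \<bar>H - \<Delta> powr \<alpha> * (\<theta>2 powr (\<alpha> - 1) * (Gamma (1 - \<alpha>) / (4 * pi * \<alpha>)))\<bar> \<le> C2 * \<Delta> powr (\<alpha> + 1 - s)"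
    define dm where "dm = damping_max"
    have dm: "0 \<le> dm" by (simp add: dm_def damping_max_def)
    define gm where "gm = Gamma (1 - \<alpha>) / (4 * pi * \<alpha>) * (\<sigma>\<^sup>2 / \<theta>2 powr (1 - \<alpha>)) * dm"
    have gm: "0 \<le> gm"
      using \<alpha> dm by (auto simp: gm_def Gamma_real_nonneg intro!: mult_nonneg_nonneg divide_nonneg_nonneg)
    \<comment> \<open>\<open>Cm\<close> belongs to the stationary variance, its 4 coming from
      \<open>modes\<close>; \<open>C3\<close> belongs to the bias, and \<open>CV\<close> combines
      squared bias and variance. In \<open>CA\<close>, 12 stems from the approximation errors and 16
      is the 4 of the splitting times the 4 of the squared eigenfunctions.\<close>
    define Cm where "Cm = 4 * \<sigma>\<^sup>2 * dm * C1"
    define C3 where "C3 = 1 + Cm + \<sigma>\<^sup>2 * dm * (1 + C2)"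
    define CV where "CV = C3\<^sup>2 + 4 * (9 * Cm\<^sup>2 + 1)"
    define CA where "CA = 12 + 16 * C\<xi> * dm * C1"
    have nn: "0 \<le> Cm" "0 \<le> C3" "0 \<le> CV" "0 \<le> CA"
      using dm C1(1) C2(1) C\<xi> by (auto simp: Cm_def C3_def CV_def CA_def)
    show thesis
    proof (rule that[of "9 + 12 * gm + CV + CA"])
      show "0 \<le> 9 + 12 * gm + CV + CA" using gm nn by simp
      fix N :: nat and y z :: real
      assume N: "0 < N" and yz: "\<delta> \<le> y" "y \<le> 1 - \<delta>" "\<delta> \<le> z" "z \<le> 1 - \<delta>"
      define p where "p = (y, z)"
      have p: "p \<in> unit_square" using yz \<delta> by (auto simp: p_def)
      define n where "n = real N"
      have n: "1 \<le> n" "0 < n" using N by (auto simp: n_def)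
      define \<nu> where "\<nu> = n powr (\<alpha> - 1)"
      \<comment> \<open>The tolerance can be chosen at will. Since \<open>\<nu>\<close> is at most
        1, the value \<open>1 / n\<^sup>2\<close> keeps the normalized total of n such errors below
        1 / n.\<close>
      define \<tau> where "\<tau> = 1 / n\<^sup>2"
      have \<nu>0: "0 \<le> \<nu>" and \<tau>0: "0 < \<tau>" using n by (auto simp: \<nu>_def \<tau>_def)
      note rates = rate_bounds[OF n(1) \<alpha> s, folded \<nu>_def \<tau>_def]
      define \<epsilon> where "\<epsilon> = n powr (- (1 - s))"
      have \<epsilon>0: "0 \<le> \<epsilon>" by (simp add: \<epsilon>_def)
      define v where "v k l = noise_eigval \<mu>0 k l powr (- \<alpha>) * ((1 - exp (- lam k l / n)) / lam k l)" for k l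
      obtain H where H: "((\<lambda>(k, l). v k l * modes p k l) has_sum H) indices"
        "\<bar>H - n powr (- \<alpha>) * (\<theta>2 powr (\<alpha> - 1) * (Gamma (1 - \<alpha>) / (4 * pi * \<alpha>)))\<bar> \<le> C2 * (1 / n) powr (\<alpha> + 1 - s)"
        using C2(2)[of "1 / n" y z] n yz unfolding rates(7) modes_def v_def p_def by auto
      \<comment> \<open>The limit is written as n^\<alpha> times a variance to match the normalized
        trace \<open>\<nu> * (n * m)\<close>, where \<nu> n = n^\<alpha>.\<close>
      have g: "limit_vol p = n powr \<alpha> * (\<sigma>\<^sup>2 * damping p * (n powr (- \<alpha>) * (\<theta>2 powr (\<alpha> - 1) * (Gamma (1 - \<alpha>) / (4 * pi * \<alpha>)))))"
      proof -
        have e1: "n powr \<alpha> * n powr (- \<alpha>) = 1" using n by (simp add: powr_minus)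
        have e2: "\<theta>2 powr (\<alpha> - 1) = 1 / \<theta>2 powr (1 - \<alpha>)"
          using powr_minus[of \<theta>2 "1 - \<alpha>"] by (simp add: divide_inverse)
        have e3: "n powr \<alpha> * (\<sigma>\<^sup>2 * damping p * (n powr (- \<alpha>) * u)) =
            (n powr \<alpha> * n powr (- \<alpha>)) * (\<sigma>\<^sup>2 * damping p * u)" for u
          by (simp only: mult_ac)
        show ?thesis unfolding e3 e1 e2 limit_vol_def by (simp add: mult_ac)
      qed
      show "\<exists>A V. A \<in> borel_measurable M \<and> V \<in> borel_measurable M \<and>
        (\<forall>\<omega>. 0 \<le> A \<omega> \<and> 0 \<le> V \<omega> \<and>
          (realized_vol \<alpha> X N (y, z) \<omega> - limit_vol (y, z))\<^sup>2 \<le> (9 + 12 * gm + CV + CA) * (A \<omega> + (A \<omega>)\<^sup>2 + V \<omega>)) \<and>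
        (\<integral>\<^sup>+\<omega>. ennreal (A \<omega>) \<partial>M) \<le> ennreal ((9 + 12 * gm + CV + CA) / real N) \<and>
        (\<integral>\<^sup>+\<omega>. ennreal (V \<omega>) \<partial>M) \<le> ennreal ((9 + 12 * gm + CV + CA) * real N powr (- 2 * (1 - s)))"
      proof (rule truncation[OF p N \<tau>0 H(1)])
        fix F b G
        assume F: "finite F" "F \<subseteq> indices"
          and vF: "\<bar>(\<Sum>(k, l)\<in>F. v k l * modes p k l) - H\<bar> \<le> \<tau>"
          and fam: "gaussian_family M {1..N} b G"
          and G: "\<And>i j. i \<in> {1..N} \<Longrightarrow> j \<in> {1..N} \<Longrightarrow>
            \<bar>G i j - (\<Sum>(k, l)\<in>F. (\<sigma> * noise_eigval \<mu>0 k l powr (- \<alpha> / 2) * eigfun \<theta> k l p)\<^sup>2 * ou_gram (lam k l) N i j)\<bar> \<le> \<tau>"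
          and rem: "\<And>i. i \<in> {1..N} \<Longrightarrow>
            (\<integral>\<^sup>+\<omega>. ennreal ((X (real i / real N) p \<omega> - X (real (i - 1) / real N) p \<omega> - b i \<omega>)\<^sup>2) \<partial>M) \<le>
            ennreal (12 * \<tau>) + 4 * (\<integral>\<^sup>+\<omega>. ennreal ((\<Sum>(k, l)\<in>F. (exp (- lam k l * (real i / real N))
              - exp (- lam k l * (real (i - 1) / real N))) * eigfun \<theta> k l p * \<xi>c k l \<omega>)\<^sup>2) \<partial>M)"
        define m where "m = (\<Sum>(k, l)\<in>F. (\<sigma> * noise_eigval \<mu>0 k l powr (- \<alpha> / 2) * eigfun \<theta> k l p)\<^sup>2 *
          ((1 - exp (- lam k l / real N)) / lam k l))"
        have m_eq: "m = \<sigma>\<^sup>2 * damping p * (\<Sum>(k, l)\<in>F. v k l * modes p k l)"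
          unfolding m_def sum_distrib_left
        proof (rule sum.cong)
          fix q assume "q \<in> F"
          then obtain k l where q: "q = (k, l)" "1 \<le> k" "1 \<le> l" using F(2) by (cases q) auto
          have "(noise_eigval \<mu>0 k l powr (- \<alpha> / 2))\<^sup>2 = noise_eigval \<mu>0 k l powr (- \<alpha>)"
            using noise_eigval_pos[OF q(2,3)] by (simp add: power2_eq_square powr_add[symmetric])
          then have "(\<sigma> * noise_eigval \<mu>0 k l powr (- \<alpha> / 2) * eigfun \<theta> k l p)\<^sup>2 =
              \<sigma>\<^sup>2 * noise_eigval \<mu>0 k l powr (- \<alpha>) * (modes p k l * damping p)"
            unfolding power_mult_distrib eigfun_square by simp
          then show "(case q of (k, l) \<Rightarrow> (\<sigma> * noise_eigval \<mu>0 k l powr (- \<alpha> / 2) * eigfun \<theta> k l p)\<^sup>2 *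
              ((1 - exp (- lam k l / real N)) / lam k l)) =
              \<sigma>\<^sup>2 * damping p * (case q of (k, l) \<Rightarrow> v k l * modes p k l)"
            by (simp only: q prod.case v_def n_def mult_ac)
        qed simp
        have v0: "0 \<le> v k l" if "(k, l) \<in> F" for k l
        proof -
          have kl: "1 \<le> k" "1 \<le> l" using that F(2) by auto
          show ?thesis
            unfolding v_def using lam_pos[OF kl] n(2)
            by (intro mult_nonneg_nonneg divide_nonneg_nonneg) auto
        qed
        have sum_v: "(\<Sum>(k, l)\<in>F. v k l) \<le> C1 * n powr (- \<alpha>)"
          using C1(3)[OF F, of "1 / n"] n unfolding rates(7) v_def by simp
        have "(\<Sum>(k, l)\<in>F. v k l * modes p k l) \<le> (\<Sum>(k, l)\<in>F. v k l * 4)"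
          using v0 modes_bounds[of p] by (intro sum_mono) (auto intro!: mult_left_mono)
        also have "\<dots> = 4 * (\<Sum>(k, l)\<in>F. v k l)"
          unfolding sum_distrib_left by (intro sum.cong refl) (simp add: case_prod_unfold)
        also have "\<dots> \<le> 4 * (C1 * n powr (- \<alpha>))"
          using sum_v by simp
        finally have sum_vm: "(\<Sum>(k, l)\<in>F. v k l * modes p k l) \<le> 4 * (C1 * n powr (- \<alpha>))" .
        have sum_vm0: "0 \<le> (\<Sum>(k, l)\<in>F. v k l * modes p k l)"
          using v0 modes_bounds[of p] by (intro sum_nonneg) (auto intro!: mult_nonneg_nonneg)
        note damp = damping_bounds[OF p, folded dm_def]
        have m0: "0 \<le> m"
          unfolding m_eq using damp(1) sum_vm0 by (intro mult_nonneg_nonneg) auto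
        have m_le: "m \<le> Cm * n powr (- \<alpha>)"
        proof -
          have "m \<le> \<sigma>\<^sup>2 * dm * (4 * (C1 * n powr (- \<alpha>)))"
            unfolding m_eq using damp sum_vm sum_vm0 dm by (intro mult_mono mult_left_mono) auto
          then show ?thesis by (simp add: Cm_def)
        qed
        define A where "A \<omega> = \<nu> * (\<Sum>i=1..N. (X (real i / real N) p \<omega> - X (real (i - 1) / real N) p \<omega> - b i \<omega>)\<^sup>2)" for \<omega>
        define V where "V \<omega> = (\<nu> * (\<Sum>i=1..N. (b i \<omega>)\<^sup>2) - limit_vol p)\<^sup>2" for \<omega>
        have b_meas: "b i \<in> borel_measurable M" if "i \<in> {1..N}" for i
          using fam that by (auto simp: gaussian_family_def gaussian_moments_def)
        have X_meas': "X (real i / real N) p \<in> borel_measurable M" if "i \<le> N" for i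
          using that N p by (intro X_meas) (auto simp: divide_le_eq_1)
        have r_meas: "(\<lambda>\<omega>. X (real i / real N) p \<omega> - X (real (i - 1) / real N) p \<omega> - b i \<omega>) \<in> borel_measurable M"
          if "i \<in> {1..N}" for i
          using that X_meas'[of i] X_meas'[of "i - 1"] b_meas[OF that]
          by (intro borel_measurable_diff) auto
        have A_meas: "A \<in> borel_measurable M"
          unfolding A_def[abs_def] using r_meas
          by (intro borel_measurable_times borel_measurable_const borel_measurable_sum borel_measurable_power) auto
        have V_meas: "V \<in> borel_measurable M"
          unfolding V_def[abs_def] using b_meas
          by (intro borel_measurable_times borel_measurable_const borel_measurable_sum
              borel_measurable_power borel_measurable_diff) auto
        have gp: "0 \<le> limit_vol p" "limit_vol p \<le> gm"
          using limit_vol_bounds[OF p] by (auto simp: gm_def dm_def)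
        have det: "0 \<le> A \<omega> \<and> 0 \<le> V \<omega> \<and>
          (realized_vol \<alpha> X N (y, z) \<omega> - limit_vol (y, z))\<^sup>2 \<le> (9 + 12 * gm + CV + CA) * (A \<omega> + (A \<omega>)\<^sup>2 + V \<omega>)" for \<omega>
        proof -
          have A0: "0 \<le> A \<omega>" "0 \<le> V \<omega>"
            unfolding A_def V_def using \<nu>0 by (auto intro!: mult_nonneg_nonneg sum_nonneg)
          have "realized_vol \<alpha> X N p \<omega> =
              \<nu> * (\<Sum>i=1..N. ((X (real i / real N) p \<omega> - X (real (i - 1) / real N) p \<omega> - b i \<omega>) + b i \<omega>)\<^sup>2)"
            unfolding realized_vol_def rates(9)[unfolded n_def] by (simp add: n_def)
          then have "(realized_vol \<alpha> X N p \<omega> - limit_vol p)\<^sup>2 \<le>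
              9 * (A \<omega>)\<^sup>2 + 12 * (limit_vol p * A \<omega>) + 9 * V \<omega>"
            unfolding A_def V_def by (simp only: square_sum_perturbation)
          also have "limit_vol p * A \<omega> \<le> gm * A \<omega>"
            using gp A0 by (intro mult_right_mono) auto
          also have "9 * (A \<omega>)\<^sup>2 + 12 * (gm * A \<omega>) + 9 * V \<omega> \<le> (9 + 12 * gm + CV + CA) * (A \<omega> + (A \<omega>)\<^sup>2 + V \<omega>)"
          proof -
            have "0 \<le> c * a" if "0 \<le> c" "0 \<le> a" for c a :: real using that by simp
            then have "0 \<le> gm * (A \<omega>)\<^sup>2" "0 \<le> gm * V \<omega>" "0 \<le> (CV + CA) * (A \<omega> + (A \<omega>)\<^sup>2 + V \<omega>)"
              using gm A0 nn by simp_all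
            then show ?thesis using A0 by (simp add: algebra_simps)
          qed
          finally show ?thesis using A0 by (simp add: p_def)
        qed
        have EA: "(\<integral>\<^sup>+\<omega>. ennreal (A \<omega>) \<partial>M) \<le> ennreal (CA / n)"
        proof -
          have "(\<integral>\<^sup>+\<omega>. ennreal (A \<omega>) \<partial>M) =
              (\<integral>\<^sup>+\<omega>. ennreal \<nu> * (\<Sum>i=1..N. ennreal ((X (real i / real N) p \<omega> - X (real (i - 1) / real N) p \<omega> - b i \<omega>)\<^sup>2)) \<partial>M)"
            unfolding A_def using \<nu>0 by (simp add: ennreal_mult' sum_ennreal)
          also have "\<dots> = ennreal \<nu> * (\<Sum>i=1..N. \<integral>\<^sup>+\<omega>. ennreal ((X (real i / real N) p \<omega> - X (real (i - 1) / real N) p \<omega> - b i \<omega>)\<^sup>2) \<partial>M)"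
            by (intro nn_integral_cmult_sum measurable_compose[OF _ measurable_ennreal] borel_measurable_power r_meas)
          also have "\<dots> \<le> ennreal \<nu> * (ennreal (12 * (n * \<tau>)) + 4 * ennreal (C\<xi> * (4 * dm * (C1 * n powr (- \<alpha>)))))"
          proof (rule mult_left_mono)
            have "(\<Sum>i=1..N. \<integral>\<^sup>+\<omega>. ennreal ((X (real i / real N) p \<omega> - X (real (i - 1) / real N) p \<omega> - b i \<omega>)\<^sup>2) \<partial>M) \<le>
                (\<Sum>i=1..N. ennreal (12 * \<tau>)) + 4 * (\<Sum>i=1..N. \<integral>\<^sup>+\<omega>. ennreal ((\<Sum>(k, l)\<in>F. (exp (- lam k l * (real i / real N))
                  - exp (- lam k l * (real (i - 1) / real N))) * eigfun \<theta> k l p * \<xi>c k l \<omega>)\<^sup>2) \<partial>M)"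
              unfolding sum_distrib_left sum.distrib[symmetric] by (intro sum_mono rem)
            also have "(\<Sum>i=1..N. ennreal (12 * \<tau>)) = ennreal (12 * (n * \<tau>))"
              using \<tau>0 by (subst sum_ennreal) (auto simp: n_def)
            also have "(\<Sum>i=1..N. \<integral>\<^sup>+\<omega>. ennreal ((\<Sum>(k, l)\<in>F. (exp (- lam k l * (real i / real N))
                  - exp (- lam k l * (real (i - 1) / real N))) * eigfun \<theta> k l p * \<xi>c k l \<omega>)\<^sup>2) \<partial>M) \<le>
                ennreal (C\<xi> * (4 * dm * (C1 * n powr (- \<alpha>))))"
              unfolding dm_def
            proof (rule initial_increments_bound[OF F N p])
              show "(\<Sum>(k, l)\<in>F. lam k l powr (- 1 - \<alpha>) * (1 - exp (- lam k l / real N))) \<le> C1 * n powr (- \<alpha>)"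
                using C1(2)[OF F, of "1 / n"] n unfolding rates(7) by (simp add: n_def)
            qed
            finally show "(\<Sum>i=1..N. \<integral>\<^sup>+\<omega>. ennreal ((X (real i / real N) p \<omega> - X (real (i - 1) / real N) p \<omega> - b i \<omega>)\<^sup>2) \<partial>M) \<le>
                ennreal (12 * (n * \<tau>)) + 4 * ennreal (C\<xi> * (4 * dm * (C1 * n powr (- \<alpha>))))"
              by (simp add: add_left_mono mult_left_mono)
          qed simp
          also have "\<dots> = ennreal (12 * (\<nu> * (n * \<tau>)) + 16 * C\<xi> * dm * C1 * (\<nu> * n powr (- \<alpha>)))"
          proof -
            have e4: "4 * ennreal u = ennreal (4 * u)" for u
              using ennreal_mult'[of 4 u] by simp
            have comb: "ennreal \<nu> * (ennreal u + 4 * ennreal u') = ennreal (\<nu> * (u + 4 * u'))" if "0 \<le> u" "0 \<le> u'" for u u'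
              unfolding e4 using that \<nu>0 by (simp add: ennreal_mult' ennreal_plus)
            have "0 \<le> 12 * (n * \<tau>)" "0 \<le> C\<xi> * (4 * dm * (C1 * n powr (- \<alpha>)))"
              using \<tau>0 n C\<xi> dm C1(1) by simp_all
            from comb[OF this] show ?thesis
              by (rule trans) (intro arg_cong[of _ _ ennreal], simp add: algebra_simps)
          qed
          also have "\<dots> \<le> ennreal (12 * (1 / n) + 16 * C\<xi> * dm * C1 * (1 / n))"
            unfolding rates(2) using rates(1) by (intro ennreal_leI) (simp add: mult.assoc)
          also have "12 * (1 / n) + 16 * C\<xi> * dm * C1 * (1 / n) = CA / n"
            by (simp add: CA_def add_divide_distrib)
          finally show ?thesis .
        qed
        have EV: "(\<integral>\<^sup>+\<omega>. ennreal (V \<omega>) \<partial>M) \<le> ennreal (CV * n powr (- 2 * (1 - s)))"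
        proof -
          note mom = noise_vol_moments[OF fam N G F, folded m_def, of \<nu> "limit_vol p", folded n_def V_def]
          have "\<bar>\<nu>\<bar> * (n * \<tau> + m) + \<bar>\<nu> * (n * m) - limit_vol p\<bar> \<le> C3 * \<epsilon>"
          proof -
            have 1: "\<nu> * (n * \<tau>) \<le> \<epsilon>" using rates(1,5) by (simp add: \<epsilon>_def)
            have 2: "\<nu> * m \<le> Cm * \<epsilon>"
            proof -
              have "\<nu> * m \<le> \<nu> * (Cm * n powr (- \<alpha>))" using m_le \<nu>0 by (rule mult_left_mono)
              also have "\<dots> = Cm * (1 / n)" using rates(2) by (simp add: mult.left_commute)
              also have "\<dots> \<le> Cm * \<epsilon>" unfolding \<epsilon>_def using rates(5) nn(1) by (rule mult_left_mono)
              finally show ?thesis .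
            qed
            define h where "h = n powr (- \<alpha>) * (\<theta>2 powr (\<alpha> - 1) * (Gamma (1 - \<alpha>) / (4 * pi * \<alpha>)))"
            have "\<nu> * (n * m) - limit_vol p = n powr \<alpha> * (\<sigma>\<^sup>2 * damping p * ((\<Sum>(k, l)\<in>F. v k l * modes p k l) - h))"
              unfolding g m_eq h_def[symmetric] using rates(3) by (simp add: mult.assoc[symmetric] right_diff_distrib)
            then have "\<bar>\<nu> * (n * m) - limit_vol p\<bar> = n powr \<alpha> * (\<sigma>\<^sup>2 * damping p * \<bar>(\<Sum>(k, l)\<in>F. v k l * modes p k l) - h\<bar>)"
              using damp(1) by (simp add: abs_mult)
            also have "\<dots> \<le> n powr \<alpha> * (\<sigma>\<^sup>2 * dm * (\<tau> + C2 * (1 / n) powr (\<alpha> + 1 - s)))"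
            proof -
              have "\<bar>(\<Sum>(k, l)\<in>F. v k l * modes p k l) - h\<bar> \<le> \<tau> + C2 * (1 / n) powr (\<alpha> + 1 - s)"
                using vF H(2) unfolding h_def by linarith
              then show ?thesis
                using damp dm by (intro mult_left_mono mult_mono) auto
            qed
            also have "\<dots> = \<sigma>\<^sup>2 * dm * (n powr \<alpha> * \<tau> + C2 * (n powr \<alpha> * (1 / n) powr (\<alpha> + 1 - s)))"
              by (simp add: algebra_simps)
            also have "\<dots> \<le> \<sigma>\<^sup>2 * dm * (\<epsilon> + C2 * \<epsilon>)"
              unfolding rates(8) using rates(4,5) dm C2(1) by (intro mult_left_mono add_mono) (auto simp: \<epsilon>_def)
            finally have 3: "\<bar>\<nu> * (n * m) - limit_vol p\<bar> \<le> \<sigma>\<^sup>2 * dm * (\<epsilon> + C2 * \<epsilon>)" .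
            have "\<bar>\<nu>\<bar> * (n * \<tau> + m) = \<nu> * (n * \<tau>) + \<nu> * m"
              using \<nu>0 by (simp add: distrib_left)
            then have "\<bar>\<nu>\<bar> * (n * \<tau> + m) + \<bar>\<nu> * (n * m) - limit_vol p\<bar> \<le> \<epsilon> + Cm * \<epsilon> + \<sigma>\<^sup>2 * dm * (\<epsilon> + C2 * \<epsilon>)"
              using 1 2 3 by linarith
            also have "\<dots> = C3 * \<epsilon>" by (simp add: C3_def algebra_simps)
            finally show ?thesis .
          qed
          moreover have "0 \<le> \<bar>\<nu>\<bar> * (n * \<tau> + m) + \<bar>\<nu> * (n * m) - limit_vol p\<bar>"
            using n \<tau>0 m0 by simp
          ultimately have sq: "(\<bar>\<nu>\<bar> * (n * \<tau> + m) + \<bar>\<nu> * (n * m) - limit_vol p\<bar>)\<^sup>2 \<le> (C3 * \<epsilon>)\<^sup>2"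
            by (rule power_mono)
          have "4 * \<nu>\<^sup>2 * n * (9 * m\<^sup>2 + n * \<tau>\<^sup>2) \<le> 4 * \<nu>\<^sup>2 * n * (9 * (Cm * n powr (- \<alpha>))\<^sup>2 + n * \<tau>\<^sup>2)"
            using m_le m0 n by (intro mult_left_mono add_right_mono power_mono) auto
          also have "\<dots> = 4 * (9 * Cm\<^sup>2 * (\<nu>\<^sup>2 * n * (n powr (- \<alpha>))\<^sup>2) + \<nu>\<^sup>2 * n * (n * \<tau>\<^sup>2))"
            by (simp add: power_mult_distrib algebra_simps)
          also have "\<dots> \<le> 4 * (9 * Cm\<^sup>2 * (1 / n) + 1 / n)"
            unfolding rates(12) using rates(11) by simp
          also have "\<dots> = 4 * (9 * Cm\<^sup>2 + 1) * (1 / n)" by (simp add: algebra_simps add_divide_distrib)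
          also have "\<dots> \<le> 4 * (9 * Cm\<^sup>2 + 1) * n powr (- 2 * (1 - s))"
            using rates(6) by (intro mult_left_mono) auto
          finally have "(\<integral>\<omega>. V \<omega> \<partial>M) \<le> (C3 * \<epsilon>)\<^sup>2 + 4 * (9 * Cm\<^sup>2 + 1) * n powr (- 2 * (1 - s))"
            using mom(2) sq by linarith
          also have "(C3 * \<epsilon>)\<^sup>2 = C3\<^sup>2 * n powr (- 2 * (1 - s))"
            using rates(10) by (simp add: power_mult_distrib \<epsilon>_def)
          finally have "(\<integral>\<omega>. V \<omega> \<partial>M) \<le> CV * n powr (- 2 * (1 - s))"
            by (simp add: CV_def distrib_right)
          moreover have "(\<integral>\<^sup>+\<omega>. ennreal (V \<omega>) \<partial>M) = ennreal (\<integral>\<omega>. V \<omega> \<partial>M)"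
            by (rule nn_integral_eq_integral[OF mom(1) AE_I2]) (assumption | rule det[THEN conjunct2, THEN conjunct1])+
          ultimately show ?thesis by (simp add: ennreal_leI)
        qed
        have EA': "(\<integral>\<^sup>+\<omega>. ennreal (A \<omega>) \<partial>M) \<le> ennreal ((9 + 12 * gm + CV + CA) / real N)"
          by (rule order_trans[OF EA ennreal_leI]) (use gm nn in \<open>simp add: n_def divide_right_mono\<close>)
        have EV': "(\<integral>\<^sup>+\<omega>. ennreal (V \<omega>) \<partial>M) \<le> ennreal ((9 + 12 * gm + CV + CA) * real N powr (- 2 * (1 - s)))"
          unfolding n_def[symmetric]
          by (rule order_trans[OF EV ennreal_leI], rule mult_right_mono) (use gm nn in simp_all)
        show ?thesis
          by (intro exI[of _ A] exI[of _ V])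
            (rule conjI[OF A_meas conjI[OF V_meas conjI[OF allI[OF det] conjI[OF EA' EV']]]])
      qed
    qed
  qed
qed

end

section \<open>Initial value and identifiability\<close>

lemma (in prob_space) indep_sum_square:
  fixes Y :: "'i \<Rightarrow> 'a \<Rightarrow> real"
  assumes "finite I" "indep_vars (\<lambda>_. borel) Y I"
    and "\<And>i. i \<in> I \<Longrightarrow> integrable M (\<lambda>\<omega>. (Y i \<omega>)\<^sup>2)" "\<And>i. i \<in> I \<Longrightarrow> expectation (Y i) = 0"
  shows "integrable M (\<lambda>\<omega>. (\<Sum>i\<in>I. Y i \<omega>)\<^sup>2) \<and> integrable M (\<lambda>\<omega>. \<Sum>i\<in>I. Y i \<omega>) \<and>
    expectation (\<lambda>\<omega>. \<Sum>i\<in>I. Y i \<omega>) = 0 \<and>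
    expectation (\<lambda>\<omega>. (\<Sum>i\<in>I. Y i \<omega>)\<^sup>2) = (\<Sum>i\<in>I. expectation (\<lambda>\<omega>. (Y i \<omega>)\<^sup>2))"
  using assms
proof (induction I)
  case empty
  then show ?case by simp
next
  case (insert i I)
  let ?S = "\<lambda>\<omega>. \<Sum>i\<in>I. Y i \<omega>"
  have "indep_vars (\<lambda>_. borel) Y I"
    using insert.prems(1) by (rule indep_vars_subset) auto
  with insert have IH: "integrable M (\<lambda>\<omega>. (?S \<omega>)\<^sup>2)" "integrable M ?S" "expectation ?S = 0"
    "expectation (\<lambda>\<omega>. (?S \<omega>)\<^sup>2) = (\<Sum>i\<in>I. expectation (\<lambda>\<omega>. (Y i \<omega>)\<^sup>2))"
    by auto
  have "Y i \<in> borel_measurable M"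
    using insert.prems(1) by (auto simp: indep_vars_def)
  moreover have Yi2: "integrable M (\<lambda>\<omega>. (Y i \<omega>)\<^sup>2)" using insert.prems(2) by simp
  ultimately have Yi: "integrable M (Y i)" by (rule square_integrable_imp_integrable)
  have ind: "indep_var borel (Y i) borel ?S"
    using insert by (intro indep_vars_sum) auto
  have cross: "integrable M (\<lambda>\<omega>. Y i \<omega> * ?S \<omega>)" "expectation (\<lambda>\<omega>. Y i \<omega> * ?S \<omega>) = 0"
    using indep_var_integrable[OF ind Yi IH(2)] indep_var_lebesgue_integral[OF ind Yi IH(2)] IH(3) by simp_all
  have sq: "(Y i \<omega> + ?S \<omega>)\<^sup>2 = (Y i \<omega>)\<^sup>2 + 2 * (Y i \<omega> * ?S \<omega>) + (?S \<omega>)\<^sup>2" for \<omega>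
    by (simp add: power2_sum)
  have sm: "(\<Sum>i\<in>insert i I. Y i \<omega>) = Y i \<omega> + ?S \<omega>" for \<omega>
    using insert.hyps by simp
  show ?case
    unfolding sm sq using insert.hyps insert.prems(3)[of i] Yi Yi2 cross IH by simp
qed

text \<open>Alternative (i): independent centred coefficients are orthogonal, so the second moment
  of the sum is the sum of the second moments, and the supremum bounds each of these by a constant
  over \<open>h\<close>.\<close>

lemma (in prob_space) centred_sum_bound:
  fixes Y :: "nat \<Rightarrow> nat \<Rightarrow> 'a \<Rightarrow> real" and h :: "nat \<Rightarrow> nat \<Rightarrow> real"
  assumes ind: "indep_vars (\<lambda>_. borel) (\<lambda>(k, l). Y k l) indices"
    and mean: "\<And>k l. 1 \<le> k \<Longrightarrow> 1 \<le> l \<Longrightarrow> expectation (Y k l) = 0"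
    and h: "\<And>k l. 1 \<le> k \<Longrightarrow> 1 \<le> l \<Longrightarrow> 0 < h k l"
    and fin: "(SUP (k, l)\<in>indices. ennreal (h k l) * (\<integral>\<^sup>+\<omega>. ennreal ((Y k l \<omega>)\<^sup>2) \<partial>M)) < \<infinity>"
  shows "\<exists>C\<ge>0. \<forall>F d. finite F \<longrightarrow> F \<subseteq> indices \<longrightarrow>
    (\<integral>\<^sup>+\<omega>. ennreal ((\<Sum>(k, l)\<in>F. d k l * Y k l \<omega>)\<^sup>2) \<partial>M) \<le> ennreal (C * (\<Sum>(k, l)\<in>F. inverse (h k l) * (d k l)\<^sup>2))"
proof -
  obtain C where C: "0 \<le> C" "(SUP (k, l)\<in>indices. ennreal (h k l) * (\<integral>\<^sup>+\<omega>. ennreal ((Y k l \<omega>)\<^sup>2) \<partial>M)) = ennreal C"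
    using fin less_top_ennreal by auto
  have Y_meas: "Y k l \<in> borel_measurable M" if "1 \<le> k" "1 \<le> l" for k l
    using ind that by (auto simp: indep_vars_def)
  have Y2: "integrable M (\<lambda>\<omega>. (Y k l \<omega>)\<^sup>2) \<and> expectation (\<lambda>\<omega>. (Y k l \<omega>)\<^sup>2) \<le> C * inverse (h k l)"
    if kl: "1 \<le> k" "1 \<le> l" for k l
  proof -
    note hp = h[OF kl]
    have "ennreal (h k l) * (\<integral>\<^sup>+\<omega>. ennreal ((Y k l \<omega>)\<^sup>2) \<partial>M) \<le> ennreal C"
      unfolding C(2)[symmetric] using kl by (intro SUP_upper2[of "(k, l)"]) auto
    then have "ennreal (inverse (h k l)) * (ennreal (h k l) * (\<integral>\<^sup>+\<omega>. ennreal ((Y k l \<omega>)\<^sup>2) \<partial>M)) \<le>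
        ennreal (inverse (h k l)) * ennreal C"
      by (rule mult_left_mono) simp
    moreover have "ennreal (inverse (h k l)) * ennreal (h k l) = 1"
      using hp by (simp add: ennreal_mult'[symmetric])
    ultimately have le: "(\<integral>\<^sup>+\<omega>. ennreal ((Y k l \<omega>)\<^sup>2) \<partial>M) \<le> ennreal (C * inverse (h k l))"
      using hp C(1) by (simp add: mult.assoc[symmetric] ennreal_mult' mult.commute)
    then have int: "integrable M (\<lambda>\<omega>. (Y k l \<omega>)\<^sup>2)"
      using Y_meas[OF kl] by (intro integrableI_nonneg) (auto intro: le_less_trans)
    then have "ennreal (expectation (\<lambda>\<omega>. (Y k l \<omega>)\<^sup>2)) \<le> ennreal (C * inverse (h k l))"
      using le by (simp add: nn_integral_eq_integral)
    then show ?thesis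
      using int hp C(1) by (simp add: ennreal_le_iff)
  qed
  have "(\<integral>\<^sup>+\<omega>. ennreal ((\<Sum>(k, l)\<in>F. d k l * Y k l \<omega>)\<^sup>2) \<partial>M) \<le> ennreal (C * (\<Sum>(k, l)\<in>F. inverse (h k l) * (d k l)\<^sup>2))"
    if F: "finite F" "F \<subseteq> indices" for F d
  proof -
    let ?Y = "\<lambda>p \<omega>. d (fst p) (snd p) * Y (fst p) (snd p) \<omega>"
    have kl: "1 \<le> fst p" "1 \<le> snd p" if "p \<in> F" for p using that F(2) by auto
    have "indep_vars (\<lambda>_. borel) (\<lambda>(k, l). Y k l) F"
      using ind F(2) by (rule indep_vars_subset)
    from indep_vars_compose2[OF this, of "\<lambda>p u. d (fst p) (snd p) * u" "\<lambda>_. borel"]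
    have iv: "indep_vars (\<lambda>_. borel) ?Y F" by (simp add: case_prod_unfold)
    have "integrable M (\<lambda>\<omega>. (\<Sum>p\<in>F. ?Y p \<omega>)\<^sup>2) \<and>
        expectation (\<lambda>\<omega>. (\<Sum>p\<in>F. ?Y p \<omega>)\<^sup>2) = (\<Sum>p\<in>F. expectation (\<lambda>\<omega>. (?Y p \<omega>)\<^sup>2))"
      using indep_sum_square[OF F(1) iv] Y2[OF kl] mean[OF kl] by (simp add: power_mult_distrib)
    then have "(\<integral>\<^sup>+\<omega>. ennreal ((\<Sum>p\<in>F. ?Y p \<omega>)\<^sup>2) \<partial>M) = ennreal (\<Sum>p\<in>F. expectation (\<lambda>\<omega>. (?Y p \<omega>)\<^sup>2))"
      by (subst nn_integral_eq_integral) auto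
    also have "(\<Sum>p\<in>F. expectation (\<lambda>\<omega>. (?Y p \<omega>)\<^sup>2)) \<le> (\<Sum>p\<in>F. C * (inverse (h (fst p) (snd p)) * (d (fst p) (snd p))\<^sup>2))"
    proof (rule sum_mono)
      fix p assume p: "p \<in> F"
      have "(d (fst p) (snd p))\<^sup>2 * expectation (\<lambda>\<omega>. (Y (fst p) (snd p) \<omega>)\<^sup>2) \<le>
          (d (fst p) (snd p))\<^sup>2 * (C * inverse (h (fst p) (snd p)))"
        using Y2[OF kl[OF p]] by (intro mult_left_mono) auto
      then show "expectation (\<lambda>\<omega>. (?Y p \<omega>)\<^sup>2) \<le> C * (inverse (h (fst p) (snd p)) * (d (fst p) (snd p))\<^sup>2)"
        by (simp add: power_mult_distrib mult_ac)
    qed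
    finally show ?thesis
      by (simp add: case_prod_unfold sum_distrib_left ennreal_leI)
  qed
  then show ?thesis using C(1) by blast
qed

text \<open>Alternative (ii): Cauchy--Schwarz with weights sqrt h puts \<open>inverse h\<close> on
  the coefficients and leaves the weighted squares of \<open>Y\<close>, whose total expectation is
  the finite series. The outcome has the same form as in the centred case.\<close>

lemma (in prob_space) summable_sum_bound:
  fixes Y :: "nat \<Rightarrow> nat \<Rightarrow> 'a \<Rightarrow> real" and h :: "nat \<Rightarrow> nat \<Rightarrow> real"
  assumes Y_meas: "\<And>k l. 1 \<le> k \<Longrightarrow> 1 \<le> l \<Longrightarrow> Y k l \<in> borel_measurable M"
    and h: "\<And>k l. 1 \<le> k \<Longrightarrow> 1 \<le> l \<Longrightarrow> 0 < h k l"
    and fin: "(\<Sum>\<^sub>\<infinity>(k, l)\<in>indices. ennreal (h k l) * (\<integral>\<^sup>+\<omega>. ennreal ((Y k l \<omega>)\<^sup>2) \<partial>M)) < \<infinity>"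
  shows "\<exists>C\<ge>0. \<forall>F d. finite F \<longrightarrow> F \<subseteq> indices \<longrightarrow>
    (\<integral>\<^sup>+\<omega>. ennreal ((\<Sum>(k, l)\<in>F. d k l * Y k l \<omega>)\<^sup>2) \<partial>M) \<le> ennreal (C * (\<Sum>(k, l)\<in>F. inverse (h k l) * (d k l)\<^sup>2))"
proof -
  let ?t = "\<lambda>p. ennreal (h (fst p) (snd p)) * (\<integral>\<^sup>+\<omega>. ennreal ((Y (fst p) (snd p) \<omega>)\<^sup>2) \<partial>M)"
  obtain C where C: "0 \<le> C" "infsum ?t indices = ennreal C"
    using fin less_top_ennreal by (auto simp: case_prod_unfold)
  have "(\<integral>\<^sup>+\<omega>. ennreal ((\<Sum>(k, l)\<in>F. d k l * Y k l \<omega>)\<^sup>2) \<partial>M) \<le> ennreal (C * (\<Sum>(k, l)\<in>F. inverse (h k l) * (d k l)\<^sup>2))"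
    if F: "finite F" "F \<subseteq> indices" for F d
  proof -
    define D where "D = (\<Sum>p\<in>F. inverse (h (fst p) (snd p)) * (d (fst p) (snd p))\<^sup>2)"
    have hp: "0 < h (fst p) (snd p)" if "p \<in> F" for p using that F(2) h by auto
    have D0: "0 \<le> D"
      unfolding D_def using less_imp_le[OF hp] by (intro sum_nonneg mult_nonneg_nonneg) auto
    have pt: "(\<Sum>(k, l)\<in>F. d k l * Y k l \<omega>)\<^sup>2 \<le> D * (\<Sum>p\<in>F. h (fst p) (snd p) * (Y (fst p) (snd p) \<omega>)\<^sup>2)" for \<omega>
    proof -
      let ?r = "\<lambda>p. sqrt (h (fst p) (snd p))"
      have "(\<Sum>(k, l)\<in>F. d k l * Y k l \<omega>) =
          (\<Sum>p\<in>F. (inverse (?r p) * d (fst p) (snd p)) * (?r p * Y (fst p) (snd p) \<omega>))"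
        unfolding case_prod_unfold
      proof (rule sum.cong)
        fix p assume "p \<in> F"
        then have "?r p \<noteq> 0" using hp[of p] by simp
        then show "d (fst p) (snd p) * Y (fst p) (snd p) \<omega> =
            (inverse (?r p) * d (fst p) (snd p)) * (?r p * Y (fst p) (snd p) \<omega>)"
          by (simp add: field_simps)
      qed simp
      also have "\<dots>\<^sup>2 \<le> (\<Sum>p\<in>F. (inverse (?r p) * d (fst p) (snd p))\<^sup>2) * (\<Sum>p\<in>F. (?r p * Y (fst p) (snd p) \<omega>)\<^sup>2)"
        by (rule Cauchy_Schwarz_ineq_sum)
      also have "(\<Sum>p\<in>F. (inverse (?r p) * d (fst p) (snd p))\<^sup>2) = D"
        unfolding D_def using less_imp_le[OF hp]
        by (intro sum.cong) (auto simp: power_mult_distrib power_inverse)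
      also have "(\<Sum>p\<in>F. (?r p * Y (fst p) (snd p) \<omega>)\<^sup>2) = (\<Sum>p\<in>F. h (fst p) (snd p) * (Y (fst p) (snd p) \<omega>)\<^sup>2)"
        using less_imp_le[OF hp] by (intro sum.cong) (auto simp: power_mult_distrib)
      finally show ?thesis .
    qed
    have "(\<integral>\<^sup>+\<omega>. ennreal ((\<Sum>(k, l)\<in>F. d k l * Y k l \<omega>)\<^sup>2) \<partial>M) \<le>
        (\<integral>\<^sup>+\<omega>. ennreal D * (\<Sum>p\<in>F. ennreal (h (fst p) (snd p)) * ennreal ((Y (fst p) (snd p) \<omega>)\<^sup>2)) \<partial>M)"
    proof (rule nn_integral_mono)
      fix \<omega>
      have "ennreal (D * (\<Sum>p\<in>F. h (fst p) (snd p) * (Y (fst p) (snd p) \<omega>)\<^sup>2)) =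
          ennreal D * (\<Sum>p\<in>F. ennreal (h (fst p) (snd p) * (Y (fst p) (snd p) \<omega>)\<^sup>2))"
        by (subst ennreal_mult'[OF D0], subst sum_ennreal) (use less_imp_le[OF hp] in auto)
      also have "\<dots> = ennreal D * (\<Sum>p\<in>F. ennreal (h (fst p) (snd p)) * ennreal ((Y (fst p) (snd p) \<omega>)\<^sup>2))"
        using less_imp_le[OF hp] by (intro arg_cong2[where f = times] sum.cong) (auto simp: ennreal_mult')
      finally show "ennreal ((\<Sum>(k, l)\<in>F. d k l * Y k l \<omega>)\<^sup>2) \<le>
          ennreal D * (\<Sum>p\<in>F. ennreal (h (fst p) (snd p)) * ennreal ((Y (fst p) (snd p) \<omega>)\<^sup>2))"
        using ennreal_leI[OF pt[of \<omega>]] by simp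
    qed
    also have "\<dots> = ennreal D * (\<Sum>p\<in>F. \<integral>\<^sup>+\<omega>. ennreal (h (fst p) (snd p)) * ennreal ((Y (fst p) (snd p) \<omega>)\<^sup>2) \<partial>M)"
      using Y_meas F(2) by (intro nn_integral_cmult_sum) (auto intro!: borel_measurable_times_ennreal)
    also have "\<dots> = ennreal D * (\<Sum>p\<in>F. ?t p)"
      using Y_meas F(2) by (intro arg_cong2[where f = times] sum.cong refl nn_integral_cmult) auto
    also have "\<dots> \<le> ennreal D * ennreal C"
    proof (rule mult_left_mono)
      have "infsum ?t indices = (SUP F\<in>{F. finite F \<and> F \<subseteq> indices}. sum ?t F)"
        by (rule nonneg_infsum_complete) simp
      then show "(\<Sum>p\<in>F. ?t p) \<le> ennreal C"
        unfolding C(2)[symmetric] using F by (auto intro: SUP_upper)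
    qed simp
    also have "\<dots> = ennreal (C * D)"
      using C(1) D0 by (simp add: ennreal_mult mult.commute)
    finally show ?thesis by (simp add: D_def case_prod_unfold)
  qed
  then show ?thesis using C(1) by blast
qed

section \<open>Equispaced designs and identifiability of the exponential surface\<close>

lemma sum_centred_squares:
  "(\<Sum>j=1..m. (real j - (real m + 1) / 2)\<^sup>2) = real m * ((real m)\<^sup>2 - 1) / 12"
proof -
  have s1: "(\<Sum>j=1..m. real j) = real m * (real m + 1) / 2"
    by (induction m) (auto simp: field_simps)
  have s2: "(\<Sum>j=1..m. (real j)\<^sup>2) = real m * (real m + 1) * (2 * real m + 1) / 6"
    by (induction m) (auto simp: field_simps power2_eq_square)
  have "(\<Sum>j=1..m. (real j - (real m + 1) / 2)\<^sup>2) =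
      (\<Sum>j=1..m. (real j)\<^sup>2 - (real m + 1) * real j + ((real m + 1) / 2)\<^sup>2)"
    by (intro sum.cong) (auto simp: power2_diff)
  also have "\<dots> = (\<Sum>j=1..m. (real j)\<^sup>2) - (real m + 1) * (\<Sum>j=1..m. real j) + real m * ((real m + 1) / 2)\<^sup>2"
    by (simp add: sum.distrib sum_subtractf sum_distrib_left)
  finally show ?thesis
    unfolding s1 s2 by (simp add: power2_eq_square field_simps)
qed

text \<open>The thinned points have a common mesh h, and the two neighbours of the window lie
  outside [\<delta>, 1 - \<delta>], so h (m + 1) > 1 - 2 \<delta>. Around the midpoint
  \<open>yb\<close> the sum of squares is h^2 m (m^2 - 1) / 12. For m \<ge> 2, (m + 1)^2 \<le> 3
  (m^2 - 1), whence 36 = 12 * 3.\<close>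

lemma thin_window_points:
  assumes tw: "thin_window \<delta> M mb J m" and m: "2 \<le> m" and \<delta>: "0 < \<delta>" "\<delta> < 1 / 2"
  obtains yb where "0 \<le> yb" "yb \<le> 1" "(\<Sum>j=1..m. thin M mb (J + j) - yb) = 0"
    "real m * ((1 - 2 * \<delta>)\<^sup>2 / 36) \<le> (\<Sum>j=1..m. (thin M mb (J + j) - yb)\<^sup>2)"
    "\<And>j. j \<in> {1..m} \<Longrightarrow> \<delta> \<le> thin M mb (J + j) \<and> thin M mb (J + j) \<le> 1 - \<delta>"
proof -
  define h where "h = real (M div mb) / real M"
  have t: "thin M mb j = h * real j" for j by (simp add: thin_def h_def)
  have w: "h * real J < \<delta>" "\<delta> \<le> h * real (J + 1)" "h * real (J + m) \<le> 1 - \<delta>" "1 - \<delta> < h * real (J + m + 1)"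
    using tw unfolding thin_window_def t by auto
  have h0: "0 \<le> h" by (simp add: h_def)
  have range: "\<delta> \<le> h * real (J + j) \<and> h * real (J + j) \<le> 1 - \<delta>" if "j \<in> {1..m}" for j
  proof -
    have "h * real (J + 1) \<le> h * real (J + j)" "h * real (J + j) \<le> h * real (J + m)"
      using that h0 by (intro mult_left_mono; simp)+
    then show ?thesis using w by linarith
  qed
  define yb where "yb = h * (real J + (real m + 1) / 2)"
  have dev: "thin M mb (J + j) - yb = h * (real j - (real m + 1) / 2)" for j
    by (simp add: t yb_def algebra_simps)
  have s1: "(\<Sum>j=1..m. real j) = real m * (real m + 1) / 2"
    by (induction m) (auto simp: field_simps)
  have zero: "(\<Sum>j=1..m. thin M mb (J + j) - yb) = 0"
    unfolding dev sum_distrib_left[symmetric] sum_subtractf s1 by simp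
  have "1 - 2 * \<delta> < h * (real m + 1)"
    using w by (simp add: algebra_simps)
  then have hm: "(1 - 2 * \<delta>)\<^sup>2 \<le> (h * (real m + 1))\<^sup>2"
    using \<delta> by (intro power_mono) auto
  have "(real m + 1)\<^sup>2 \<le> 3 * ((real m)\<^sup>2 - 1)"
  proof -
    have "0 \<le> (real m - 2) * (real m + 1)" using m by simp
    then show ?thesis by (simp add: power2_eq_square algebra_simps)
  qed
  then have "h\<^sup>2 * (real m + 1)\<^sup>2 \<le> h\<^sup>2 * (3 * ((real m)\<^sup>2 - 1))"
    by (rule mult_left_mono) simp
  then have "(1 - 2 * \<delta>)\<^sup>2 \<le> h\<^sup>2 * (3 * ((real m)\<^sup>2 - 1))"
    using hm by (simp add: power_mult_distrib)
  then have "real m * (1 - 2 * \<delta>)\<^sup>2 \<le> real m * (h\<^sup>2 * (3 * ((real m)\<^sup>2 - 1)))"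
    by (rule mult_left_mono) simp
  then have le: "real m * (1 - 2 * \<delta>)\<^sup>2 / 36 \<le> real m * (h\<^sup>2 * (3 * ((real m)\<^sup>2 - 1))) / 36"
    by (rule divide_right_mono) simp
  have "real m * (h\<^sup>2 * (3 * Q)) / 36 = h\<^sup>2 * (real m * Q / 12)" for Q :: real
    by simp
  with le have spread: "real m * ((1 - 2 * \<delta>)\<^sup>2 / 36) \<le> (\<Sum>j=1..m. (thin M mb (J + j) - yb)\<^sup>2)"
    unfolding dev power_mult_distrib sum_distrib_left[symmetric] sum_centred_squares
    by (simp only: times_divide_eq_right)
  have yb: "2 * yb = h * real (J + 1) + h * real (J + m)"
    by (simp add: yb_def algebra_simps)
  have "\<delta> \<le> h * real (J + 1)" "h * real (J + 1) \<le> 1 - \<delta>" "\<delta> \<le> h * real (J + m)" "h * real (J + m) \<le> 1 - \<delta>"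
    using range[of 1] range[of m] m by auto
  then have "0 \<le> yb" "yb \<le> 1" using \<delta> yb by linarith+
  then show ?thesis
    using that[OF _ _ zero spread] range unfolding t by blast
qed

text \<open>After centring, the constant and the two coordinates are orthogonal on the product grid,
  so the sum of squares is diagonal in A, b and c, where A is the value at the centre. Recovering
  \<open>a\<close> from A costs a factor 3; the 4 is this 3 plus the term b^2 or c^2 itself.\<close>

lemma affine_least_squares:
  fixes a b c v yb zb :: real and y z :: "nat \<Rightarrow> real"
  assumes v: "0 < v" and yb: "0 \<le> yb" "yb \<le> 1" and zb: "0 \<le> zb" "zb \<le> 1"
    and y: "(\<Sum>j=1..m1. y j - yb) = 0" "real m1 * v \<le> (\<Sum>j=1..m1. (y j - yb)\<^sup>2)"
    and z: "(\<Sum>j=1..m2. z j - zb) = 0" "real m2 * v \<le> (\<Sum>j=1..m2. (z j - zb)\<^sup>2)"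
  shows "real (m1 * m2) * (a\<^sup>2 + b\<^sup>2 + c\<^sup>2) \<le>
    (3 + 4 / v) * (\<Sum>j1=1..m1. \<Sum>j2=1..m2. (a + b * y j1 + c * z j2)\<^sup>2)"
proof -
  define A where "A = a + b * yb + c * zb"
  define Y where "Y j = y j - yb" for j
  define Z where "Z j = z j - zb" for j
  have sq: "(a + b * y i + c * z j)\<^sup>2 =
      A\<^sup>2 + b\<^sup>2 * (Y i)\<^sup>2 + c\<^sup>2 * (Z j)\<^sup>2 + 2 * A * b * Y i + 2 * A * c * Z j + 2 * b * c * (Y i * Z j)" for i j
    by (simp add: A_def Y_def Z_def power2_eq_square algebra_simps)
  have "(\<Sum>j1=1..m1. \<Sum>j2=1..m2. (a + b * y j1 + c * z j2)\<^sup>2) =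
      real m1 * real m2 * A\<^sup>2 + real m2 * b\<^sup>2 * (\<Sum>j=1..m1. (Y j)\<^sup>2) + real m1 * c\<^sup>2 * (\<Sum>j=1..m2. (Z j)\<^sup>2)
      + 2 * A * b * real m2 * (\<Sum>j=1..m1. Y j) + 2 * A * c * real m1 * (\<Sum>j=1..m2. Z j)
      + 2 * b * c * ((\<Sum>j=1..m1. Y j) * (\<Sum>j=1..m2. Z j))"
    unfolding sq sum.distrib sum_product by (simp add: sum_distrib_left mult_ac)
  also have "\<dots> = real m1 * real m2 * A\<^sup>2 + real m2 * b\<^sup>2 * (\<Sum>j=1..m1. (Y j)\<^sup>2) + real m1 * c\<^sup>2 * (\<Sum>j=1..m2. (Z j)\<^sup>2)"
    using y(1) z(1) by (simp add: Y_def Z_def)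
  also have "\<dots> \<ge> real m1 * real m2 * A\<^sup>2 + real m2 * b\<^sup>2 * (real m1 * v) + real m1 * c\<^sup>2 * (real m2 * v)"
    using y(2) z(2) by (intro add_mono mult_left_mono order_refl) (auto simp: Y_def Z_def)
  finally have low: "real (m1 * m2) * (A\<^sup>2 + v * b\<^sup>2 + v * c\<^sup>2) \<le>
      (\<Sum>j1=1..m1. \<Sum>j2=1..m2. (a + b * y j1 + c * z j2)\<^sup>2)"
    by (simp add: algebra_simps)
  have "a\<^sup>2 + b\<^sup>2 + c\<^sup>2 \<le> (3 + 4 / v) * (A\<^sup>2 + v * b\<^sup>2 + v * c\<^sup>2)"
  proof -
    have three: "(u1 + u2 + u3)\<^sup>2 \<le> 3 * (u1\<^sup>2 + u2\<^sup>2 + u3\<^sup>2)" for u1 u2 u3 :: real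
      using zero_le_power2[of "u1 - u2"] zero_le_power2[of "u2 - u3"] zero_le_power2[of "u1 - u3"]
      by (simp add: power2_eq_square algebra_simps)
    have "a\<^sup>2 = (A + (- b * yb) + (- c * zb))\<^sup>2" by (simp add: A_def)
    also have "\<dots> \<le> 3 * (A\<^sup>2 + (- b * yb)\<^sup>2 + (- c * zb)\<^sup>2)" by (rule three)
    finally have "a\<^sup>2 \<le> 3 * (A\<^sup>2 + b\<^sup>2 * yb\<^sup>2 + c\<^sup>2 * zb\<^sup>2)" by (simp add: power_mult_distrib)
    then have "a\<^sup>2 \<le> 3 * A\<^sup>2 + 3 * (b\<^sup>2 * yb\<^sup>2) + 3 * (c\<^sup>2 * zb\<^sup>2)" by (simp only: distrib_left)
    moreover have "b\<^sup>2 * yb\<^sup>2 \<le> b\<^sup>2" "c\<^sup>2 * zb\<^sup>2 \<le> c\<^sup>2"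
      using yb zb by (auto intro!: mult_left_le simp: power_le_one)
    ultimately have "a\<^sup>2 + b\<^sup>2 + c\<^sup>2 \<le> 3 * A\<^sup>2 + 4 * b\<^sup>2 + 4 * c\<^sup>2" by linarith
    also have "\<dots> \<le> (3 + 4 / v) * A\<^sup>2 + (3 * v + 4) * b\<^sup>2 + (3 * v + 4) * c\<^sup>2"
      using v by (intro add_mono mult_right_mono) auto
    also have "\<dots> = (3 + 4 / v) * (A\<^sup>2 + v * b\<^sup>2 + v * c\<^sup>2)"
      using v by (simp add: distrib_left distrib_right mult.assoc[symmetric])
    finally show ?thesis .
  qed
  then have "real (m1 * m2) * (a\<^sup>2 + b\<^sup>2 + c\<^sup>2) \<le> real (m1 * m2) * ((3 + 4 / v) * (A\<^sup>2 + v * b\<^sup>2 + v * c\<^sup>2))"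
    by (rule mult_left_mono) simp
  also have "\<dots> = (3 + 4 / v) * (real (m1 * m2) * (A\<^sup>2 + v * b\<^sup>2 + v * c\<^sup>2))"
    by simp
  also have "\<dots> \<le> (3 + 4 / v) * (\<Sum>j1=1..m1. \<Sum>j2=1..m2. (a + b * y j1 + c * z j2)\<^sup>2)"
    using low v by (intro mult_left_mono) auto
  finally show ?thesis .
qed

definition exp_model :: "real \<Rightarrow> real \<times> real \<times> real \<Rightarrow> real \<Rightarrow> real \<Rightarrow> real" where
  "exp_model c v y z = c * fst v * exp (- (fst (snd v) * y + snd (snd v) * z))"

lemma exp_diff_ge:
  fixes u u' L :: real
  assumes "0 \<le> L" "L \<le> exp u" "L \<le> exp u'"
  shows "L * \<bar>u - u'\<bar> \<le> \<bar>exp u - exp u'\<bar>"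
proof -
  have *: "L * (x - x') \<le> exp x - exp x'" if "x' \<le> x" "L \<le> exp x'" for x x'
  proof -
    have "L * (x - x') \<le> exp x' * (x - x')" using that by (intro mult_right_mono) auto
    also have "\<dots> \<le> exp x' * (exp (x - x') - 1)"
    proof (rule mult_left_mono)
      show "x - x' \<le> exp (x - x') - 1" using exp_ge_add_one_self[of "x - x'"] by linarith
    qed simp
    also have "\<dots> = exp x - exp x'" by (simp add: right_diff_distrib exp_add[symmetric])
    finally show ?thesis .
  qed
  show ?thesis
    using *[of u' u] *[of u u'] assms by (cases "u' \<le> u") auto
qed

text \<open>The model is the exponential of an affine function only in terms of ln S; this bound
  leads back from ln S to S.\<close>

lemma ln_diff_ge:
  fixes s t B :: real
  assumes "0 < s" "0 < t" "s \<le> B" "t \<le> B"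
  shows "\<bar>s - t\<bar> \<le> B * \<bar>ln s - ln t\<bar>"
proof -
  have *: "x - y \<le> B * (ln x - ln y)" if "0 < y" "y \<le> x" "x \<le> B" for x y
  proof -
    have "ln (y / x) \<le> y / x - 1" using that by (intro ln_le_minus_one) auto
    then have "(x - y) / x \<le> ln x - ln y" using that by (simp add: ln_div diff_divide_distrib)
    then have "x - y \<le> x * (ln x - ln y)" using that by (simp add: field_simps)
    also have "\<dots> \<le> B * (ln x - ln y)" using that by (intro mult_right_mono) auto
    finally show ?thesis .
  qed
  show ?thesis
    using *[of t s] *[of s t] assms by (cases "t \<le> s") auto
qed

text \<open>Up to an additive constant, the logarithm of the surface is affine in (ln S, \<kappa>,
  \<eta>), and on the compact range exp and ln distort distances by bounded factors, so
  \<open>affine_least_squares\<close> applies. The bound holds on all of \<Xi>, not only near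
  \<open>v0\<close>; hence the rate follows without a preceding consistency step. Two points in each
  direction separate the parameters: at a single ordinate y, S and \<kappa> enter only through S
  exp(-\<kappa> y).\<close>

lemma exp_model_identifiable:
  fixes \<Xi> :: "(real \<times> real \<times> real) set"
  assumes \<Xi>: "compact \<Xi>" "\<Xi> \<subseteq> {0<..} \<times> UNIV" "v0 \<in> \<Xi>" and C0: "0 < C0" and \<delta>: "0 < \<delta>" "\<delta> < 1 / 2"
  shows "\<exists>c>0. \<forall>M1 mb1 J1 m1 M2 mb2 J2 m2. \<forall>v\<in>\<Xi>. thin_window \<delta> M1 mb1 J1 m1 \<longrightarrow> thin_window \<delta> M2 mb2 J2 m2 \<longrightarrow>
    2 \<le> m1 \<longrightarrow> 2 \<le> m2 \<longrightarrow> c * real (m1 * m2) * (norm (v - v0))\<^sup>2 \<le>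
      (\<Sum>j1=1..m1. \<Sum>j2=1..m2. (exp_model C0 v (thin M1 mb1 (J1 + j1)) (thin M2 mb2 (J2 + j2))
        - exp_model C0 v0 (thin M1 mb1 (J1 + j1)) (thin M2 mb2 (J2 + j2)))\<^sup>2)"
proof -
  obtain vm where vm: "vm \<in> \<Xi>" "\<And>v. v \<in> \<Xi> \<Longrightarrow> fst vm \<le> fst v"
  proof -
    have "continuous_on \<Xi> fst" "\<Xi> \<noteq> {}" using \<Xi>(3) by (auto intro!: continuous_intros)
    from continuous_attains_inf[OF \<Xi>(1) this(2,1)] show ?thesis using that by blast
  qed
  have vm0: "0 < fst vm" using vm(1) \<Xi>(2) by auto
  obtain B where B: "\<And>v. v \<in> \<Xi> \<Longrightarrow> norm v \<le> B"
    using compact_imp_bounded[OF \<Xi>(1)] by (auto simp: bounded_iff)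
  have bd: "fst vm \<le> fst v" "fst v \<le> B" "\<bar>fst (snd v)\<bar> \<le> B" "\<bar>snd (snd v)\<bar> \<le> B" if "v \<in> \<Xi>" for v
  proof -
    have "norm (fst v) \<le> B" "norm (snd v) \<le> B"
      using B[OF that] norm_fst_le[of "fst v" "snd v"] norm_snd_le[of "snd v" "fst v"] by auto
    moreover have "norm (fst (snd v)) \<le> norm (snd v)" "norm (snd (snd v)) \<le> norm (snd v)"
      using norm_fst_le[of "fst (snd v)" "snd (snd v)"] norm_snd_le[of "snd (snd v)" "fst (snd v)"] by auto
    ultimately show "fst vm \<le> fst v" "fst v \<le> B" "\<bar>fst (snd v)\<bar> \<le> B" "\<bar>snd (snd v)\<bar> \<le> B"
      using vm(2)[OF that] by auto
  qed
  \<comment> \<open>A lower bound for S exp(-(\<kappa> y + \<eta> z)) on the unit square, both rates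
    being at most \<open>B\<close> in absolute value.\<close>
  define L where "L = fst vm * exp (- (2 * B))"
  have L: "0 < L" using vm0 by (simp add: L_def)
  define u where "u v y z = ln (fst v) - (fst (snd v) * y + snd (snd v) * z)" for v :: "real \<times> real \<times> real" and y z
  have exp_u: "exp (u v y z) = fst v * exp (- (fst (snd v) * y + snd (snd v) * z))" if "v \<in> \<Xi>" for v y z
  proof -
    have "exp (ln (fst v)) = fst v" using bd(1)[OF that] vm0 by simp
    then show ?thesis
      unfolding u_def diff_conv_add_uminus exp_add[of "ln (fst v)"] by simp
  qed
  have model: "exp_model C0 v y z = C0 * exp (u v y z)" if "v \<in> \<Xi>" for v y z
    unfolding exp_model_def exp_u[OF that] by simp
  have L_le: "L \<le> exp (u v y z)" if "v \<in> \<Xi>" "0 \<le> y" "y \<le> 1" "0 \<le> z" "z \<le> 1" for v y z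
  proof -
    have "\<bar>fst (snd v) * y\<bar> \<le> B" "\<bar>snd (snd v) * z\<bar> \<le> B"
      using bd(3,4)[OF that(1)] that mult_left_le[of y "\<bar>fst (snd v)\<bar>"] mult_left_le[of z "\<bar>snd (snd v)\<bar>"]
      by (auto simp: abs_mult)
    then have "exp (- (2 * B)) \<le> exp (- (fst (snd v) * y + snd (snd v) * z))" by simp
    then have "L \<le> fst v * exp (- (fst (snd v) * y + snd (snd v) * z))"
      unfolding L_def using bd(1)[OF that(1)] vm0 by (intro mult_mono) auto
    also have "\<dots> = exp (u v y z)"
      by (rule exp_u[OF that(1), symmetric])
    finally show ?thesis .
  qed
  define V where "V = (1 - 2 * \<delta>)\<^sup>2 / 36"
  have V: "0 < V" using \<delta> by (simp add: V_def)
  \<comment> \<open>3 + 4 / V comes from the affine problem, 1 + B^2 from the return from ln S to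
    S.\<close>
  define K where "K = (3 + 4 / V) * (1 + B\<^sup>2)"
  have K: "0 < K" using V by (auto simp: K_def intro!: mult_pos_pos add_pos_pos add_pos_nonneg)
  have main: "(C0 * L)\<^sup>2 / K * real (m1 * m2) * (norm (v - v0))\<^sup>2 \<le>
      (\<Sum>j1=1..m1. \<Sum>j2=1..m2. (exp_model C0 v (thin M1 mb1 (J1 + j1)) (thin M2 mb2 (J2 + j2))
        - exp_model C0 v0 (thin M1 mb1 (J1 + j1)) (thin M2 mb2 (J2 + j2)))\<^sup>2)"
    if v: "v \<in> \<Xi>" and tw: "thin_window \<delta> M1 mb1 J1 m1" "thin_window \<delta> M2 mb2 J2 m2" and m: "2 \<le> m1" "2 \<le> m2"
    for M1 mb1 J1 m1 M2 mb2 J2 m2 v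
  proof -
    obtain yb where yb: "0 \<le> yb" "yb \<le> 1" "(\<Sum>j=1..m1. thin M1 mb1 (J1 + j) - yb) = 0"
      "real m1 * V \<le> (\<Sum>j=1..m1. (thin M1 mb1 (J1 + j) - yb)\<^sup>2)"
      "\<And>j. j \<in> {1..m1} \<Longrightarrow> \<delta> \<le> thin M1 mb1 (J1 + j) \<and> thin M1 mb1 (J1 + j) \<le> 1 - \<delta>"
      unfolding V_def by (fact thin_window_points[OF tw(1) m(1) \<delta>])
    obtain zb where zb: "0 \<le> zb" "zb \<le> 1" "(\<Sum>j=1..m2. thin M2 mb2 (J2 + j) - zb) = 0"
      "real m2 * V \<le> (\<Sum>j=1..m2. (thin M2 mb2 (J2 + j) - zb)\<^sup>2)"
      "\<And>j. j \<in> {1..m2} \<Longrightarrow> \<delta> \<le> thin M2 mb2 (J2 + j) \<and> thin M2 mb2 (J2 + j) \<le> 1 - \<delta>"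
      unfolding V_def by (fact thin_window_points[OF tw(2) m(2) \<delta>])
    define a where "a = ln (fst v) - ln (fst v0)"
    define b where "b = - (fst (snd v) - fst (snd v0))"
    define c where "c = - (snd (snd v) - snd (snd v0))"
    have "(norm (v - v0))\<^sup>2 = (fst v - fst v0)\<^sup>2 + b\<^sup>2 + c\<^sup>2"
      by (simp add: norm_prod_def b_def c_def power2_commute)
    also have "(fst v - fst v0)\<^sup>2 \<le> (B * \<bar>a\<bar>)\<^sup>2"
      unfolding a_def power2_abs[of "fst v - fst v0", symmetric]
      using bd[OF v] bd[OF \<Xi>(3)] vm0 by (intro power_mono ln_diff_ge) auto
    finally have "(norm (v - v0))\<^sup>2 \<le> B\<^sup>2 * a\<^sup>2 + b\<^sup>2 + c\<^sup>2" by (simp add: power_mult_distrib)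
    also have "\<dots> \<le> (1 + B\<^sup>2) * a\<^sup>2 + (1 + B\<^sup>2) * b\<^sup>2 + (1 + B\<^sup>2) * c\<^sup>2"
      by (simp add: distrib_right)
    finally have nrm: "(norm (v - v0))\<^sup>2 \<le> (1 + B\<^sup>2) * (a\<^sup>2 + b\<^sup>2 + c\<^sup>2)" by (simp add: distrib_left)
    define D where "D = (\<Sum>j1=1..m1. \<Sum>j2=1..m2. (a + b * thin M1 mb1 (J1 + j1) + c * thin M2 mb2 (J2 + j2))\<^sup>2)"
    have "real (m1 * m2) * (norm (v - v0))\<^sup>2 \<le> (1 + B\<^sup>2) * (real (m1 * m2) * (a\<^sup>2 + b\<^sup>2 + c\<^sup>2))"
      using mult_left_mono[OF nrm, of "real (m1 * m2)"] by (simp only: mult.left_commute of_nat_0_le_iff)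
    also have "\<dots> \<le> (1 + B\<^sup>2) * ((3 + 4 / V) * D)"
      unfolding D_def using yb zb V by (intro mult_left_mono affine_least_squares) auto
    finally have "real (m1 * m2) * (norm (v - v0))\<^sup>2 \<le> K * D"
      by (simp only: K_def mult_ac)
    then have "(C0 * L)\<^sup>2 / K * (real (m1 * m2) * (norm (v - v0))\<^sup>2) \<le> (C0 * L)\<^sup>2 / K * (K * D)"
      using K by (intro mult_left_mono) auto
    also have "\<dots> = (C0 * L)\<^sup>2 * D" using K by simp
    also have "\<dots> \<le> (\<Sum>j1=1..m1. \<Sum>j2=1..m2. (exp_model C0 v (thin M1 mb1 (J1 + j1)) (thin M2 mb2 (J2 + j2))
        - exp_model C0 v0 (thin M1 mb1 (J1 + j1)) (thin M2 mb2 (J2 + j2)))\<^sup>2)"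
      unfolding D_def sum_distrib_left
    proof (intro sum_mono)
      fix j1 j2 assume j: "j1 \<in> {1..m1}" "j2 \<in> {1..m2}"
      let ?y = "thin M1 mb1 (J1 + j1)" and ?z = "thin M2 mb2 (J2 + j2)"
      have "L * \<bar>u v ?y ?z - u v0 ?y ?z\<bar> \<le> \<bar>exp (u v ?y ?z) - exp (u v0 ?y ?z)\<bar>"
        using yb(5)[OF j(1)] zb(5)[OF j(2)] \<delta> L v \<Xi>(3) by (intro exp_diff_ge L_le) auto
      then have "C0 * (L * \<bar>u v ?y ?z - u v0 ?y ?z\<bar>) \<le> C0 * \<bar>exp (u v ?y ?z) - exp (u v0 ?y ?z)\<bar>"
        using C0 by (intro mult_left_mono) auto
      also have "\<dots> = \<bar>exp_model C0 v ?y ?z - exp_model C0 v0 ?y ?z\<bar>"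
        unfolding model[OF v] model[OF \<Xi>(3)] right_diff_distrib[symmetric] using C0 by (simp add: abs_mult)
      finally have "(C0 * (L * \<bar>u v ?y ?z - u v0 ?y ?z\<bar>))\<^sup>2 \<le> \<bar>exp_model C0 v ?y ?z - exp_model C0 v0 ?y ?z\<bar>\<^sup>2"
        using C0 L by (intro power_mono) auto
      moreover have "u v ?y ?z - u v0 ?y ?z = a + b * ?y + c * ?z"
        by (simp add: u_def a_def b_def c_def algebra_simps)
      ultimately show "(C0 * L)\<^sup>2 * (a + b * ?y + c * ?z)\<^sup>2 \<le> (exp_model C0 v ?y ?z - exp_model C0 v0 ?y ?z)\<^sup>2"
        by (simp add: power_mult_distrib mult.assoc)
    qed
    finally show ?thesis by (simp only: mult.assoc)
  qed
  show ?thesis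
    by (rule exI[of _ "(C0 * L)\<^sup>2 / K"]) (use main C0 L K in auto)
qed

lemma (in prob_space) prob_gt_le:
  fixes u :: "'a \<Rightarrow> real"
  assumes [measurable]: "u \<in> borel_measurable M" and "(\<integral>\<^sup>+\<omega>. ennreal (u \<omega>) \<partial>M) \<le> ennreal e" "0 \<le> e" "0 < t"
  shows "measure M {\<omega>\<in>space M. t < u \<omega>} \<le> e / t"
proof -
  let ?A = "{\<omega>\<in>space M. t < u \<omega>}"
  have "ennreal t * emeasure M ?A = (\<integral>\<^sup>+\<omega>. ennreal t * indicator ?A \<omega> \<partial>M)"
    by (rule nn_integral_cmult_indicator[symmetric]) measurable
  also have "\<dots> \<le> (\<integral>\<^sup>+\<omega>. ennreal (u \<omega>) \<partial>M)"
    by (intro nn_integral_mono) (auto simp: indicator_def intro!: ennreal_leI)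
  also have "\<dots> \<le> ennreal e" by fact
  finally have "ennreal (t * measure M ?A) \<le> ennreal e"
    using assms(4) by (simp add: emeasure_eq_measure ennreal_mult)
  then show ?thesis
    using assms(3,4) by (simp add: ennreal_le_iff field_simps)
qed

lemma least_squares_comparison:
  fixes Z f g :: "'i \<Rightarrow> real"
  assumes "(\<Sum>i\<in>A. (Z i - f i)\<^sup>2) \<le> (\<Sum>i\<in>A. (Z i - g i)\<^sup>2)"
  shows "(\<Sum>i\<in>A. (f i - g i)\<^sup>2) \<le> 4 * (\<Sum>i\<in>A. (Z i - g i)\<^sup>2)"
proof -
  have "(f i - g i)\<^sup>2 \<le> 2 * (Z i - f i)\<^sup>2 + 2 * (Z i - g i)\<^sup>2" for i
    using zero_le_power2[of "(Z i - f i) + (Z i - g i)"] by (simp add: power2_eq_square algebra_simps)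
  then have "(\<Sum>i\<in>A. (f i - g i)\<^sup>2) \<le> (\<Sum>i\<in>A. 2 * (Z i - f i)\<^sup>2 + 2 * (Z i - g i)\<^sup>2)"
    by (intro sum_mono)
  also have "\<dots> = 2 * (\<Sum>i\<in>A. (Z i - f i)\<^sup>2) + 2 * (\<Sum>i\<in>A. (Z i - g i)\<^sup>2)"
    by (simp add: sum.distrib sum_distrib_left)
  finally show ?thesis using assms by simp
qed

section \<open>Rate of the estimator\<close>

context spde_field
begin

text \<open>Summation over the design keeps the form of the pointwise bound, because squares of
  nonnegative numbers sum to at most the square of their sum. The square of the total then carries
  m^2 instead of m, which \<rho> < 1 makes affordable in \<open>estimator_rate\<close>.\<close>

lemma total_error:
  assumes s: "\<alpha> \<le> s" "1 / 2 < s" "s < 1" and \<delta>: "0 < \<delta>" "\<delta> < 1 / 2"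
  shows "\<exists>C\<ge>0. \<forall>N>0. \<forall>P. finite P \<longrightarrow> P \<subseteq> {\<delta>..1 - \<delta>} \<times> {\<delta>..1 - \<delta>} \<longrightarrow>
    (\<exists>A V. A \<in> borel_measurable M \<and> V \<in> borel_measurable M \<and>
      (\<forall>\<omega>. 0 \<le> A \<omega> \<and> 0 \<le> V \<omega> \<and>
        (\<Sum>p\<in>P. (realized_vol \<alpha> X N p \<omega> - limit_vol p)\<^sup>2) \<le> C * (A \<omega> + (A \<omega>)\<^sup>2 + V \<omega>)) \<and>
      (\<integral>\<^sup>+\<omega>. ennreal (A \<omega>) \<partial>M) \<le> ennreal (real (card P) * (C / real N)) \<and>
      (\<integral>\<^sup>+\<omega>. ennreal (V \<omega>) \<partial>M) \<le> ennreal (real (card P) * (C * real N powr (- 2 * (1 - s)))))"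
proof (rule pointwise_error[OF s \<delta>])
  fix C :: real
  assume C0: "0 \<le> C" and C: "\<And>N y z. 0 < N \<Longrightarrow> \<delta> \<le> y \<Longrightarrow> y \<le> 1 - \<delta> \<Longrightarrow> \<delta> \<le> z \<Longrightarrow> z \<le> 1 - \<delta> \<Longrightarrow>
      \<exists>A V. A \<in> borel_measurable M \<and> V \<in> borel_measurable M \<and>
        (\<forall>\<omega>. 0 \<le> A \<omega> \<and> 0 \<le> V \<omega> \<and>
          (realized_vol \<alpha> X N (y, z) \<omega> - limit_vol (y, z))\<^sup>2 \<le> C * (A \<omega> + (A \<omega>)\<^sup>2 + V \<omega>)) \<and>
        (\<integral>\<^sup>+\<omega>. ennreal (A \<omega>) \<partial>M) \<le> ennreal (C / real N) \<and>
        (\<integral>\<^sup>+\<omega>. ennreal (V \<omega>) \<partial>M) \<le> ennreal (C * real N powr (- 2 * (1 - s)))"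
  show ?thesis
  proof (rule exI[of _ C], intro conjI C0 allI impI)
    fix N :: nat and P :: "(real \<times> real) set"
    assume N: "0 < N" and P: "finite P" "P \<subseteq> {\<delta>..1 - \<delta>} \<times> {\<delta>..1 - \<delta>}"
    define Q where "Q p A V \<longleftrightarrow> A \<in> borel_measurable M \<and> V \<in> borel_measurable M \<and>
        (\<forall>\<omega>. 0 \<le> A \<omega> \<and> 0 \<le> V \<omega> \<and>
          (realized_vol \<alpha> X N p \<omega> - limit_vol p)\<^sup>2 \<le> C * (A \<omega> + (A \<omega>)\<^sup>2 + V \<omega>)) \<and>
        (\<integral>\<^sup>+\<omega>. ennreal (A \<omega>) \<partial>M) \<le> ennreal (C / real N) \<and>
        (\<integral>\<^sup>+\<omega>. ennreal (V \<omega>) \<partial>M) \<le> ennreal (C * real N powr (- 2 * (1 - s)))" for p A V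
    define A where "A p = (SOME A. \<exists>V. Q p A V)" for p
    define V where "V p = (SOME V. Q p (A p) V)" for p
    have QAV: "Q p (A p) (V p)" if "p \<in> P" for p
    proof -
      obtain y z where p: "p = (y, z)" by (cases p)
      have yz: "\<delta> \<le> y" "y \<le> 1 - \<delta>" "\<delta> \<le> z" "z \<le> 1 - \<delta>" using that P(2) by (auto simp: p)
      have "\<exists>A V. Q p A V" unfolding Q_def p by (rule C[OF N yz])
      then have "\<exists>V. Q p (A p) V" unfolding A_def by (rule someI_ex)
      then show ?thesis unfolding V_def by (rule someI_ex)
    qed
    note AV = QAV[unfolded Q_def]
    define SA where "SA \<omega> = (\<Sum>p\<in>P. A p \<omega>)" for \<omega>
    define SV where "SV \<omega> = (\<Sum>p\<in>P. V p \<omega>)" for \<omega>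
    have "SA \<in> borel_measurable M" "SV \<in> borel_measurable M"
      unfolding SA_def[abs_def] SV_def[abs_def] using AV by (auto intro!: borel_measurable_sum)
    moreover have "0 \<le> SA \<omega> \<and> 0 \<le> SV \<omega> \<and>
        (\<Sum>p\<in>P. (realized_vol \<alpha> X N p \<omega> - limit_vol p)\<^sup>2) \<le> C * (SA \<omega> + (SA \<omega>)\<^sup>2 + SV \<omega>)" for \<omega>
    proof -
      have nn: "0 \<le> A p \<omega>" "0 \<le> V p \<omega>" if "p \<in> P" for p using AV[OF that] by auto
      have SA0: "0 \<le> SA \<omega>" "0 \<le> SV \<omega>" unfolding SA_def SV_def using nn by (auto intro!: sum_nonneg)
      have "(\<Sum>p\<in>P. (A p \<omega>)\<^sup>2) \<le> (\<Sum>p\<in>P. A p \<omega> * SA \<omega>)"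
        unfolding power2_eq_square SA_def using nn P(1) by (intro sum_mono mult_left_mono member_le_sum) auto
      also have "\<dots> = (SA \<omega>)\<^sup>2" by (simp add: SA_def sum_distrib_right power2_eq_square)
      finally have sq: "(\<Sum>p\<in>P. (A p \<omega>)\<^sup>2) \<le> (SA \<omega>)\<^sup>2" .
      have "(\<Sum>p\<in>P. (realized_vol \<alpha> X N p \<omega> - limit_vol p)\<^sup>2) \<le> (\<Sum>p\<in>P. C * (A p \<omega> + (A p \<omega>)\<^sup>2 + V p \<omega>))"
        using AV by (intro sum_mono) auto
      also have "\<dots> = C * (SA \<omega> + (\<Sum>p\<in>P. (A p \<omega>)\<^sup>2) + SV \<omega>)"
        by (simp add: sum_distrib_left[symmetric] sum.distrib SA_def SV_def)
      also have "\<dots> \<le> C * (SA \<omega> + (SA \<omega>)\<^sup>2 + SV \<omega>)"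
        using sq C0 by (intro mult_left_mono) auto
      finally show ?thesis using SA0 by simp
    qed
    moreover have "(\<integral>\<^sup>+\<omega>. ennreal (\<Sum>p\<in>P. B p \<omega>) \<partial>M) \<le> ennreal (real (card P) * e)"
      if B: "\<And>p. p \<in> P \<Longrightarrow> B p \<in> borel_measurable M" "\<And>p \<omega>. p \<in> P \<Longrightarrow> 0 \<le> B p \<omega>"
        "\<And>p. p \<in> P \<Longrightarrow> (\<integral>\<^sup>+\<omega>. ennreal (B p \<omega>) \<partial>M) \<le> ennreal e" "0 \<le> e" for B e
    proof -
      have "(\<integral>\<^sup>+\<omega>. ennreal (\<Sum>p\<in>P. B p \<omega>) \<partial>M) = (\<integral>\<^sup>+\<omega>. (\<Sum>p\<in>P. ennreal (B p \<omega>)) \<partial>M)"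
        using B(2) by (intro nn_integral_cong) (simp add: sum_ennreal)
      also have "\<dots> = (\<Sum>p\<in>P. \<integral>\<^sup>+\<omega>. ennreal (B p \<omega>) \<partial>M)"
        using B(1) by (intro nn_integral_sum) auto
      also have "\<dots> \<le> (\<Sum>p\<in>P. ennreal e)" using B(3) by (rule sum_mono)
      also have "\<dots> = ennreal (real (card P) * e)"
        using B(4) by (subst sum_ennreal) auto
      finally show ?thesis .
    qed
    note sum_bd = this
    have "(\<integral>\<^sup>+\<omega>. ennreal (SA \<omega>) \<partial>M) \<le> ennreal (real (card P) * (C / real N))"
      unfolding SA_def using AV C0 by (intro sum_bd) auto
    moreover have "(\<integral>\<^sup>+\<omega>. ennreal (SV \<omega>) \<partial>M) \<le> ennreal (real (card P) * (C * real N powr (- 2 * (1 - s))))"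
      unfolding SV_def using AV C0 by (intro sum_bd) auto
    ultimately show "\<exists>A V. A \<in> borel_measurable M \<and> V \<in> borel_measurable M \<and>
      (\<forall>\<omega>. 0 \<le> A \<omega> \<and> 0 \<le> V \<omega> \<and>
        (\<Sum>p\<in>P. (realized_vol \<alpha> X N p \<omega> - limit_vol p)\<^sup>2) \<le> C * (A \<omega> + (A \<omega>)\<^sup>2 + V \<omega>)) \<and>
      (\<integral>\<^sup>+\<omega>. ennreal (A \<omega>) \<partial>M) \<le> ennreal (real (card P) * (C / real N)) \<and>
      (\<integral>\<^sup>+\<omega>. ennreal (V \<omega>) \<partial>M) \<le> ennreal (real (card P) * (C * real N powr (- 2 * (1 - s))))"
      by (intro exI[of _ SA] exI[of _ SV] conjI allI) simp_all
  qed
qed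

end

text \<open>Errors are summed over points, the contrast over index pairs; injectivity identifies the
  two sums and gives the design its cardinality.\<close>

lemma thin_inj:
  assumes "thin_window \<delta> M mb J m"
  shows "inj (\<lambda>j. thin M mb (J + j))"
proof -
  have "1 \<le> mb" "mb \<le> M" using assms by (auto simp: thin_window_def)
  then have "0 < real (M div mb)" "0 < real M" by (auto simp: div_greater_zero_iff)
  then show ?thesis by (auto simp: inj_on_def thin_def)
qed

context spde_field
begin

text \<open>The squared normalized error is at most \<open>W1 + K * W2\<^sup>2\<close>, where
  \<open>W1\<close> holds the terms linear in \<open>A\<close> and \<open>V\<close>. No bound for
  the mean of \<open>W2\<^sup>2\<close> is at hand, so the bad event is covered by one event for
  \<open>W1\<close> and one for \<open>W2\<close>, each estimated by Markov's inequality.\<close>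

lemma estimator_rate:
  fixes M1 M2 mb1 mb2 J1 J2 m1 m2 :: "nat \<Rightarrow> nat" and \<delta> \<rho> \<gamma> :: real
    and \<Xi> :: "(real \<times> real \<times> real) set" and est :: "nat \<Rightarrow> 'a \<Rightarrow> real \<times> real \<times> real"
  defines "v0 \<equiv> (\<sigma>\<^sup>2 / \<theta>2 powr (1 - \<alpha>), \<theta>1 / \<theta>2, \<eta>1 / \<theta>2)"
  assumes \<rho>: "\<rho> < min 1 (2 * (1 - \<alpha>))"
    and mb: "(\<lambda>N. real (mb1 N * mb2 N)) \<in> O(\<lambda>N. real N powr \<rho>)"
    and \<delta>: "0 < \<delta>" "\<delta> < 1 / 2"
    and tw1: "\<forall>\<^sub>F N in sequentially. thin_window \<delta> (M1 N) (mb1 N) (J1 N) (m1 N)"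
    and tw2: "\<forall>\<^sub>F N in sequentially. thin_window \<delta> (M2 N) (mb2 N) (J2 N) (m2 N)"
    and two: "\<forall>\<^sub>F N in sequentially. 2 \<le> m1 N \<and> 2 \<le> m2 N"
    and \<Xi>: "compact \<Xi>" "\<Xi> \<subseteq> {0<..} \<times> UNIV" "v0 \<in> \<Xi>"
    and argmin: "\<And>N. AE \<omega> in M. is_arg_min
           (contrast \<alpha> (\<lambda>p. realized_vol \<alpha> X N p \<omega>)
              (\<lambda>j. thin (M1 N) (mb1 N) (J1 N + j)) (\<lambda>j. thin (M2 N) (mb2 N) (J2 N + j))
              (m1 N) (m2 N))
           (\<lambda>v. v \<in> \<Xi>) (est N \<omega>)"
    and \<gamma>: "\<gamma> < min (1/2) (1 - \<alpha>) - \<rho> / 2"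
  shows "tendsto_in_prob M
           (\<lambda>N \<omega>. (sqrt (real (m1 N * m2 N)) * real N powr \<gamma>) *\<^sub>R (est N \<omega> - v0))
           (\<lambda>_. 0) sequentially"
proof -
  \<comment> \<open>The bound on \<gamma> says that max(1/2, \<alpha>) < 1 - \<gamma> - \<rho>/2,
    and \<alpha> < 1 settles the rest; this leaves room for \<open>s\<close>.\<close>
  have "max (1 / 2) \<alpha> < min 1 (1 - \<gamma> - \<rho> / 2)" using \<gamma> \<alpha> \<rho> by (auto simp: min_def max_def split: if_splits)
  then obtain s where "max (1 / 2) \<alpha> < s" "s < min 1 (1 - \<gamma> - \<rho> / 2)" using dense by blast
  then have s: "\<alpha> \<le> s" "1 / 2 < s" "s < 1" "\<gamma> + \<rho> / 2 < 1 - s" by auto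
  define c0 where "c0 = Gamma (1 - \<alpha>) / (4 * pi * \<alpha>)"
  have c0: "0 < c0" using \<alpha> by (simp add: c0_def Gamma_real_pos)
  obtain c where c: "0 < c" "\<And>M1 mb1 J1 m1 M2 mb2 J2 m2 v. v \<in> \<Xi> \<Longrightarrow> thin_window \<delta> M1 mb1 J1 m1 \<Longrightarrow>
      thin_window \<delta> M2 mb2 J2 m2 \<Longrightarrow> 2 \<le> m1 \<Longrightarrow> 2 \<le> m2 \<Longrightarrow> c * real (m1 * m2) * (norm (v - v0))\<^sup>2 \<le>
      (\<Sum>j1=1..m1. \<Sum>j2=1..m2. (exp_model c0 v (thin M1 mb1 (J1 + j1)) (thin M2 mb2 (J2 + j2))
        - exp_model c0 v0 (thin M1 mb1 (J1 + j1)) (thin M2 mb2 (J2 + j2)))\<^sup>2)"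
    using exp_model_identifiable[OF \<Xi> c0 \<delta>] by (elim exE conjE) (use that in simp)
  obtain C where C0: "0 \<le> C" and C: "\<And>N P. 0 < N \<Longrightarrow> finite P \<Longrightarrow> P \<subseteq> {\<delta>..1 - \<delta>} \<times> {\<delta>..1 - \<delta>} \<Longrightarrow>
    (\<exists>A V. A \<in> borel_measurable M \<and> V \<in> borel_measurable M \<and>
      (\<forall>\<omega>. 0 \<le> A \<omega> \<and> 0 \<le> V \<omega> \<and>
        (\<Sum>p\<in>P. (realized_vol \<alpha> X N p \<omega> - limit_vol p)\<^sup>2) \<le> C * (A \<omega> + (A \<omega>)\<^sup>2 + V \<omega>)) \<and>
      (\<integral>\<^sup>+\<omega>. ennreal (A \<omega>) \<partial>M) \<le> ennreal (real (card P) * (C / real N)) \<and>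
      (\<integral>\<^sup>+\<omega>. ennreal (V \<omega>) \<partial>M) \<le> ennreal (real (card P) * (C * real N powr (- 2 * (1 - s)))))"
    using total_error[OF s(1-3) \<delta>] by (elim exE conjE) (use that in simp)
  obtain Cb where Cb: "0 < Cb" "\<forall>\<^sub>F N in sequentially. norm (real (mb1 N * mb2 N)) \<le> Cb * norm (real N powr \<rho>)"
    using landau_o.bigE[OF mb] by blast
  define K where "K = 4 * C / c"
  have K0: "0 \<le> K" using C0 c(1) by (simp add: K_def)
  have vol: "limit_vol (y, z) = exp_model c0 v0 y z" for y z
    by (simp add: limit_vol_def damping_def exp_model_def v0_def c0_def)
  show ?thesis
    unfolding tendsto_in_prob_def
  proof (intro allI impI)
    fix e :: real assume e: "0 < e"
    \<comment> \<open>Chosen so that \<open>K * e2\<^sup>2\<close> is at most half of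
      \<open>e\<^sup>2\<close>; the summand 1 covers K = 0.\<close>
    define e2 where "e2 = e / sqrt (2 * (K + 1))"
    have e2: "0 < e2" using e K0 by (simp add: e2_def)
    \<comment> \<open>The two Markov bounds with m replaced by \<open>Cb * n powr \<rho>\<close>.
      The exponents are negative: 2 \<gamma> + \<rho> < 1 by the bound on \<gamma>, the second by
      the choice of \<open>s\<close>, and \<gamma> + \<rho> < 1 by \<gamma> < (1 - \<rho>) / 2 and
      \<rho> < 1.\<close>
    define bnd where "bnd n = 2 * (K * C * Cb) / e\<^sup>2 * (n powr (2 * \<gamma> + \<rho> - 1) + n powr (2 * \<gamma> + \<rho> - 2 * (1 - s)))
      + C * Cb / e2 * n powr (\<gamma> + \<rho> - 1)" for n :: real
    have bnd_lim: "(\<lambda>N. bnd (real N)) \<longlonglongrightarrow> 0"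
    proof -
      have "(\<lambda>N. real N powr a) \<longlonglongrightarrow> 0" if "a < 0" for a
        using that filterlim_real_sequentially by (rule tendsto_neg_powr)
      note p = this
      have "(\<lambda>N. bnd (real N)) \<longlonglongrightarrow> 2 * (K * C * Cb) / e\<^sup>2 * (0 + 0) + C * Cb / e2 * 0"
        unfolding bnd_def
        using \<gamma> \<rho> s(4) by (intro tendsto_add tendsto_mult tendsto_const p) auto
      then show ?thesis by simp
    qed
    let ?bad = "\<lambda>N. {\<omega>\<in>space M. e < norm ((sqrt (real (m1 N * m2 N)) * real N powr \<gamma>) *\<^sub>R (est N \<omega> - v0) - 0)}"
    have "\<forall>\<^sub>F N in sequentially. measure M (?bad N) \<le> bnd (real N)"
      using tw1 tw2 two Cb(2) eventually_gt_at_top[of 0]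
    proof eventually_elim
      case (elim N)
      define y where "y j = thin (M1 N) (mb1 N) (J1 N + j)" for j
      define z where "z j = thin (M2 N) (mb2 N) (J2 N + j)" for j
      define J where "J = {1..m1 N} \<times> {1..m2 N}"
      define \<phi> where "\<phi> j = (y (fst j), z (snd j))" for j
      define P where "P = \<phi> ` J"
      define mm where "mm = real (m1 N * m2 N)"
      define n where "n = real N"
      define \<nu> where "\<nu> = n powr \<gamma>"
      note windows = elim(1,2)
      have n: "0 < n" using elim(5) by (simp add: n_def)
      have m: "2 \<le> m1 N" "2 \<le> m2 N" using elim(3) by auto
      have finJ: "finite J" by (simp add: J_def)
      have inj: "inj_on \<phi> J"
        using thin_inj[OF elim(1)] thin_inj[OF elim(2)]
        by (auto simp: inj_on_def \<phi>_def y_def z_def prod_eq_iff)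
      have cardP: "real (card P) = mm"
        unfolding P_def card_image[OF inj] by (simp add: J_def mm_def)
      have yr: "\<delta> \<le> y j \<and> y j \<le> 1 - \<delta>" if "j \<in> {1..m1 N}" for j
        unfolding y_def by (rule thin_window_points[OF elim(1) m(1) \<delta>]) (use that in blast)
      have zr: "\<delta> \<le> z j \<and> z j \<le> 1 - \<delta>" if "j \<in> {1..m2 N}" for j
        unfolding z_def by (rule thin_window_points[OF elim(2) m(2) \<delta>]) (use that in blast)
      have P: "finite P" "P \<subseteq> {\<delta>..1 - \<delta>} \<times> {\<delta>..1 - \<delta>}"
        using yr zr by (auto simp: P_def J_def \<phi>_def)
      have mm_le: "mm \<le> Cb * n powr \<rho>"
      proof -
        have "m1 N \<le> mb1 N" "m2 N \<le> mb2 N"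
          using elim(1,2) by (auto simp: thin_window_def)
        then have "mm \<le> real (mb1 N * mb2 N)"
          unfolding mm_def of_nat_le_iff by (rule mult_le_mono)
        then show ?thesis using elim(4) by (simp add: n_def)
      qed
      have mm0: "0 \<le> mm" by (simp add: mm_def)
      obtain A V where AV: "A \<in> borel_measurable M" "V \<in> borel_measurable M"
        "\<And>\<omega>. 0 \<le> A \<omega>" "\<And>\<omega>. 0 \<le> V \<omega>"
        "\<And>\<omega>. (\<Sum>p\<in>P. (realized_vol \<alpha> X N p \<omega> - limit_vol p)\<^sup>2) \<le> C * (A \<omega> + (A \<omega>)\<^sup>2 + V \<omega>)"
        "(\<integral>\<^sup>+\<omega>. ennreal (A \<omega>) \<partial>M) \<le> ennreal (mm * (C / n))"
        "(\<integral>\<^sup>+\<omega>. ennreal (V \<omega>) \<partial>M) \<le> ennreal (mm * (C * n powr (- 2 * (1 - s))))"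
        using C[OF elim(5) P] unfolding cardP n_def[symmetric] by (elim exE conjE) (use that in simp)
      note [measurable] = AV(1,2)
      define W1 where "W1 \<omega> = K * \<nu>\<^sup>2 * (A \<omega> + V \<omega>)" for \<omega>
      define W2 where "W2 \<omega> = \<nu> * A \<omega>" for \<omega>
      have \<nu>0: "0 \<le> \<nu>" by (simp add: \<nu>_def)
      \<comment> \<open>The minimizing property holds almost surely, so the bad event is contained
        in the two Markov events up to a null set.\<close>
      have AE: "AE \<omega> in M. \<omega> \<in> ?bad N \<longrightarrow> \<omega> \<in> {\<omega>\<in>space M. e\<^sup>2 / 2 < W1 \<omega>} \<union> {\<omega>\<in>space M. e2 < W2 \<omega>}"
        using argmin[of N]
      proof eventually_elim
        case (elim \<omega>)
        define Z where "Z j = realized_vol \<alpha> X N (\<phi> j) \<omega>" for j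
        define f where "f v j = exp_model c0 v (y (fst j)) (z (snd j))" for v j
        have con: "contrast \<alpha> (\<lambda>p. realized_vol \<alpha> X N p \<omega>)
              (\<lambda>j. thin (M1 N) (mb1 N) (J1 N + j)) (\<lambda>j. thin (M2 N) (mb2 N) (J2 N + j))
              (m1 N) (m2 N) v = (\<Sum>j\<in>J. (Z j - f v j)\<^sup>2)" for v
          unfolding J_def sum.cartesian_product' Z_def f_def \<phi>_def y_def z_def
          by (cases v) (simp add: exp_model_def c0_def)
        have est: "est N \<omega> \<in> \<Xi>" "(\<Sum>j\<in>J. (Z j - f (est N \<omega>) j)\<^sup>2) \<le> (\<Sum>j\<in>J. (Z j - f v0 j)\<^sup>2)"
          using elim \<Xi>(3) unfolding is_arg_min_def con by (simp, meson not_less)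
        have "c * mm * (norm (est N \<omega> - v0))\<^sup>2 \<le> (\<Sum>j\<in>J. (f (est N \<omega>) j - f v0 j)\<^sup>2)"
          using c(2)[OF est(1) windows m] unfolding J_def sum.cartesian_product' f_def y_def z_def mm_def by simp
        also have "\<dots> \<le> 4 * (\<Sum>j\<in>J. (Z j - f v0 j)\<^sup>2)"
          by (rule least_squares_comparison[OF est(2)])
        also have "(\<Sum>j\<in>J. (Z j - f v0 j)\<^sup>2) = (\<Sum>p\<in>P. (realized_vol \<alpha> X N p \<omega> - limit_vol p)\<^sup>2)"
          unfolding P_def sum.reindex[OF inj] Z_def f_def by (simp add: \<phi>_def vol)
        also have "4 * \<dots> \<le> 4 * (C * (A \<omega> + (A \<omega>)\<^sup>2 + V \<omega>))"
          using AV(5)[of \<omega>] by simp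
        finally have "mm * (norm (est N \<omega> - v0))\<^sup>2 \<le> K * (A \<omega> + (A \<omega>)\<^sup>2 + V \<omega>)"
          using c(1) by (simp add: K_def field_simps)
        then have "\<nu>\<^sup>2 * (mm * (norm (est N \<omega> - v0))\<^sup>2) \<le> \<nu>\<^sup>2 * (K * (A \<omega> + (A \<omega>)\<^sup>2 + V \<omega>))"
          by (rule mult_left_mono) simp
        also have "\<dots> = W1 \<omega> + K * (W2 \<omega>)\<^sup>2"
          by (simp add: W1_def W2_def power_mult_distrib algebra_simps)
        finally have le: "\<nu>\<^sup>2 * (mm * (norm (est N \<omega> - v0))\<^sup>2) \<le> W1 \<omega> + K * (W2 \<omega>)\<^sup>2" .
        have sq: "(norm ((sqrt (real (m1 N * m2 N)) * real N powr \<gamma>) *\<^sub>R (est N \<omega> - v0) - 0))\<^sup>2 =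
            \<nu>\<^sup>2 * (mm * (norm (est N \<omega> - v0))\<^sup>2)"
          using mm0 unfolding mm_def[symmetric] n_def[symmetric] \<nu>_def[symmetric]
          by (simp add: power_mult_distrib)
        show ?case
        proof (intro impI, rule ccontr)
          assume bad: "\<omega> \<in> ?bad N" and "\<omega> \<notin> {\<omega>\<in>space M. e\<^sup>2 / 2 < W1 \<omega>} \<union> {\<omega>\<in>space M. e2 < W2 \<omega>}"
          then have w: "W1 \<omega> \<le> e\<^sup>2 / 2" "W2 \<omega> \<le> e2" by auto
          have "(W2 \<omega>)\<^sup>2 \<le> e2\<^sup>2"
            using w(2) \<nu>0 AV(3)[of \<omega>] by (intro power_mono) (auto simp: W2_def)
          also have "e2\<^sup>2 = e\<^sup>2 / (2 * (K + 1))" using K0 by (simp add: e2_def power_divide)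
          finally have "K * (W2 \<omega>)\<^sup>2 \<le> K * (e\<^sup>2 / (2 * (K + 1)))" using K0 by (rule mult_left_mono)
          also have "\<dots> \<le> (K + 1) * (e\<^sup>2 / (2 * (K + 1)))"
            using K0 by (intro mult_right_mono) auto
          also have "\<dots> = e\<^sup>2 / 2"
          proof -
            have "2 * K + 2 \<noteq> 0" using K0 by linarith
            then show ?thesis by (simp add: divide_eq_eq eq_divide_eq)
          qed
          finally have "\<nu>\<^sup>2 * (mm * (norm (est N \<omega> - v0))\<^sup>2) \<le> e\<^sup>2"
            using le w(1) by linarith
          moreover have "e\<^sup>2 < (norm ((sqrt (real (m1 N * m2 N)) * real N powr \<gamma>) *\<^sub>R (est N \<omega> - v0) - 0))\<^sup>2"
            using bad e by (intro power_strict_mono) auto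
          ultimately show False unfolding sq by linarith
        qed
      qed
      define E1 where "E1 = K * \<nu>\<^sup>2 * (mm * (C / n) + mm * (C * n powr (- 2 * (1 - s))))"
      define E2 where "E2 = \<nu> * (mm * (C / n))"
      have E0: "0 \<le> E1" "0 \<le> E2"
        using K0 C0 mm0 n \<nu>0 by (auto simp: E1_def E2_def)
      have "measure M {\<omega>\<in>space M. e\<^sup>2 / 2 < W1 \<omega>} \<le> E1 / (e\<^sup>2 / 2)"
      proof (rule prob_gt_le)
        have "(\<integral>\<^sup>+\<omega>. ennreal (W1 \<omega>) \<partial>M) = (\<integral>\<^sup>+\<omega>. ennreal (K * \<nu>\<^sup>2) * (ennreal (A \<omega>) + ennreal (V \<omega>)) \<partial>M)"
          using K0 AV(3,4) by (intro nn_integral_cong) (simp add: W1_def ennreal_mult ennreal_plus)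
        also have "\<dots> = ennreal (K * \<nu>\<^sup>2) * ((\<integral>\<^sup>+\<omega>. ennreal (A \<omega>) \<partial>M) + (\<integral>\<^sup>+\<omega>. ennreal (V \<omega>) \<partial>M))"
          by (subst nn_integral_cmult) (auto simp: nn_integral_add)
        also have "\<dots> \<le> ennreal (K * \<nu>\<^sup>2) * (ennreal (mm * (C / n)) + ennreal (mm * (C * n powr (- 2 * (1 - s)))))"
          by (intro mult_left_mono add_mono AV(6,7)) simp
        also have "\<dots> = ennreal E1"
          unfolding E1_def using K0 C0 mm0 n
          by (subst ennreal_plus[symmetric], simp, simp, subst ennreal_mult[symmetric]) auto
        finally show "(\<integral>\<^sup>+\<omega>. ennreal (W1 \<omega>) \<partial>M) \<le> ennreal E1" .
        show "W1 \<in> borel_measurable M" unfolding W1_def[abs_def] by measurable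
      qed (use E0 e in auto)
      moreover have "measure M {\<omega>\<in>space M. e2 < W2 \<omega>} \<le> E2 / e2"
      proof (rule prob_gt_le)
        have "(\<integral>\<^sup>+\<omega>. ennreal (W2 \<omega>) \<partial>M) = ennreal \<nu> * (\<integral>\<^sup>+\<omega>. ennreal (A \<omega>) \<partial>M)"
          using \<nu>0 by (simp add: W2_def ennreal_mult' nn_integral_cmult)
        also have "\<dots> \<le> ennreal \<nu> * ennreal (mm * (C / n))"
          by (intro mult_left_mono AV(6)) simp
        also have "\<dots> = ennreal E2"
          unfolding E2_def by (rule ennreal_mult'[OF \<nu>0, symmetric])
        finally show "(\<integral>\<^sup>+\<omega>. ennreal (W2 \<omega>) \<partial>M) \<le> ennreal E2" .
        show "W2 \<in> borel_measurable M" unfolding W2_def[abs_def] by measurable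
      qed (use E0 e2 in auto)
      moreover have "measure M (?bad N) \<le> measure M ({\<omega>\<in>space M. e\<^sup>2 / 2 < W1 \<omega>} \<union> {\<omega>\<in>space M. e2 < W2 \<omega>})"
        by (rule finite_measure_mono_AE[OF AE]) (simp add: W1_def W2_def)
      moreover have "measure M ({\<omega>\<in>space M. e\<^sup>2 / 2 < W1 \<omega>} \<union> {\<omega>\<in>space M. e2 < W2 \<omega>}) \<le>
          measure M {\<omega>\<in>space M. e\<^sup>2 / 2 < W1 \<omega>} + measure M {\<omega>\<in>space M. e2 < W2 \<omega>}"
        by (rule measure_Un_le) (simp_all add: W1_def W2_def)
      moreover have "E1 / (e\<^sup>2 / 2) + E2 / e2 \<le> bnd n"
      proof -
        have "E1 \<le> K * \<nu>\<^sup>2 * ((Cb * n powr \<rho>) * (C / n) + (Cb * n powr \<rho>) * (C * n powr (- 2 * (1 - s))))"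
          unfolding E1_def using mm_le K0 C0 n by (intro mult_left_mono add_mono mult_right_mono) auto
        also have "\<dots> = K * C * Cb * (n powr (2 * \<gamma> + \<rho> - 1) + n powr (2 * \<gamma> + \<rho> - 2 * (1 - s)))"
        proof -
          have p1: "\<nu>\<^sup>2 * n powr \<rho> / n = n powr (2 * \<gamma> + \<rho> - 1)"
            using n by (simp add: \<nu>_def powr_power powr_add powr_diff mult.commute)
          have p2: "\<nu>\<^sup>2 * n powr \<rho> * n powr (- 2 * (1 - s)) = n powr (2 * \<gamma> + \<rho> - 2 * (1 - s))"
            using n by (simp add: \<nu>_def power2_eq_square powr_add[symmetric]) (simp add: algebra_simps)
          have "K * \<nu>\<^sup>2 * ((Cb * n powr \<rho>) * (C / n) + (Cb * n powr \<rho>) * (C * q)) =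
              K * C * Cb * (\<nu>\<^sup>2 * n powr \<rho> / n + \<nu>\<^sup>2 * n powr \<rho> * q)" for q
            by (simp add: algebra_simps)
          then show ?thesis unfolding p1[symmetric] p2[symmetric] .
        qed
        finally have E1: "E1 / (e\<^sup>2 / 2) \<le> K * C * Cb * (n powr (2 * \<gamma> + \<rho> - 1) + n powr (2 * \<gamma> + \<rho> - 2 * (1 - s))) / (e\<^sup>2 / 2)"
          by (rule divide_right_mono) simp
        have "E2 \<le> \<nu> * ((Cb * n powr \<rho>) * (C / n))"
          unfolding E2_def using mm_le \<nu>0 C0 n by (intro mult_left_mono mult_right_mono) auto
        also have "\<dots> = C * Cb * n powr (\<gamma> + \<rho> - 1)"
          using n by (simp add: \<nu>_def powr_add powr_diff)
        finally have "E2 / e2 \<le> C * Cb * n powr (\<gamma> + \<rho> - 1) / e2"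
          using e2 by (intro divide_right_mono) auto
        with E1 show ?thesis by (simp add: bnd_def mult_ac)
      qed
      ultimately show ?case unfolding n_def by linarith
    qed
    then show "(\<lambda>N. measure M {\<omega>\<in>space M. e < norm ((sqrt (real (m1 N * m2 N)) * real N powr \<gamma>) *\<^sub>R (est N \<omega> - v0) - 0)})
        \<longlonglongrightarrow> 0"
      by (rule tendsto_sandwich[OF always_eventually _ tendsto_const bnd_lim, rotated]) simp
  qed
qed

end

theorem theorem3p5:
  fixes M :: "'a measure"
    and \<alpha> \<theta>0 \<theta>1 \<eta>1 \<theta>2 \<sigma> \<mu>0 \<delta> \<rho> \<gamma> :: real
    and \<theta> :: drift
    and \<Theta> :: "(real \<times> real \<times> real \<times> real \<times> real) set"
    and \<M> :: "real set"
    and w :: "nat \<Rightarrow> nat \<Rightarrow> real \<Rightarrow> 'a \<Rightarrow> real"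
    and \<xi> :: "'a \<Rightarrow> real \<times> real \<Rightarrow> real"
    and \<xi>c :: "nat \<Rightarrow> nat \<Rightarrow> 'a \<Rightarrow> real"
    and X :: "real \<Rightarrow> real \<times> real \<Rightarrow> 'a \<Rightarrow> real"
    and M1 M2 mb1 mb2 J1 J2 m1 m2 :: "nat \<Rightarrow> nat"
    and S \<kappa> \<eta> :: real
    and \<Xi>2 :: "(real \<times> real \<times> real) set"
    and est :: "nat \<Rightarrow> 'a \<Rightarrow> real \<times> real \<times> real"
  assumes "prob_space M"
    and "0 < \<alpha>" "\<alpha> < 1"
    and "compact \<Theta>" "convex \<Theta>" "\<Theta> \<subseteq> {(a, b, c, d, s). 0 < d \<and> 0 < s}"
    and "(\<theta>0, \<theta>1, \<eta>1, \<theta>2, \<sigma>) \<in> interior \<Theta>"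
    and "compact \<M>" "convex \<M>" "\<M> \<subseteq> {- 2 * pi\<^sup>2<..}" "\<mu>0 \<in> interior \<M>"
    and \<theta>: "\<theta> = (\<theta>0, \<theta>1, \<eta>1, \<theta>2)"
    and "0 < eigval \<theta> 1 1"
    and "\<forall>k\<ge>1. \<forall>l\<ge>1. brownian_motion M (w k l)"
    and "prob_space.indep_vars M (\<lambda>_. PiM {0..} (\<lambda>_. borel))
           (\<lambda>(k, l) \<omega>. \<lambda>t\<in>{0..}. w k l t \<omega>) indices"
    and "\<xi> \<in> measurable M (H_borel \<theta>)"
    and "prob_space.indep_set M
           (sets (vimage_algebra (space M) \<xi> (H_borel \<theta>)))
           (sets (vimage_algebra (space M)
              (\<lambda>\<omega>. \<lambda>((k, l), t)\<in>indices \<times> {0..}. w k l t \<omega>)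
              (PiM (indices \<times> {0..}) (\<lambda>_. borel))))"
    and "is_mild_solution M \<alpha> \<theta> \<sigma> \<mu>0 w \<xi> X"
    and \<xi>c: "\<xi>c = (\<lambda>k l \<omega>. inner_w \<theta> (\<xi> \<omega>) (eigfun \<theta> k l))"
    and "prob_space.indep_vars M (\<lambda>_. borel) (\<lambda>(k, l). \<xi>c k l) indices"
    and "(SUP (k, l)\<in>indices. ennreal (eigval \<theta> k l powr (1 + \<alpha>))
            * (\<integral>\<^sup>+\<omega>. ennreal ((\<xi>c k l \<omega>) ^ 4) \<partial>M)) < \<infinity>"
    and "((\<forall>k\<ge>1. \<forall>l\<ge>1. prob_space.expectation M (\<xi>c k l) = 0)
            \<and> (SUP (k, l)\<in>indices. ennreal (eigval \<theta> k l powr (1 + \<alpha>))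
                  * (\<integral>\<^sup>+\<omega>. ennreal ((\<xi>c k l \<omega>)\<^sup>2) \<partial>M)) < \<infinity>)
       \<or> (\<Sum>\<^sub>\<infinity>(k, l)\<in>indices. ennreal (eigval \<theta> k l powr (1 + \<alpha>))
                  * (\<integral>\<^sup>+\<omega>. ennreal ((\<xi>c k l \<omega>)\<^sup>2) \<partial>M)) < \<infinity>"
    and "0 < \<rho>" "\<rho> < min 1 (2 * (1 - \<alpha>))"
    and "(\<lambda>N. real (mb1 N * mb2 N)) \<in> O(\<lambda>N. real N powr \<rho>)"
    and "0 < \<delta>" "\<delta> < 1/2"
    and "\<forall>\<^sub>F N in sequentially. thin_window \<delta> (M1 N) (mb1 N) (J1 N) (m1 N)"
    and "\<forall>\<^sub>F N in sequentially. thin_window \<delta> (M2 N) (mb2 N) (J2 N) (m2 N)"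
    and "\<forall>\<^sub>F N in sequentially. 2 \<le> m1 N \<and> 2 \<le> m2 N"
    and "filterlim (\<lambda>N. m1 N * m2 N) at_top sequentially"
    and S: "S = \<sigma>\<^sup>2 / \<theta>2 powr (1 - \<alpha>)" and \<kappa>: "\<kappa> = \<theta>1 / \<theta>2" and \<eta>: "\<eta> = \<eta>1 / \<theta>2"
    and "compact \<Xi>2" "convex \<Xi>2" "\<Xi>2 \<subseteq> {0<..} \<times> UNIV" "(S, \<kappa>, \<eta>) \<in> interior \<Xi>2"
    and "\<forall>N. est N \<in> borel_measurable M"
    and "\<forall>N. AE \<omega> in M. is_arg_min
           (contrast \<alpha> (\<lambda>p. realized_vol \<alpha> X N p \<omega>)
              (\<lambda>j. thin (M1 N) (mb1 N) (J1 N + j)) (\<lambda>j. thin (M2 N) (mb2 N) (J2 N + j))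
              (m1 N) (m2 N))
           (\<lambda>v. v \<in> \<Xi>2) (est N \<omega>)"
    and "\<gamma> < min (1/2) (1 - \<alpha>) - \<rho> / 2"
  shows "tendsto_in_prob M
           (\<lambda>N \<omega>. (sqrt (real (m1 N * m2 N)) * real N powr \<gamma>) *\<^sub>R (est N \<omega> - (S, \<kappa>, \<eta>)))
           (\<lambda>_. 0) sequentially"
proof -
  interpret prob_space M by fact
  have pos: "0 < \<theta>2" "0 < \<sigma>"
    using assms(6,7) interior_subset[of \<Theta>] by auto
  have \<mu>0: "- 2 * pi\<^sup>2 < \<mu>0"
    using assms(10,11) interior_subset[of \<M>] by auto
  \<comment> \<open>Positivity of the eigenvalues is needed already to find \<open>C\<xi>\<close>,
    which is a parameter of \<open>spde_field\<close>; the smaller locale is therefore interpreted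
    first.\<close>
  interpret spec: spectrum \<theta>2 "- \<theta>0 + (\<theta>1\<^sup>2 + \<eta>1\<^sup>2) / (4 * \<theta>2)" \<mu>0 \<alpha> "eigval \<theta>"
  proof
    show "0 < - \<theta>0 + (\<theta>1\<^sup>2 + \<eta>1\<^sup>2) / (4 * \<theta>2) + 2 * (pi\<^sup>2 * \<theta>2)"
      using assms(13) by (simp add: \<theta> eigval.simps mult_ac)
  qed (use assms(2,3) pos \<mu>0 in \<open>auto simp: \<theta> eigval.simps\<close>)
  obtain x where xX: "(\<forall>k\<ge>1. \<forall>l\<ge>1. \<forall>t\<in>{0..1}. is_coordinate M \<alpha> \<theta> \<sigma> \<mu>0 w \<xi> k l t (x k l t)) \<and>
      (\<forall>t\<in>{0..1}. \<forall>p\<in>unit_square. X t p \<in> borel_measurable M \<and>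
        L2_tendsto M (\<lambda>F \<omega>. \<Sum>(k, l)\<in>F. x k l t \<omega> * eigfun \<theta> k l p) (X t p) (finite_subsets_at_top indices))"
    using assms(18) unfolding is_mild_solution_def by (rule exE)
  have x: "is_coordinate M \<alpha> \<theta> \<sigma> \<mu>0 w \<xi> k l t (x k l t)" if "1 \<le> k" "1 \<le> l" "t \<in> {0..1}" for k l t
    using conjunct1[OF xX] that by blast
  have X: "X t p \<in> borel_measurable M"
    "L2_tendsto M (\<lambda>F \<omega>. \<Sum>(k, l)\<in>F. x k l t \<omega> * eigfun \<theta> k l p) (X t p) (finite_subsets_at_top indices)"
    if "t \<in> {0..1}" "p \<in> unit_square" for t p
    using conjunct2[OF xX] that by blast+
  \<comment> \<open>The stochastic integrals are hidden behind the existential of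
    \<open>is_coordinate\<close>; a choice turns them into a family \<open>I\<close> that can be
    handed to the locale.\<close>
  define Q where "Q k l t I \<longleftrightarrow> is_wiener_integral M (w k l) (\<lambda>s. exp (- eigval \<theta> k l * (t - s))) t I \<and>
      (\<forall>\<omega>\<in>space M. x k l t \<omega> = exp (- eigval \<theta> k l * t) * inner_w \<theta> (\<xi> \<omega>) (eigfun \<theta> k l)
        + \<sigma> * noise_eigval \<mu>0 k l powr (- \<alpha> / 2) * I \<omega>)" for k l t I
  define I where "I k l t = (SOME I. Q k l t I)" for k l t
  have I: "Q k l t (I k l t)" if "1 \<le> k" "1 \<le> l" "t \<in> {0..1}" for k l t
    unfolding I_def using x[OF that] unfolding is_coordinate_def Q_def by (rule someI_ex)
  have \<xi>_meas: "\<xi>c k l \<in> borel_measurable M" if "1 \<le> k" "1 \<le> l" for k l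
    using assms(20) that by (auto simp: indep_vars_def)
  have hpos: "0 < eigval \<theta> k l powr (1 + \<alpha>)" if "1 \<le> k" "1 \<le> l" for k l
    using spec.lam_pos[OF that] by simp
  have inv: "inverse (eigval \<theta> k l powr (1 + \<alpha>)) = eigval \<theta> k l powr (- 1 - \<alpha>)" for k l
    using powr_minus[of "eigval \<theta> k l" "1 + \<alpha>"] by simp
  \<comment> \<open>Both alternatives on the initial value meet in one weighted second-moment bound
    for finite combinations of its coefficients.\<close>
  have "\<exists>C\<ge>0. \<forall>F d. finite F \<longrightarrow> F \<subseteq> indices \<longrightarrow>
      (\<integral>\<^sup>+\<omega>. ennreal ((\<Sum>(k, l)\<in>F. d k l * \<xi>c k l \<omega>)\<^sup>2) \<partial>M) \<le>
      ennreal (C * (\<Sum>(k, l)\<in>F. inverse (eigval \<theta> k l powr (1 + \<alpha>)) * (d k l)\<^sup>2))"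
    using assms(22)
  proof
    assume "(\<forall>k\<ge>1. \<forall>l\<ge>1. expectation (\<xi>c k l) = 0)
            \<and> (SUP (k, l)\<in>indices. ennreal (eigval \<theta> k l powr (1 + \<alpha>))
                  * (\<integral>\<^sup>+\<omega>. ennreal ((\<xi>c k l \<omega>)\<^sup>2) \<partial>M)) < \<infinity>"
    then show ?thesis
      by (intro centred_sum_bound assms(20) hpos) auto
  next
    assume "(\<Sum>\<^sub>\<infinity>(k, l)\<in>indices. ennreal (eigval \<theta> k l powr (1 + \<alpha>))
                  * (\<integral>\<^sup>+\<omega>. ennreal ((\<xi>c k l \<omega>)\<^sup>2) \<partial>M)) < \<infinity>"
    then show ?thesis
      by (intro summable_sum_bound \<xi>_meas hpos) auto
  qed
  then obtain C\<xi> where C\<xi>: "0 \<le> C\<xi>" "\<And>F d. finite F \<Longrightarrow> F \<subseteq> indices \<Longrightarrow>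
      (\<integral>\<^sup>+\<omega>. ennreal ((\<Sum>(k, l)\<in>F. d k l * \<xi>c k l \<omega>)\<^sup>2) \<partial>M) \<le>
      ennreal (C\<xi> * (\<Sum>(k, l)\<in>F. eigval \<theta> k l powr (- 1 - \<alpha>) * (d k l)\<^sup>2))"
    unfolding inv by (elim exE conjE) (use that in simp)
  interpret spde_field M \<alpha> \<theta>0 \<theta>1 \<eta>1 \<theta>2 \<sigma> \<mu>0 C\<xi> w \<xi>c x I X
  proof (unfold_locales, unfold \<theta>[symmetric])
    fix k l :: nat and t :: real and \<omega>
    assume "1 \<le> k" "1 \<le> l" "t \<in> {0..1}" "\<omega> \<in> space M"
    then show "x k l t \<omega> = exp (- eigval \<theta> k l * t) * \<xi>c k l \<omega> + \<sigma> * noise_eigval \<mu>0 k l powr (- \<alpha> / 2) * I k l t \<omega>"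
      using I unfolding Q_def \<xi>c by blast
  next
    fix k l :: nat and t :: real
    assume "1 \<le> k" "1 \<le> l" "t \<in> {0..1}"
    then show "is_wiener_integral M (w k l) (\<lambda>s. exp (- eigval \<theta> k l * (t - s))) t (I k l t)"
      using I unfolding Q_def by blast
  next
    show "brownian_motion M (w k l)" if "1 \<le> k" "1 \<le> l" for k l
      using assms(14) that by blast
    show "indep_vars (\<lambda>_. PiM {0..} (\<lambda>_. borel)) (\<lambda>(k, l) \<omega>. \<lambda>t\<in>{0..}. w k l t \<omega>) indices"
      by (rule assms(15))
  qed (fact assms(2,3,13) pos \<mu>0 X \<xi>_meas C\<xi>)+
  show ?thesis
    unfolding S \<kappa> \<eta>
  proof (rule estimator_rate)
    show "(\<sigma>\<^sup>2 / \<theta>2 powr (1 - \<alpha>), \<theta>1 / \<theta>2, \<eta>1 / \<theta>2) \<in> \<Xi>2"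
      using assms(38) interior_subset[of \<Xi>2] unfolding S \<kappa> \<eta> by blast
    show "\<And>N. AE \<omega> in M. is_arg_min
           (contrast \<alpha> (\<lambda>p. realized_vol \<alpha> X N p \<omega>)
              (\<lambda>j. thin (M1 N) (mb1 N) (J1 N + j)) (\<lambda>j. thin (M2 N) (mb2 N) (J2 N + j))
              (m1 N) (m2 N))
           (\<lambda>v. v \<in> \<Xi>2) (est N \<omega>)"
      using assms(40) by blast
  qed (fact assms(24-30,35,37,41))+
qed

end
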